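(* Let $0\le \delta<\infty$, let $k\ge 1$ be an integer and let $1\le p<\infty$. If $\Omega\subset\mathbb{R}^n$ is a bounded $\delta$-Gromov hyperbolic domain, then $C^{\infty}(\Omega)\cap W^{k,\infty}(\Omega)$ is dense in $L^{k,p}(\Omega)$ (with respect to the homogeneous Sobolev seminorm).
   Context: A domain is a nonempty connected open set. For a domain $\Omega\subset\mathbb{R}^n$, $k\in\mathbb{N}$ and $p\in[1,\infty]$, the homogeneous Sobolev space is $L^{k,p}(\Omega)=\{u\in L^1_{loc}(\Omega): D^{\alpha}u\in L^p(\Omega)\text{ for all multi-indices } |\alpha|=k\}$ (distributional derivatives), equipped with the seminorm $\sum_{|\alpha|=k}\|D^{\alpha}u\|_{L^p(\Omega)}$. The space $W^{k,p}(\Omega)=\{u\in L^1_{loc}(\Omega): D^{\alpha}u\in L^p(\Omega)\text{ for all } |\alpha|\le k\}$ is equipped with the norm $\sum_{|\alpha|\le k}\|D^{\alpha}u\|_{L^p(\Omega)}$. For a domain $\Omega\subsetneq\mathbb{R}^n$ write $d_{\Omega}(z)=\mathrm{dist}(z,\partial\Omega)$. The quasihyperbolic distance is $k_{\Omega}(x,y)=\inf_{\gamma}\int_{\gamma}\frac{|dz|}{d_{\Omega}(z)}$, the infimum being over rectifiable curves $\gamma\subset\Omega$ joining $x$ and $y$. A quasihyperbolic geodesic joining $x$ and $y$ is a curve attaining this infimum (such curves always exist). The domain $\Omega\subsetneq\mathbb{R}^n$ is $\delta$-Gromov hyperbolic if for any three points $x,y,z\in\Omega$, any quasihyperbolic geodesics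 $\Gamma_{xy},\Gamma_{yz},\Gamma_{zx}$ joining them pairwise, and any $w$ lying on one of these three geodesics, the ball $\{u\in\Omega: k_{\Omega}(u,w)\le\delta\}$ intersects the union of the other two geodesics. *)

theory Defs
  imports "HOL-Analysis.Analysis" "HOL-Probability.Essential_Supremum"
begin

section \<open>Smooth functions and classical partial derivatives\<close>

definition partial :: "'n::finite \<Rightarrow> (real^'n \<Rightarrow> real) \<Rightarrow> real^'n \<Rightarrow> real" where
  "partial i f x = deriv (\<lambda>t. f (x + t *\<^sub>R axis i 1)) 0"

fun Ck_on :: "nat \<Rightarrow> (real^'n::finite) set \<Rightarrow> (real^'n \<Rightarrow> real) \<Rightarrow> bool" where
  "Ck_on 0 S f \<longleftrightarrow> continuous_on S f"
| "Ck_on (Suc k) S f \<longleftrightarrow> continuous_on S f \<and>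
     (\<forall>i. (\<forall>x\<in>S. (\<lambda>t. f (x + t *\<^sub>R axis i 1)) differentiable (at 0)) \<and> Ck_on k S (partial i f))"

definition smooth :: "(real^'n::finite) set \<Rightarrow> (real^'n \<Rightarrow> real) set" where
  "smooth S = {f. \<forall>k. Ck_on k S f}"

text \<open>A multi-index is a function \<open>'n \<Rightarrow> nat\<close>. The index type carries no order, so the
  partial derivatives are taken along an arbitrary fixed enumeration of it; by symmetry of mixed
  partials the enumeration is irrelevant for smooth functions, the only ones to which
  \<open>classical_deriv\<close> is applied.\<close>

definition order_of :: "('n::finite \<Rightarrow> nat) \<Rightarrow> nat" where
  "order_of \<alpha> = (\<Sum>i\<in>UNIV. \<alpha> i)"

definition index_enum :: "'n::finite list" where
  "index_enum = (SOME is. distinct is \<and> set is = UNIV)"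

definition classical_deriv :: "('n::finite \<Rightarrow> nat) \<Rightarrow> (real^'n \<Rightarrow> real) \<Rightarrow> real^'n \<Rightarrow> real" where
  "classical_deriv \<alpha> f = foldr (\<lambda>i g. (partial i ^^ \<alpha> i) g) index_enum f"

section \<open>Distributional derivatives and Sobolev spaces\<close>

definition test_functions :: "(real^'n::finite) set \<Rightarrow> (real^'n \<Rightarrow> real) set" where
  "test_functions \<Omega> = {\<phi> \<in> smooth UNIV. compact (closure {x. \<phi> x \<noteq> 0}) \<and> closure {x. \<phi> x \<noteq> 0} \<subseteq> \<Omega>}"

definition L1_loc :: "(real^'n::finite) set \<Rightarrow> (real^'n \<Rightarrow> real) set" where
  "L1_loc \<Omega> = {u. \<forall>K. compact K \<and> K \<subseteq> \<Omega> \<longrightarrow> u absolutely_integrable_on K}"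

definition is_weak_deriv ::
  "(real^'n::finite) set \<Rightarrow> ('n \<Rightarrow> nat) \<Rightarrow> (real^'n \<Rightarrow> real) \<Rightarrow> (real^'n \<Rightarrow> real) \<Rightarrow> bool" where
  "is_weak_deriv \<Omega> \<alpha> u g \<longleftrightarrow> u \<in> L1_loc \<Omega> \<and> g \<in> L1_loc \<Omega> \<and>
     (\<forall>\<phi>\<in>test_functions \<Omega>.
        (LINT x|lebesgue_on \<Omega>. u x * classical_deriv \<alpha> \<phi> x)
          = (-1) ^ order_of \<alpha> * (LINT x|lebesgue_on \<Omega>. g x * \<phi> x))"

text \<open>Functions stand for themselves rather than for their almost-everywhere classes, and their
  values outside \<open>\<Omega>\<close> are irrelevant. A weak derivative is unique up to null subsets of \<open>\<Omega>\<close>, so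
  its \<open>L\<^sup>p\<close> norm does not depend on the representative chosen here.\<close>

definition weak_deriv ::
  "(real^'n::finite) set \<Rightarrow> ('n \<Rightarrow> nat) \<Rightarrow> (real^'n \<Rightarrow> real) \<Rightarrow> real^'n \<Rightarrow> real" where
  "weak_deriv \<Omega> \<alpha> u = (SOME g. is_weak_deriv \<Omega> \<alpha> u g)"

text \<open>Meaningful for \<open>1 \<le> p \<le> \<infinity>\<close>; the value is \<open>\<infinity>\<close> when the integral diverges.\<close>

definition Lp_norm :: "ennreal \<Rightarrow> (real^'n::finite) set \<Rightarrow> (real^'n \<Rightarrow> real) \<Rightarrow> ennreal" where
  "Lp_norm p \<Omega> f =
     (if p = \<infinity> then esssup (lebesgue_on \<Omega>) (\<lambda>x. ennreal \<bar>f x\<bar>)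
      else (let I = \<integral>\<^sup>+ x. ennreal (\<bar>f x\<bar> powr enn2real p) \<partial>lebesgue_on \<Omega> in
              if I = \<infinity> then \<infinity> else ennreal (enn2real I powr (1 / enn2real p))))"

definition Lp :: "ennreal \<Rightarrow> (real^'n::finite) set \<Rightarrow> (real^'n \<Rightarrow> real) set" where
  "Lp p \<Omega> = {f \<in> borel_measurable (lebesgue_on \<Omega>). Lp_norm p \<Omega> f < \<infinity>}"

definition sobolev_L :: "nat \<Rightarrow> ennreal \<Rightarrow> (real^'n::finite) set \<Rightarrow> (real^'n \<Rightarrow> real) set" where
  "sobolev_L k p \<Omega> =
     {u \<in> L1_loc \<Omega>. \<forall>\<alpha>. order_of \<alpha> = k \<longrightarrow> (\<exists>g\<in>Lp p \<Omega>. is_weak_deriv \<Omega> \<alpha> u g)}"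

definition sobolev_W :: "nat \<Rightarrow> ennreal \<Rightarrow> (real^'n::finite) set \<Rightarrow> (real^'n \<Rightarrow> real) set" where
  "sobolev_W k p \<Omega> =
     {u \<in> L1_loc \<Omega>. \<forall>\<alpha>. order_of \<alpha> \<le> k \<longrightarrow> (\<exists>g\<in>Lp p \<Omega>. is_weak_deriv \<Omega> \<alpha> u g)}"

definition sobolev_L_seminorm ::
  "nat \<Rightarrow> ennreal \<Rightarrow> (real^'n::finite) set \<Rightarrow> (real^'n \<Rightarrow> real) \<Rightarrow> ennreal" where
  "sobolev_L_seminorm k p \<Omega> u = (\<Sum>\<alpha> | order_of \<alpha> = k. Lp_norm p \<Omega> (weak_deriv \<Omega> \<alpha> u))"

definition dense_in_sobolev_L ::
  "(real^'n::finite \<Rightarrow> real) set \<Rightarrow> nat \<Rightarrow> ennreal \<Rightarrow> (real^'n) set \<Rightarrow> bool" where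
  "dense_in_sobolev_L D k p \<Omega> \<longleftrightarrow> D \<subseteq> sobolev_L k p \<Omega> \<and>
     (\<forall>u\<in>sobolev_L k p \<Omega>. \<forall>\<epsilon>::real. \<epsilon> > 0 \<longrightarrow>
        (\<exists>v\<in>D. sobolev_L_seminorm k p \<Omega> (\<lambda>x. u x - v x) < ennreal \<epsilon>))"

section \<open>Rectifiable curves and arc-length integrals\<close>

text \<open>Lengths of the polygons inscribed in the restriction of a curve to \<open>{a..b}\<close>.\<close>

definition inscribed_lengths :: "(real \<Rightarrow> real^'n::finite) \<Rightarrow> real \<Rightarrow> real \<Rightarrow> real set" where
  "inscribed_lengths \<gamma> a b =
     {\<Sum>i<length ts - 1. dist (\<gamma> (ts ! i)) (\<gamma> (ts ! Suc i)) | ts. sorted ts \<and> set ts \<subseteq> {a..b}}"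

definition rectifiable :: "(real \<Rightarrow> real^'n::finite) \<Rightarrow> bool" where
  "rectifiable \<gamma> \<longleftrightarrow> path \<gamma> \<and> bdd_above (inscribed_lengths \<gamma> 0 1)"

definition arc_length :: "(real \<Rightarrow> real^'n::finite) \<Rightarrow> real \<Rightarrow> real" where
  "arc_length \<gamma> t = Sup (inscribed_lengths \<gamma> 0 t)"

text \<open>The arc-length parametrization of a rectifiable curve on \<open>{0..arc_length \<gamma> 1}\<close>. The curve
  is constant on each level set of \<open>arc_length \<gamma>\<close>, so the choice of \<open>t\<close> is immaterial.\<close>

definition arc_length_param :: "(real \<Rightarrow> real^'n::finite) \<Rightarrow> real \<Rightarrow> real^'n" where
  "arc_length_param \<gamma> s = \<gamma> (SOME t. t \<in> {0..1} \<and> arc_length \<gamma> t = s)"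

definition line_integral :: "(real^'n::finite \<Rightarrow> real) \<Rightarrow> (real \<Rightarrow> real^'n) \<Rightarrow> real" where
  "line_integral \<rho> \<gamma> = integral {0..arc_length \<gamma> 1} (\<lambda>s. \<rho> (arc_length_param \<gamma> s))"

section \<open>Quasihyperbolic geometry\<close>

definition is_domain :: "(real^'n::finite) set \<Rightarrow> bool" where
  "is_domain \<Omega> \<longleftrightarrow> \<Omega> \<noteq> {} \<and> open \<Omega> \<and> connected \<Omega>"

definition qh_length :: "(real^'n::finite) set \<Rightarrow> (real \<Rightarrow> real^'n) \<Rightarrow> real" where
  "qh_length \<Omega> \<gamma> = line_integral (\<lambda>z. 1 / infdist z (frontier \<Omega>)) \<gamma>"

definition joining_curves ::
  "(real^'n::finite) set \<Rightarrow> real^'n \<Rightarrow> real^'n \<Rightarrow> (real \<Rightarrow> real^'n) set" where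
  "joining_curves \<Omega> x y =
     {\<gamma>. rectifiable \<gamma> \<and> path_image \<gamma> \<subseteq> \<Omega> \<and> pathstart \<gamma> = x \<and> pathfinish \<gamma> = y}"

definition qh_dist :: "(real^'n::finite) set \<Rightarrow> real^'n \<Rightarrow> real^'n \<Rightarrow> real" where
  "qh_dist \<Omega> x y = (INF \<gamma>\<in>joining_curves \<Omega> x y. qh_length \<Omega> \<gamma>)"

definition qh_geodesic ::
  "(real^'n::finite) set \<Rightarrow> real^'n \<Rightarrow> real^'n \<Rightarrow> (real \<Rightarrow> real^'n) \<Rightarrow> bool" where
  "qh_geodesic \<Omega> x y \<gamma> \<longleftrightarrow> \<gamma> \<in> joining_curves \<Omega> x y \<and> qh_length \<Omega> \<gamma> = qh_dist \<Omega> x y"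

definition qh_cball :: "(real^'n::finite) set \<Rightarrow> real^'n \<Rightarrow> real \<Rightarrow> (real^'n) set" where
  "qh_cball \<Omega> w r = {u \<in> \<Omega>. qh_dist \<Omega> u w \<le> r}"

definition gromov_hyperbolic_domain :: "real \<Rightarrow> (real^'n::finite) set \<Rightarrow> bool" where
  "gromov_hyperbolic_domain \<delta> \<Omega> \<longleftrightarrow> is_domain \<Omega> \<and> \<Omega> \<noteq> UNIV \<and>
     (\<forall>x\<in>\<Omega>. \<forall>y\<in>\<Omega>. \<forall>z\<in>\<Omega>. \<forall>\<Gamma>xy \<Gamma>yz \<Gamma>zx.
        qh_geodesic \<Omega> x y \<Gamma>xy \<and> qh_geodesic \<Omega> y z \<Gamma>yz \<and> qh_geodesic \<Omega> z x \<Gamma>zx \<longrightarrow>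
          (\<forall>w\<in>path_image \<Gamma>xy. qh_cball \<Omega> w \<delta> \<inter> (path_image \<Gamma>yz \<union> path_image \<Gamma>zx) \<noteq> {}) \<and>
          (\<forall>w\<in>path_image \<Gamma>yz. qh_cball \<Omega> w \<delta> \<inter> (path_image \<Gamma>zx \<union> path_image \<Gamma>xy) \<noteq> {}) \<and>
          (\<forall>w\<in>path_image \<Gamma>zx. qh_cball \<Omega> w \<delta> \<inter> (path_image \<Gamma>xy \<union> path_image \<Gamma>yz) \<noteq> {}))"

end

theory Submission
  imports Defs "HOL-Complex_Analysis.Great_Picard"
begin


text \<open>
  Mollification at scale \<open>\<eta>\<close> approximates a Sobolev function \<open>u\<close> by smooth functions with bounded
  derivatives, but only at points whose distance to the boundary is at least a multiple of \<open>\<eta>\<close>. On the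
  rest of \<open>\<Omega>\<close> the mollification is replaced by polynomials of degree less than \<open>k\<close>, whose derivatives of
  order \<open>k\<close> vanish. The error is small if one passes from the mollification to a polynomial, and from one
  polynomial to another, only where the two are close to each other. The geometry of \<open>\<Omega>\<close> provides such
  places.

  Gromov hyperbolicity enters through \<open>annulus_lemma\<close>: if a connected subset \<open>\<sigma>\<close> of \<open>\<Omega>\<close> joins the ends of
  a geodesic and \<open>b\<close> lies on that geodesic, then not all geodesics from \<open>b\<close> to points of \<open>\<sigma>\<close> can cross a
  thick Euclidean annulus centred in \<open>\<Omega>\<close>. Seen from \<open>b\<close>, hyperbolicity gives \<open>\<Omega>\<close> a visual
  quasi-metric in which the ends of \<open>\<sigma>\<close> have distance one (\<open>chain_lemma\<close>, \<open>visual_ultra\<close>). Hence \<open>\<sigma>\<close> carries a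
  measure of total mass at least one half whose shadows at quasihyperbolic distance \<open>s\<close> from \<open>b\<close> have mass
  decaying exponentially in \<open>s\<close>. Crossing an annulus of logarithmic thickness \<open>J\<close> costs every geodesic a
  weight proportional to \<open>J\<close> (\<open>crossing_weight\<close>), while the powers of order \<open>n + 1\<close> of the weights of
  separated points, \<open>n\<close> being the dimension, sum to at most a multiple of \<open>J\<close> by volume
  (\<open>weight_sum_le\<close>). Young's inequality for the product of mass and weight shows that both are compatible
  only for bounded \<open>J\<close> (\<open>crossing_energy\<close>).

  Consequently (\<open>separation_and_containment\<close>) a ball centred on a geodesic with radius comparable to the
  distance of its centre to the boundary separates the ends of the geodesic, and a geodesic stays close
  to every connected set joining its ends. Fix a base point \<open>x0\<close>. By separation, all points that cannot
  be reached from \<open>x0\<close> along a geodesic avoiding the \<open>\<eta>\<close>-collar of the boundary lie behind finitely many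
  gates of size comparable to \<open>\<eta>\<close>, whose centres have distance \<open>\<eta>\<close> to the boundary. Each small connected
  piece of \<open>\<Omega>\<close> is labelled by the centre of a gate behind which it lies, or has no label. By containment
  and thin triangles, where labels change the two centres, or the centre and the unlabelled point, are
  joined by a chain of boundedly many points on the scale \<open>\<eta>\<close> (\<open>visible_link\<close>, \<open>labelling_exists\<close>).

  The approximation is glued by means of a lattice partition of unity from the mollification of \<open>u\<close> on
  unlabelled pieces and from the Taylor polynomial of the mollification at \<open>z\<close> on pieces with label \<open>z\<close>.
  The pieces are the components of \<open>\<Omega>\<close> in lattice cubes, so that parts of \<open>\<Omega>\<close> on the two sides of a thin
  wall do not interact. Where the labels do not change, the derivatives of order \<open>k\<close> are those of the
  mollification or zero. Where they change, \<open>taylor_chain\<close> bounds them by the size of the derivatives of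
  \<open>u\<close> near the gate (\<open>pointwise_estimate\<close>). The gates overlap a bounded number of times, hence the error in
  \<open>L\<^sup>p\<close> is at most the error of the mollification plus the norms of the derivatives of \<open>u\<close> over the part
  of \<open>\<Omega>\<close> behind the gates and over a collar of width comparable to \<open>\<eta>\<close> (\<open>integral_estimate\<close>). Both sets
  shrink to the empty set as \<open>\<eta>\<close> tends to zero, because every point is joined to \<open>x0\<close> by a path at positive
  distance from the boundary.
\<close>

section \<open>Arc length\<close>

definition polygon_length :: "(real => real^'n::finite) => real list => real" where
  "polygon_length g ts = (\<Sum>i<length ts - 1. dist (g (ts ! i)) (g (ts ! Suc i)))"

lemma polygon_length_simps [simp]:
  "polygon_length g [] = 0" "polygon_length g [a] = 0"
  "polygon_length g (a # b # ts) = dist (g a) (g b) + polygon_length g (b # ts)"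
  unfolding polygon_length_def by (simp_all add: sum.lessThan_Suc_shift del: sum.lessThan_Suc)

lemma polygon_length_append:
  "polygon_length g (xs @ a # ys) = polygon_length g (xs @ [a]) + polygon_length g (a # ys)"
proof (induction xs)
  case (Cons x xs) then show ?case by (cases xs) auto
qed auto

lemma polygon_length_insert: "polygon_length g (xs @ ys) \<le> polygon_length g (xs @ [a]) + polygon_length g (a # ys)"
proof (induction xs)
  case Nil
  then show ?case by (cases ys) auto
next
  case (Cons x xs)
  show ?case
  proof (cases xs)
    case Nil
    then show ?thesis
    proof (cases ys)
      case (Cons y zs)
      then show ?thesis using Nil dist_triangle[of "g x" "g y" "g a"] by (auto)
    qed auto
  next
    case (Cons z zs) then show ?thesis using Cons.IH by auto
  qed
qed

lemma inscribed_lengths_eq: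
  "inscribed_lengths g a b = {polygon_length g ts | ts. sorted ts \<and> set ts \<subseteq> {a..b}}"
  unfolding inscribed_lengths_def polygon_length_def by simp

lemma rectifiable_bdd:
  assumes "rectifiable g" "b \<le> 1" shows "bdd_above (inscribed_lengths g 0 b)"
proof -
  have "inscribed_lengths g 0 b \<subseteq> inscribed_lengths g 0 1"
    unfolding inscribed_lengths_eq using assms(2) by force
  then show ?thesis using assms(1) bdd_above_mono unfolding rectifiable_def by metis
qed

lemma polygon_length_le_arc_length:
  assumes "rectifiable g" "b \<le> 1" "sorted ts" "set ts \<subseteq> {0..b}"
  shows "polygon_length g ts \<le> arc_length g b"
  unfolding arc_length_def
  by (rule cSup_upper[OF _ rectifiable_bdd[OF assms(1,2)]]) (use assms in \<open>auto simp: inscribed_lengths_eq\<close>)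

lemma arc_length_le:
  assumes "\<And>ts. sorted ts ==> set ts \<subseteq> {0..b} ==> polygon_length g ts \<le> B"
  shows "arc_length g b \<le> B"
  unfolding arc_length_def
proof (rule cSup_least)
  have "sorted []" "set [] \<subseteq> {0..b}" by auto
  then show "inscribed_lengths g 0 b \<noteq> {}" unfolding inscribed_lengths_eq by blast
qed (use assms in \<open>auto simp: inscribed_lengths_eq\<close>)

lemma arc_length_add_polygon:
  assumes g: "rectifiable g" and b: "b \<le> 1" and ts: "sorted (v # ts)" "set (v # ts) \<subseteq> {0..b}"
  shows "arc_length g v + polygon_length g (v # ts) \<le> arc_length g b"
proof -
  have "arc_length g v \<le> arc_length g b - polygon_length g (v # ts)"
  proof (rule arc_length_le)
    fix us assume us: "sorted us" "set us \<subseteq> {0..v}"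
    have "polygon_length g us \<le> polygon_length g (us @ [v])"
      using polygon_length_insert[of g us "[]" v] by simp
    also have "... = polygon_length g (us @ v # ts) - polygon_length g (v # ts)"
      using polygon_length_append[of g us v ts] by simp
    also have "polygon_length g (us @ v # ts) \<le> arc_length g b"
    proof (rule polygon_length_le_arc_length[OF g b])
      show "sorted (us @ v # ts)" unfolding sorted_append using us ts by fastforce
      show "set (us @ v # ts) \<subseteq> {0..b}" using us ts by fastforce
    qed
    finally show "polygon_length g us \<le> arc_length g b - polygon_length g (v # ts)" by simp
  qed
  then show ?thesis by simp
qed

lemma arc_length_add_dist:
  assumes "rectifiable g" "0 \<le> s" "s \<le> t" "t \<le> 1"
  shows "arc_length g s + dist (g s) (g t) \<le> arc_length g t"
  using arc_length_add_polygon[OF assms(1,4), of s "[t]"] assms by simp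

lemma arc_length_mono:
  assumes "rectifiable g" "0 \<le> s" "s \<le> t" "t \<le> 1"
  shows "arc_length g s \<le> arc_length g t"
  using arc_length_add_dist[OF assms] zero_le_dist[of "g s" "g t"] by linarith

lemma arc_length_0 [simp]: "arc_length g 0 = 0"
proof (rule antisym)
  show "arc_length g 0 \<le> 0"
  proof (rule arc_length_le)
    fix ts :: "real list" assume "sorted ts" "set ts \<subseteq> {0..0}"
    then have "\<forall>i<length ts. ts ! i = 0" using nth_mem by fastforce
    then show "polygon_length g ts \<le> 0" unfolding polygon_length_def
      by (intro sum_nonpos) auto
  qed
  have "bdd_above (inscribed_lengths g 0 0)"
  proof (rule bdd_aboveI[of _ 0])
    fix x assume "x \<in> inscribed_lengths g 0 0"
    then obtain ts where ts: "x = polygon_length g ts" "set ts \<subseteq> {0..0}" by (auto simp: inscribed_lengths_eq)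
    then have "\<forall>i<length ts. ts ! i = 0" using nth_mem by fastforce
    then show "x \<le> 0" unfolding ts polygon_length_def
      by (intro sum_nonpos) auto
  qed
  then show "0 \<le> arc_length g 0" unfolding arc_length_def
    by (rule cSup_upper[rotated]) (auto simp: inscribed_lengths_eq intro!: exI[of _ "[]"])
qed

lemma sorted_split:
  fixes ts :: "real list"
  assumes "sorted ts"
  obtains us vs where "ts = us @ vs" "\<And>x. x \<in> set us ==> x \<le> u" "\<And>x. x \<in> set vs ==> u < x"
proof -
  have "ts = takeWhile (\<lambda>x. x \<le> u) ts @ dropWhile (\<lambda>x. x \<le> u) ts" by simp
  moreover have "u < x" if x: "x \<in> set (dropWhile (\<lambda>x. x \<le> u) ts)" for x
  proof (cases "dropWhile (\<lambda>x. x \<le> u) ts")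
    case Nil
    show ?thesis using x unfolding Nil by simp
  next
    case (Cons y ys)
    then have "u < y" using hd_dropWhile[of "\<lambda>x. x \<le> u" ts] by force
    moreover have "sorted (y # ys)" using Cons assms sorted_dropWhile[of ts] by metis
    ultimately show ?thesis using x Cons by auto
  qed
  moreover have "x \<le> u" if "x \<in> set (takeWhile (\<lambda>x. x \<le> u) ts)" for x
    using set_takeWhileD[OF that] by simp
  ultimately show ?thesis using that by blast
qed

text \<open>Inserting a point of the partition near \<open>u\<close> shows that the variation over an interval without
  partition points is almost the chord.\<close>

lemma arc_length_gap:
  assumes g: "rectifiable g" and uv: "0 \<le> u" "u \<le> v" "v \<le> 1"
    and ts: "sorted ts" "set ts \<subseteq> {0..1}" "\<And>x. x \<in> set ts ==> x \<le> u \<or> v \<le> x"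
  shows "arc_length g v - arc_length g u \<le> dist (g u) (g v) + (arc_length g 1 - polygon_length g ts)"
proof -
  obtain us vs where s: "ts = us @ vs" "\<And>x. x \<in> set us ==> x \<le> u" "\<And>x. x \<in> set vs ==> u < x"
    using sorted_split[OF ts(1)] by metis
  have vv: "v \<le> x" if "x \<in> set vs" for x using ts(3)[of x] s(3)[OF that] that s(1) by auto
  have "polygon_length g ts \<le> polygon_length g (us @ [u]) + polygon_length g (u # vs)"
    unfolding s(1) by (rule polygon_length_insert)
  moreover have "polygon_length g (us @ [u]) \<le> arc_length g u"
    by (rule polygon_length_le_arc_length[OF g]) (use uv ts s in \<open>auto simp: sorted_append\<close>)
  moreover have "polygon_length g (u # vs) \<le> dist (g u) (g v) + polygon_length g (v # vs)"
    using polygon_length_insert[of g "[u]" vs v] by simp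
  moreover have "arc_length g v + polygon_length g (v # vs) \<le> arc_length g 1"
    by (rule arc_length_add_polygon[OF g]) (use uv ts s vv in \<open>auto simp: sorted_append\<close>)
  ultimately show ?thesis by linarith
qed

lemma continuous_arc_length:
  assumes g: "rectifiable g" shows "continuous_on {0..1} (arc_length g)"
  unfolding continuous_on_iff
proof (intro ballI allI impI)
  fix t e :: real assume t: "t \<in> {0..1}" and e: "0 < e"
  have "arc_length g 1 - e/2 < Sup (inscribed_lengths g 0 1)" using e unfolding arc_length_def by simp
  moreover have "inscribed_lengths g 0 1 \<noteq> {}"
    unfolding inscribed_lengths_eq by (auto intro!: exI[of _ "[]"])
  ultimately obtain x where "x \<in> inscribed_lengths g 0 1" "arc_length g 1 - e/2 < x"
    using less_cSup_iff[OF _ rectifiable_bdd[OF g]] by auto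
  then obtain ts where ts: "sorted ts" "set ts \<subseteq> {0..1}" "arc_length g 1 - e/2 < polygon_length g ts"
    unfolding inscribed_lengths_eq by auto
  have "finite (set ts - {t})" by simp
  then obtain d1 where d1: "d1 > 0" "\<And>x. x \<in> set ts ==> x \<noteq> t ==> d1 \<le> dist t x"
    using finite_set_avoid[of "set ts" t] by auto
  have "continuous_on {0..1} g" using g unfolding rectifiable_def path_def by simp
  then obtain d2 where d2: "d2 > 0" "\<And>x. x \<in> {0..1} ==> dist x t < d2 ==> dist (g x) (g t) < e/2"
    unfolding continuous_on_iff using t half_gt_zero[OF e] by blast
  have "dist (arc_length g x) (arc_length g t) < e" if x: "x \<in> {0..1}" "dist x t < min d1 d2" for x
  proof -
    define u v where "u = min x t" and "v = max x t"
    have uv: "0 \<le> u" "u \<le> v" "v \<le> 1" using x t unfolding u_def v_def by auto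
    have "y \<le> u \<or> v \<le> y" if "y \<in> set ts" for y
      using d1(2)[OF that] x unfolding u_def v_def dist_real_def by (cases "y = t") auto
    from arc_length_gap[OF g uv ts(1,2) this]
    have "arc_length g v - arc_length g u \<le> dist (g u) (g v) + (arc_length g 1 - polygon_length g ts)" .
    also have "dist (g u) (g v) = dist (g x) (g t)" unfolding u_def v_def by (simp add: min_def max_def dist_commute)
    also have "... < e/2" using d2(2) x by auto
    finally have "arc_length g v - arc_length g u < e" using ts(3) by simp
    moreover have "arc_length g u \<le> arc_length g v" by (rule arc_length_mono[OF g uv])
    ultimately show ?thesis unfolding u_def v_def dist_real_def by (auto simp: min_def max_def split: if_splits)
  qed
  then show "\<exists>d>0. \<forall>x'\<in>{0..1}. dist x' t < d --> dist (arc_length g x') (arc_length g t) < e"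
    using d1(1) d2(1) by (intro exI[of _ "min d1 d2"]) auto
qed

lemma arc_length_ivt:
  assumes g: "rectifiable g" and "0 \<le> u" "u \<le> v" "v \<le> 1" "arc_length g u \<le> s" "s \<le> arc_length g v"
  obtains t where "u \<le> t" "t \<le> v" "arc_length g t = s"
  using IVT'[of "arc_length g" u s v] continuous_on_subset[OF continuous_arc_length[OF g], of "{u..v}"] assms
  by auto

lemma arc_length_param_arc_length:
  assumes g: "rectifiable g" and t: "t \<in> {0..1}"
  shows "arc_length_param g (arc_length g t) = g t"
proof -
  define u where "u = (SOME u. u \<in> {0..1} \<and> arc_length g u = arc_length g t)"
  have u: "u \<in> {0..1} \<and> arc_length g u = arc_length g t" unfolding u_def by (rule someI[of _ t]) (use t in auto)
  have "dist (g u) (g t) \<le> 0"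
  proof (cases "u \<le> t")
    case True
    then have "arc_length g u + dist (g u) (g t) \<le> arc_length g t"
      using arc_length_add_dist[OF g, of u t] u t by fastforce
    then show ?thesis using u by linarith
  next
    case False
    then have "arc_length g t + dist (g t) (g u) \<le> arc_length g u"
      using arc_length_add_dist[OF g, of t u] u t by fastforce
    then show ?thesis using u by (simp add: dist_commute)
  qed
  then have "g u = g t" by simp
  then show ?thesis unfolding arc_length_param_def u_def[symmetric] .
qed

lemma arc_length_param_point:
  assumes g: "rectifiable g" and s: "s \<in> {0..arc_length g 1}"
  obtains t where "t \<in> {0..1}" "arc_length g t = s" "arc_length_param g s = g t"
proof -
  obtain t where "0 \<le> t" "t \<le> 1" "arc_length g t = s"
    using arc_length_ivt[OF g, of 0 1 s] s by auto
  then show ?thesis using that[of t] arc_length_param_arc_length[OF g, of t] by auto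
qed

lemma arc_length_param_lipschitz:
  assumes g: "rectifiable g" and s: "s \<in> {0..arc_length g 1}" "s' \<in> {0..arc_length g 1}"
  shows "dist (arc_length_param g s) (arc_length_param g s') \<le> \<bar>s - s'\<bar>"
proof -
  obtain t where t: "t \<in> {0..1}" "arc_length g t = s" "arc_length_param g s = g t"
    using arc_length_param_point[OF g s(1)] .
  obtain t' where t': "t' \<in> {0..1}" "arc_length g t' = s'" "arc_length_param g s' = g t'"
    using arc_length_param_point[OF g s(2)] .
  have "dist (g a) (g b) \<le> \<bar>arc_length g a - arc_length g b\<bar>"
    if "a \<in> {0..1}" "b \<in> {0..1}" "a \<le> b" for a b
    using arc_length_add_dist[OF g, of a b] that by fastforce
  from this[of t t'] this[of t' t] show ?thesis
    using t t' by (cases "t \<le> t'") (auto simp: dist_commute abs_minus_commute)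
qed


section \<open>Tame curves\<close>

locale bounded_domain =
  fixes \<Omega> :: "(real^'n::finite) set"
  assumes domain: "is_domain \<Omega>" and bdd: "bounded \<Omega>"
begin

abbreviation "d z \<equiv> infdist z (frontier \<Omega>)"
abbreviation "k \<equiv> qh_dist \<Omega>"

lemma open_dom [simp]: "open \<Omega>" and connected_dom: "connected \<Omega>" and nonempty_dom: "\<Omega> \<noteq> {}"
  using domain unfolding is_domain_def by auto

lemma frontier_nonempty: "frontier \<Omega> \<noteq> {}"
proof -
  have "\<Omega> \<noteq> UNIV" using bdd not_bounded_UNIV[where 'a="real^'n"] by metis
  then have "UNIV - \<Omega> \<noteq> {}" by blast
  then show ?thesis using connected_Int_frontier[of UNIV \<Omega>] nonempty_dom by auto
qed

lemma d_pos: "z \<in> \<Omega> ==> 0 < d z"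
  by (rule infdist_pos_not_in_closed[OF frontier_closed frontier_nonempty])
     (metis open_dom frontier_disjoint_eq disjoint_iff)

lemma d_lip: "\<bar>d x - d y\<bar> \<le> dist x y"
  by (rule infdist_triangle_abs)

lemma d_le: "d y \<le> d x + dist x y"
  using d_lip[of x y] by linarith

lemma ball_d_subset: assumes "z \<in> \<Omega>" shows "ball z (d z) \<subseteq> \<Omega>"
proof (rule ccontr)
  assume "\<not> ?thesis"
  then have "ball z (d z) \<inter> frontier \<Omega> \<noteq> {}"
    using assms d_pos[OF assms] centre_in_ball[of z "d z"] by (intro connected_Int_frontier) blast+
  then obtain w where "dist z w < d z" "w \<in> frontier \<Omega>" by auto
  then show False using infdist_le[of w "frontier \<Omega>" z] by linarith
qed

text \<open>The quasihyperbolic metric is studied through curves whose speed is at most the distance to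
  the boundary. The condition is stated in integrated form, because this form is preserved by
  pointwise limits; it replaces both rectifiability and the line integral.\<close>

definition tame :: "real => (real => real^'n) => bool" where
  "tame T c \<longleftrightarrow> 0 \<le> T \<and> (\<forall>s\<in>{0..T}. c s \<in> \<Omega>) \<and>
     (\<forall>s\<in>{0..T}. \<forall>t\<in>{0..T}. dist (c s) (c t) \<le> (exp \<bar>s - t\<bar> - 1) * d (c s))"

lemma tameD:
  assumes "tame T c"
  shows "0 \<le> T" "s \<in> {0..T} ==> c s \<in> \<Omega>"
    "s \<in> {0..T} ==> t \<in> {0..T} ==> dist (c s) (c t) \<le> (exp \<bar>s - t\<bar> - 1) * d (c s)"
  using assms unfolding tame_def by blast+

lemma tame_d:
  assumes "tame T c" "s \<in> {0..T}" "t \<in> {0..T}"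
  shows "d (c t) \<le> exp \<bar>s - t\<bar> * d (c s)"
  using d_le[of "c t" "c s"] tameD(3)[OF assms] by (simp add: algebra_simps)

lemma exp_minus_one_le: "exp x - 1 \<le> x * exp (x::real)" if "0 \<le> x"
proof -
  have "1 - x \<le> exp (- x)" using exp_ge_add_one_self[of "-x"] by simp
  then have "(1 - x) * exp x \<le> exp (-x) * exp x" by (intro mult_right_mono) auto
  then show ?thesis by (simp add: algebra_simps exp_minus)
qed

lemma tame_lipschitz:
  assumes c: "tame T c" and s: "s \<in> {a..b}" and t: "t \<in> {a..b}" and ab: "0 \<le> a" "b \<le> T"
  shows "dist (c s) (c t) \<le> \<bar>s - t\<bar> * (exp (b - a) * exp (b - a) * d (c a))"
proof -
  have "exp \<bar>s - t\<bar> - 1 \<le> \<bar>s - t\<bar> * exp \<bar>s - t\<bar>" by (rule exp_minus_one_le) auto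
  also have "... \<le> \<bar>s - t\<bar> * exp (b - a)" using s t by (intro mult_left_mono) auto
  finally have 1: "exp \<bar>s - t\<bar> - 1 \<le> \<bar>s - t\<bar> * exp (b - a)" .
  have "d (c s) \<le> exp \<bar>a - s\<bar> * d (c a)" by (rule tame_d[OF c]) (use s t ab in auto)
  also have "... \<le> exp (b - a) * d (c a)" using s by (intro mult_right_mono) (auto simp: infdist_nonneg)
  finally have 2: "d (c s) \<le> exp (b - a) * d (c a)" .
  have "dist (c s) (c t) \<le> (exp \<bar>s - t\<bar> - 1) * d (c s)" by (rule tameD(3)[OF c]) (use s t ab in auto)
  also have "... \<le> (\<bar>s - t\<bar> * exp (b - a)) * (exp (b - a) * d (c a))"
    by (rule mult_mono[OF 1 2]) (auto simp: infdist_nonneg)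
  finally show ?thesis by (simp add: algebra_simps)
qed

lemma tame_const: "z \<in> \<Omega> ==> 0 \<le> T ==> tame T (\<lambda>_. z)"
  unfolding tame_def using d_pos[of z] by auto

lemma tame_segment:
  assumes "tame T c" "0 \<le> a" "a \<le> b" "b \<le> T"
  shows "tame (b - a) (\<lambda>t. c (a + t))"
  unfolding tame_def
proof (intro conjI ballI)
  fix s t assume "s \<in> {0..b - a}" "t \<in> {0..b - a}"
  then show "dist (c (a + s)) (c (a + t)) \<le> (exp \<bar>s - t\<bar> - 1) * d (c (a + s))"
    using tameD(3)[OF assms(1), of "a + s" "a + t"] assms by auto
qed (use assms tameD[OF assms(1)] in auto)

lemma tame_reverse:
  assumes "tame T c" shows "tame T (\<lambda>t. c (T - t))"
  unfolding tame_def
proof (intro conjI ballI)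
  fix s t assume "s \<in> {0..T}" "t \<in> {0..T}"
  then show "dist (c (T - s)) (c (T - t)) \<le> (exp \<bar>s - t\<bar> - 1) * d (c (T - s))"
    using tameD(3)[OF assms(1), of "T - s" "T - t"] by (simp add: abs_minus_commute)
qed (use tameD[OF assms(1)] in auto)

lemma tame_join:
  assumes c: "tame S c" and e: "tame T e" and "c S = e 0"
  shows "tame (S + T) (\<lambda>t. if t \<le> S then c t else e (t - S))"
proof -
  have *: "dist x z \<le> (exp (a + b) - 1) * d x"
    if "dist x y \<le> (exp a - 1) * d x" "dist y z \<le> (exp b - 1) * d y" "0 \<le> b" for x y z a b
  proof -
    have "d y \<le> exp a * d x" using that(1) d_le[of y x] by (simp add: algebra_simps)
    then have "(exp b - 1) * d y \<le> (exp b - 1) * (exp a * d x)" using that(3) by (intro mult_left_mono) auto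
    then show ?thesis using dist_triangle[of x z y] that(1,2) by (simp add: algebra_simps exp_add)
  qed
  have S: "0 \<le> S" and T: "0 \<le> T" using tameD(1)[OF c] tameD(1)[OF e] by auto
  show ?thesis unfolding tame_def
  proof (intro conjI ballI)
    fix s t assume st: "s \<in> {0..S + T}" "t \<in> {0..S + T}"
    let ?e = "\<lambda>t. if t \<le> S then c t else e (t - S)"
    consider "s \<le> S" "t \<le> S" | "S < s" "S < t" | "s \<le> S" "S < t" | "S < s" "t \<le> S" by linarith
    then show "dist (?e s) (?e t) \<le> (exp \<bar>s - t\<bar> - 1) * d (?e s)"
    proof cases
      case 1 then show ?thesis using tameD(3)[OF c, of s t] st by auto
    next
      case 2 then show ?thesis using tameD(3)[OF e, of "s-S" "t-S"] st by auto
    next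
      case 3
      have "dist (c s) (e (t - S)) \<le> (exp ((S - s) + (t - S)) - 1) * d (c s)"
        by (rule *[of _ "c S"]) (use tameD(3)[OF c, of s S] tameD(3)[OF e, of 0 "t - S"] 3 st S T assms(3) in auto)
      then show ?thesis using 3 by auto
    next
      case 4
      have "dist (e (s - S)) (c t) \<le> (exp ((s - S) + (S - t)) - 1) * d (e (s - S))"
        by (rule *[of _ "c S"]) (use tameD(3)[OF c, of S t] tameD(3)[OF e, of "s - S" 0] 4 st S T assms(3) in auto)
      then show ?thesis using 4 by auto
    qed
  qed (use S T tameD(2)[OF c] tameD(2)[OF e] in auto)
qed

lemma abs_diff_le_exp: "\<bar>s - t\<bar> \<le> exp \<bar>s - t\<bar> - (1::real)"
  using exp_ge_add_one_self[of "\<bar>s - t\<bar>"] by linarith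

lemma tame_line:
  assumes x: "x \<in> \<Omega>" and y: "dist x y < d x"
  shows "\<exists>c. tame (dist x y / (d x - dist x y)) c \<and> c 0 = x \<and> c (dist x y / (d x - dist x y)) = y"
proof (cases "x = y")
  case True then show ?thesis using tame_const[OF x, of 0] by (intro exI[of _ "\<lambda>_. x"]) auto
next
  case False
  define T where "T = dist x y / (d x - dist x y)"
  define c where "c t = x + (t / T) *\<^sub>R (y - x)" for t
  have T: "0 < T" using False y unfolding T_def by (simp add: divide_simps)
  have dT: "dist x y = T * (d x - dist x y)" using y unfolding T_def by simp
  have dc: "dist (c s) (c t) = \<bar>s - t\<bar> * (d x - dist x y)" for s t
  proof -
    have "c s - c t = ((s - t) / T) *\<^sub>R (y - x)" unfolding c_def by (simp add: algebra_simps diff_divide_distrib)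
    then have "dist (c s) (c t) = \<bar>s - t\<bar> / T * dist x y"
      using T by (simp add: dist_norm norm_minus_commute)
    also have "... = \<bar>s - t\<bar> * (d x - dist x y)" using T by (subst dT) (simp)
    finally show ?thesis .
  qed
  have c0: "c 0 = x" and cT: "c T = y" using T unfolding c_def by auto
  have dx: "dist x (c s) \<le> dist x y" if "s \<in> {0..T}" for s
  proof -
    have "s * (d x - dist x y) \<le> T * (d x - dist x y)" using that y by (intro mult_right_mono) auto
    then show ?thesis using dc[of 0 s] c0 dT that by auto
  qed
  have "tame T c" unfolding tame_def
  proof (intro conjI ballI)
    fix s assume s: "s \<in> {0..T}"
    show "c s \<in> \<Omega>" using dx[OF s] y ball_d_subset[OF x] by (auto simp: subset_iff)
    fix t assume "t \<in> {0..T}"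
    have "\<bar>s - t\<bar> * (d x - dist x y) \<le> (exp \<bar>s - t\<bar> - 1) * d (c s)"
      by (rule mult_mono) (use dx[OF s] d_le[of x "c s"] y abs_diff_le_exp in \<open>auto simp: dist_commute\<close>)
    then show "dist (c s) (c t) \<le> (exp \<bar>s - t\<bar> - 1) * d (c s)" unfolding dc .
  qed (use T in auto)
  then show ?thesis using c0 cT unfolding T_def by blast
qed

lemma tame_exists:
  assumes "x \<in> \<Omega>" "y \<in> \<Omega>" shows "\<exists>T c. tame T c \<and> c 0 = x \<and> c T = y"
proof (rule connected_equivalence_relation[OF connected_dom assms])
  fix x y assume "\<exists>T c. tame T c \<and> c 0 = x \<and> c T = y"
  then obtain T c where "tame T c" "c 0 = x" "c T = y" by blast
  then show "\<exists>T c. tame T c \<and> c 0 = y \<and> c T = x"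
    using tame_reverse[of T c] by (intro exI[of _ T] exI[of _ "\<lambda>t. c (T - t)"]) auto
next
  fix x y z
  assume "\<exists>T c. tame T c \<and> c 0 = x \<and> c T = y" "\<exists>T c. tame T c \<and> c 0 = y \<and> c T = z"
  then obtain S c T e where *: "tame S c" "c 0 = x" "c S = y" "tame T e" "e 0 = y" "e T = z" by blast
  then show "\<exists>T c. tame T c \<and> c 0 = x \<and> c T = z"
    using tame_join[of S c T e] tameD(1)[OF *(1)] tameD(1)[OF *(4)]
    by (intro exI[of _ "S+T"] exI[of _ "\<lambda>t. if t \<le> S then c t else e (t - S)"]) (auto split: if_splits)
next
  fix a assume a: "a \<in> \<Omega>"
  show "\<exists>U. openin (top_of_set \<Omega>) U \<and> a \<in> U \<and> (\<forall>x\<in>U. \<exists>T c. tame T c \<and> c 0 = a \<and> c T = x)"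
    using tame_line[OF a] ball_d_subset[OF a] d_pos[OF a]
    by (intro exI[of _ "ball a (d a)"]) (auto simp: open_subset, blast)
qed

end

lemma polygon_length_lipschitz:
  assumes "\<And>a b. u \<le> a ==> a \<le> b ==> b \<le> v ==> dist (g a) (g b) \<le> K * (b - a)"
    and "u \<le> v" "0 \<le> K" "sorted ts" "set ts \<subseteq> {u..v}"
  shows "polygon_length g ts \<le> K * (v - u)"
  using assms
proof (induction ts arbitrary: u)
  case Nil then show ?case by simp
next
  case (Cons a ts)
  show ?case
  proof (cases ts)
    case Nil then show ?thesis using Cons.prems by simp
  next
    case (Cons b bs)
    have "polygon_length g ts \<le> K * (v - b)"
      by (rule Cons.IH) (use Cons.prems Cons in auto)
    moreover have "dist (g a) (g b) \<le> K * (b - a)" using Cons.prems Cons by auto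
    moreover have "K * a \<ge> K * u" using Cons.prems by (intro mult_left_mono) auto
    ultimately show ?thesis unfolding Cons by (simp add: algebra_simps)
  qed
qed

lemma arc_length_lipschitz:
  assumes g: "rectifiable g" and "0 \<le> u" "u \<le> v" "v \<le> 1" "0 \<le> K"
    and lip: "\<And>a b. u \<le> a ==> a \<le> b ==> b \<le> v ==> dist (g a) (g b) \<le> K * (b - a)"
  shows "arc_length g v - arc_length g u \<le> K * (v - u)"
proof -
  have "arc_length g v \<le> arc_length g u + K * (v - u)"
  proof (rule arc_length_le)
    fix ts assume ts: "sorted ts" "set ts \<subseteq> {0..v}"
    obtain us vs where s: "ts = us @ vs" "\<And>x. x \<in> set us ==> x \<le> u" "\<And>x. x \<in> set vs ==> u < x"
      using sorted_split[OF ts(1)] by metis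
    have "polygon_length g ts \<le> polygon_length g (us @ [u]) + polygon_length g (u # vs)"
      unfolding s(1) by (rule polygon_length_insert)
    moreover have "polygon_length g (us @ [u]) \<le> arc_length g u"
      by (rule polygon_length_le_arc_length[OF g]) (use assms ts s in \<open>auto simp: sorted_append\<close>)
    moreover have "polygon_length g (u # vs) \<le> K * (v - u)"
      by (rule polygon_length_lipschitz[OF lip]) (use assms ts s in \<open>auto simp: sorted_append less_imp_le\<close>)
    ultimately show "polygon_length g ts \<le> arc_length g u + K * (v - u)" by linarith
  qed
  then show ?thesis by simp
qed


text \<open>A function whose increments are at most linear up to a factor tending to \<open>1\<close> has slope at
  most that of the linear bound.\<close>

lemma increment_bound:
  fixes \<phi> :: "real => real"
  assumes inc: "\<And>u v. 0 \<le> u ==> u \<le> v ==> v \<le> 1 ==> \<phi> v - \<phi> u \<le> (v - u) * (T * exp (3 * T * (v - u)))"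
  shows "\<phi> 1 - \<phi> 0 \<le> T"
proof -
  have "\<phi> 1 - \<phi> 0 \<le> T * exp (3 * T * inverse (real (Suc N)))" for N
  proof -
    let ?h = "inverse (real (Suc N))"
    have "\<phi> 1 - \<phi> 0 = (\<Sum>j<Suc N. \<phi> (real (Suc j) * ?h) - \<phi> (real j * ?h))"
      by (subst sum_lessThan_telescope) auto
    also have "... \<le> (\<Sum>j<Suc N. ?h * (T * exp (3 * T * ?h)))"
    proof (rule sum_mono)
      fix j assume j: "j \<in> {..<Suc N}"
      have e: "real (Suc j) * ?h - real j * ?h = ?h" by (simp add: algebra_simps)
      have "real (Suc j) * ?h \<le> real (Suc N) * ?h" using j by (intro mult_right_mono) auto
      then have "real (Suc j) * ?h \<le> 1" by simp
      moreover have "real j * ?h \<le> real (Suc j) * ?h" by (intro mult_right_mono) auto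
      ultimately show "\<phi> (real (Suc j) * ?h) - \<phi> (real j * ?h) \<le> ?h * (T * exp (3 * T * ?h))"
        using inc[of "real j * ?h" "real (Suc j) * ?h"] unfolding e by simp
    qed
    also have "... = T * exp (3 * T * ?h)" by simp
    finally show ?thesis .
  qed
  moreover have "(\<lambda>N. T * exp (3 * T * inverse (real (Suc N)))) \<longlonglongrightarrow> T * exp (3 * T * 0)"
    by (intro tendsto_intros LIMSEQ_inverse_real_of_nat)
  ultimately show ?thesis by (intro LIMSEQ_le_const[of _ "T"]) auto
qed

lemma ln_le_integral_inverse:
  fixes D \<rho> :: "real => real"
  assumes "s \<le> s'" "0 < D0" "(\<lambda>r. 1 / D r) integrable_on {s..s'}"
    and D: "\<And>r. r \<in> {s..s'} ==> 0 < D r \<and> D r \<le> D0 + \<rho> r"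
    and \<rho>: "\<rho> = (\<lambda>r. r - s) \<or> \<rho> = (\<lambda>r. s' - r)"
  shows "s' - s \<le> (exp (integral {s..s'} (\<lambda>r. 1 / D r)) - 1) * D0"
proof -
  have pos: "0 < D0 + \<rho> r" if "r \<in> {s..s'}" for r using \<rho> that assms(2) by auto
  have "((\<lambda>r. 1 / (D0 + \<rho> r)) has_integral (ln (D0 + (s' - s)) - ln D0)) {s..s'}"
    using \<rho>
  proof
    assume \<rho>: "\<rho> = (\<lambda>r. r - s)"
    have "((\<lambda>r. 1 / (D0 + (r - s))) has_integral (ln (D0 + (s' - s)) - ln (D0 + (s - s)))) {s..s'}"
      using assms(1,2)
      by (intro fundamental_theorem_of_calculus)
         (auto intro!: derivative_eq_intros simp: has_real_derivative_iff_has_vector_derivative[symmetric])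
    then show ?thesis using \<rho> by simp
  next
    assume \<rho>: "\<rho> = (\<lambda>r. s' - r)"
    have "((\<lambda>r. 1 / (D0 + (s' - r))) has_integral ((- ln (D0 + (s' - s'))) - (- ln (D0 + (s' - s))))) {s..s'}"
      using assms(1,2)
      by (intro fundamental_theorem_of_calculus)
         (auto intro!: derivative_eq_intros simp: has_real_derivative_iff_has_vector_derivative[symmetric])
    then show ?thesis using \<rho> by simp
  qed
  then have "ln (D0 + (s' - s)) - ln D0 \<le> integral {s..s'} (\<lambda>r. 1 / D r)"
    using integrable_integral[OF assms(3)] D pos
    by (elim has_integral_le) (auto intro!: divide_left_mono)
  then have "exp (ln (D0 + (s' - s)) - ln D0) \<le> exp (integral {s..s'} (\<lambda>r. 1 / D r))" by simp
  moreover have "exp (ln (D0 + (s' - s)) - ln D0) = (D0 + (s' - s)) / D0"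
    using assms(1,2) by (simp add: exp_diff)
  ultimately have "(D0 + (s' - s)) / D0 \<le> exp (integral {s..s'} (\<lambda>r. 1 / D r))" by metis
  then show ?thesis using assms(2) by (simp add: divide_le_eq algebra_simps)
qed

context bounded_domain
begin

lemma continuous_inverse_d_param:
  assumes g: "rectifiable g" "path_image g \<subseteq> \<Omega>"
  shows "continuous_on {0..arc_length g 1} (\<lambda>s. 1 / d (arc_length_param g s))"
proof -
  have "continuous_on {0..arc_length g 1} (\<lambda>s. d (arc_length_param g s))"
    unfolding continuous_on_iff
  proof (intro ballI allI impI)
    fix s e assume "s \<in> {0..arc_length g 1}" "(0::real) < e"
    then have "dist (d (arc_length_param g s')) (d (arc_length_param g s)) < e"
      if "s' \<in> {0..arc_length g 1}" "dist s' s < e" for s'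
      using d_lip[of "arc_length_param g s'" "arc_length_param g s"]
        arc_length_param_lipschitz[OF g(1) that(1), of s] that by (simp add: dist_real_def)
    then show "\<exists>d'>0. \<forall>x'\<in>{0..arc_length g 1}. dist x' s < d' -->
        dist (d (arc_length_param g x')) (d (arc_length_param g s)) < e" using \<open>0 < e\<close> by blast
  qed
  moreover have "0 < d (arc_length_param g s)" if "s \<in> {0..arc_length g 1}" for s
    using arc_length_param_point[OF g(1) that] g(2) d_pos unfolding path_image_def by (metis image_subset_iff)
  ultimately show ?thesis by (intro continuous_on_divide continuous_on_const) force+
qed

text \<open>On a short parameter interval the distance to the boundary is nearly constant and the arc length is
  nearly bounded by its product with the elapsed time; \<open>increment_bound\<close> removes the factor that
  remains.\<close>

lemma tame_qh_length:
  assumes c: "tame T c"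
  shows "\<exists>g\<in>joining_curves \<Omega> (c 0) (c T). qh_length \<Omega> g \<le> T \<and> path_image g = c ` {0..T}"
proof
  define g where "g t = c (T * t)" for t
  have T: "0 \<le> T" using tameD[OF c] by simp
  have rng: "T * t \<in> {0..T}" if "t \<in> {0..1}" for t
    using that T mult_left_le[of t T] by auto
  have lip: "dist (g a) (g b) \<le> (T * (exp (T * (v - u)))\<^sup>2 * d (g u)) * (b - a)"
    if "0 \<le> u" "u \<le> a" "a \<le> b" "b \<le> v" "v \<le> 1" for a b u v
  proof -
    have "T * u \<le> T * a" "T * a \<le> T * b" "T * b \<le> T * v" "T * v \<le> T"
      using T that by (auto intro!: mult_left_mono simp: mult_left_le)
    then show ?thesis
      using tame_lipschitz[OF c, of "T * a" "T * u" "T * v" "T * b"] T that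
      unfolding g_def power2_eq_square by (auto simp: algebra_simps)
  qed
  have img: "path_image g = c ` {0..T}"
  proof
    show "path_image g \<subseteq> c ` {0..T}" unfolding path_image_def g_def using rng by blast
    show "c ` {0..T} \<subseteq> path_image g"
    proof
      fix y assume "y \<in> c ` {0..T}"
      then obtain s where s: "s \<in> {0..T}" "y = c s" by blast
      show "y \<in> path_image g" unfolding path_image_def g_def
        using s T by (intro image_eqI[of _ _ "s / T"]) (auto simp: divide_simps)
    qed
  qed
  have "continuous_on {0..1} g"
  proof -
    define K where "K = T * (exp (T * (1 - 0)))\<^sup>2 * d (g 0)"
    have "K-lipschitz_on {0..1} g"
    proof (rule lipschitz_onI)
      fix x y :: real assume "x \<in> {0..1}" "y \<in> {0..1}"
      then show "dist (g x) (g y) \<le> K * dist x y"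
        using lip[of 0 x y 1] lip[of 0 y x 1] unfolding K_def
        by (cases "x \<le> y") (auto simp: dist_commute dist_real_def)
    qed (use T in \<open>auto simp: K_def infdist_nonneg\<close>)
    then show ?thesis by (rule lipschitz_on_continuous_on)
  qed
  moreover have "bdd_above (inscribed_lengths g 0 1)"
  proof (rule bdd_aboveI)
    fix x assume "x \<in> inscribed_lengths g 0 1"
    then obtain ts where "x = polygon_length g ts" "sorted ts" "set ts \<subseteq> {0..1}" by (auto simp: inscribed_lengths_eq)
    then show "x \<le> (T * (exp (T * (1 - 0)))\<^sup>2 * d (g 0)) * (1 - 0)"
      using polygon_length_lipschitz[where u = 0 and v = 1, OF lip[of 0 _ _ 1]] T by (auto simp: infdist_nonneg)
  qed
  ultimately have g: "rectifiable g" unfolding rectifiable_def path_def by simp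
  have sub: "path_image g \<subseteq> \<Omega>" unfolding img using tameD(2)[OF c] by blast
  have "pathstart g = c 0" "pathfinish g = c T" unfolding pathstart_def pathfinish_def g_def by auto
  then show "g \<in> joining_curves \<Omega> (c 0) (c T)" unfolding joining_curves_def using g sub by simp
  define f where "f s = 1 / d (arc_length_param g s)" for s
  have int: "f integrable_on {a..b}" if "0 \<le> a" "b \<le> arc_length g 1" for a b
    using continuous_on_subset[OF continuous_inverse_d_param[OF g sub]] that unfolding f_def
    by (intro integrable_continuous_interval) auto
  define \<phi> where "\<phi> u = integral {0..arc_length g u} f" for u
  have "\<phi> v - \<phi> u \<le> (v - u) * (T * exp (3 * T * (v - u)))" if uv: "0 \<le> u" "u \<le> v" "v \<le> 1" for u v
  proof -
    let ?E = "exp (T * (v - u))"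
    have l: "0 \<le> arc_length g u" "arc_length g u \<le> arc_length g v" "arc_length g v \<le> arc_length g 1"
      using arc_length_mono[OF g] uv arc_length_0[of g] by (metis order.refl order.trans)+
    have du: "0 < d (g u)" using tameD(2)[OF c rng[of u]] uv d_pos unfolding g_def by auto
    have "\<phi> v - \<phi> u = integral {arc_length g u..arc_length g v} f"
      unfolding \<phi>_def
      using Henstock_Kurzweil_Integration.integral_combine[of 0 "arc_length g u" "arc_length g v" f] l int by auto
    also have "... \<le> integral {arc_length g u..arc_length g v} (\<lambda>_. ?E / d (g u))"
    proof (rule integral_le)
      fix s assume s: "s \<in> {arc_length g u..arc_length g v}"
      then obtain t where t: "u \<le> t" "t \<le> v" "arc_length g t = s"
        using arc_length_ivt[OF g uv] by auto
      then have p: "arc_length_param g s = g t" using arc_length_param_arc_length[OF g, of t] uv by auto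
      have "0 < d (g t)" using tameD(2)[OF c rng[of t]] uv t d_pos unfolding g_def by auto
      moreover have "d (g u) \<le> exp \<bar>T * t - T * u\<bar> * d (g t)"
        unfolding g_def by (rule tame_d[OF c rng rng]) (use uv t in auto)
      moreover have "\<bar>T * t - T * u\<bar> \<le> T * (v - u)"
        using T t by (simp add: right_diff_distrib[symmetric] abs_mult mult_left_mono)
      then have "exp \<bar>T * t - T * u\<bar> * d (g t) \<le> ?E * d (g t)"
        by (intro mult_right_mono) (auto simp: infdist_nonneg)
      ultimately have "0 < d (g t)" "d (g u) \<le> ?E * d (g t)" by linarith+
      then show "f s \<le> ?E / d (g u)" unfolding f_def p using du by (simp add: divide_simps mult.commute)
    qed (use int l in auto)
    also have "... = (arc_length g v - arc_length g u) * (?E / d (g u))" using l by simp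
    also have "... \<le> ((T * ?E\<^sup>2 * d (g u)) * (v - u)) * (?E / d (g u))"
      using arc_length_lipschitz[OF g uv _ lip[OF uv(1) _ _ _ uv(3)]] T du
      by (intro mult_right_mono) (auto simp: infdist_nonneg)
    also have "... = (v - u) * (T * ?E ^ 3)" using du by (simp add: field_simps power_numeral_reduce)
    also have "?E ^ 3 = exp (3 * T * (v - u))" by (simp add: exp_of_nat_mult[symmetric] mult.assoc)
    finally show ?thesis .
  qed
  from increment_bound[of \<phi>, OF this] have "\<phi> 1 - \<phi> 0 \<le> T" by blast
  moreover have "qh_length \<Omega> g = \<phi> 1" unfolding qh_length_def line_integral_def \<phi>_def f_def ..
  moreover have "\<phi> 0 = 0" unfolding \<phi>_def by simp
  ultimately show "qh_length \<Omega> g \<le> T \<and> path_image g = c ` {0..T}" using img by simp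
qed

text \<open>Conversely, a rectifiable curve becomes tame when it is parametrized by its quasihyperbolic length.\<close>

lemma joining_curve_tame:
  assumes "g \<in> joining_curves \<Omega> x y"
  shows "\<exists>c. tame (qh_length \<Omega> g) c \<and> c 0 = x \<and> c (qh_length \<Omega> g) = y"
proof -
  have g: "rectifiable g" and sub: "path_image g \<subseteq> \<Omega>" and ends: "g 0 = x" "g 1 = y"
    using assms unfolding joining_curves_def pathstart_def pathfinish_def by auto
  define L where "L = arc_length g 1"
  define b where "b = arc_length_param g"
  define \<tau> where "\<tau> s = integral {0..s} (\<lambda>s. 1 / d (b s))" for s
  have L: "0 \<le> L" unfolding L_def using arc_length_mono[OF g, of 0 1] by simp
  have b0: "b 0 = x" "b L = y"
    unfolding b_def L_def using arc_length_param_arc_length[OF g, of 0] arc_length_param_arc_length[OF g, of 1] ends by auto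
  have b\<Omega>: "b s \<in> \<Omega>" if "s \<in> {0..L}" for s
    using arc_length_param_point[OF g, of s] that sub unfolding b_def L_def path_image_def by (metis image_subset_iff)
  have blip: "dist (b s) (b s') \<le> \<bar>s - s'\<bar>" if "s \<in> {0..L}" "s' \<in> {0..L}" for s s'
    using arc_length_param_lipschitz[OF g] that unfolding b_def L_def by blast
  have int: "(\<lambda>s. 1 / d (b s)) integrable_on {p..q}" if "0 \<le> p" "q \<le> L" for p q
    using continuous_on_subset[OF continuous_inverse_d_param[OF g sub]] that unfolding b_def L_def
    by (intro integrable_continuous_interval) auto
  have T: "qh_length \<Omega> g = \<tau> L" unfolding qh_length_def line_integral_def \<tau>_def L_def b_def ..
  have est: "s' - s \<le> (exp (\<tau> s' - \<tau> s) - 1) * d (b p)"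
    if s: "0 \<le> s" "s \<le> s'" "s' \<le> L" and p: "p = s \<or> p = s'" for s s' p
  proof -
    have "\<tau> s' - \<tau> s = integral {s..s'} (\<lambda>s. 1 / d (b s))" unfolding \<tau>_def
      using Henstock_Kurzweil_Integration.integral_combine[of 0 s s' "\<lambda>s. 1 / d (b s)"] s int by auto
    moreover have "s' - s \<le> (exp (integral {s..s'} (\<lambda>s. 1 / d (b s))) - 1) * d (b p)"
    proof (rule ln_le_integral_inverse[where \<rho> = "if p = s then (\<lambda>r. r - s) else (\<lambda>r. s' - r)"])
      fix r assume r: "r \<in> {s..s'}"
      have "d (b r) \<le> d (b p) + dist (b p) (b r)" by (rule d_le)
      also have "dist (b p) (b r) \<le> \<bar>p - r\<bar>" by (rule blip) (use p r s in auto)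
      finally show "0 < d (b r) \<and> d (b r) \<le> d (b p) + (if p = s then (\<lambda>r. r - s) else (\<lambda>r. s' - r)) r"
        using r s p d_pos[OF b\<Omega>[of r]] by auto
    qed (use s int p d_pos[OF b\<Omega>[of p]] in auto)
    ultimately show ?thesis by simp
  qed
  have mono: "\<tau> s \<le> \<tau> s'" if s: "0 \<le> s" "s \<le> s'" "s' \<le> L" for s s'
  proof -
    have "0 \<le> (exp (\<tau> s' - \<tau> s) - 1) * d (b s)" using est[OF s, of s] s by linarith
    then show ?thesis using d_pos[OF b\<Omega>[of s]] s by (simp add: zero_le_mult_iff)
  qed
  define \<sigma> where "\<sigma> t = (SOME s. s \<in> {0..L} \<and> \<tau> s = t)" for t
  have \<sigma>: "\<sigma> t \<in> {0..L} \<and> \<tau> (\<sigma> t) = t" if t: "t \<in> {0..\<tau> L}" for t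
  proof -
    have "continuous_on {0..L} \<tau>" unfolding \<tau>_def
      by (rule indefinite_integral_continuous_1) (use int in auto)
    then have "\<exists>s\<ge>0. s \<le> L \<and> \<tau> s = t" using t L by (intro IVT'[of \<tau>]) (auto simp: \<tau>_def)
    then have "\<exists>s. s \<in> {0..L} \<and> \<tau> s = t" by auto
    then show ?thesis unfolding \<sigma>_def by (rule someI_ex)
  qed
  have tame: "tame (\<tau> L) (\<lambda>t. b (\<sigma> t))" unfolding tame_def
  proof (intro conjI ballI)
    show "0 \<le> \<tau> L" using mono[of 0 L] L by (simp add: \<tau>_def)
    fix t assume t: "t \<in> {0..\<tau> L}"
    show "b (\<sigma> t) \<in> \<Omega>" using b\<Omega> \<sigma>[OF t] by blast
    fix t' assume t': "t' \<in> {0..\<tau> L}"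
    note st = \<sigma>[OF t] and st' = \<sigma>[OF t']
    have "\<bar>\<sigma> t - \<sigma> t'\<bar> \<le> (exp \<bar>t - t'\<bar> - 1) * d (b (\<sigma> t))"
    proof (cases "\<sigma> t \<le> \<sigma> t'")
      case True
      then show ?thesis using est[of "\<sigma> t" "\<sigma> t'" "\<sigma> t"] mono[of "\<sigma> t" "\<sigma> t'"] st st' by auto
    next
      case False
      then show ?thesis using est[of "\<sigma> t'" "\<sigma> t" "\<sigma> t"] mono[of "\<sigma> t'" "\<sigma> t"] st st' by auto
    qed
    then show "dist (b (\<sigma> t)) (b (\<sigma> t')) \<le> (exp \<bar>t - t'\<bar> - 1) * d (b (\<sigma> t))"
      using blip[of "\<sigma> t" "\<sigma> t'"] st st' by linarith
  qed
  have T0: "0 \<le> \<tau> L" using tameD(1)[OF tame] .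
  have "\<sigma> 0 = 0"
    using \<sigma>[of 0] est[of 0 "\<sigma> 0" 0] T0 by (auto simp: \<tau>_def)
  moreover have "\<sigma> (\<tau> L) = L"
    using \<sigma>[of "\<tau> L"] est[of "\<sigma> (\<tau> L)" L L] T0 by auto
  ultimately show ?thesis using tame b0 unfolding T by (intro exI[of _ "\<lambda>t. b (\<sigma> t)"]) auto
qed

end


section \<open>The quasihyperbolic metric and its geodesics\<close>

context bounded_domain
begin

text \<open>By \<open>tame_lipschitz\<close> tame curves on a fixed interval are equicontinuous, and the defining inequality
  passes to pointwise limits; the inequality also keeps the limit inside \<open>\<Omega>\<close>.\<close>

lemma tame_limit:
  assumes K: "0 \<le> K" and c: "\<And>j. tame (S j) (c j)" "\<And>j. c j 0 = x" "\<And>j. c j (S j) = y"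
    and S: "\<And>j. K \<le> S j" "\<And>j. S j \<le> K + 1" "S \<longlonglongrightarrow> K" and x: "x \<in> \<Omega>"
  shows "\<exists>c. tame K c \<and> c 0 = x \<and> c K = y"
proof -
  define e where "e j t = c j (min t (S j))" for j t
  define M where "M = exp (K + 1) * d x"
  have M: "0 < M" unfolding M_def using d_pos[OF x] by simp
  have rng: "min s (S j) \<in> {0..S j}" if "s \<in> {0..K+1}" for s j using that K S(1)[of j] by auto
  have e\<Omega>: "e j s \<in> \<Omega>" if "s \<in> {0..K+1}" for s j
    unfolding e_def by (rule tameD(2)[OF c(1) rng[OF that]])
  have etame: "dist (e j s) (e j t) \<le> (exp \<bar>s - t\<bar> - 1) * d (e j s)"
    if "s \<in> {0..K+1}" "t \<in> {0..K+1}" for s t j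
  proof -
    have "dist (e j s) (e j t) \<le> (exp \<bar>min s (S j) - min t (S j)\<bar> - 1) * d (e j s)"
      unfolding e_def by (rule tameD(3)[OF c(1) rng rng]) (use that in auto)
    also have "... \<le> (exp \<bar>s - t\<bar> - 1) * d (e j s)"
      by (intro mult_right_mono) (auto simp: infdist_nonneg)
    finally show ?thesis .
  qed
  have e0: "e j 0 = x" for j unfolding e_def using c(2) K S(1)[of j] by simp
  have dM: "d (e j s) \<le> M" and dm: "exp (- (K + 1)) * d x \<le> d (e j s)" if s: "s \<in> {0..K+1}" for s j
  proof -
    have *: "min s (S j) \<in> {0..S j}" "0 \<in> {0..S j}" using rng[OF s] K S(1)[of j] by auto
    have m: "exp \<bar>min s (S j)\<bar> \<le> exp (K + 1)" using rng[OF s, of j] S(2)[of j] by auto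
    have "d (e j s) \<le> exp \<bar>0 - min s (S j)\<bar> * d (c j 0)"
      unfolding e_def by (rule tame_d[OF c(1) *(2,1)])
    also have "... \<le> M" unfolding M_def c(2) using m by (intro mult_right_mono) (auto simp: infdist_nonneg)
    finally show "d (e j s) \<le> M" .
    have "d x \<le> exp \<bar>min s (S j) - 0\<bar> * d (e j s)"
      unfolding e_def c(2)[of j, symmetric] by (rule tame_d[OF c(1) *])
    also have "... \<le> exp (K + 1) * d (e j s)" using m by (intro mult_right_mono) (auto simp: infdist_nonneg)
    finally have "exp (- (K + 1)) * d x \<le> exp (- (K + 1)) * (exp (K + 1) * d (e j s))"
      by (intro mult_left_mono) auto
    then show "exp (- (K + 1)) * d x \<le> d (e j s)"
      unfolding mult.assoc[symmetric] exp_add[symmetric] by simp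
  qed
  have lip: "norm (e j s - e j t) \<le> (exp \<bar>s - t\<bar> - 1) * M" if "s \<in> {0..K+1}" "t \<in> {0..K+1}" for s t j
    using order_trans[OF etame[OF that, of j] mult_left_mono[OF dM[OF that(1), of j]]] by (simp add: dist_norm)
  obtain R where R: "\<And>z. z \<in> \<Omega> ==> norm z \<le> R" using bdd unfolding bounded_iff by blast
  have cont: "((\<lambda>r. (exp \<bar>r\<bar> - 1) * M) \<longlongrightarrow> (exp \<bar>0\<bar> - 1) * M) (at (0::real))" by (intro tendsto_intros)
  obtain g r where gr: "strict_mono (r :: nat => nat)"
    "\<And>\<epsilon>. 0 < \<epsilon> ==> \<exists>N. \<forall>n t. n \<ge> N \<and> t \<in> {0..K+1} --> norm (e (r n) t - g t) < \<epsilon>"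
  proof (rule Arzela_Ascoli[of "{0..K+1}" e R])
    fix s \<epsilon> :: real assume s: "s \<in> {0..K+1}" and \<epsilon>: "0 < \<epsilon>"
    have "\<forall>\<^sub>F r in at 0. (exp \<bar>r\<bar> - 1) * M < \<epsilon>" using order_tendstoD(2)[OF cont] \<epsilon> by auto
    then obtain \<delta> where \<delta>: "0 < \<delta>" "\<And>r. r \<noteq> 0 ==> \<bar>r\<bar> < \<delta> ==> (exp \<bar>r\<bar> - 1) * M < \<epsilon>"
      unfolding eventually_at by auto
    have "norm (e n s - e n t) < \<epsilon>" if "t \<in> {0..K+1}" "norm (s - t) < \<delta>" for n t
      using lip[OF s that(1), of n] \<delta>(2)[of "s - t"] that(2) \<epsilon> by (cases "s = t") auto
    then show "\<exists>\<delta>>0. \<forall>n t. t \<in> {0..K+1} \<and> norm (s - t) < \<delta> --> norm (e n s - e n t) < \<epsilon>"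
      using \<delta>(1) by blast
  qed (use R e\<Omega> in auto)
  have lim: "(\<lambda>n. e (r n) t) \<longlonglongrightarrow> g t" if "t \<in> {0..K+1}" for t
    unfolding LIMSEQ_iff using gr(2) that by blast
  have dlim: "(\<lambda>n. d (e (r n) t)) \<longlonglongrightarrow> d (g t)" if "t \<in> {0..K+1}" for t
    by (intro tendsto_infdist lim[OF that])
  have "tame K g" unfolding tame_def
  proof (intro conjI ballI)
    fix s assume s: "s \<in> {0..K}"
    have s': "s \<in> {0..K+1}" using s by auto
    have "g s \<in> closure \<Omega>" by (rule closed_sequentially[OF closed_closure _ lim[OF s']])
        (use e\<Omega>[OF s'] closure_subset in blast)
    moreover have "exp (- (K + 1)) * d x \<le> d (g s)"
      by (rule LIMSEQ_le_const[OF dlim[OF s']]) (use dm[OF s'] in blast)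
    then have "0 < d (g s)" using d_pos[OF x] by (smt (verit) exp_gt_zero mult_pos_pos)
    then have "g s \<notin> frontier \<Omega>" by auto
    ultimately show "g s \<in> \<Omega>" by (simp add: frontier_def interior_open)
    fix t assume t: "t \<in> {0..K}"
    have t': "t \<in> {0..K+1}" using t by auto
    show "dist (g s) (g t) \<le> (exp \<bar>s - t\<bar> - 1) * d (g s)"
      by (rule LIMSEQ_le[OF tendsto_dist[OF lim[OF s'] lim[OF t']] tendsto_mult[OF tendsto_const dlim[OF s']]])
         (use etame[OF s' t'] in blast)
  qed (rule K)
  moreover have "g 0 = x"
    using lim[of 0] K unfolding e0 by (simp add: LIMSEQ_const_iff)
  moreover have "g K = y"
  proof (rule LIMSEQ_unique[OF lim])
    have "(\<lambda>n. (exp \<bar>K - S n\<bar> - 1) * M) \<longlonglongrightarrow> (exp \<bar>K - K\<bar> - 1) * M"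
      by (intro tendsto_intros S(3))
    then have "(\<lambda>n. (exp \<bar>K - S n\<bar> - 1) * M) \<longlonglongrightarrow> 0" by simp
    then have "(\<lambda>n. e n K - y) \<longlonglongrightarrow> 0"
    proof (rule Lim_null_comparison[rotated], intro always_eventually allI)
      fix n
      have "e n (S n) = y" unfolding e_def using c(3) by simp
      then show "norm (e n K - y) \<le> (exp \<bar>K - S n\<bar> - 1) * M"
        using lip[of K "S n" n] K S(1,2)[of n] by auto
    qed
    then have "(\<lambda>n. e n K) \<longlonglongrightarrow> y" by (simp add: LIM_zero_iff)
    then show "(\<lambda>n. e (r n) K) \<longlonglongrightarrow> y" using LIMSEQ_subseq_LIMSEQ[OF _ gr(1)] unfolding o_def by blast
  qed (use K in auto)
  ultimately show ?thesis by blast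
qed

lemma qh_bdd_below: "bdd_below (qh_length \<Omega> ` joining_curves \<Omega> x y)"
proof (rule bdd_belowI[of _ 0])
  fix l assume "l \<in> qh_length \<Omega> ` joining_curves \<Omega> x y"
  then show "0 \<le> l" using joining_curve_tame tameD(1) by (metis imageE)
qed

lemma qh_le:
  assumes "tame T c" shows "k (c 0) (c T) \<le> T"
proof -
  from tame_qh_length[OF assms] obtain \<gamma> where \<gamma>: "\<gamma> \<in> joining_curves \<Omega> (c 0) (c T)" "qh_length \<Omega> \<gamma> \<le> T" by blast
  have "k (c 0) (c T) \<le> qh_length \<Omega> \<gamma>" unfolding qh_dist_def
    by (rule cINF_lower[OF qh_bdd_below \<gamma>(1)])
  with \<gamma>(2) show ?thesis by simp
qed

text \<open>Compactness of tame curves: the infimum defining the quasihyperbolic distance is attained.\<close>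

lemma qh_attained:
  assumes x: "x \<in> \<Omega>" and y: "y \<in> \<Omega>"
  shows "\<exists>c. tame (k x y) c \<and> c 0 = x \<and> c (k x y) = y"
proof -
  have ne: "qh_length \<Omega> ` joining_curves \<Omega> x y \<noteq> {}"
    using tame_exists[OF x y] tame_qh_length by (metis empty_iff image_is_empty)
  have "\<exists>S c. tame S c \<and> c 0 = x \<and> c S = y \<and> k x y \<le> S \<and> S \<le> k x y + inverse (real (Suc j))" for j
  proof -
    have "Inf (qh_length \<Omega> ` joining_curves \<Omega> x y) < k x y + inverse (real (Suc j))"
      unfolding qh_dist_def by simp
    then obtain \<gamma> where \<gamma>: "\<gamma> \<in> joining_curves \<Omega> x y" "qh_length \<Omega> \<gamma> < k x y + inverse (real (Suc j))"
      using cInf_lessD[OF ne] by blast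
    have "k x y \<le> qh_length \<Omega> \<gamma>" unfolding qh_dist_def by (rule cINF_lower[OF qh_bdd_below \<gamma>(1)])
    then show ?thesis using joining_curve_tame[OF \<gamma>(1)] \<gamma>(2) by (metis less_imp_le)
  qed
  then obtain S c where Sc: "\<And>j. tame (S j) (c j) \<and> c j 0 = x \<and> c j (S j) = y \<and> k x y \<le> S j \<and> S j \<le> k x y + inverse (real (Suc j))"
    by metis
  have K: "0 \<le> k x y" unfolding qh_dist_def
    by (rule cInf_greatest[OF ne]) (use joining_curve_tame tameD(1) in \<open>metis imageE\<close>)
  have "S \<longlonglongrightarrow> k x y"
  proof (rule tendsto_sandwich[of "\<lambda>_. k x y" S _ "\<lambda>j. k x y + inverse (real (Suc j))"])
    have "(\<lambda>j. k x y + inverse (real (Suc j))) \<longlonglongrightarrow> k x y + 0" by (intro tendsto_intros LIMSEQ_inverse_real_of_nat)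
    then show "(\<lambda>j. k x y + inverse (real (Suc j))) \<longlonglongrightarrow> k x y" by simp
  qed (use Sc in auto)
  moreover have "S j \<le> k x y + 1" for j
    using Sc[of j] by (smt (verit) inverse_le_1_iff of_nat_0_le_iff of_nat_Suc)
  ultimately show ?thesis using Sc by (intro tame_limit[OF K _ _ _ _ _ _ x, of S c]) auto
qed

lemma k_nonneg: "x \<in> \<Omega> ==> y \<in> \<Omega> ==> 0 \<le> k x y"
  using qh_attained tameD(1) by blast

lemma k_self [simp]: "x \<in> \<Omega> ==> k x x = 0"
  using qh_le[OF tame_const[of x 0]] k_nonneg[of x x] by simp

lemma k_sym: assumes "x \<in> \<Omega>" "y \<in> \<Omega>" shows "k x y = k y x"
proof -
  have "k y x \<le> k x y" if xy: "x \<in> \<Omega>" "y \<in> \<Omega>" for x y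
  proof -
    obtain c where c: "tame (k x y) c" "c 0 = x" "c (k x y) = y" using qh_attained[OF xy] by blast
    show ?thesis using qh_le[OF tame_reverse[OF c(1)]] c by simp
  qed
  then show ?thesis using assms by (meson order_antisym)
qed

lemma k_triangle:
  assumes "x \<in> \<Omega>" "y \<in> \<Omega>" "z \<in> \<Omega>" shows "k x z \<le> k x y + k y z"
proof -
  obtain c e where c: "tame (k x y) c" "c 0 = x" "c (k x y) = y"
    and e: "tame (k y z) e" "e 0 = y" "e (k y z) = z"
    using qh_attained[OF assms(1,2)] qh_attained[OF assms(2,3)] by blast
  have "c (k x y) = e 0" using c e by simp
  from qh_le[OF tame_join[OF c(1) e(1) this]] show ?thesis
    using c e k_nonneg[OF assms(1,2)] k_nonneg[OF assms(2,3)] by (auto split: if_splits)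
qed

lemma dist_le_exp_k:
  assumes "x \<in> \<Omega>" "y \<in> \<Omega>" shows "dist x y \<le> (exp (k x y) - 1) * d x"
proof -
  obtain c where c: "tame (k x y) c" "c 0 = x" "c (k x y) = y" using qh_attained[OF assms] by blast
  show ?thesis using tameD(3)[OF c(1), of 0 "k x y"] c k_nonneg[OF assms] by simp
qed

lemma d_le_exp_k:
  assumes "x \<in> \<Omega>" "y \<in> \<Omega>" shows "d y \<le> exp (k x y) * d x"
  using dist_le_exp_k[OF assms] d_le[of y x] by (simp add: algebra_simps)

lemma k_le_dist:
  assumes x: "x \<in> \<Omega>" and y: "dist x y \<le> d x / 2"
  shows "y \<in> \<Omega>" "k x y \<le> 2 * dist x y / d x"
proof -
  have *: "dist x y < d x" using y d_pos[OF x] by linarith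
  then show "y \<in> \<Omega>" using ball_d_subset[OF x] by auto
  from tame_line[OF x *] have "k x y \<le> dist x y / (d x - dist x y)" using qh_le by metis
  also have "... \<le> dist x y / (d x / 2)" using y d_pos[OF x] * by (intro divide_left_mono mult_pos_pos) auto
  finally show "k x y \<le> 2 * dist x y / d x" by (simp add: mult.commute)
qed

definition geo :: "real^'n => real^'n => (real => real^'n) => bool" where
  "geo x y c \<longleftrightarrow> x \<in> \<Omega> \<and> y \<in> \<Omega> \<and> c 0 = x \<and> c (k x y) = y \<and> (\<forall>s\<in>{0..k x y}. c s \<in> \<Omega>) \<and>
     (\<forall>s\<in>{0..k x y}. \<forall>t\<in>{0..k x y}. k (c s) (c t) = \<bar>s - t\<bar>)"

lemma geoD:
  assumes "geo x y c"
  shows "x \<in> \<Omega>" "y \<in> \<Omega>" "c 0 = x" "c (k x y) = y" "s \<in> {0..k x y} ==> c s \<in> \<Omega>"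
    "s \<in> {0..k x y} ==> t \<in> {0..k x y} ==> k (c s) (c t) = \<bar>s - t\<bar>" "0 \<le> k x y"
  using assms k_nonneg unfolding geo_def by blast+

lemma geo_dist:
  assumes "geo x y c" "s \<in> {0..k x y}"
  shows "k x (c s) = s" "k (c s) y = k x y - s"
  using geoD(6)[OF assms(1), of 0 s] geoD(6)[OF assms(1), of s "k x y"] geoD[OF assms(1)] assms(2) by auto

lemma geo_exists:
  assumes "x \<in> \<Omega>" "y \<in> \<Omega>" shows "\<exists>c. geo x y c"
proof -
  let ?T = "k x y"
  obtain c where c: "tame ?T c" "c 0 = x" "c ?T = y" using qh_attained[OF assms] by blast
  have T: "0 \<le> ?T" by (rule k_nonneg[OF assms])
  have in\<Omega>: "c s \<in> \<Omega>" if "s \<in> {0..?T}" for s by (rule tameD(2)[OF c(1) that])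
  have le: "k (c s) (c t) \<le> t - s" if "0 \<le> s" "s \<le> t" "t \<le> ?T" for s t
    using qh_le[OF tame_segment[OF c(1) that]] by simp
  have eq: "k (c s) (c t) = t - s" if st: "0 \<le> s" "s \<le> t" "t \<le> ?T" for s t
  proof -
    have "?T \<le> k x (c s) + k (c s) y" by (rule k_triangle) (use assms in\<Omega> st in auto)
    also have "k (c s) y \<le> k (c s) (c t) + k (c t) y" by (rule k_triangle) (use assms in\<Omega> st in auto)
    finally show ?thesis using le[of 0 s] le[of t ?T] le[OF st] c st by auto
  qed
  have "k (c s) (c t) = \<bar>s - t\<bar>" if "s \<in> {0..?T}" "t \<in> {0..?T}" for s t
    using eq[of s t] eq[of t s] that k_sym[OF in\<Omega>[OF that(1)] in\<Omega>[OF that(2)]] by (cases "s \<le> t") auto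
  then show ?thesis unfolding geo_def using assms c in\<Omega> by blast
qed

lemma geo_tame: assumes "geo x y c" shows "tame (k x y) c"
  unfolding tame_def using geoD[OF assms] dist_le_exp_k by metis

lemma geo_reverse: assumes "geo x y c" shows "geo y x (\<lambda>t. c (k x y - t))"
proof -
  have s: "k y x = k x y" by (rule k_sym) (use geoD[OF assms] in auto)
  show ?thesis unfolding geo_def s
  proof (intro conjI ballI)
    fix u v assume "u \<in> {0..k x y}" "v \<in> {0..k x y}"
    then show "k (c (k x y - u)) (c (k x y - v)) = \<bar>u - v\<bar>"
      using geoD(6)[OF assms, of "k x y - u" "k x y - v"] by auto
  qed (use geoD[OF assms] in auto)
qed

lemma geo_initial: assumes "geo x y c" "s \<in> {0..k x y}" shows "geo x (c s) c"
  using assms geoD[OF assms(1)] geo_dist(1)[OF assms] unfolding geo_def by auto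

lemma geo_continuous: assumes "geo x y c" shows "continuous_on {0..k x y} c"
proof (rule lipschitz_on_continuous_on, rule lipschitz_onI)
  fix s t assume "s \<in> {0..k x y}" "t \<in> {0..k x y}"
  then show "dist (c s) (c t) \<le> (exp (k x y - 0) * exp (k x y - 0) * d (c 0)) * dist s t"
    using tame_lipschitz[OF geo_tame[OF assms], of s 0 "k x y" t] by (simp add: dist_real_def mult.commute)
qed (auto simp: infdist_nonneg)

end

locale hyperbolic_domain = bounded_domain \<Omega> for \<Omega> :: "(real^'n::finite) set" +
  fixes \<delta> :: real
  assumes \<delta>_nonneg: "0 \<le> \<delta>" and hyperbolic: "gromov_hyperbolic_domain \<delta> \<Omega>"
begin

lemma thin_triangle:
  assumes a: "geo x y a" and b: "geo y z b" and c: "geo z x c" and s: "s \<in> {0..k x y}"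
  shows "(\<exists>t\<in>{0..k y z}. k (a s) (b t) \<le> \<delta>) \<or> (\<exists>t\<in>{0..k z x}. k (a s) (c t) \<le> \<delta>)"
proof -
  have *: "\<exists>\<gamma>. qh_geodesic \<Omega> x y \<gamma> \<and> path_image \<gamma> = a ` {0..k x y}" if a: "geo x y a" for x y a
  proof -
    from tame_qh_length[OF geo_tame[OF a]] obtain \<gamma>
      where \<gamma>: "\<gamma> \<in> joining_curves \<Omega> x y" "qh_length \<Omega> \<gamma> \<le> k x y" "path_image \<gamma> = a ` {0..k x y}"
      using geoD[OF a] by auto
    have "k x y \<le> qh_length \<Omega> \<gamma>" unfolding qh_dist_def by (rule cINF_lower[OF qh_bdd_below \<gamma>(1)])
    then show ?thesis unfolding qh_geodesic_def using \<gamma> by auto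
  qed
  obtain \<gamma>1 where 1: "qh_geodesic \<Omega> x y \<gamma>1" "path_image \<gamma>1 = a ` {0..k x y}" using *[OF a] by blast
  obtain \<gamma>2 where 2: "qh_geodesic \<Omega> y z \<gamma>2" "path_image \<gamma>2 = b ` {0..k y z}" using *[OF b] by blast
  obtain \<gamma>3 where 3: "qh_geodesic \<Omega> z x \<gamma>3" "path_image \<gamma>3 = c ` {0..k z x}" using *[OF c] by blast
  have "qh_cball \<Omega> (a s) \<delta> \<inter> (path_image \<gamma>2 \<union> path_image \<gamma>3) \<noteq> {}"
    using hyperbolic geoD[OF a] geoD[OF b] 1 2 3 s unfolding gromov_hyperbolic_domain_def by blast
  then obtain u where "u \<in> \<Omega>" "k u (a s) \<le> \<delta>" "u \<in> b ` {0..k y z} \<union> c ` {0..k z x}"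
    unfolding qh_cball_def 2 3 by blast
  then show ?thesis using k_sym[of u "a s"] geoD(5)[OF a s] by auto
qed

end


section \<open>Chains, nets and packings\<close>

text \<open>The chain is split at the last link at which the partial sum is at most half of the total. This leaves
  two chains of at most half the total, and \<open>K\<^sup>2 \<le> 2\<close> absorbs the two applications of the
  quasi-ultrametric inequality.\<close>

lemma chain_lemma:
  fixes q :: "'a => 'a => real"
  assumes pos: "\<And>x y. x \<in> S ==> y \<in> S ==> 0 < q x y"
    and ultra: "\<And>x y z. x \<in> S ==> y \<in> S ==> z \<in> S ==> q x z \<le> K * max (q x y) (q y z)"
    and K: "1 \<le> K" "K\<^sup>2 \<le> 2"
  shows "0 < M ==> (\<And>i. i \<le> M ==> v i \<in> S) ==> q (v 0) (v M) \<le> 2 * (\<Sum>i<M. q (v i) (v (Suc i)))"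
proof (induction M arbitrary: v rule: less_induct)
  case (less M)
  define P where "P j = (\<Sum>i<j. q (v i) (v (Suc i)))" for j
  have qpos: "0 < q (v i) (v (Suc i))" if "i < M" for i using pos less.prems(2) that by simp
  have PM: "0 < P M" unfolding P_def by (rule sum_pos) (use qpos less.prems(1) in auto)
  have "\<exists>p<M. P p \<le> P M / 2 \<and> P M / 2 < P (Suc p)"
  proof (rule ccontr)
    assume *: "\<not> ?thesis"
    have "j \<le> M ==> P j \<le> P M / 2" for j
    proof (induction j)
      case 0 then show ?case using PM unfolding P_def by simp
    next
      case (Suc j) then show ?case using * by force
    qed
    from this[of M] PM show False by simp
  qed
  then obtain p where p: "p < M" "P p \<le> P M / 2" "P M / 2 < P (Suc p)" by blast
  have K2: "K * (K * X) \<le> 2 * X" if "0 \<le> X" for X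
    using mult_right_mono[OF K(2) that] by (simp add: power2_eq_square mult.assoc)
  have KX: "X \<le> K * X" if "0 \<le> X" for X using mult_right_mono[OF K(1) that] by simp
  have S: "v 0 \<in> S" "v p \<in> S" "v (Suc p) \<in> S" "v M \<in> S" using less.prems p by auto
  have mid: "q (v p) (v (Suc p)) \<le> P M"
    unfolding P_def using p(1) qpos by (intro member_le_sum) (auto intro: less_imp_le)
  have "q (v 0) (v (Suc p)) \<le> K * P M"
  proof (cases "p = 0")
    case True
    then show ?thesis using order_trans[OF mid KX[of "P M"]] PM by simp
  next
    case False
    have "q (v 0) (v p) \<le> 2 * P p" unfolding P_def by (rule less.IH) (use False p less.prems in auto)
    then have "max (q (v 0) (v p)) (q (v p) (v (Suc p))) \<le> P M" using p(2) mid by simp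
    then have "K * max (q (v 0) (v p)) (q (v p) (v (Suc p))) \<le> K * P M" using K(1) by (intro mult_left_mono) auto
    then show ?thesis using ultra[OF S(1,2,3)] by linarith
  qed
  moreover have "q (v 0) (v M) \<le> 2 * P M" if "Suc p \<noteq> M" and 1: "q (v 0) (v (Suc p)) \<le> K * P M"
  proof -
    have "q (v (Suc p)) (v M) \<le> 2 * (\<Sum>i<M - Suc p. q (v (i + Suc p)) (v (Suc (i + Suc p))))"
      using less.IH[of "M - Suc p" "\<lambda>i. v (i + Suc p)"] p that less.prems by auto
    also have "(\<Sum>i<M - Suc p. q (v (i + Suc p)) (v (Suc (i + Suc p)))) = P M - P (Suc p)"
    proof -
      have "P M = P (Suc p) + (\<Sum>i\<in>{Suc p..<M}. q (v i) (v (Suc i)))"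
        unfolding P_def lessThan_atLeast0 using p(1) by (subst sum.atLeastLessThan_concat) auto
      moreover have "(\<Sum>i\<in>{Suc p..<M}. q (v i) (v (Suc i))) = (\<Sum>i<M - Suc p. q (v (i + Suc p)) (v (Suc (i + Suc p))))"
        using sum.shift_bounds_nat_ivl[of "\<lambda>i. q (v i) (v (Suc i))" 0 "Suc p" "M - Suc p"] p(1)
        by (simp add: lessThan_atLeast0)
      ultimately show ?thesis by simp
    qed
    also have "2 * (P M - P (Suc p)) \<le> P M" using p(3) by (simp add: field_simps)
    also have "... \<le> K * P M" using KX PM by simp
    finally have "q (v (Suc p)) (v M) \<le> K * P M" .
    then have "K * max (q (v 0) (v (Suc p))) (q (v (Suc p)) (v M)) \<le> K * (K * P M)"
      using 1 K(1) by (intro mult_left_mono) auto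
    then show ?thesis using ultra[OF S(1,3,4)] K2[of "P M"] PM by linarith
  qed
  moreover have "K * P M \<le> K * (K * P M)" using KX PM K(1) by (intro mult_left_mono) auto
  ultimately show ?case using K2[of "P M"] PM unfolding P_def[symmetric] by (cases "Suc p = M") fastforce+
qed

definition running_max :: "(nat => real) => nat => real" where
  "running_max a i = Max (a ` {..i})"

lemma running_max_Suc: "running_max a (Suc i) = max (a (Suc i)) (running_max a i)"
  unfolding running_max_def atMost_Suc by (simp add: Max_insert)

lemma running_max_ge: "j \<le> i ==> a j \<le> running_max a i"
  unfolding running_max_def by (intro Max_ge) auto

lemma running_max_0 [simp]: "running_max a 0 = a 0"
  unfolding running_max_def by simp

text \<open>Only indices at which the maximum is attained contribute, and between the first and the last of them
  in \<open>I\<close> the sequence varies by at most \<open>D\<close>.\<close>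

lemma running_max_increments:
  fixes a :: "nat => real"
  defines "m \<equiv> \<lambda>i. running_max a (Suc i) - running_max a i"
  assumes I: "finite I" and D: "0 \<le> D"
    and osc: "\<And>i j. i \<in> I ==> j \<in> I ==> a (Suc i) - a (Suc j) \<le> D"
    and step: "\<And>i. i \<in> I ==> a (Suc i) - a i \<le> D"
  shows "(\<Sum>i\<in>I. m i) \<le> 2 * D"
proof -
  have m0: "0 \<le> m i" for i unfolding m_def running_max_Suc by simp
  define I' where "I' = {i\<in>I. m i \<noteq> 0}"
  have fin: "finite I'" unfolding I'_def using I by simp
  have "(\<Sum>i\<in>I. m i) = (\<Sum>i\<in>I'. m i)" unfolding I'_def using I by (intro sum.mono_neutral_right) auto
  also have "... \<le> 2 * D"
  proof (cases "I' = {}")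
    case True then show ?thesis using D by simp
  next
    case False
    define j l where "j = Min I'" and "l = Max I'"
    have jl: "j \<in> I'" "l \<in> I'" "I' \<subseteq> {j..l}" "j \<le> l" unfolding j_def l_def using fin False by auto
    have "(\<Sum>i\<in>I'. m i) \<le> (\<Sum>i\<in>{j..l}. m i)" by (rule sum_mono2) (use jl m0 in auto)
    also have "... = running_max a (Suc l) - running_max a j"
      unfolding m_def using jl(4) by (rule sum_Suc_diff[OF le_SucI])
    also have "running_max a (Suc l) = a (Suc l)"
      using jl(2) unfolding I'_def m_def running_max_Suc by (auto simp: max_def split: if_splits)
    also have "a (Suc l) - running_max a j \<le> (a (Suc l) - a (Suc j)) + (a (Suc j) - a j)"
      using running_max_ge[of j j a] by simp
    also have "... \<le> 2 * D" using osc[of l j] step[of j] jl unfolding I'_def by simp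
    finally show ?thesis .
  qed
  finally show ?thesis .
qed

lemma finite_net:
  assumes "finite P" and "\<And>p. p \<in> P ==> near p p" and "\<And>p q. p \<in> P ==> q \<in> P ==> near p q ==> near q p"
  shows "\<exists>C\<subseteq>P. (\<forall>c\<in>C. \<forall>c'\<in>C. c \<noteq> c' --> \<not> near c c') \<and> (\<forall>p\<in>P. \<exists>c\<in>C. near p c)"
  using assms
proof (induction P rule: finite_induct)
  case (insert p P)
  have "\<exists>C\<subseteq>P. (\<forall>c\<in>C. \<forall>c'\<in>C. c \<noteq> c' --> \<not> near c c') \<and> (\<forall>p\<in>P. \<exists>c\<in>C. near p c)"
    by (rule insert.IH) (use insert.prems in blast)+
  then obtain C where C: "C \<subseteq> P" "\<forall>c\<in>C. \<forall>c'\<in>C. c \<noteq> c' --> \<not> near c c'" "\<forall>p\<in>P. \<exists>c\<in>C. near p c" by blast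
  show ?case
  proof (cases "\<exists>c\<in>C. near p c")
    case True
    then have "\<forall>x\<in>insert p P. \<exists>c\<in>C. near x c" using C(3) by blast
    then show ?thesis using C(1,2) by blast
  next
    case False
    then have "\<not> near c p" if "c \<in> C" for c using insert.prems(2)[of c p] that C(1) by blast
    moreover have "\<not> near p c" if "c \<in> C" for c using False that by blast
    ultimately have "\<forall>c\<in>insert p C. \<forall>c'\<in>insert p C. c \<noteq> c' --> \<not> near c c'" using C(2) by simp
    moreover have "\<forall>x\<in>insert p P. \<exists>c\<in>insert p C. near x c" using C(3) insert.prems(1)[of p] by blast
    moreover have "insert p C \<subseteq> insert p P" using C(1) by blast
    ultimately show ?thesis by blast
  qed
qed auto

lemma packing_balls:
  fixes C :: "(real^'n::finite) set"
  assumes "finite C" "disjoint_family_on (\<lambda>c. ball c (\<rho> c)) C" "0 \<le> R"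
    and sub: "\<And>c. c \<in> C ==> 0 \<le> \<rho> c \<and> ball c (\<rho> c) \<subseteq> ball a R"
  shows "(\<Sum>c\<in>C. \<rho> c ^ CARD('n)) \<le> R ^ CARD('n)"
proof -
  let ?u = "unit_ball_vol (real (CARD('n)))"
  have u: "0 < ?u" by (rule unit_ball_vol_pos) simp
  have "?u * (\<Sum>c\<in>C. \<rho> c ^ CARD('n)) = (\<Sum>c\<in>C. measure lborel (ball c (\<rho> c)))"
    unfolding sum_distrib_left using sub by (intro sum.cong) (auto simp: content_ball)
  also have "... = measure lborel (\<Union>c\<in>C. ball c (\<rho> c))"
    by (rule measure_finite_Union[symmetric])
       (use assms emeasure_lborel_ball_finite[THEN less_imp_neq] in auto)
  also have "... \<le> measure lborel (ball a R)"
    by (rule measure_mono_fmeasurable)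
       (use sub in \<open>auto simp: fmeasurable_def emeasure_lborel_ball_finite[unfolded infinity_ennreal_def] intro!: sets.finite_UN assms(1)\<close>)
  also have "... = ?u * R ^ CARD('n)" using assms(3) by (simp add: content_ball)
  finally show ?thesis using u by simp
qed


section \<open>The weight of an annulus\<close>

text \<open>The potential is the distance from \<open>x\<close> in the length metric generated by \<open>q\<close>, which \<open>chain_lemma\<close>
  compares with \<open>q\<close>.\<close>

lemma chain_potential:
  fixes q :: "'a => 'a => real"
  assumes pos: "\<And>x y. x \<in> S ==> y \<in> S ==> 0 < q x y"
    and ultra: "\<And>x y z. x \<in> S ==> y \<in> S ==> z \<in> S ==> q x z \<le> K * max (q x y) (q y z)"
    and K: "1 \<le> K" "K\<^sup>2 \<le> 2" and x: "x \<in> S"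
  shows "\<exists>f. f x = 0 \<and> (\<forall>z\<in>S. f z \<le> q x z \<and> (z \<noteq> x --> q x z \<le> 2 * f z)) \<and>
           (\<forall>z\<in>S. \<forall>z'\<in>S. f z' - f z \<le> q z z')"
proof -
  define Q where "Q z = {(\<Sum>i<M. q (v i) (v (Suc i))) | M v. v 0 = x \<and> v M = z \<and> (\<forall>i\<le>M. v i \<in> S)}" for z
  define f where "f z = Inf (Q z)" for z
  have Q0: "0 \<le> t" if "t \<in> Q z" for t z
    using that pos unfolding Q_def by (force intro!: sum_nonneg simp: less_imp_le)
  have bdd: "bdd_below (Q z)" for z using Q0 by (intro bdd_belowI[of _ 0])
  have Q1: "q x z \<in> Q z" if "z \<in> S" for z
    unfolding Q_def mem_Collect_eq
    by (rule exI[of _ "Suc 0"], rule exI[of _ "\<lambda>i. if i = 0 then x else z"]) (use that x in auto)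
  have Qx: "0 \<in> Q x" unfolding Q_def mem_Collect_eq
    by (rule exI[of _ 0], rule exI[of _ "\<lambda>i. x"]) (use x in auto)
  have ne: "Q z \<noteq> {}" if "z \<in> S" for z using Q1[OF that] by auto
  have "f x = 0" unfolding f_def
    by (rule antisym[OF cInf_lower[OF Qx bdd] cInf_greatest[OF ne[OF x] Q0]])
  moreover have "f z \<le> q x z" if "z \<in> S" for z
    unfolding f_def by (rule cInf_lower[OF Q1[OF that] bdd])
  moreover have "q x z \<le> 2 * f z" if z: "z \<in> S" "z \<noteq> x" for z
  proof -
    have "q x z / 2 \<le> f z" unfolding f_def
    proof (rule cInf_greatest[OF ne[OF z(1)]])
      fix t assume "t \<in> Q z"
      then obtain M v where t: "t = (\<Sum>i<M. q (v i) (v (Suc i)))" "v 0 = x" "v M = z" "\<forall>i\<le>M. v i \<in> S"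
        unfolding Q_def by auto
      have "0 < M" using t z by (cases M) auto
      then have "q (v 0) (v M) \<le> 2 * (\<Sum>i<M. q (v i) (v (Suc i)))"
        using chain_lemma[of S q K M v, OF pos ultra K] t by blast
      then show "q x z / 2 \<le> t" using t by simp
    qed
    then show ?thesis by simp
  qed
  moreover have "f z' - f z \<le> q z z'" if z: "z \<in> S" "z' \<in> S" for z z'
  proof -
    have "f z' - q z z' \<le> f z" unfolding f_def[of z]
    proof (rule cInf_greatest[OF ne[OF z(1)]])
      fix t assume "t \<in> Q z"
      then obtain M v where t: "t = (\<Sum>i<M. q (v i) (v (Suc i)))" "v 0 = x" "v M = z" "\<forall>i\<le>M. v i \<in> S"
        unfolding Q_def by auto
      have "t + q z z' \<in> Q z'" unfolding Q_def mem_Collect_eq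
        by (rule exI[of _ "Suc M"], rule exI[of _ "\<lambda>i. if i \<le> M then v i else z'"]) (use t z in auto)
      from cInf_lower[OF this bdd] show "f z' - q z z' \<le> t" unfolding f_def by simp
    qed
    then show ?thesis by simp
  qed
  ultimately show ?thesis by blast
qed

lemma ln_diff_le:
  fixes x y :: real
  assumes "0 < x" "0 < y" "z \<le> x" "z \<le> y" "0 < z" "\<bar>x - y\<bar> \<le> D"
  shows "\<bar>ln x - ln y\<bar> \<le> D / z"
proof -
  have *: "ln v - ln u \<le> D / z" if "0 < u" "u \<le> v" "z \<le> u" "v - u \<le> D" for u v
  proof -
    have "ln v - ln u = ln (v / u)" using that by (simp add: ln_div)
    also have "... \<le> v / u - 1" using that by (intro ln_le_minus_one) auto
    also have "... = (v - u) / u" using that by (simp add: field_simps)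
    also have "... \<le> D / z" using that assms by (intro frac_le) auto
    finally show ?thesis .
  qed
  show ?thesis
  proof (cases "x \<le> y")
    case True
    then have "ln x \<le> ln y" using assms by simp
    then show ?thesis using *[of x y] True assms by auto
  next
    case False
    then have "ln y \<le> ln x" using assms by simp
    then show ?thesis using *[of y x] False assms by auto
  qed
qed

context bounded_domain
begin

text \<open>The Euclidean size of the annulus at a point, and the length of its passage through the annulus
  in logarithmic scale. The weight of a point bounds the change of \<open>log_pos\<close> over a quasihyperbolic
  step near it.\<close>

definition scale_at :: "real^'n => real => real^'n => real" where
  "scale_at a r p = max (dist p a) r"

definition log_pos :: "real^'n => real => real => real^'n => real" where
  "log_pos a r J p = min (ln (scale_at a r p / r)) J"

definition weight :: "real^'n => real => real => real^'n => real" where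
  "weight a r J c = (if scale_at a r c \<le> 25 * exp J * r then 150 * d c / scale_at a r c else 0)"

lemma k_le_1D:
  assumes "p \<in> \<Omega>" "p' \<in> \<Omega>" "k p p' \<le> 1"
  shows "dist p p' \<le> 2 * d p" "d p' \<le> 3 * d p" "d p \<le> 3 * d p'"
proof -
  have e: "exp (k p p') \<le> 3" using assms(3) exp_le by (smt (verit) exp_le_cancel_iff)
  have d: "0 \<le> d p" "0 \<le> d p'" by (auto simp: infdist_nonneg)
  show "dist p p' \<le> 2 * d p"
    using dist_le_exp_k[OF assms(1,2)] mult_right_mono[of "exp (k p p') - 1" 2 "d p"] e d by linarith
  show "d p' \<le> 3 * d p"
    using d_le_exp_k[OF assms(1,2)] mult_right_mono[OF e d(1)] by linarith
  show "d p \<le> 3 * d p'"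
    using d_le_exp_k[OF assms(2,1)] k_sym[OF assms(1,2)] mult_right_mono[OF e d(2)] by simp
qed

context
  fixes a r assumes a: "a \<in> \<Omega>" and r: "d a \<le> r"
begin

lemma r_pos: "0 < r" using r d_pos[OF a] by linarith

lemma scale_at_pos: "0 < scale_at a r p" "r \<le> scale_at a r p"
  using r_pos unfolding scale_at_def by auto

lemma d_le_scale_at: "d p \<le> 2 * scale_at a r p"
  using d_le[of p a] r unfolding scale_at_def by (auto simp: dist_commute)

lemma scale_at_step:
  assumes "p \<in> \<Omega>" "p' \<in> \<Omega>" "k p p' \<le> 1"
  shows "\<bar>scale_at a r p - scale_at a r p'\<bar> \<le> dist p p'" "dist p p' \<le> 4 * scale_at a r p"
    "scale_at a r p' \<le> 5 * scale_at a r p" "scale_at a r p \<le> 5 * scale_at a r p'"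
proof -
  have *: "\<bar>scale_at a r p - scale_at a r p'\<bar> \<le> dist p p'" for p p'
    unfolding scale_at_def using dist_triangle[of p a p'] dist_triangle[of p' a p] by (auto simp: dist_commute)
  have **: "dist p p' \<le> 4 * scale_at a r p" if "p \<in> \<Omega>" "p' \<in> \<Omega>" "k p p' \<le> 1" for p p'
    using k_le_1D(1)[OF that] d_le_scale_at[of p] by simp
  show "\<bar>scale_at a r p - scale_at a r p'\<bar> \<le> dist p p'" by (rule *)
  show "dist p p' \<le> 4 * scale_at a r p" by (rule **[OF assms])
  then show "scale_at a r p' \<le> 5 * scale_at a r p" using *[of p p'] by linarith
  have "dist p' p \<le> 4 * scale_at a r p'" using **[of p' p] assms k_sym[OF assms(1,2)] by simp
  then show "scale_at a r p \<le> 5 * scale_at a r p'" using *[of p' p] by linarith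
qed

lemma log_pos_diff: "\<bar>log_pos a r J p - log_pos a r J p'\<bar> \<le> \<bar>ln (scale_at a r p) - ln (scale_at a r p')\<bar>"
  unfolding log_pos_def using scale_at_pos[of p] scale_at_pos[of p'] r_pos by (auto simp: ln_div min_def)

lemma log_pos_step:
  assumes "p \<in> \<Omega>" "p' \<in> \<Omega>" "k p p' \<le> 1"
  shows "\<bar>log_pos a r J p - log_pos a r J p'\<bar> \<le> 20"
proof -
  note s = scale_at_step[OF assms] and pos = scale_at_pos(1)[of p] scale_at_pos(1)[of p']
  have "\<bar>ln (scale_at a r p) - ln (scale_at a r p')\<bar> \<le> (4 * scale_at a r p) / (scale_at a r p / 5)"
    by (rule ln_diff_le) (use s pos in auto)
  then show ?thesis using log_pos_diff[of J p p'] pos by simp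
qed

lemma log_pos_step_weight:
  assumes p: "p \<in> \<Omega>" "p' \<in> \<Omega>" "k p p' \<le> 1" and c: "c \<in> \<Omega>" "k p c \<le> 1"
  shows "\<bar>log_pos a r J p - log_pos a r J p'\<bar> \<le> weight a r J c"
proof -
  note s = scale_at_step[OF p] and s' = scale_at_step[OF p(1) c]
  note pos = scale_at_pos(1)[of p] scale_at_pos(1)[of p'] scale_at_pos(1)[of c]
  show ?thesis
  proof (cases "scale_at a r c \<le> 25 * exp J * r")
    case True
    have "dist p p' \<le> 6 * d c" using k_le_1D[OF p] k_le_1D(3)[OF p(1) c] by linarith
    then have "\<bar>ln (scale_at a r p) - ln (scale_at a r p')\<bar> \<le> (6 * d c) / (scale_at a r c / 25)"
      by (intro ln_diff_le) (use s s' pos in auto)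
    then show ?thesis using log_pos_diff[of J p p'] True unfolding weight_def by simp
  next
    case False
    have "ln (scale_at a r u / r) \<ge> J" if "25 * scale_at a r u \<ge> scale_at a r c" for u
    proof -
      have "exp J * r \<le> scale_at a r u" using False that by linarith
      then have "exp J \<le> scale_at a r u / r" using r_pos by (simp add: field_simps)
      then show ?thesis using ln_ge_iff r_pos scale_at_pos by (simp add: ln_ge_iff)
    qed
    from this[of p] this[of p'] show ?thesis using s s' pos False unfolding log_pos_def weight_def by auto
  qed
qed

text \<open>The logarithmic position changes by \<open>J\<close> along the geodesic, and rounding the two parameters to
  integers changes it by at most \<open>20\<close> each.\<close>

lemma crossing_weight:
  assumes c: "geo b w c" and s: "s \<in> {0..k b w}" "dist (c s) a \<le> r"
    and t: "t \<in> {0..k b w}" "exp J * r \<le> dist (c t) a" and J: "0 \<le> J"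
    and \<pi>: "\<And>i. i \<le> nat \<lfloor>k b w\<rfloor> ==> \<pi> (c (real i)) \<in> \<Omega> \<and> k (c (real i)) (\<pi> (c (real i))) \<le> 1"
  shows "J - 40 \<le> (\<Sum>i\<le>nat \<lfloor>k b w\<rfloor>. weight a r J (\<pi> (c (real i))))"
proof -
  define N where "N = nat \<lfloor>k b w\<rfloor>"
  define f where "f i = log_pos a r J (c (real i))" for i :: nat
  have N: "real i \<in> {0..k b w}" if "i \<le> N" for i
    using that geoD(7)[OF c] unfolding N_def by (simp add: le_nat_floor le_nat_iff le_floor_iff)
  have w0: "0 \<le> weight a r J z" for z unfolding weight_def using scale_at_pos[of z] by (auto simp: infdist_nonneg)
  have step: "\<bar>f (Suc i) - f i\<bar> \<le> weight a r J (\<pi> (c (real i)))" if "Suc i \<le> N" for i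
  proof -
    have i: "real i \<in> {0..k b w}" "real (Suc i) \<in> {0..k b w}" using N[of i] N[of "Suc i"] that by auto
    have "k (c (real i)) (c (real (Suc i))) \<le> 1" using geoD(6)[OF c i] by simp
    from log_pos_step_weight[OF geoD(5)[OF c i(1)] geoD(5)[OF c i(2)] this] \<pi>[of i] that
    show ?thesis unfolding f_def N_def by (simp add: abs_minus_commute)
  qed
  have tele: "\<bar>f j - f i\<bar> \<le> (\<Sum>l\<in>{i..<j}. \<bar>f (Suc l) - f l\<bar>)" if "i \<le> j" for i j
    using sum_abs[of "\<lambda>l. f (Suc l) - f l" "{i..<j}"] sum_Suc_diff'[OF that, of f] by simp
  have *: "\<bar>f j - f i\<bar> \<le> (\<Sum>i\<le>N. weight a r J (\<pi> (c (real i))))" if "i \<le> j" "j \<le> N" for i j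
  proof -
    have "(\<Sum>l\<in>{i..<j}. \<bar>f (Suc l) - f l\<bar>) \<le> (\<Sum>l\<in>{i..<j}. weight a r J (\<pi> (c (real l))))"
      by (rule sum_mono) (use step that in auto)
    also have "... \<le> (\<Sum>i\<le>N. weight a r J (\<pi> (c (real i))))" by (rule sum_mono2) (use w0 that in auto)
    finally show ?thesis using tele[OF that(1)] by linarith
  qed
  have near: "\<bar>f (nat \<lfloor>u\<rfloor>) - log_pos a r J (c u)\<bar> \<le> 20 \<and> nat \<lfloor>u\<rfloor> \<le> N" if u: "u \<in> {0..k b w}" for u
  proof -
    have l: "nat \<lfloor>u\<rfloor> \<le> N" unfolding N_def using u by (intro nat_mono floor_mono) auto
    have "real (nat \<lfloor>u\<rfloor>) \<le> u" "u \<le> real (nat \<lfloor>u\<rfloor>) + 1" using u by (auto simp: of_nat_nat)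
    then have "k (c (real (nat \<lfloor>u\<rfloor>))) (c u) \<le> 1" using geoD(6)[OF c N[OF l] u] by linarith
    from log_pos_step[OF geoD(5)[OF c N[OF l]] geoD(5)[OF c u] this] l show ?thesis unfolding f_def by simp
  qed
  have "scale_at a r (c s) = r" using s unfolding scale_at_def by simp
  then have 1: "log_pos a r J (c s) = 0" unfolding log_pos_def using r_pos J by simp
  have "exp J * r \<le> scale_at a r (c t)" using t unfolding scale_at_def by simp
  then have "exp J \<le> scale_at a r (c t) / r" using r_pos by (simp add: field_simps)
  then have 2: "log_pos a r J (c t) = J" unfolding log_pos_def using r_pos scale_at_pos by (simp add: ln_ge_iff)
  have "J - 40 \<le> \<bar>f (nat \<lfloor>t\<rfloor>) - f (nat \<lfloor>s\<rfloor>)\<bar>" using near[OF s(1)] near[OF t(1)] 1 2 by linarith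
  also have "... \<le> (\<Sum>i\<le>N. weight a r J (\<pi> (c (real i))))"
    using *[of "nat \<lfloor>s\<rfloor>" "nat \<lfloor>t\<rfloor>"] *[of "nat \<lfloor>t\<rfloor>" "nat \<lfloor>s\<rfloor>"] near[OF s(1)] near[OF t(1)]
    by (cases "nat \<lfloor>s\<rfloor> \<le> nat \<lfloor>t\<rfloor>") (auto simp: abs_minus_commute)
  finally show ?thesis unfolding N_def .
qed

lemma separated_balls_disjoint:
  assumes C: "C \<subseteq> \<Omega>" "\<And>c c'. c \<in> C ==> c' \<in> C ==> c \<noteq> c' ==> 1 \<le> k c c'"
  shows "disjoint_family_on (\<lambda>c. ball c (d c / 8)) C"
  unfolding disjoint_family_on_def
proof (intro ballI impI)
  fix c c' assume c: "c \<in> C" "c' \<in> C" "c \<noteq> c'"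
  have *: "\<not> dist c c' < d c / 4" if "c \<in> C" "c' \<in> C" "c \<noteq> c'" for c c'
  proof
    assume h: "dist c c' < d c / 4"
    have "k c c' \<le> 2 * dist c c' / d c" by (rule k_le_dist(2)) (use that C h zero_le_dist[of c c'] in \<open>auto, linarith\<close>)
    also have "... < 1" using h d_pos[of c] that C by (auto simp: divide_simps)
    finally show False using C(2)[OF that] by simp
  qed
  show "ball c (d c / 8) \<inter> ball c' (d c' / 8) = {}"
  proof (rule ccontr)
    assume "\<not> ?thesis"
    then obtain z where "dist c z < d c / 8" "dist c' z < d c' / 8" by auto
    then have "dist c c' < d c / 8 + d c' / 8" using dist_triangle2[of c c' z] by linarith
    moreover have "\<not> dist c c' < d c / 4" "\<not> dist c c' < d c' / 4" using *[of c c'] *[of c' c] c by (auto simp: dist_commute)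
    ultimately show False by linarith
  qed
qed

text \<open>Only about \<open>J\<close> dyadic shells meet the annulus, and by volume each of them contributes a bounded
  amount.\<close>

lemma weight_sum_le:
  assumes C: "finite C" "C \<subseteq> \<Omega>" "\<And>c c'. c \<in> C ==> c' \<in> C ==> c \<noteq> c' ==> 1 \<le> k c c'" and J: "0 \<le> J"
  shows "(\<Sum>c\<in>C. weight a r J c ^ Suc CARD('n)) \<le> 300 * 150 ^ CARD('n) * 48 ^ CARD('n) * (J + 6)"
proof -
  let ?n = "CARD('n)"
  define C' where "C' = {c\<in>C. scale_at a r c \<le> 25 * exp J * r}"
  define l where "l c = nat \<lfloor>ln (scale_at a r c / r)\<rfloor>" for c
  define N where "N = nat \<lfloor>J + 5\<rfloor>"
  have fin: "finite C'" unfolding C'_def using C(1) by simp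
  have l: "exp (real (l c)) * r \<le> scale_at a r c" "scale_at a r c \<le> exp (real (l c) + 1) * r" for c
  proof -
    have 1: "1 \<le> scale_at a r c / r" using scale_at_pos[of c] r_pos by simp
    then have "0 \<le> ln (scale_at a r c / r)" by simp
    then have "real (l c) \<le> ln (scale_at a r c / r)" "ln (scale_at a r c / r) \<le> real (l c) + 1"
      unfolding l_def by (auto simp: of_nat_nat)
    then have "exp (real (l c)) \<le> scale_at a r c / r" "scale_at a r c / r \<le> exp (real (l c) + 1)"
      using 1 by (auto simp: ln_ge_iff[symmetric] ln_le_cancel_iff[symmetric] simp del: ln_le_cancel_iff)
    then show "exp (real (l c)) * r \<le> scale_at a r c" "scale_at a r c \<le> exp (real (l c) + 1) * r"
      using r_pos by (simp_all add: field_simps)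
  qed
  have lN: "l c \<le> N" if "c \<in> C'" for c
  proof -
    have "(2::real) ^ 5 \<le> exp 1 ^ 5" using exp_ge_add_one_self[of "1::real"] by (intro power_mono) auto
    then have "25 \<le> exp (5::real)" by (simp add: exp_of_nat_mult[symmetric])
    then have "25 * exp J * r \<le> exp 5 * exp J * r" using r_pos by (intro mult_right_mono) auto
    moreover have "scale_at a r c \<le> 25 * exp J * r" using that by (simp add: C'_def)
    ultimately have "scale_at a r c \<le> exp 5 * exp J * r" by (rule order_trans[rotated])
    then have "scale_at a r c / r \<le> exp (J + 5)"
      using r_pos by (simp add: exp_add divide_le_eq mult.commute)
    then have "ln (scale_at a r c / r) \<le> ln (exp (J + 5))"
      using scale_at_pos[of c] r_pos by (subst ln_le_cancel_iff) auto
    then have "ln (scale_at a r c / r) \<le> J + 5" by simp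
    then show ?thesis unfolding l_def N_def by (intro nat_mono floor_mono)
  qed
  have shell: "(\<Sum>c\<in>{c\<in>C'. l c = i}. (d c / scale_at a r c) ^ ?n) \<le> 48 ^ ?n" for i
  proof -
    define R where "R = exp (real i) * r"
    have R: "0 < R" unfolding R_def using r_pos by simp
    have e3: "exp (real i + 1) * r \<le> 3 * R" unfolding R_def exp_add
      using mult_right_mono[OF exp_le, of "exp (real i) * r"] r_pos by (simp add: ac_simps)
    have "(\<Sum>c\<in>{c\<in>C'. l c = i}. (d c / 8) ^ ?n) \<le> (6 * R) ^ ?n"
    proof (rule packing_balls)
      show "disjoint_family_on (\<lambda>c. ball c (d c / 8)) {c \<in> C'. l c = i}"
        using separated_balls_disjoint[OF C(2,3)] by (rule disjoint_family_on_mono[rotated]) (auto simp: C'_def)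
      fix c assume c: "c \<in> {c \<in> C'. l c = i}"
      have "dist c a \<le> scale_at a r c" unfolding scale_at_def by simp
      then have "dist a c \<le> 3 * R" "d c / 8 \<le> 3 * R"
        using l(2)[of c] c e3 d_le_scale_at[of c] R by (auto simp: dist_commute)
      then show "0 \<le> d c / 8 \<and> ball c (d c / 8) \<subseteq> ball a (6 * R)"
        using dist_triangle[of a _ c] by (auto simp: infdist_nonneg) (smt (verit))
    qed (use fin R in auto)
    moreover have "(\<Sum>c\<in>{c\<in>C'. l c = i}. (d c / scale_at a r c) ^ ?n) \<le> (\<Sum>c\<in>{c\<in>C'. l c = i}. (8 / R) ^ ?n * (d c / 8) ^ ?n)"
    proof (rule sum_mono)
      fix c assume c: "c \<in> {c\<in>C'. l c = i}"
      have "R \<le> scale_at a r c" using l(1)[of c] c unfolding R_def by auto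
      then have "d c / scale_at a r c \<le> d c / R" using R by (intro divide_left_mono) (auto simp: infdist_nonneg)
      then have "(d c / scale_at a r c) ^ ?n \<le> (d c / R) ^ ?n"
        using scale_at_pos[of c] by (intro power_mono) (auto simp: infdist_nonneg)
      then show "(d c / scale_at a r c) ^ ?n \<le> (8 / R) ^ ?n * (d c / 8) ^ ?n"
        unfolding power_mult_distrib[symmetric] by simp
    qed
    ultimately have "(\<Sum>c\<in>{c\<in>C'. l c = i}. (d c / scale_at a r c) ^ ?n) \<le> (8 / R) ^ ?n * (6 * R) ^ ?n"
      unfolding sum_distrib_left[symmetric] using R
      by (elim order_trans) (rule mult_left_mono, auto)
    also have "... = ((8 / R) * (6 * R)) ^ ?n" by (rule power_mult_distrib[symmetric])
    also have "(8 / R) * (6 * R) = 48" using R by simp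
    finally show ?thesis .
  qed
  have "(\<Sum>c\<in>C. weight a r J c ^ Suc ?n) = (\<Sum>c\<in>C'. weight a r J c ^ Suc ?n)"
    unfolding C'_def using C(1) by (intro sum.mono_neutral_right) (auto simp: weight_def)
  also have "... \<le> (\<Sum>c\<in>C'. 300 * 150 ^ ?n * (d c / scale_at a r c) ^ ?n)"
  proof (rule sum_mono)
    fix c assume c: "c \<in> C'"
    define x where "x = d c / scale_at a r c"
    have x: "0 \<le> x" "x \<le> 2" unfolding x_def using scale_at_pos[of c] d_le_scale_at[of c]
      by (auto simp: infdist_nonneg divide_simps)
    have "weight a r J c = 150 * x" using c unfolding weight_def C'_def x_def by simp
    then have "weight a r J c ^ Suc ?n = (150 * x) * (150 ^ ?n * x ^ ?n)" by (simp add: power_mult_distrib)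
    also have "... \<le> 300 * (150 ^ ?n * x ^ ?n)" using x by (intro mult_right_mono) auto
    finally show "weight a r J c ^ Suc ?n \<le> 300 * 150 ^ ?n * (d c / scale_at a r c) ^ ?n"
      unfolding x_def by simp
  qed
  also have "... = 300 * 150 ^ ?n * (\<Sum>c\<in>C'. (d c / scale_at a r c) ^ ?n)" by (simp add: sum_distrib_left)
  also have "(\<Sum>c\<in>C'. (d c / scale_at a r c) ^ ?n) = (\<Sum>i\<in>{..N}. \<Sum>c\<in>{c\<in>C'. l c = i}. (d c / scale_at a r c) ^ ?n)"
    by (rule sum.group[symmetric]) (use fin lN in auto)
  also have "300 * 150 ^ ?n * (\<Sum>i\<in>{..N}. \<Sum>c\<in>{c\<in>C'. l c = i}. (d c / scale_at a r c) ^ ?n)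
      \<le> 300 * 150 ^ ?n * (\<Sum>i\<in>{..N}. 48 ^ ?n)"
    by (intro mult_left_mono sum_mono shell) auto
  also have "... = 300 * 150 ^ ?n * 48 ^ ?n * (real N + 1)" by simp
  also have "... \<le> 300 * 150 ^ ?n * 48 ^ ?n * (J + 6)"
    unfolding N_def using J by (intro mult_left_mono) (auto simp: of_nat_nat)
  finally show ?thesis .
qed

end

end


section \<open>The visual quasi-metric and the crossing estimate\<close>

context hyperbolic_domain
begin

text \<open>The distance from a base point to the geodesics between two points plays the role of the
  Gromov product. Thin triangles make it an ultrametric up to \<open>\<delta>\<close>, so that its exponential is a
  quasi-ultrametric with constant at most the square root of \<open>2\<close>.\<close>

definition gdist :: "real^'n => real^'n => real^'n => real" where
  "gdist b w w' = Inf {k b (c s) | c s. geo w w' c \<and> s \<in> {0..k w w'}}"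

definition visual :: "real^'n => real^'n => real^'n => real" where
  "visual b w w' = exp (- (ln 2 / (2 * (\<delta> + 1))) * gdist b w w')"

lemma gdist_le:
  assumes "b \<in> \<Omega>" "geo w w' c" "s \<in> {0..k w w'}" shows "gdist b w w' \<le> k b (c s)"
  unfolding gdist_def
proof (rule cInf_lower)
  show "bdd_below {k b (c s) |c s. geo w w' c \<and> s \<in> {0..k w w'}}"
    by (rule bdd_belowI[of _ 0]) (use k_nonneg geoD(5) assms(1) in blast)
qed (use assms in blast)

lemma gdist_ge:
  assumes "w \<in> \<Omega>" "w' \<in> \<Omega>" "\<And>c s. geo w w' c ==> s \<in> {0..k w w'} ==> B \<le> k b (c s)"
  shows "B \<le> gdist b w w'"
  unfolding gdist_def
proof (rule cInf_greatest)
  obtain c where "geo w w' c" using geo_exists[OF assms(1,2)] by blast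
  then show "{k b (c s) |c s. geo w w' c \<and> s \<in> {0..k w w'}} \<noteq> {}" using geoD(7) by fastforce
qed (use assms in blast)

lemma gdist_nonneg: "b \<in> \<Omega> ==> w \<in> \<Omega> ==> w' \<in> \<Omega> ==> 0 \<le> gdist b w w'"
  by (rule gdist_ge) (use k_nonneg geoD(5) in blast)+

lemma gdist_sym_le: assumes "b \<in> \<Omega>" "w \<in> \<Omega>" "w' \<in> \<Omega>" shows "gdist b w w' \<le> gdist b w' w"
proof (rule gdist_ge[OF assms(3,2)])
  fix c s assume c: "geo w' w c" "s \<in> {0..k w' w}"
  show "gdist b w w' \<le> k b (c s)"
    using gdist_le[OF assms(1) geo_reverse[OF c(1)], of "k w' w - s"] c(2) k_sym[OF assms(2,3)] by simp
qed

lemma gdist_sym: "b \<in> \<Omega> ==> w \<in> \<Omega> ==> w' \<in> \<Omega> ==> gdist b w w' = gdist b w' w"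
  by (intro antisym gdist_sym_le)

lemma gdist_ultra:
  assumes b: "b \<in> \<Omega>" and xyz: "x \<in> \<Omega>" "y \<in> \<Omega>" "z \<in> \<Omega>"
  shows "min (gdist b x y) (gdist b y z) - \<delta> \<le> gdist b x z"
proof (rule gdist_ge[OF xyz(1,3)])
  fix c s assume c: "geo x z c" and s: "s \<in> {0..k x z}"
  obtain e where e: "geo z y e" using geo_exists xyz by blast
  obtain h where h: "geo y x h" using geo_exists xyz by blast
  have tri: "k b u \<le> k b (c s) + \<delta>" if "k (c s) u \<le> \<delta>" "u \<in> \<Omega>" for u
    using k_triangle[OF b geoD(5)[OF c s] that(2)] that(1) by linarith
  from thin_triangle[OF c e h s] show "min (gdist b x y) (gdist b y z) - \<delta> \<le> k b (c s)"
  proof (elim disjE bexE)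
    fix t assume t: "t \<in> {0..k z y}" "k (c s) (e t) \<le> \<delta>"
    have "gdist b y z \<le> k b (e t)" using gdist_le[OF b e t(1)] gdist_sym[OF b xyz(2,3)] by simp
    then show ?thesis using tri[OF t(2) geoD(5)[OF e t(1)]] by linarith
  next
    fix t assume t: "t \<in> {0..k y x}" "k (c s) (h t) \<le> \<delta>"
    have "gdist b x y \<le> k b (h t)" using gdist_le[OF b h t(1)] gdist_sym[OF b xyz(1,2)] by simp
    then show ?thesis using tri[OF t(2) geoD(5)[OF h t(1)]] by linarith
  qed
qed

text \<open>If two geodesics from \<open>b\<close> are close to each other at level \<open>s\<close>, a geodesic between their ends would
  gain nothing by returning to a lower level, so the visual quasi-metric decays exponentially in \<open>s\<close>.\<close>

lemma gdist_ge_level: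
  assumes c: "geo b w c" and c': "geo b w' c'" and s: "0 \<le> s" "s \<le> k b w" "s \<le> k b w'"
    and near: "k (c s) (c' s) \<le> 2"
  shows "s - 1 \<le> gdist b w w'"
proof (rule gdist_ge)
  show w: "w \<in> \<Omega>" "w' \<in> \<Omega>" using geoD[OF c] geoD[OF c'] by auto
  have b: "b \<in> \<Omega>" using geoD[OF c] by auto
  fix e t assume e: "geo w w' e" and t: "t \<in> {0..k w w'}"
  have u: "e t \<in> \<Omega>" by (rule geoD(5)[OF e t])
  have p: "c s \<in> \<Omega>" "c' s \<in> \<Omega>" using geoD(5)[OF c] geoD(5)[OF c'] s by auto
  have "k b w \<le> k b (e t) + k (e t) w" "k b w' \<le> k b (e t) + k (e t) w'"
    using k_triangle b u w by auto
  moreover have "k w (e t) = t" "k (e t) w' = k w w' - t" using geo_dist[OF e t] by auto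
  moreover have "k w w' \<le> k w (c s) + (k (c s) (c' s) + k (c' s) w')"
    using k_triangle[OF w(1) p(1) w(2)] k_triangle[OF p w(2)] by linarith
  moreover have "k (c s) w = k b w - s" "k (c' s) w' = k b w' - s" using geo_dist[OF c] geo_dist[OF c'] s by auto
  ultimately show "s - 1 \<le> k b (e t)" using near k_sym[OF w(1) u] k_sym[OF w(1) p(1)] by linarith
qed

lemma gdist_ge_near:
  assumes "b \<in> \<Omega>" "w \<in> \<Omega>" "w' \<in> \<Omega>" shows "k b w - k w w' \<le> gdist b w w'"
proof (rule gdist_ge[OF assms(2,3)])
  fix e t assume e: "geo w w' e" and t: "t \<in> {0..k w w'}"
  have u: "e t \<in> \<Omega>" by (rule geoD(5)[OF e t])
  show "k b w - k w w' \<le> k b (e t)"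
    using k_triangle[OF assms(1) u assms(2)] geo_dist[OF e t] t k_sym[OF assms(2) u] by simp
qed

lemma rate_pos: "0 < ln 2 / (2 * (\<delta> + 1))" "ln 2 / (2 * (\<delta> + 1)) \<le> ln 2"
  using \<delta>_nonneg by (auto simp: divide_simps mult_le_cancel_left1)

lemma visual_pos: "0 < visual b w w'"
  unfolding visual_def by simp

lemma visual_le: "B \<le> gdist b w w' ==> visual b w w' \<le> exp (- (ln 2 / (2 * (\<delta> + 1))) * B)"
  unfolding visual_def exp_le_cancel_iff by (rule mult_left_mono_neg) (use rate_pos in auto)

lemma visual_le_1: "b \<in> \<Omega> ==> w \<in> \<Omega> ==> w' \<in> \<Omega> ==> visual b w w' \<le> 1"
  using visual_le[of 0 b w w'] gdist_nonneg by simp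

lemma visual_ultra:
  assumes "b \<in> \<Omega>" "x \<in> \<Omega>" "y \<in> \<Omega>" "z \<in> \<Omega>"
  shows "visual b x z \<le> exp (ln 2 / (2 * (\<delta> + 1)) * \<delta>) * max (visual b x y) (visual b y z)"
proof -
  let ?\<epsilon> = "ln 2 / (2 * (\<delta> + 1))"
  have max: "exp (- e * min X Y) = max (exp (- e * X)) (exp (- e * Y))" if "0 < e" for X Y e :: real
    using that by (cases "X \<le> Y") (auto simp: min_def max_def)
  note * = max[OF rate_pos(1)]
  have shift: "exp (- e * (X - \<delta>)) = exp (e * \<delta>) * exp (- e * X)" for X e :: real
    by (simp add: exp_add[symmetric] algebra_simps)
  have "visual b x z \<le> exp (- ?\<epsilon> * (min (gdist b x y) (gdist b y z) - \<delta>))"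
    by (rule visual_le[OF gdist_ultra[OF assms]])
  also have "... = exp (?\<epsilon> * \<delta>) * exp (- ?\<epsilon> * min (gdist b x y) (gdist b y z))"
    by (rule shift)
  finally show ?thesis unfolding * visual_def .
qed

lemma visual_constant: "1 \<le> exp (ln 2 / (2 * (\<delta> + 1)) * \<delta>)" "(exp (ln 2 / (2 * (\<delta> + 1)) * \<delta>))\<^sup>2 \<le> 2"
proof -
  let ?\<epsilon> = "ln 2 / (2 * (\<delta> + 1))"
  show "1 \<le> exp (?\<epsilon> * \<delta>)" using rate_pos(1) \<delta>_nonneg by simp
  have "(exp (?\<epsilon> * \<delta>))\<^sup>2 = exp (2 * (?\<epsilon> * \<delta>))" by (simp add: exp_of_nat_mult[of 2, symmetric, simplified])
  also have "2 * (?\<epsilon> * \<delta>) = ln 2 * (\<delta> / (\<delta> + 1))" using \<delta>_nonneg by (simp add: field_simps)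
  also have "exp (ln 2 * (\<delta> / (\<delta> + 1))) \<le> exp (ln 2 * 1)"
    unfolding exp_le_cancel_iff by (rule mult_left_mono) (use \<delta>_nonneg in auto)
  finally show "(exp (?\<epsilon> * \<delta>))\<^sup>2 \<le> 2" by simp
qed

abbreviation crosses :: "real^'n => real => real => real => (real => real^'n) => bool" where
  "crosses a r J T c \<equiv> \<exists>s\<in>{0..T}. \<exists>t\<in>{0..T}. dist (c s) a \<le> r \<and> exp J * r \<le> dist (c t) a"

lemma connected_chain:
  assumes \<sigma>: "connected \<sigma>" "\<sigma> \<subseteq> \<Omega>" and xy: "x \<in> \<sigma>" "y \<in> \<sigma>"
  shows "\<exists>N w. w 0 = x \<and> w N = y \<and> (\<forall>i\<le>N. w i \<in> \<sigma>) \<and> (\<forall>i<N. k (w i) (w (Suc i)) \<le> 1)"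
proof -
  define R where "R = {(u, v). u \<in> \<sigma> \<and> v \<in> \<sigma> \<and> k u v \<le> 1}"
  have "sym R" unfolding sym_def R_def using k_sym \<sigma>(2) by (auto simp: subset_iff)
  then have sym: "sym (R\<^sup>*)" by (rule sym_rtrancl)
  have "(x, y) \<in> R\<^sup>*"
  proof (rule connected_equivalence_relation[OF \<sigma>(1) xy, of "\<lambda>u v. (u, v) \<in> R\<^sup>*"])
    fix a assume a: "a \<in> \<sigma>"
    then have "a \<in> \<Omega>" using \<sigma>(2) by blast
    have "(a, u) \<in> R\<^sup>*" if u: "u \<in> \<sigma> \<inter> ball a (d a / 2)" for u
    proof -
      have "k a u \<le> 2 * dist a u / d a" by (rule k_le_dist(2)[OF \<open>a \<in> \<Omega>\<close>]) (use u in auto)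
      also have "... \<le> 1" using u d_pos[OF \<open>a \<in> \<Omega>\<close>] by (auto simp: divide_simps)
      finally show ?thesis using a u unfolding R_def by auto
    qed
    then show "\<exists>T. openin (top_of_set \<sigma>) T \<and> a \<in> T \<and> (\<forall>u\<in>T. (a, u) \<in> R\<^sup>*)"
      using a d_pos[OF \<open>a \<in> \<Omega>\<close>] by (intro exI[of _ "\<sigma> \<inter> ball a (d a / 2)"]) (auto intro: openin_open_Int)
  qed (use sym in \<open>auto simp: sym_def\<close>)
  then obtain N where "(x, y) \<in> R ^^ N" by (auto simp: rtrancl_power)
  then obtain w where w: "w 0 = x" "w N = y" "\<forall>i<N. (w i, w (Suc i)) \<in> R" unfolding relpow_fun_conv by blast
  have "w i \<in> \<sigma>" if "i \<le> N" for i
    using w xy that unfolding R_def by (cases i) auto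
  then show ?thesis using w unfolding R_def by blast
qed

text \<open>The total weight collected by the geodesics to the points of a chain, measured with the
  increments of the visual potential along the chain. The increments over the shadow of a net point
  at level \<open>s\<close> decay exponentially in \<open>s\<close>, whereas the total weight of the net is linear in \<open>J\<close>; the
  free parameter \<open>t\<close> balances the two.\<close>

lemma crossing_energy:
  assumes a: "a \<in> \<Omega>" and r: "d a \<le> r" and J: "40 \<le> J" and t: "0 < t"
    and geo0: "geo x y c0" "s0 \<in> {0..k x y}" "b = c0 s0"
    and \<sigma>: "connected \<sigma>" "\<sigma> \<subseteq> \<Omega>" "x \<in> \<sigma>" "y \<in> \<sigma>" and xy: "x \<noteq> y"
    and cross: "\<And>w. w \<in> \<sigma> ==> \<exists>c. geo b w c \<and>
      crosses a r J (k b w) c"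
    and \<epsilon>: "\<epsilon> = ln 2 / (2 * (\<delta> + 1))"
  shows "(J - 40) / 2 \<le> 4 * t / (1 - exp (- \<epsilon> / (2 * CARD('n)))) +
    300 * 150 ^ CARD('n) * 48 ^ CARD('n) * (J + 6) / (t ^ CARD('n) * (1 - exp (- \<epsilon> / 2)))"
proof -
  let ?n = "CARD('n)"
  have n: "0 < real ?n" by simp
  have b: "b \<in> \<Omega>" using geoD(5)[OF geo0(1,2)] geo0(3) by simp
  have x: "x \<in> \<Omega>" and y: "y \<in> \<Omega>" using \<sigma> by auto
  have \<epsilon>0: "0 < \<epsilon>" "\<epsilon> \<le> ln 2" unfolding \<epsilon> using rate_pos by auto
  let ?q = "visual b"
  have q1: "?q x y = 1"
  proof -
    have "gdist b x y \<le> k b b" using gdist_le[OF b geo0(1,2)] geo0(3) by simp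
    then have "gdist b x y = 0" using gdist_nonneg[OF b x y] b by simp
    then show ?thesis unfolding visual_def by simp
  qed
  obtain f where f: "f x = 0" "\<And>z. z \<in> \<Omega> ==> f z \<le> ?q x z"
      "\<And>z. z \<in> \<Omega> ==> z \<noteq> x ==> ?q x z \<le> 2 * f z" "\<And>z z'. z \<in> \<Omega> ==> z' \<in> \<Omega> ==> f z' - f z \<le> ?q z z'"
    using chain_potential[of \<Omega> ?q, OF visual_pos visual_ultra[OF b] visual_constant x] by blast
  obtain N w where w: "w 0 = x" "w N = y" "\<And>i. i \<le> N ==> w i \<in> \<sigma>" "\<And>i. i < N ==> k (w i) (w (Suc i)) \<le> 1"
    using connected_chain[OF \<sigma>] by blast
  have w\<Omega>: "w i \<in> \<Omega>" if "i \<le> N" for i using w(3)[OF that] \<sigma>(2) by blast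
  define A where "A i = f (w i)" for i
  define m where "m i = running_max A (Suc i) - running_max A i" for i
  have m0: "0 \<le> m i" for i unfolding m_def running_max_Suc by simp
  have summ: "(\<Sum>i<N. m i) = running_max A N"
    unfolding m_def sum_lessThan_telescope by (simp add: A_def w f)
  have m_ge: "1 / 2 \<le> (\<Sum>i<N. m i)"
    unfolding summ using running_max_ge[of N N A] f(3)[OF y] q1 xy by (simp add: A_def w)
  have m_le: "(\<Sum>i<N. m i) \<le> 1"
    unfolding summ running_max_def
  proof (rule Max.boundedI)
    fix u assume "u \<in> A ` {..N}"
    then obtain i where "i \<le> N" "u = f (w i)" unfolding A_def by auto
    then show "u \<le> 1" using f(2)[OF w\<Omega>] visual_le_1[OF b x w\<Omega>] by (auto intro: order_trans)
  qed auto
  have "\<exists>c. geo b (w (Suc i)) c \<and> crosses a r J (k b (w (Suc i))) c" if "i < N" for i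
    using cross w(3) that by simp
  then obtain cc where cc: "\<And>i. i < N ==> geo b (w (Suc i)) (cc i) \<and> crosses a r J (k b (w (Suc i))) (cc i)" by metis
  define L where "L i = nat \<lfloor>k b (w (Suc i))\<rfloor>" for i
  have L: "real s \<in> {0..k b (w (Suc i))}" if "i < N" "s \<le> L i" for i s
    using that k_nonneg[OF b w\<Omega>[of "Suc i"]] unfolding L_def by (simp add: le_nat_floor le_nat_iff le_floor_iff)
  define P where "P = (\<lambda>(i, s). cc i (real s)) ` (SIGMA i:{..<N}. {..L i})"
  have finP: "finite P" unfolding P_def by auto
  have P\<Omega>: "P \<subseteq> \<Omega>" unfolding P_def using geoD(5) cc L by fastforce
  have "\<exists>C\<subseteq>P. (\<forall>c\<in>C. \<forall>c'\<in>C. c \<noteq> c' --> \<not> k c c' < 1) \<and> (\<forall>p\<in>P. \<exists>c\<in>C. k p c < 1)"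
  proof (rule finite_net[OF finP])
    fix p assume "p \<in> P" then have "p \<in> \<Omega>" using P\<Omega> by blast
    then show "k p p < 1" by simp
  next
    fix p q assume "p \<in> P" "q \<in> P" "k p q < 1"
    moreover from this have "p \<in> \<Omega>" "q \<in> \<Omega>" using P\<Omega> by auto
    ultimately show "k q p < 1" using k_sym[of p q] by simp
  qed
  then obtain C where C: "C \<subseteq> P" "\<And>c c'. c \<in> C ==> c' \<in> C ==> c \<noteq> c' ==> 1 \<le> k c c'" "\<forall>p\<in>P. \<exists>c\<in>C. k p c < 1"
    unfolding not_less by blast
  from C(3) have "\<forall>p\<in>P. \<exists>c. c \<in> C \<and> k p c < 1" by blast
  from bchoice[OF this] obtain \<pi> where \<pi>: "\<And>p. p \<in> P ==> \<pi> p \<in> C \<and> k p (\<pi> p) < 1" by blast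
  have finC: "finite C" using C(1) finP finite_subset by blast
  have C\<Omega>: "C \<subseteq> \<Omega>" using C(1) P\<Omega> by blast
  have inP: "cc i (real s) \<in> P" if "i < N" "s \<le> L i" for i s unfolding P_def using that by force
  define wt where "wt = weight a r J"
  have wt0: "0 \<le> wt c" for c unfolding wt_def weight_def using scale_at_pos(1)[OF a r, of c] by (auto simp: infdist_nonneg)
  define Sm where "Sm = Max (insert 0 (L ` {..<N}))"
  have LS: "L i \<le> Sm" if "i < N" for i unfolding Sm_def using that by (intro Max_ge) auto
  define I where "I s c = {i\<in>{..<N}. s \<le> L i \<and> \<pi> (cc i (real s)) = c}" for s c
  define \<mu> where "\<mu> s c = (\<Sum>i\<in>I s c. m i)" for s c
  have \<mu>0: "0 \<le> \<mu> s c" for s c unfolding \<mu>_def by (intro sum_nonneg m0)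
  \<comment> \<open>the total weight as a sum over levels and net points\<close>
  have "(J - 40) / 2 \<le> (J - 40) * (\<Sum>i<N. m i)" using mult_left_mono[OF m_ge, of "J - 40"] J by simp
  also have "... \<le> (\<Sum>i<N. m i * (\<Sum>s\<le>L i. wt (\<pi> (cc i (real s)))))"
    unfolding sum_distrib_left[of "J - 40"]
  proof (rule sum_mono)
    fix i assume "i \<in> {..<N}"
    then have i: "i < N" by simp
    from cc[OF i] obtain s t where st: "geo b (w (Suc i)) (cc i)" "s \<in> {0..k b (w (Suc i))}" "dist (cc i s) a \<le> r"
      "t \<in> {0..k b (w (Suc i))}" "exp J * r \<le> dist (cc i t) a" by blast
    have "J - 40 \<le> (\<Sum>s\<le>L i. wt (\<pi> (cc i (real s))))"
    proof -
      have "0 \<le> J" using J by simp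
      moreover have "\<pi> (cc i (real s)) \<in> \<Omega> \<and> k (cc i (real s)) (\<pi> (cc i (real s))) \<le> 1"
        if "s \<le> nat \<lfloor>k b (w (Suc i))\<rfloor>" for s
        using \<pi>[OF inP[OF i]] C\<Omega> that unfolding L_def by force
      ultimately show ?thesis
        unfolding wt_def L_def by (rule crossing_weight[OF a r st, where \<pi> = \<pi>])
    qed
    then show "(J - 40) * m i \<le> m i * (\<Sum>s\<le>L i. wt (\<pi> (cc i (real s))))"
      using m0[of i] by (simp add: mult.commute mult_left_mono)
  qed
  also have "... = (\<Sum>i<N. \<Sum>s\<le>Sm. \<Sum>c\<in>C. if i \<in> I s c then m i * wt c else 0)"
  proof (rule sum.cong[OF refl])
    fix i assume "i \<in> {..<N}"
    then have i: "i < N" by simp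
    have "m i * (\<Sum>s\<le>L i. wt (\<pi> (cc i (real s)))) = (\<Sum>s\<le>Sm. if s \<le> L i then m i * wt (\<pi> (cc i (real s))) else 0)"
      unfolding sum_distrib_left using LS[OF i] by (intro sum.mono_neutral_cong_left) auto
    also have "... = (\<Sum>s\<le>Sm. \<Sum>c\<in>C. if i \<in> I s c then m i * wt c else 0)"
    proof (rule sum.cong[OF refl])
      fix s assume "s \<in> {..Sm}"
      show "(if s \<le> L i then m i * wt (\<pi> (cc i (real s))) else 0) = (\<Sum>c\<in>C. if i \<in> I s c then m i * wt c else 0)"
      proof (cases "s \<le> L i")
        case True
        have "(\<Sum>c\<in>C. if i \<in> I s c then m i * wt c else 0) = (\<Sum>c\<in>C. if c = \<pi> (cc i (real s)) then m i * wt c else 0)"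
          unfolding I_def using True i by (intro sum.cong) auto
        also have "... = m i * wt (\<pi> (cc i (real s)))" using finC \<pi>[OF inP[OF i True]] by (simp add: sum.delta)
        finally show ?thesis using True by simp
      qed (simp add: I_def)
    qed
    finally show "m i * (\<Sum>s\<le>L i. wt (\<pi> (cc i (real s)))) = (\<Sum>s\<le>Sm. \<Sum>c\<in>C. if i \<in> I s c then m i * wt c else 0)" .
  qed
  also have "... = (\<Sum>s\<le>Sm. \<Sum>c\<in>C. wt c * \<mu> s c)"
  proof -
    have "(\<Sum>i<N. if i \<in> I s c then m i * wt c else 0) = wt c * \<mu> s c" for s c
    proof -
      have "(\<Sum>i<N. if i \<in> I s c then m i * wt c else 0) = (\<Sum>i\<in>I s c. m i * wt c)"
        by (rule sum.mono_neutral_cong_right) (auto simp: I_def)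
      then show ?thesis unfolding \<mu>_def by (simp add: sum_distrib_left mult.commute)
    qed
    note inner = this
    have "(\<Sum>i<N. \<Sum>s\<le>Sm. \<Sum>c\<in>C. if i \<in> I s c then m i * wt c else 0)
        = (\<Sum>s\<le>Sm. \<Sum>i<N. \<Sum>c\<in>C. if i \<in> I s c then m i * wt c else 0)" by (rule sum.swap)
    also have "... = (\<Sum>s\<le>Sm. \<Sum>c\<in>C. \<Sum>i<N. if i \<in> I s c then m i * wt c else 0)"
      by (intro sum.cong[OF refl] sum.swap)
    finally show ?thesis unfolding inner .
  qed
  also have "... \<le> (\<Sum>s\<le>Sm. 4 * t * exp (- \<epsilon> / (2 * ?n)) ^ s + (\<Sum>c\<in>C. wt c ^ Suc ?n) / t ^ ?n * exp (- \<epsilon> / 2) ^ s)"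
  proof (rule sum_mono)
    fix s
    have \<mu>sum: "(\<Sum>c\<in>C. \<mu> s c) \<le> 1"
    proof -
      have "(\<Sum>c\<in>C. \<mu> s c) = (\<Sum>i\<in>(\<Union>c\<in>C. I s c). m i)"
        unfolding \<mu>_def by (rule sum.UNION_disjoint[symmetric]) (auto simp: I_def finC)
      also have "... \<le> (\<Sum>i<N. m i)" by (rule sum_mono2) (auto simp: I_def m0)
      finally show ?thesis using m_le by simp
    qed
    have lvl: "exp (- \<epsilon> * (real s - 1)) \<le> 2 * exp (- \<epsilon> * real s)"
    proof -
      have "exp (- \<epsilon> * (real s - 1)) = exp \<epsilon> * exp (- \<epsilon> * real s)" by (simp add: algebra_simps exp_add[symmetric])
      moreover have "exp \<epsilon> \<le> 2" using \<epsilon>0(2) exp_le_cancel_iff[of \<epsilon> "ln 2"] by (simp del: exp_le_cancel_iff)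
      ultimately show ?thesis by simp
    qed
    have \<mu>le: "\<mu> s c \<le> 4 * exp (- \<epsilon> * real s)" for c
    proof -
      have "\<mu> s c \<le> 2 * (2 * exp (- \<epsilon> * real s))" unfolding \<mu>_def m_def
      proof (rule running_max_increments)
        fix i j assume ij: "i \<in> I s c" "j \<in> I s c"
        then have i: "i < N" "s \<le> L i" "\<pi> (cc i (real s)) = c" and j: "j < N" "s \<le> L j" "\<pi> (cc j (real s)) = c"
          unfolding I_def by auto
        have pi: "cc i (real s) \<in> \<Omega>" "cc j (real s) \<in> \<Omega>" "c \<in> \<Omega>"
          using inP[OF i(1,2)] inP[OF j(1,2)] P\<Omega> \<pi>[OF inP[OF i(1,2)]] C\<Omega> i(3) by auto
        have "k (cc i (real s)) (cc j (real s)) \<le> k (cc i (real s)) c + k (cc j (real s)) c"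
          using k_triangle[OF pi(1,3,2)] k_sym[OF pi(2,3)] by simp
        also have "... \<le> 2" using \<pi>[OF inP[OF i(1,2)]] \<pi>[OF inP[OF j(1,2)]] i(3) j(3) by simp
        finally have "real s - 1 \<le> gdist b (w (Suc j)) (w (Suc i))"
          using gdist_ge_level[of b "w (Suc j)" "cc j" "w (Suc i)" "cc i" "real s"] cc i j L[OF i(1,2)] L[OF j(1,2)] k_sym[OF pi(1,2)]
          by auto
        from visual_le[OF this] f(4)[of "w (Suc j)" "w (Suc i)"] w\<Omega>[of "Suc j"] w\<Omega>[of "Suc i"] i j lvl
        show "A (Suc i) - A (Suc j) \<le> 2 * exp (- \<epsilon> * real s)" unfolding A_def \<epsilon> by auto
      next
        fix i assume "i \<in> I s c"
        then have i: "i < N" "s \<le> L i" unfolding I_def by auto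
        have W: "w i \<in> \<Omega>" "w (Suc i) \<in> \<Omega>" using w\<Omega> i by auto
        have "real s - 1 \<le> gdist b (w (Suc i)) (w i)"
          using gdist_ge_near[OF b W(2,1)] w(4)[OF i(1)] k_sym[OF W] L[OF i] by auto
        then have "real s - 1 \<le> gdist b (w i) (w (Suc i))" using gdist_sym[OF b W] by simp
        from visual_le[OF this] f(4)[OF W] lvl
        show "A (Suc i) - A i \<le> 2 * exp (- \<epsilon> * real s)" unfolding A_def \<epsilon> by auto
      qed (auto simp: I_def)
      then show ?thesis by simp
    qed
    let ?u = "exp (- \<epsilon> / (2 * ?n)) ^ s"
    define \<beta> where "\<beta> = 4 * exp (- \<epsilon> * real s / ?n)"
    define \<tau> where "\<tau> = t * exp (\<epsilon> * real s / (2 * ?n))"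
    have \<tau>: "0 < \<tau>" unfolding \<tau>_def using t by simp
    have \<beta>: "0 < \<beta>" unfolding \<beta>_def by simp
    have \<tau>\<beta>: "\<tau> * \<beta> = 4 * t * ?u"
    proof -
      have "exp (\<epsilon> * real s / (2 * ?n)) * exp (- \<epsilon> * real s / ?n) = ?u"
        unfolding exp_of_nat_mult[symmetric] exp_add[symmetric] by (rule arg_cong[of _ _ exp]) (simp add: field_simps)
      then show ?thesis unfolding \<tau>_def \<beta>_def by simp
    qed
    have \<tau>n: "\<tau> ^ ?n = t ^ ?n / exp (- \<epsilon> / 2) ^ s"
    proof -
      have "exp (\<epsilon> * real s / (2 * ?n)) ^ ?n = exp (\<epsilon> / 2 * real s)"
        unfolding exp_of_nat_mult[symmetric] by (rule arg_cong[of _ _ exp]) (simp add: field_simps)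
      moreover have "exp (- \<epsilon> / 2) ^ s * exp (\<epsilon> / 2 * real s) = 1"
        unfolding exp_of_nat_mult[symmetric] exp_add[symmetric] by simp
      ultimately show ?thesis unfolding \<tau>_def power_mult_distrib by (simp add: field_simps)
    qed
    have \<beta>n: "4 * exp (- \<epsilon> * real s) \<le> \<beta> ^ ?n"
    proof -
      have "exp (- \<epsilon> * real s / ?n) ^ ?n = exp (- \<epsilon> * real s)"
        unfolding exp_of_nat_mult[symmetric] by (rule arg_cong[of _ _ exp]) simp
      moreover have "(4::real) ^ 1 \<le> 4 ^ ?n" by (rule power_increasing) auto
      ultimately show ?thesis unfolding \<beta>_def power_mult_distrib by simp
    qed
    have key: "wt c * \<mu> s c \<le> \<tau> * \<beta> * \<mu> s c + wt c ^ Suc ?n / \<tau> ^ ?n" for c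
    proof (cases "wt c \<le> \<tau> * \<beta>")
      case True
      then show ?thesis using mult_right_mono[OF True \<mu>0[of s c]] wt0[of c] \<tau>
        by (smt (verit) divide_nonneg_pos zero_le_power zero_less_power)
    next
      case False
      then have "\<beta> \<le> wt c / \<tau>" using \<tau> by (simp add: field_simps)
      then have "\<beta> ^ ?n \<le> (wt c / \<tau>) ^ ?n" using \<beta> by (intro power_mono) auto
      then have "\<mu> s c \<le> (wt c / \<tau>) ^ ?n" using \<mu>le[of c] \<beta>n by linarith
      then have "wt c * \<mu> s c \<le> wt c * (wt c / \<tau>) ^ ?n" using wt0 by (intro mult_left_mono)
      also have "... = wt c ^ Suc ?n / \<tau> ^ ?n" by (simp add: power_divide)
      finally show ?thesis using \<tau> \<beta> \<mu>0[of s c] by (smt (verit) mult_nonneg_nonneg)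
    qed
    have "(\<Sum>c\<in>C. wt c * \<mu> s c) \<le> (\<Sum>c\<in>C. \<tau> * \<beta> * \<mu> s c + wt c ^ Suc ?n / \<tau> ^ ?n)" by (rule sum_mono) (rule key)
    also have "... = \<tau> * \<beta> * (\<Sum>c\<in>C. \<mu> s c) + (\<Sum>c\<in>C. wt c ^ Suc ?n) / \<tau> ^ ?n"
      by (simp add: sum.distrib sum_distrib_left sum_divide_distrib)
    also have "\<tau> * \<beta> * (\<Sum>c\<in>C. \<mu> s c) \<le> \<tau> * \<beta> * 1" by (rule mult_left_mono[OF \<mu>sum]) (use \<tau> \<beta> in auto)
    finally show "(\<Sum>c\<in>C. wt c * \<mu> s c) \<le> 4 * t * ?u + (\<Sum>c\<in>C. wt c ^ Suc ?n) / t ^ ?n * exp (- \<epsilon> / 2) ^ s"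
      unfolding \<tau>n \<tau>\<beta> by simp
  qed
  also have "... = 4 * t * (\<Sum>s\<le>Sm. exp (- \<epsilon> / (2 * ?n)) ^ s) + (\<Sum>c\<in>C. wt c ^ Suc ?n) / t ^ ?n * (\<Sum>s\<le>Sm. exp (- \<epsilon> / 2) ^ s)"
    by (simp add: sum.distrib sum_distrib_left)
  also have "... \<le> 4 * t * (1 / (1 - exp (- \<epsilon> / (2 * ?n)))) +
      (300 * 150 ^ ?n * 48 ^ ?n * (J + 6)) / t ^ ?n * (1 / (1 - exp (- \<epsilon> / 2)))"
  proof -
    have g: "(\<Sum>s\<le>M. z ^ s) \<le> 1 / (1 - z)" if "0 \<le> z" "z < 1" for z :: real and M
    proof -
      have "(\<Sum>s\<le>M. z ^ s) = (1 - z ^ Suc M) / (1 - z)" using that by (subst sum_gp0) auto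
      also have "... \<le> 1 / (1 - z)" using that by (intro divide_right_mono) auto
      finally show ?thesis .
    qed
    have "(\<Sum>c\<in>C. wt c ^ Suc ?n) \<le> 300 * 150 ^ ?n * 48 ^ ?n * (J + 6)"
      unfolding wt_def by (rule weight_sum_le[OF a r finC C\<Omega> C(2)]) (use J in auto)
    then show ?thesis using t \<epsilon>0 n wt0 J
      by (intro add_mono mult_mono divide_right_mono g) (auto intro!: sum_nonneg simp: divide_simps)
  qed
  finally show ?thesis by (simp add: field_simps)
qed

end


section \<open>Gates\<close>

context hyperbolic_domain
begin

text \<open>In \<open>crossing_energy\<close> the parameter \<open>t\<close> is taken so large that the volume term is at most
  \<open>(J + 6) / 8\<close>. What remains bounds \<open>J\<close>.\<close>

lemma annulus_lemma:
  obtains J where "0 \<le> J"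
    "\<And>a r x y c0 s0 \<sigma>. [|a \<in> \<Omega>; d a \<le> r; geo x y c0; s0 \<in> {0..k x y}; connected \<sigma>; \<sigma> \<subseteq> \<Omega>; x \<in> \<sigma>; y \<in> \<sigma>|]
      ==> \<exists>w\<in>\<sigma>. \<forall>c. geo (c0 s0) w c -->
        \<not> crosses a r J (k (c0 s0) w) c"
proof -
  let ?n = "CARD('n)"
  define \<epsilon> where "\<epsilon> = ln 2 / (2 * (\<delta> + 1))"
  have \<epsilon>: "0 < \<epsilon>" unfolding \<epsilon>_def using rate_pos by simp
  define B where "B = 300 * 150 ^ ?n * 48 ^ ?n / (1 - exp (- \<epsilon> / 2))"
  define t where "t = 8 * B + 1"
  define G where "G = 4 * t / (1 - exp (- \<epsilon> / (2 * ?n)))"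
  define J where "J = 40 + 3 * (21 + G)"
  have B: "0 < B" unfolding B_def using \<epsilon> by (intro divide_pos_pos) auto
  have t: "1 \<le> t" unfolding t_def using B by simp
  have G: "0 \<le> G" unfolding G_def using t \<epsilon> by (intro divide_nonneg_nonneg) auto
  have J40: "40 \<le> J" unfolding J_def using G by simp
  have "t \<le> t ^ ?n" using t by (intro self_le_power) auto
  then have tn: "8 * B \<le> t ^ ?n" "0 < t ^ ?n" unfolding t_def using B by auto
  show ?thesis
  proof (rule that[of J])
    show "0 \<le> J" using J40 by simp
    fix a r x y c0 s0 \<sigma>
    assume a: "a \<in> \<Omega>" "d a \<le> r" and g: "geo x y c0" "s0 \<in> {0..k x y}"
      and \<sigma>: "connected \<sigma>" "\<sigma> \<subseteq> \<Omega>" "x \<in> \<sigma>" "y \<in> \<sigma>"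
    have r: "0 < r" by (rule r_pos[OF a])
    show "\<exists>w\<in>\<sigma>. \<forall>c. geo (c0 s0) w c -->
        \<not> crosses a r J (k (c0 s0) w) c"
    proof (cases "x = y")
      case True
      then have "s0 = 0" using g geoD(1)[OF g(1)] by simp
      then have b: "c0 s0 = x" using geoD(3)[OF g(1)] by simp
      have "1 * r < exp J * r" using J40 r by (intro mult_strict_right_mono) auto
      then have "\<not> crosses a r J (k (c0 s0) x) c" for c
        unfolding b using geoD(1)[OF g(1)] by auto
      then show ?thesis using \<sigma>(3) by blast
    next
      case False
      show ?thesis
      proof (rule ccontr)
        assume "\<not> ?thesis"
        then have "\<And>w. w \<in> \<sigma> ==> \<exists>c. geo (c0 s0) w c \<and>
          crosses a r J (k (c0 s0) w) c" by blast
        from crossing_energy[OF a J40 _ g refl \<sigma> False this \<epsilon>_def, of t] t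
        have "(J - 40) / 2 \<le> G + 300 * 150 ^ ?n * 48 ^ ?n * (J + 6) / (t ^ ?n * (1 - exp (- \<epsilon> / 2)))"
          unfolding G_def by simp
        also have "300 * 150 ^ ?n * 48 ^ ?n * (J + 6) / (t ^ ?n * (1 - exp (- \<epsilon> / 2))) = (J + 6) * (B / t ^ ?n)"
          unfolding B_def by (simp add: mult.commute)
        also have "... \<le> (J + 6) * (1 / 8)"
          using tn J40 by (intro mult_left_mono) (auto simp: divide_simps)
        finally have "(J - 40) / 2 \<le> G + (J + 6) * (1 / 8)" by simp
        then show False unfolding J_def using G by (simp add: field_simps)
      qed
    qed
  qed
qed

text \<open>A component of \<open>\<Omega>\<close> in a ball. Only the component of the centre is taken: other parts of \<open>\<Omega>\<close> in the
  same ball may be far away inside \<open>\<Omega>\<close>.\<close>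

definition gate :: "real => real^'n => (real^'n) set" where
  "gate \<rho> z = connected_component_set (\<Omega> \<inter> ball z \<rho>) z"

lemma gate_props:
  "connected (gate \<rho> z)" "gate \<rho> z \<subseteq> \<Omega>" "gate \<rho> z \<subseteq> ball z \<rho>" "z \<in> \<Omega> ==> 0 < \<rho> ==> z \<in> gate \<rho> z"
  using connected_component_subset[of "\<Omega> \<inter> ball z \<rho>" z] unfolding gate_def by auto

lemma gate_maximal: "connected S ==> S \<subseteq> \<Omega> ==> S \<subseteq> ball z \<rho> ==> z \<in> S ==> S \<subseteq> gate \<rho> z"
  unfolding gate_def by (rule connected_component_maximal) auto

text \<open>For the first part the annulus is centred at the point \<open>z\<close> of the geodesic itself: the geodesic from
  \<open>z\<close> to a suitable point of \<open>\<sigma>\<close> never leaves the ball, hence stays in its gate. For the second part \<open>\<sigma>\<close>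
  lies inside the annulus, and the geodesic from a point outside to any point of \<open>\<sigma>\<close> would cross it.\<close>

lemma separation_and_containment:
  obtains M where "1 \<le> M"
    "\<And>x y c s \<sigma>. [|geo x y c; s \<in> {0..k x y}; connected \<sigma>; \<sigma> \<subseteq> \<Omega>; x \<in> \<sigma>; y \<in> \<sigma>|]
      ==> \<sigma> \<inter> gate (M * d (c s)) (c s) \<noteq> {}"
    "\<And>x y c s z r \<sigma>. [|geo x y c; s \<in> {0..k x y}; connected \<sigma>; \<sigma> \<subseteq> \<Omega> \<inter> cball z r; x \<in> \<sigma>; y \<in> \<sigma>; z \<in> \<Omega>; d z \<le> r|]
      ==> dist (c s) z < M * r"
proof -
  obtain J where J: "0 \<le> J"
    "\<And>a r x y c0 s0 \<sigma>. [|a \<in> \<Omega>; d a \<le> r; geo x y c0; s0 \<in> {0..k x y}; connected \<sigma>; \<sigma> \<subseteq> \<Omega>; x \<in> \<sigma>; y \<in> \<sigma>|]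
      ==> \<exists>w\<in>\<sigma>. \<forall>c. geo (c0 s0) w c -->
        \<not> crosses a r J (k (c0 s0) w) c"
    by (rule annulus_lemma) blast
  show ?thesis
  proof (rule that[of "exp J"])
    show "1 \<le> exp J" using J(1) by simp
  next
    fix x y c s \<sigma>
    assume g: "geo x y c" "s \<in> {0..k x y}" and \<sigma>: "connected \<sigma>" "\<sigma> \<subseteq> \<Omega>" "x \<in> \<sigma>" "y \<in> \<sigma>"
    let ?z = "c s"
    have z: "?z \<in> \<Omega>" by (rule geoD(5)[OF g])
    obtain w where w: "w \<in> \<sigma>" "\<And>e. geo ?z w e ==>
      \<not> crosses ?z (d ?z) J (k ?z w) e"
      using J(2)[OF z order.refl g \<sigma>] by blast
    obtain e where e: "geo ?z w e" using geo_exists z w(1) \<sigma>(2) by blast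
    have e0: "dist (e 0) ?z \<le> d ?z" "0 \<in> {0..k ?z w}" using geoD[OF e] by (auto simp: infdist_nonneg)
    have "e ` {0..k ?z w} \<subseteq> gate (exp J * d ?z) ?z"
    proof (rule gate_maximal)
      show "connected (e ` {0..k ?z w})" by (rule connected_continuous_image[OF geo_continuous[OF e]]) simp
      show "e ` {0..k ?z w} \<subseteq> \<Omega>" using geoD(5)[OF e] by blast
      show "e ` {0..k ?z w} \<subseteq> ball ?z (exp J * d ?z)"
        using w(2)[OF e] e0 by (force simp: dist_commute not_le)
      show "?z \<in> e ` {0..k ?z w}" using geoD(3)[OF e] e0(2) by force
    qed
    moreover have "w \<in> e ` {0..k ?z w}" using geoD(4,7)[OF e] by force
    ultimately show "\<sigma> \<inter> gate (exp J * d ?z) ?z \<noteq> {}" using w(1) by blast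
  next
    fix x y c s z r \<sigma>
    assume g: "geo x y c" "s \<in> {0..k x y}" and \<sigma>: "connected \<sigma>" "\<sigma> \<subseteq> \<Omega> \<inter> cball z r" "x \<in> \<sigma>" "y \<in> \<sigma>"
      and z: "z \<in> \<Omega>" "d z \<le> r"
    have \<sigma>': "\<sigma> \<subseteq> \<Omega>" using \<sigma>(2) by blast
    obtain w where w: "w \<in> \<sigma>" "\<And>e. geo (c s) w e ==>
      \<not> (\<exists>s'\<in>{0..k (c s) w}. \<exists>t\<in>{0..k (c s) w}. dist (e s') z \<le> r \<and> exp J * r \<le> dist (e t) z)"
      using J(2)[OF z g \<sigma>(1) \<sigma>' \<sigma>(3,4)] by blast
    obtain e where e: "geo (c s) w e" using geo_exists geoD(5)[OF g] w(1) \<sigma>' by blast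
    have "dist (e (k (c s) w)) z \<le> r" using geoD(4)[OF e] w(1) \<sigma>(2) by (auto simp: dist_commute)
    then have "\<not> exp J * r \<le> dist (e 0) z" using w(2)[OF e] geoD(7)[OF e] by fastforce
    then show "dist (c s) z < exp J * r" using geoD(3)[OF e] by simp
  qed
qed

definition behind :: "real^'n => (real^'n) set => (real^'n) set" where
  "behind x0 A = {y\<in>\<Omega>. \<forall>\<sigma>. connected \<sigma> \<and> \<sigma> \<subseteq> \<Omega> \<and> x0 \<in> \<sigma> \<and> y \<in> \<sigma> --> \<sigma> \<inter> A \<noteq> {}}"

lemma behindD:
  "y \<in> behind x0 A ==> connected \<sigma> ==> \<sigma> \<subseteq> \<Omega> ==> x0 \<in> \<sigma> ==> y \<in> \<sigma> ==> \<sigma> \<inter> A \<noteq> {}"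
  unfolding behind_def by blast

lemma not_behindD:
  assumes "y \<in> \<Omega>" "y \<notin> behind x0 A"
  obtains \<sigma> where "connected \<sigma>" "\<sigma> \<subseteq> \<Omega>" "x0 \<in> \<sigma>" "y \<in> \<sigma>" "\<sigma> \<inter> A = {}"
  using assms unfolding behind_def by blast

lemma behind_connected:
  assumes W: "connected W" "W \<subseteq> \<Omega>" "W \<inter> A = {}" "W \<inter> behind x0 A \<noteq> {}"
  shows "W \<subseteq> behind x0 A"
proof (rule ccontr)
  assume "\<not> ?thesis"
  then obtain y where y: "y \<in> W" "y \<notin> behind x0 A" by blast
  obtain \<sigma> where \<sigma>: "connected \<sigma>" "\<sigma> \<subseteq> \<Omega>" "x0 \<in> \<sigma>" "y \<in> \<sigma>" "\<sigma> \<inter> A = {}"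
    using not_behindD[of y x0 A] y W(2) by blast
  obtain w where w: "w \<in> W" "w \<in> behind x0 A" using W(4) by blast
  have "connected (\<sigma> \<union> W)" using \<sigma> y W by (intro connected_Un) auto
  then have "(\<sigma> \<union> W) \<inter> A \<noteq> {}" by (rule behindD[OF w(2)]) (use \<sigma> W w in auto)
  then show False using \<sigma>(5) W(3) by blast
qed

text \<open>On a path from \<open>y\<close> to \<open>x0\<close> let the closure of \<open>A\<close>, say, be met first. If the closures had no common
  point in \<open>\<Omega>\<close>, one could pass on into \<open>A\<close>, and from there to \<open>x0\<close> without meeting \<open>B\<close>, because \<open>A\<close> is
  not behind \<open>B\<close>; but \<open>y\<close> is.\<close>

lemma gates_touch:
  assumes A: "connected A" "A \<subseteq> \<Omega>" "A \<noteq> {}" and B: "connected B" "B \<subseteq> \<Omega>" "B \<noteq> {}"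
    and nest: "\<not> behind x0 A \<subseteq> behind x0 B" "\<not> behind x0 B \<subseteq> behind x0 A"
    and y: "y \<in> behind x0 A" "y \<in> behind x0 B" and x0: "x0 \<in> \<Omega>"
  shows "\<exists>q\<in>\<Omega>. q \<in> closure A \<and> q \<in> closure B"
proof (rule ccontr)
  assume no: "\<not> ?thesis"
  have dis: "A \<inter> B = {}" using no A(2) closure_subset[of A] closure_subset[of B] by blast
  have sep: "B \<inter> behind x0 A = {}"
    if AB: "A \<inter> B = {}" "connected B" "B \<subseteq> \<Omega>" "\<not> behind x0 B \<subseteq> behind x0 A" for A B
  proof (rule ccontr)
    assume "B \<inter> behind x0 A \<noteq> {}"
    then have sub: "B \<subseteq> behind x0 A" using behind_connected[of B A x0] AB by blast
    have "behind x0 B \<subseteq> behind x0 A"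
    proof
      fix u assume u: "u \<in> behind x0 B"
      show "u \<in> behind x0 A"
      proof (rule ccontr)
        assume n: "u \<notin> behind x0 A"
        have "u \<in> \<Omega>" using u unfolding behind_def by blast
        then obtain \<sigma> where \<sigma>: "connected \<sigma>" "\<sigma> \<subseteq> \<Omega>" "x0 \<in> \<sigma>" "u \<in> \<sigma>" "\<sigma> \<inter> A = {}"
          using not_behindD n by blast
        then obtain p where "p \<in> \<sigma>" "p \<in> B" using behindD[OF u] by blast
        then show False using behindD[of p x0 A \<sigma>] sub \<sigma> by blast
      qed
    qed
    then show False using AB(4) by blast
  qed
  have yO: "y \<in> \<Omega>" using y unfolding behind_def by blast
  have "path_connected \<Omega>" using connected_open_path_connected connected_dom open_dom by blast
  then obtain g where g: "path g" "path_image g \<subseteq> \<Omega>" "pathstart g = y" "pathfinish g = x0"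
    using yO x0 unfolding path_connected_def by blast
  have gc: "continuous_on {0..1} g" using g(1) unfolding path_def .
  define T where "T = {0..1} \<inter> g -` (closure A \<union> closure B)"
  have "closed T" unfolding T_def by (rule continuous_closed_preimage[OF gc]) auto
  then have cT: "compact T" unfolding T_def by (simp add: compact_eq_bounded_closed bounded_subset[of "{0..1}"])
  have "path_image g \<inter> A \<noteq> {}"
    by (rule behindD[OF y(1)]) (use g connected_path_image pathfinish_in_path_image[of g] pathstart_in_path_image[of g] in auto)
  then have "T \<noteq> {}" unfolding T_def path_image_def using closure_subset[of A] by auto
  then obtain t0 where t0: "t0 \<in> T" "\<And>t. t \<in> T ==> t0 \<le> t" using compact_attains_inf[OF cT] by auto
  have t01: "t0 \<in> {0..1}" using t0(1) unfolding T_def by blast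
  have before: "g t \<notin> closure A \<and> g t \<notin> closure B" if "0 \<le> t" "t < t0" for t
    using t0(2)[of t] that t01 unfolding T_def by auto
  have main: False
    if AB: "connected A" "A \<subseteq> \<Omega>" "A \<noteq> {}" "A \<inter> behind x0 B = {}" "A \<inter> B = {}"
      and q: "g t0 \<in> closure A" "g t0 \<notin> closure B" and B: "\<And>t. 0 \<le> t ==> t < t0 ==> g t \<notin> closure B"
      and yB: "y \<in> behind x0 B" for A B
  proof -
    have "connected (insert (g t0) A)"
      by (rule connected_intermediate_closure[OF AB(1)]) (use q closure_subset in auto)
    moreover have "connected (g ` {0..t0})"
      by (rule connected_continuous_image[OF continuous_on_subset[OF gc]]) (use t01 in auto)
    ultimately have c1: "connected (g ` {0..t0} \<union> insert (g t0) A)"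
      using t01 by (intro connected_Un) auto
    obtain a where a: "a \<in> A" using AB(3) by blast
    then have "a \<in> \<Omega>" "a \<notin> behind x0 B" using AB by auto
    then obtain \<sigma> where \<sigma>: "connected \<sigma>" "\<sigma> \<subseteq> \<Omega>" "x0 \<in> \<sigma>" "a \<in> \<sigma>" "\<sigma> \<inter> B = {}"
      by (rule not_behindD)
    define U where "U = (g ` {0..t0} \<union> insert (g t0) A) \<union> \<sigma>"
    have "connected U" unfolding U_def by (rule connected_Un[OF c1 \<sigma>(1)]) (use \<sigma>(4) a in auto)
    moreover have "g t \<in> \<Omega>" if "t \<in> {0..t0}" for t using g(2) that t01 unfolding path_image_def by auto
    then have "U \<subseteq> \<Omega>" unfolding U_def using AB(2) \<sigma>(2) t01 by auto
    moreover have "y \<in> U"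
    proof -
      have "y = g 0" using g(3) unfolding pathstart_def by simp
      then show ?thesis unfolding U_def using t01 by auto
    qed
    ultimately have "U \<inter> B \<noteq> {}" using behindD[OF yB, of U] \<sigma>(3) unfolding U_def by blast
    moreover have "g t \<notin> B" if "t \<in> {0..t0}" for t
      using B[of t] q(2) that closure_subset[of B] by (cases "t = t0") auto
    ultimately show False unfolding U_def using AB(5) \<sigma>(5) t01 by auto
  qed
  have ins: "g t0 \<in> \<Omega>" using g(2) t01 unfolding path_image_def by blast
  from t0(1) consider "g t0 \<in> closure A" "g t0 \<notin> closure B" | "g t0 \<in> closure B" "g t0 \<notin> closure A"
    using no ins unfolding T_def by blast
  then show False
  proof cases
    case 1
    show False
      by (rule main[of A B]) (use A 1 sep[of B A] B dis nest before y in auto)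
  next
    case 2
    show False
      by (rule main[of B A]) (use A 2 sep[of A B] B dis nest before y in auto)
  qed
qed

end


section \<open>Pieces, chains and depth\<close>

context hyperbolic_domain
begin

text \<open>A finite net of the closure is moved into \<open>S\<close> and then thinned out by \<open>finite_net\<close>.\<close>

lemma bounded_net:
  fixes S :: "(real^'m::finite) set"
  assumes S: "bounded S" and e: "0 < e"
  obtains C where "finite C" "C \<subseteq> S" "\<And>c c'. c \<in> C ==> c' \<in> C ==> c \<noteq> c' ==> e / 2 \<le> dist c c'"
    "\<And>z. z \<in> S ==> \<exists>c\<in>C. dist z c < e"
proof -
  have "compact (closure S)" using S by simp
  then have "\<exists>K. finite K \<and> K \<subseteq> closure S \<and> closure S \<subseteq> (\<Union>x\<in>K. ball x (e / 4))"
    using compact_imp_seq_compact seq_compact_imp_totally_bounded e by (metis zero_less_divide_iff zero_less_numeral)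
  then obtain K where K: "finite K" "K \<subseteq> closure S" "closure S \<subseteq> (\<Union>x\<in>K. ball x (e / 4))" by blast
  have "\<exists>s. s \<in> S \<and> dist s x < e / 4" if "x \<in> K" for x
    using K(2) that e closure_approachable[of x S] by (metis (no_types) subsetD zero_less_divide_iff zero_less_numeral)
  then obtain s where s: "\<And>x. x \<in> K ==> s x \<in> S \<and> dist (s x) x < e / 4" by metis
  have "\<exists>C\<subseteq>s ` K. (\<forall>c\<in>C. \<forall>c'\<in>C. c \<noteq> c' --> \<not> dist c c' < e / 2) \<and> (\<forall>p\<in>s ` K. \<exists>c\<in>C. dist p c < e / 2)"
    by (rule finite_net) (use K(1) e in \<open>auto simp: dist_commute\<close>)
  then obtain C where C: "C \<subseteq> s ` K" "\<forall>c\<in>C. \<forall>c'\<in>C. c \<noteq> c' --> \<not> dist c c' < e / 2"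
    "\<forall>p\<in>s ` K. \<exists>c\<in>C. dist p c < e / 2" by blast
  show ?thesis
  proof (rule that[of C])
    show "finite C" using C(1) K(1) finite_subset by blast
    show "C \<subseteq> S" using C(1) s by blast
    show "e / 2 \<le> dist c c'" if "c \<in> C" "c' \<in> C" "c \<noteq> c'" for c c' using C(2) that by force
    fix z assume "z \<in> S"
    then have "z \<in> closure S" using closure_subset by blast
    then obtain x where x: "x \<in> K" "dist x z < e / 4" using K(3) by auto
    obtain c where c: "c \<in> C" "dist (s x) c < e / 2" using C(3) x(1) by blast
    have "dist z c \<le> dist z x + (dist x (s x) + dist (s x) c)"
      using dist_triangle[of z c x] dist_triangle[of x c "s x"] by linarith
    also have "... < e" using x(2) c(2) s[OF x(1)] by (simp add: dist_commute)
    finally show "\<exists>c\<in>C. dist z c < e" using c(1) by blast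
  qed
qed

text \<open>A chain of boundedly many points at distance comparable to \<open>\<eta>\<close> from the boundary, with steps so
  short that a function can be compared with its Taylor polynomials along the chain.\<close>

definition linked :: "real => real => nat => real => real^'n => real^'n => bool" where
  "linked \<kappa> C N \<eta> z y \<longleftrightarrow> (\<exists>p M. M \<le> N \<and> p 0 = z \<and> p M = y \<and>
     (\<forall>i\<le>M. p i \<in> \<Omega> \<and> \<kappa> * \<eta> \<le> d (p i) \<and> dist (p i) z \<le> C * \<eta>) \<and>
     (\<forall>i<M. dist (p i) (p (Suc i)) \<le> \<kappa> * \<eta> / (8 * CARD('n))))"

definition visible :: "real^'n => real => (real^'n) set" where
  "visible x0 \<eta> = {y. \<exists>c. geo x0 y c \<and> (\<forall>s\<in>{0..k x0 y}. \<eta> \<le> d (c s))}"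

text \<open>The geodesic from \<open>z\<close> to \<open>y\<close> stays near \<open>G\<close> by containment, and at a distance of at least a multiple
  of \<open>\<eta>\<close> from the boundary by thinness of the triangle with vertex \<open>x0\<close>. Points at a fixed small
  quasihyperbolic distance along it are then separated on the scale \<open>\<eta>\<close>, so their number is bounded by
  volume.\<close>

lemma visible_link:
  assumes M: "1 \<le> M"
    "\<And>x y c s z r \<sigma>. [|geo x y c; s \<in> {0..k x y}; connected \<sigma>; \<sigma> \<subseteq> \<Omega> \<inter> cball z r; x \<in> \<sigma>; y \<in> \<sigma>; z \<in> \<Omega>; d z \<le> r|]
      ==> dist (c s) z < M * r"
    and R: "1 \<le> R"
  shows "\<exists>N. \<forall>\<eta>>0. \<forall>z y G x0. z \<in> visible x0 \<eta> \<and> d z = \<eta> \<and> y \<in> visible x0 \<eta> \<and> connected G \<and> G \<subseteq> \<Omega> \<inter> cball z (R * \<eta>) \<and>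
     z \<in> G \<and> y \<in> G --> linked (exp (- \<delta>)) (M * R) N \<eta> z y"
proof -
  let ?n = "CARD('n)"
  define \<kappa> where "\<kappa> = exp (- \<delta>)"
  have \<kappa>: "0 < \<kappa>" "\<kappa> \<le> 1" unfolding \<kappa>_def using \<delta>_nonneg by auto
  have MR: "1 \<le> M * R" using M(1) R mult_mono[of 1 M 1 R] by simp
  define b where "b = \<kappa> / (8 * ?n) / (1 + M * R)"
  have b: "0 < b" unfolding b_def using \<kappa> MR by (intro divide_pos_pos) auto
  have b1: "b \<le> 1"
  proof -
    have "\<kappa> / (8 * ?n) \<le> 1" using \<kappa> by (simp add: divide_simps) (smt (verit) of_nat_0_less_iff of_nat_1 of_nat_le_iff zero_less_card_finite Suc_leI One_nat_def)
    moreover have "b \<le> \<kappa> / (8 * ?n) / 1" unfolding b_def using MR \<kappa> by (intro divide_left_mono) auto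
    ultimately show ?thesis by linarith
  qed
  define h where "h = ln (1 + b)"
  have h: "0 < h" "h \<le> 1" "exp h = 1 + b"
    unfolding h_def using b b1 ln_add_one_self_le_self2[of b] by (auto simp: ln_gt_zero)
  define \<rho> where "\<rho> = h * \<kappa> / 4"
  have \<rho>: "0 < \<rho>" unfolding \<rho>_def using h \<kappa> by simp
  define N where "N = nat \<lceil>((M * R + \<rho>) / \<rho>) ^ ?n\<rceil> + 1"
  show ?thesis
  proof (intro exI[of _ N] allI impI, elim conjE)
    fix \<eta> :: real and z y G x0
    assume \<eta>: "0 < \<eta>" and z: "z \<in> visible x0 \<eta>" "d z = \<eta>" and y: "y \<in> visible x0 \<eta>"
      and G: "connected G" "G \<subseteq> \<Omega> \<inter> cball z (R * \<eta>)" "z \<in> G" "y \<in> G"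
    obtain cz where cz: "geo x0 z cz" "\<And>s. s \<in> {0..k x0 z} ==> \<eta> \<le> d (cz s)" using z(1) unfolding visible_def by blast
    obtain cy where cy: "geo x0 y cy" "\<And>s. s \<in> {0..k x0 y} ==> \<eta> \<le> d (cy s)" using y unfolding visible_def by blast
    have zO: "z \<in> \<Omega>" and yO: "y \<in> \<Omega>" and xO: "x0 \<in> \<Omega>" using geoD[OF cz(1)] geoD[OF cy(1)] by auto
    obtain e where e: "geo z y e" using geo_exists[OF zO yO] by blast
    define T where "T = k z y"
    have T: "0 \<le> T" unfolding T_def by (rule k_nonneg[OF zO yO])
    have eO: "e s \<in> \<Omega>" if "s \<in> {0..T}" for s using geoD(5)[OF e] that unfolding T_def by blast
    have edist: "dist (e s) z \<le> M * R * \<eta>" if "s \<in> {0..T}" for s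
      using M(2)[OF e _ G(1,2,3,4) zO, of s] that z(2) R \<eta> unfolding T_def by (simp add: mult.assoc)
    have ed: "\<kappa> * \<eta> \<le> d (e s)" if s: "s \<in> {0..T}" for s
    proof -
      have *: "\<kappa> * \<eta> \<le> d (e s)" if u: "u \<in> \<Omega>" "k (e s) u \<le> \<delta>" "\<eta> \<le> d u" for u
      proof -
        have "\<eta> \<le> exp (k (e s) u) * d (e s)" using d_le_exp_k[OF eO[OF s] u(1)] u(3) by linarith
        also have "... \<le> exp \<delta> * d (e s)" using u(2) by (intro mult_right_mono) (auto simp: infdist_nonneg)
        finally have "exp (- \<delta>) * \<eta> \<le> exp (- \<delta>) * (exp \<delta> * d (e s))" by (intro mult_left_mono) auto
        then show ?thesis unfolding \<kappa>_def mult.assoc[symmetric] exp_add[symmetric] by simp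
      qed
      have s': "s \<in> {0..k z y}" using s unfolding T_def .
      from thin_triangle[OF e geo_reverse[OF cy(1)] cz(1) s'] show ?thesis
      proof (elim disjE bexE)
        fix t assume t: "t \<in> {0..k y x0}" "k (e s) (cy (k x0 y - t)) \<le> \<delta>"
        have "k x0 y - t \<in> {0..k x0 y}" using t(1) k_sym[OF xO yO] by auto
        then show ?thesis using * t(2) cy(2) geoD(5)[OF cy(1)] by blast
      next
        fix t assume t: "t \<in> {0..k x0 z}" "k (e s) (cz t) \<le> \<delta>"
        then show ?thesis using * cz(2) geoD(5)[OF cz(1)] by blast
      qed
    qed
    define p where "p i = e (min (real i * h) T)" for i :: nat
    define m where "m = nat \<lfloor>T / h\<rfloor>"
    have rng: "min (real i * h) T \<in> {0..T}" for i using T h by auto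
    have sep: "2 * \<rho> * \<eta> \<le> dist (p i) (p j)" if ij: "i \<le> m" "j \<le> m" "i \<noteq> j" for i j
    proof -
      have le: "real i * h \<le> T" if "i \<le> m" for i
      proof -
        have "real i \<le> T / h" using that T h unfolding m_def by (simp add: le_nat_floor le_nat_iff le_floor_iff)
        then show ?thesis using h by (simp add: field_simps)
      qed
      have "k (p i) (p j) = \<bar>real i * h - real j * h\<bar>"
        unfolding p_def using geoD(6)[OF e, of "real i * h" "real j * h"] le ij h unfolding T_def by (simp add: min_def)
      also have "... = \<bar>real i - real j\<bar> * h" using h by (simp add: left_diff_distrib[symmetric] abs_mult)
      also have "... \<ge> 1 * h" using ij h by (intro mult_right_mono) auto
      finally have kh: "h \<le> k (p i) (p j)" by simp
      have pO: "p i \<in> \<Omega>" unfolding p_def by (rule eO[OF rng])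
      have dp: "\<kappa> * \<eta> \<le> d (p i)" unfolding p_def by (rule ed[OF rng])
      have \<rho>2: "2 * \<rho> * \<eta> = h * (\<kappa> * \<eta>) / 2" unfolding \<rho>_def by simp
      show ?thesis
      proof (cases "dist (p i) (p j) \<le> d (p i) / 2")
        case True
        have "h \<le> 2 * dist (p i) (p j) / d (p i)" using k_le_dist(2)[OF pO True] kh by linarith
        then have "h * d (p i) \<le> 2 * dist (p i) (p j)" using d_pos[OF pO] by (simp add: field_simps)
        moreover have "h * (\<kappa> * \<eta>) \<le> h * d (p i)" using dp h by (intro mult_left_mono) auto
        ultimately show ?thesis unfolding \<rho>2 by linarith
      next
        case False
        have "h * (\<kappa> * \<eta>) \<le> 1 * (\<kappa> * \<eta>)" using h \<kappa> \<eta> by (intro mult_right_mono) auto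
        then show ?thesis using False dp unfolding \<rho>2 by linarith
      qed
    qed
    have inj: "inj_on p {..m}"
    proof (rule inj_onI, rule ccontr)
      fix i j assume "i \<in> {..m}" "j \<in> {..m}" "p i = p j" "i \<noteq> j"
      then have "2 * \<rho> * \<eta> \<le> 0" using sep[of i j] by simp
      moreover have "0 < \<rho> * \<eta>" using \<rho> \<eta> by simp
      ultimately show False by linarith
    qed
    have "(\<Sum>c\<in>p ` {..m}. (\<rho> * \<eta>) ^ ?n) \<le> (M * R * \<eta> + \<rho> * \<eta>) ^ ?n"
    proof (rule packing_balls)
      show "disjoint_family_on (\<lambda>c. ball c (\<rho> * \<eta>)) (p ` {..m})"
        unfolding disjoint_family_on_def
      proof (intro ballI impI, rule ccontr)
        fix c c' assume c: "c \<in> p ` {..m}" "c' \<in> p ` {..m}" "c \<noteq> c'" and "ball c (\<rho> * \<eta>) \<inter> ball c' (\<rho> * \<eta>) \<noteq> {}"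
        then obtain u where "dist c u < \<rho> * \<eta>" "dist c' u < \<rho> * \<eta>" by auto
        then have "dist c c' < 2 * \<rho> * \<eta>" using dist_triangle2[of c c' u] by linarith
        moreover obtain i j where ij: "i \<le> m" "j \<le> m" "c = p i" "c' = p j" using c by auto
        then have "2 * \<rho> * \<eta> \<le> dist c c'" using sep[of i j] c(3) by blast
        ultimately show False by simp
      qed
      fix c assume "c \<in> p ` {..m}"
      then have "dist c z \<le> M * R * \<eta>" unfolding p_def using edist[OF rng] by auto
      then have "u \<in> ball z (M * R * \<eta> + \<rho> * \<eta>)" if "u \<in> ball c (\<rho> * \<eta>)" for u
        using that dist_triangle[of z u c] by (simp add: dist_commute)
      then show "0 \<le> \<rho> * \<eta> \<and> ball c (\<rho> * \<eta>) \<subseteq> ball z (M * R * \<eta> + \<rho> * \<eta>)" using \<rho> \<eta> by auto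
    qed (use \<rho> \<eta> MR in auto)
    also have "(\<Sum>c\<in>p ` {..m}. (\<rho> * \<eta>) ^ ?n) = real (m + 1) * (\<rho> * \<eta>) ^ ?n"
      by (simp add: card_image[OF inj])
    also have "(M * R * \<eta> + \<rho> * \<eta>) ^ ?n = ((M * R + \<rho>) / \<rho>) ^ ?n * (\<rho> * \<eta>) ^ ?n"
    proof -
      have "(M * R + \<rho>) / \<rho> * (\<rho> * \<eta>) = M * R * \<eta> + \<rho> * \<eta>" using \<rho> by (simp add: field_simps)
      then show ?thesis by (metis power_mult_distrib)
    qed
    finally have "real (m + 1) \<le> ((M * R + \<rho>) / \<rho>) ^ ?n" using \<rho> \<eta> by simp
    then have mN: "m + 1 \<le> N" unfolding N_def by linarith
    have "T / h \<le> real (m + 1)" unfolding m_def using T h real_of_int_floor_add_one_ge[of "T / h"] by (simp add: add.commute)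
    then have end': "T \<le> real (m + 1) * h" using h by (simp add: field_simps)
    show "linked (exp (- \<delta>)) (M * R) N \<eta> z y" unfolding linked_def \<kappa>_def[symmetric]
    proof (intro exI[of _ p] exI[of _ "m + 1"] conjI allI impI mN)
      show "p 0 = z" unfolding p_def using T geoD(3)[OF e] by simp
      show "p (m + 1) = y" unfolding p_def using end' geoD(4)[OF e] by (simp add: T_def min_absorb2)
      show "p i \<in> \<Omega>" for i unfolding p_def by (rule eO[OF rng])
      show "\<kappa> * \<eta> \<le> d (p i)" for i unfolding p_def by (rule ed[OF rng])
      show "dist (p i) z \<le> M * R * \<eta>" for i unfolding p_def by (rule edist[OF rng])
      show "dist (p i) (p (Suc i)) \<le> \<kappa> * \<eta> / real (8 * ?n)" for i
      proof -
        have "\<bar>min (real i * h) T - min (real (Suc i) * h) T\<bar> \<le> h" using h by (auto simp: min_def algebra_simps)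
        then have "exp \<bar>min (real i * h) T - min (real (Suc i) * h) T\<bar> \<le> 1 + b" using h(3) by (metis exp_le_cancel_iff)
        moreover have "dist (p i) (p (Suc i)) \<le> (exp \<bar>min (real i * h) T - min (real (Suc i) * h) T\<bar> - 1) * d (p i)"
          unfolding p_def using tameD(3)[OF geo_tame[OF e]] rng unfolding T_def by blast
        ultimately have "dist (p i) (p (Suc i)) \<le> b * d (p i)"
          by (smt (verit) mult_right_mono infdist_nonneg)
        also have "d (p i) \<le> \<eta> + M * R * \<eta>" using d_le[of "p i" z] z(2) edist[OF rng[of i]] unfolding p_def by (simp add: dist_commute)
        then have "b * d (p i) \<le> b * (\<eta> + M * R * \<eta>)" using b by (intro mult_left_mono) auto
        also have "b * (\<eta> + M * R * \<eta>) = \<kappa> * \<eta> / (8 * ?n)"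
        proof -
          have "b * (1 + M * R) = \<kappa> / (8 * ?n)" unfolding b_def using MR by simp
          then have "b * (1 + M * R) * \<eta> = \<kappa> / (8 * ?n) * \<eta>" by simp
          then show ?thesis by (simp add: algebra_simps)
        qed
        finally show ?thesis by simp
      qed
    qed
  qed
qed

definition piece :: "real => (real^'n) set => bool" where
  "piece \<eta> V \<longleftrightarrow> V \<noteq> {} \<and> connected V \<and> V \<subseteq> \<Omega> \<and> (\<forall>x\<in>V. \<forall>y\<in>V. dist x y \<le> \<eta> / 2)"

definition deep :: "real^'n => real => (real^'n) set" where
  "deep x0 \<eta> = {x\<in>\<Omega>. \<forall>\<sigma>. connected \<sigma> \<and> \<sigma> \<subseteq> \<Omega> \<and> x0 \<in> \<sigma> \<and> x \<in> \<sigma> --> (\<exists>w\<in>\<sigma>. d w \<le> \<eta>)}"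

lemma eventually_not_deep:
  assumes "x0 \<in> \<Omega>" "x \<in> \<Omega>" obtains e where "0 < e" "\<And>\<eta>. \<eta> < e ==> x \<notin> deep x0 \<eta>"
proof -
  have "path_connected \<Omega>" using connected_open_path_connected connected_dom open_dom by blast
  then obtain g where g: "path g" "path_image g \<subseteq> \<Omega>" "pathstart g = x0" "pathfinish g = x"
    using assms unfolding path_connected_def by blast
  have "compact (path_image g)" "path_image g \<noteq> {}" using g(1) by auto
  moreover have "continuous_on (path_image g) d" by (intro continuous_intros)
  ultimately obtain w where w: "w \<in> path_image g" "\<forall>u\<in>path_image g. d w \<le> d u"
    using continuous_attains_inf[of "path_image g" d] by blast
  show ?thesis
  proof (rule that[of "d w"])
    show "0 < d w" using d_pos w(1) g(2) by blast
    fix \<eta> assume "\<eta> < d w"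
    then have "\<forall>u\<in>path_image g. \<not> d u \<le> \<eta>" using w(2) by force
    moreover have "connected (path_image g)" using g(1) connected_path_image by blast
    ultimately show "x \<notin> deep x0 \<eta>"
      using g pathstart_in_path_image[of g] pathfinish_in_path_image[of g] unfolding deep_def by blast
  qed
qed

end


section \<open>Labelling the pieces\<close>

context hyperbolic_domain
begin

text \<open>A labelling of the small connected pieces of the domain: a piece in front of all gates has no
  label, a piece behind some gate is labelled by (the centre of) one such gate. The essential
  property is the last one: where the label changes, the piece is close to the gate, and the
  different labels are linked by a short chain of points that keep a distance comparable to \<open>\<eta>\<close>
  from the boundary.\<close>

definition labelling ::
  "real => real => nat => real => real^'n => real => ((real^'n) set => (real^'n) option) => (real^'n) set => bool" where
  "labelling \<kappa> C N K x0 \<eta> lab Z \<longleftrightarrow> finite Z \<and> (\<forall>z\<in>Z. z \<in> \<Omega> \<and> d z = \<eta>) \<and>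
     (\<forall>z\<in>Z. \<forall>z'\<in>Z. z \<noteq> z' --> \<eta> / 2 \<le> dist z z') \<and>
     (\<forall>V z. piece \<eta> V \<and> lab V = Some z --> z \<in> Z \<and> V \<subseteq> deep x0 (K * \<eta>)) \<and>
     (\<forall>V. piece \<eta> V \<and> lab V = None --> (\<forall>x\<in>V. \<eta> \<le> d x)) \<and>
     (\<forall>V V' z. piece \<eta> V \<and> piece \<eta> V' \<and> V \<inter> V' \<noteq> {} \<and> lab V = Some z \<and> lab V' \<noteq> Some z -->
        V \<union> V' \<subseteq> cball z (C * \<eta>) \<and>
        (case lab V' of None => \<forall>x\<in>V'. linked \<kappa> C N \<eta> z x | Some z' => linked \<kappa> C N \<eta> z z'))"

lemma first_hit:
  assumes c: "geo x0 y c" and \<eta>: "\<eta> < d x0" and s: "s \<in> {0..k x0 y}" "d (c s) < \<eta>"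
  shows "\<exists>t\<in>{0..k x0 y}. d (c t) = \<eta> \<and> (\<forall>u\<in>{0..t}. \<eta> \<le> d (c u))"
proof -
  have cont: "continuous_on {0..k x0 y} (\<lambda>t. d (c t))"
    by (intro continuous_intros geo_continuous[OF c])
  define T where "T = {0..k x0 y} \<inter> (\<lambda>t. d (c t)) -` {..\<eta>}"
  have "closed T" unfolding T_def by (rule continuous_closed_preimage[OF cont]) auto
  then have "compact T" unfolding T_def by (simp add: compact_eq_bounded_closed bounded_subset[of "{0..k x0 y}"])
  moreover have "T \<noteq> {}" using s unfolding T_def by auto
  ultimately obtain t where t: "t \<in> T" "\<And>u. u \<in> T ==> t \<le> u" using compact_attains_inf by metis
  have t': "t \<in> {0..k x0 y}" "d (c t) \<le> \<eta>" using t(1) unfolding T_def by auto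
  have before: "\<eta> < d (c u)" if "0 \<le> u" "u < t" for u using t(2)[of u] that t' unfolding T_def by (cases "d (c u) \<le> \<eta>") auto
  have "d (c t) = \<eta>"
  proof (rule ccontr)
    assume "d (c t) \<noteq> \<eta>"
    then have lt: "d (c t) < \<eta>" using t' by simp
    have "continuous_on {0..t} (\<lambda>t. d (c t))" using continuous_on_subset[OF cont] t' by auto
    then have "\<exists>u\<ge>0. u \<le> t \<and> d (c u) = \<eta>"
      using IVT2'[of "\<lambda>t. d (c t)" t \<eta> 0] lt \<eta> geoD(3)[OF c] t' by auto
    then obtain u where u: "0 \<le> u" "u \<le> t" "d (c u) = \<eta>" by blast
    then have "u < t" using lt by (cases "u = t") auto
    then show False using before u by auto
  qed
  moreover have "\<eta> \<le> d (c u)" if "u \<in> {0..t}" for u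
    using before[of u] calculation that by (cases "u = t") auto
  ultimately show ?thesis using t'(1) by blast
qed

text \<open>A geodesic from \<open>x0\<close> to a point that is not \<open>visible\<close> first enters the collar at a point \<open>z\<close> with
  \<open>d z = \<eta>\<close> that is itself \<open>visible\<close>, and the gate at \<open>z\<close> separates. Gates at the points of a finite net
  suffice, and among them those with a maximal part behind them. A piece that meets several such
  parts takes the first in a fixed enumeration; where the label changes, one of the two pieces meets a
  gate, or two gates touch, so that a connected set of size comparable to \<open>\<eta>\<close> joins the two centres
  and \<open>visible_link\<close> applies.\<close>

lemma labelling_exists:
  obtains \<kappa> C N K x0 \<eta>0 where "0 < \<kappa>" "\<kappa> \<le> 1" "1 \<le> C" "x0 \<in> \<Omega>" "0 < \<eta>0"
    "\<And>\<eta>. 0 < \<eta> ==> \<eta> < \<eta>0 ==> \<exists>lab Z. labelling \<kappa> C N K x0 \<eta> lab Z"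
proof -
  obtain x0 where x0: "x0 \<in> \<Omega>" using nonempty_dom by blast
  obtain M where M: "1 \<le> M"
    "\<And>x y c s \<sigma>. [|geo x y c; s \<in> {0..k x y}; connected \<sigma>; \<sigma> \<subseteq> \<Omega>; x \<in> \<sigma>; y \<in> \<sigma>|]
      ==> \<sigma> \<inter> gate (M * d (c s)) (c s) \<noteq> {}"
    "\<And>x y c s z r \<sigma>. [|geo x y c; s \<in> {0..k x y}; connected \<sigma>; \<sigma> \<subseteq> \<Omega> \<inter> cball z r; x \<in> \<sigma>; y \<in> \<sigma>; z \<in> \<Omega>; d z \<le> r|]
      ==> dist (c s) z < M * r"
    by (rule separation_and_containment) blast
  define R where "R = 4 * (M + 1)"
  have R: "1 \<le> R" unfolding R_def using M(1) by simp
  obtain N where N: "\<And>\<eta> z y G. 0 < \<eta> ==> z \<in> visible x0 \<eta> ==> d z = \<eta> ==> y \<in> visible x0 \<eta> ==>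
      connected G ==> G \<subseteq> \<Omega> \<inter> cball z (R * \<eta>) ==> z \<in> G ==> y \<in> G ==> linked (exp (- \<delta>)) (M * R) N \<eta> z y"
    by (rule exE[OF visible_link[OF M(1) _ R]], (rule M(3); assumption), (rule that; blast))
  have MR: "R \<le> M * R" using M(1) R by (simp add: mult_le_cancel_right1)
  define \<eta>0 where "\<eta>0 = d x0"
  have \<eta>0: "0 < \<eta>0" unfolding \<eta>0_def using d_pos[OF x0] by simp
  show ?thesis
  proof (rule that[of "exp (- \<delta>)" "M * R" x0 \<eta>0 N "M + 3"])
    show "0 < exp (- \<delta>)" "exp (- \<delta>) \<le> 1" using \<delta>_nonneg by auto
    show "1 \<le> M * R" using R MR by (rule order_trans)
    fix \<eta> :: real assume \<eta>: "0 < \<eta>" "\<eta> < \<eta>0"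
    define S where "S = {z \<in> visible x0 \<eta>. d z = \<eta>}"
    have goodO: "visible x0 \<eta> \<subseteq> \<Omega>" unfolding visible_def using geoD(2) by blast
    have bS: "bounded S" by (rule bounded_subset[OF bdd]) (use goodO in \<open>auto simp: S_def\<close>)
    obtain Z0 where Z0: "finite Z0" "Z0 \<subseteq> S" "\<And>c c'. c \<in> Z0 ==> c' \<in> Z0 ==> c \<noteq> c' ==> \<eta> / 2 \<le> dist c c'"
      "\<And>z. z \<in> S ==> \<exists>c\<in>Z0. dist z c < \<eta>" by (rule bounded_net[OF bS \<eta>(1)]) blast
    define A where "A z = gate ((M + 1) * \<eta>) z" for z
    define H where "H z = behind x0 (A z)" for z
    \<comment> \<open>a smallest subfamily of gates behind which lies everything that lies behind some gate\<close>
    define cover where "cover Z \<longleftrightarrow> Z \<subseteq> Z0 \<and> (\<forall>z\<in>Z0. \<exists>z'\<in>Z. H z \<subseteq> H z')" for Z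
    have "cover Z0" unfolding cover_def by blast
    then obtain Z where Z: "cover Z" "\<And>Y. cover Y ==> card Z \<le> card Y"
      using ex_has_least_nat[of cover Z0 card] by blast
    have finZ: "finite Z" using Z(1) Z0(1) finite_subset unfolding cover_def by blast
    have ZS: "Z \<subseteq> S" using Z(1) Z0(2) unfolding cover_def by blast
    have Zp: "z \<in> \<Omega>" "d z = \<eta>" "z \<in> visible x0 \<eta>" if "z \<in> Z" for z using that ZS goodO unfolding S_def by auto
    have anti: "\<not> H z \<subseteq> H z'" if "z \<in> Z" "z' \<in> Z" "z \<noteq> z'" for z z'
    proof
      assume sub: "H z \<subseteq> H z'"
      have "cover (Z - {z})" unfolding cover_def
      proof (intro conjI ballI)
        show "Z - {z} \<subseteq> Z0" using Z(1) unfolding cover_def by blast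
        fix w assume "w \<in> Z0"
        then obtain w' where "w' \<in> Z" "H w \<subseteq> H w'" using Z(1) unfolding cover_def by blast
        then show "\<exists>z'\<in>Z - {z}. H w \<subseteq> H z'" using that sub by (cases "w' = z") blast+
      qed
      then have "card Z \<le> card (Z - {z})" by (rule Z(2))
      then show False using finZ that(1) card_Diff1_less[of Z z] by simp
    qed
    have Aprops: "connected (A z)" "A z \<subseteq> \<Omega>" "A z \<subseteq> ball z ((M + 1) * \<eta>)" "z \<in> Z ==> z \<in> A z" for z
      unfolding A_def using gate_props[where \<rho> = "(M + 1) * \<eta>" and z = z] Zp(1)[of z] M(1) \<eta> by auto
    have Adist: "dist z u \<le> (M + 1) * \<eta>" if "u \<in> closure (A z)" for u z
    proof -
      have "closure (A z) \<subseteq> cball z ((M + 1) * \<eta>)"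
        by (rule closure_minimal) (use Aprops(3)[of z] ball_subset_cball in auto)
      then show ?thesis using that by auto
    qed
    have Adist': "dist z u \<le> (M + 1) * \<eta>" if "u \<in> A z" for u z
      using Adist[of u z] that closure_subset[of "A z"] by blast
    have touch: "\<exists>q\<in>\<Omega>. q \<in> closure (A z) \<and> q \<in> closure (A z')"
      if z: "z \<in> Z" "z' \<in> Z" "z \<noteq> z'" and y: "y \<in> H z" "y \<in> H z'" for z z' y
      by (rule gates_touch[of _ _ x0 y])
         (use Aprops[of z] Aprops[of z'] z y x0 anti[of z z'] anti[of z' z] in \<open>auto simp: H_def\<close>)
    have notgood: "\<exists>z\<in>Z. y \<in> H z" if y: "y \<in> \<Omega>" "y \<notin> visible x0 \<eta>" for y
    proof -
      obtain c where c: "geo x0 y c" using geo_exists[OF x0 y(1)] by blast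
      obtain s where s: "s \<in> {0..k x0 y}" "d (c s) < \<eta>" using y(2) c unfolding visible_def by force
      have "\<eta> < d x0" using \<eta> unfolding \<eta>0_def by simp
      from first_hit[OF c this s] obtain t where t: "t \<in> {0..k x0 y}" "d (c t) = \<eta>" "\<forall>u\<in>{0..t}. \<eta> \<le> d (c u)" by blast
      have "c t \<in> S" unfolding S_def visible_def using geo_initial[OF c t(1)] t geo_dist(1)[OF c t(1)] by auto
      then obtain z where z: "z \<in> Z0" "dist (c t) z < \<eta>" using Z0(4) by blast
      have zp: "z \<in> \<Omega>" "d z = \<eta>" using z(1) Z0(2) goodO unfolding S_def by auto
      have "gate (M * \<eta>) (c t) \<union> ball z \<eta> \<subseteq> A z" unfolding A_def
      proof (rule gate_maximal)
        show "connected (gate (M * \<eta>) (c t) \<union> ball z \<eta>)"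
          by (rule connected_Un) (use gate_props[where \<rho> = "M * \<eta>" and z = "c t"] z(2) geoD(5)[OF c t(1)] M(1) \<eta> in \<open>auto simp: dist_commute\<close>)
        show "gate (M * \<eta>) (c t) \<union> ball z \<eta> \<subseteq> \<Omega>" using gate_props(2) ball_d_subset[OF zp(1)] zp(2) by auto
        have "ball (c t) (M * \<eta>) \<subseteq> ball z ((M + 1) * \<eta>)"
        proof
          fix u assume "u \<in> ball (c t) (M * \<eta>)"
          then show "u \<in> ball z ((M + 1) * \<eta>)"
            using z(2) dist_triangle[of z u "c t"] by (simp add: algebra_simps dist_commute)
        qed
        moreover have "ball z \<eta> \<subseteq> ball z ((M + 1) * \<eta>)" using M(1) \<eta> by (intro subset_ball) (simp add: algebra_simps)
        ultimately show "gate (M * \<eta>) (c t) \<union> ball z \<eta> \<subseteq> ball z ((M + 1) * \<eta>)" using gate_props(3) by blast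
        show "z \<in> gate (M * \<eta>) (c t) \<union> ball z \<eta>" using \<eta> by simp
      qed
      then have "y \<in> H z" unfolding H_def behind_def using M(2)[OF c t(1)] t(2) y(1) by blast
      then show ?thesis using Z(1) z(1) unfolding cover_def by blast
    qed
    obtain idx :: "real^'n => nat" where idx: "inj_on idx Z" using finite_imp_inj_to_nat_seg[OF finZ] by blast
    define lab where "lab V = (if \<forall>z\<in>Z. V \<inter> H z = {} then None
      else Some (SOME z. z \<in> Z \<and> V \<inter> H z \<noteq> {} \<and> (\<forall>w\<in>Z. V \<inter> H w \<noteq> {} --> idx z \<le> idx w)))" for V
    have labS: "z \<in> Z \<and> V \<inter> H z \<noteq> {} \<and> (\<forall>w\<in>Z. V \<inter> H w \<noteq> {} --> idx z \<le> idx w)" if l: "lab V = Some z" for V z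
    proof -
      have ex: "\<exists>z. z \<in> Z \<and> V \<inter> H z \<noteq> {}" using l unfolding lab_def by (auto split: if_splits)
      have "\<exists>z. (z \<in> Z \<and> V \<inter> H z \<noteq> {}) \<and> (\<forall>w. w \<in> Z \<and> V \<inter> H w \<noteq> {} --> idx z \<le> idx w)"
        using ex_has_least_nat[of "\<lambda>z. z \<in> Z \<and> V \<inter> H z \<noteq> {}" _ idx] ex by metis
      then have "\<exists>z. z \<in> Z \<and> V \<inter> H z \<noteq> {} \<and> (\<forall>w\<in>Z. V \<inter> H w \<noteq> {} --> idx z \<le> idx w)" by blast
      from someI_ex[OF this] show ?thesis using l unfolding lab_def by (auto split: if_splits)
    qed
    have labN: "V \<inter> H z = {}" if "lab V = None" "z \<in> Z" for V z
      using that unfolding lab_def by (auto split: if_splits)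
    have deepV: "V \<subseteq> deep x0 ((M + 3) * \<eta>)" if V: "piece \<eta> V" "lab V = Some z" for V z
    proof
      fix x assume x: "x \<in> V"
      have z: "z \<in> Z" "V \<inter> H z \<noteq> {}" using labS[OF V(2)] by auto
      show "x \<in> deep x0 ((M + 3) * \<eta>)" unfolding deep_def mem_Collect_eq
      proof (intro conjI allI impI; (elim conjE)?)
        show "x \<in> \<Omega>" using V(1) x unfolding piece_def by blast
        fix \<sigma> assume \<sigma>: "connected \<sigma>" "\<sigma> \<subseteq> \<Omega>" "x0 \<in> \<sigma>" "x \<in> \<sigma>"
        have "connected (\<sigma> \<union> V)" using \<sigma> x V(1) unfolding piece_def by (intro connected_Un) auto
        then have "(\<sigma> \<union> V) \<inter> A z \<noteq> {}"
          using z(2) behindD[of _ x0 "A z" "\<sigma> \<union> V"] \<sigma> V(1) unfolding H_def piece_def by blast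
        then obtain w where w: "w \<in> \<sigma> \<union> V" "w \<in> A z" by blast
        have dw: "d w \<le> (M + 2) * \<eta>"
          using d_le[of w z] Adist[of w z] w(2) closure_subset[of "A z"] Zp(2)[OF z(1)] by (auto simp: algebra_simps)
        show "\<exists>w\<in>\<sigma>. d w \<le> (M + 3) * \<eta>"
        proof (cases "w \<in> \<sigma>")
          case True then show ?thesis using dw \<eta> by (intro bexI[of _ w]) (auto simp: algebra_simps)
        next
          case False
          then have "dist w x \<le> \<eta> / 2" using w(1) V(1) x unfolding piece_def by blast
          then have "d x \<le> (M + 3) * \<eta>" using d_le[of x w] dw \<eta> by (simp add: algebra_simps)
          then show ?thesis using \<sigma>(4) by blast
        qed
      qed
    qed
    have goodN: "x \<in> visible x0 \<eta>" if "piece \<eta> V" "lab V = None" "x \<in> V" for V x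
    proof (rule ccontr)
      assume "x \<notin> visible x0 \<eta>"
      moreover have "x \<in> \<Omega>" using that unfolding piece_def by blast
      ultimately obtain z where "z \<in> Z" "x \<in> H z" using notgood by blast
      then show False using labN[OF that(2)] that(3) by blast
    qed
    have farN: "\<eta> \<le> d x" if x: "x \<in> visible x0 \<eta>" for x
    proof -
      obtain c where c: "geo x0 x c" "\<forall>s\<in>{0..k x0 x}. \<eta> \<le> d (c s)" using x unfolding visible_def by blast
      have "k x0 x \<in> {0..k x0 x}" using geoD(7)[OF c(1)] by simp
      then show ?thesis using c(2) geoD(4)[OF c(1)] by metis
    qed
    have change: "V \<union> V' \<subseteq> cball z (M * R * \<eta>) \<and>
        (case lab V' of None => \<forall>x\<in>V'. linked (exp (- \<delta>)) (M * R) N \<eta> z x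
           | Some z' => linked (exp (- \<delta>)) (M * R) N \<eta> z z')"
      if V: "piece \<eta> V" "piece \<eta> V'" "V \<inter> V' \<noteq> {}" and l: "lab V = Some z" "lab V' \<noteq> Some z" for V V' z
    proof -
      define W where "W = V \<union> V'"
      have W: "connected W" "W \<subseteq> \<Omega>" unfolding W_def using V unfolding piece_def by (auto intro: connected_Un)
      have diam: "dist u w \<le> \<eta>" if "u \<in> W" "w \<in> W" for u w
      proof -
        obtain v where v: "v \<in> V" "v \<in> V'" using V(3) by blast
        have "dist u v \<le> \<eta> / 2" "dist w v \<le> \<eta> / 2" using that V v unfolding W_def piece_def by blast+
        then show ?thesis using dist_triangle2[of u w v] by linarith
      qed
      have z: "z \<in> Z" "V \<inter> H z \<noteq> {}" "\<And>w. w \<in> Z ==> V \<inter> H w \<noteq> {} ==> idx z \<le> idx w" using labS[OF l(1)] by auto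
      have Re: "R * \<eta> \<le> M * R * \<eta>" using MR \<eta> by (intro mult_right_mono) auto
      have nearW: "dist z u \<le> (M + 2) * \<eta>" if wz: "W \<inter> A z \<noteq> {}" "u \<in> W" for u z
      proof -
        obtain w where w: "w \<in> W" "w \<in> A z" using wz(1) by blast
        have "dist z w \<le> (M + 1) * \<eta>" using Adist[of w z] w(2) closure_subset by blast
        then show ?thesis using dist_triangle[of z u w] diam[OF w(1) wz(2)] by (simp add: algebra_simps)
      qed
      show ?thesis
      proof (cases "lab V'")
        case None
        have "W \<inter> A z \<noteq> {}"
        proof
          assume "W \<inter> A z = {}"
          then have "W \<subseteq> H z" unfolding H_def using behind_connected[OF W] z(2) unfolding H_def W_def by blast
          then show False using labN[OF None z(1)] V(2) unfolding W_def piece_def by blast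
        qed
        then have c: "connected (W \<union> A z)" using W Aprops by (intro connected_Un) auto
        have sub: "W \<union> A z \<subseteq> \<Omega> \<inter> cball z (R * \<eta>)"
        proof -
          have "(M + 2) * \<eta> \<le> R * \<eta>" "(M + 1) * \<eta> \<le> R * \<eta>" unfolding R_def using M(1) \<eta> by (intro mult_right_mono; simp)+
          then have "dist z u \<le> R * \<eta>" if "u \<in> W \<union> A z" for u
            using that nearW[OF \<open>W \<inter> A z \<noteq> {}\<close>, of u] Adist'[of u z] by (elim UnE) linarith+
          then show ?thesis using W(2) Aprops(2)[of z] by auto
        qed
        have "linked (exp (- \<delta>)) (M * R) N \<eta> z x" if "x \<in> V'" for x
          by (rule N[OF \<eta>(1) Zp(3,2)[OF z(1)] goodN[OF V(2) None that] c sub])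
             (use Aprops(4)[OF z(1)] that in \<open>auto simp: W_def\<close>)
        then show ?thesis using None sub Re unfolding W_def by (auto simp: subset_iff intro: order_trans)
      next
        case (Some z')
        have z': "z' \<in> Z" "V' \<inter> H z' \<noteq> {}" "\<And>w. w \<in> Z ==> V' \<inter> H w \<noteq> {} ==> idx z' \<le> idx w"
          using labS[OF Some] by auto
        have zz: "z \<noteq> z'" using Some l(2) by auto
        then have idxne: "idx z \<noteq> idx z'" using idx z(1) z'(1) by (auto simp: inj_on_def)
        have in_z: "W \<subseteq> H z" if "W \<inter> A z = {}"
          unfolding H_def using behind_connected[OF W that] z(2) unfolding H_def W_def by blast
        have in_z': "W \<subseteq> H z'" if "W \<inter> A z' = {}"
          unfolding H_def using behind_connected[OF W that] z'(2) unfolding H_def W_def by blast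
        have one: "W \<inter> A z \<noteq> {} \<or> W \<inter> A z' \<noteq> {}"
        proof (rule ccontr)
          assume "\<not> ?thesis"
          then have "W \<subseteq> H z" "W \<subseteq> H z'" using in_z in_z' by auto
          then have "V' \<inter> H z \<noteq> {}" "V \<inter> H z' \<noteq> {}" using V unfolding W_def piece_def by auto
          then have "idx z' \<le> idx z" "idx z \<le> idx z'" using z z' by auto
          then show False using idxne by simp
        qed
        \<comment> \<open>either the two pieces meet both gates, or the gates touch at a point \<open>q\<close>\<close>
        have "\<exists>q S. dist z q \<le> (M + 2) * \<eta> \<and> dist z' q \<le> (M + 1) * \<eta> \<and> S \<subseteq> \<Omega> \<inter> {q} \<and> connected (W \<union> A z \<union> A z' \<union> S)"
        proof (cases "W \<inter> A z \<noteq> {} \<and> W \<inter> A z' \<noteq> {}")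
          case True
          then obtain w where w: "w \<in> W" "w \<in> A z'" by blast
          have "connected (W \<union> A z \<union> A z' \<union> {})" using True W Aprops by (auto intro!: connected_Un)
          moreover have "dist z w \<le> (M + 2) * \<eta>" "dist z' w \<le> (M + 1) * \<eta>" using nearW True w Adist' by blast+
          ultimately show ?thesis by blast
        next
          case False
          have "W \<subseteq> H z \<or> W \<subseteq> H z'" using False in_z in_z' by blast
          then obtain y where y: "y \<in> H z" "y \<in> H z'" using z(2) z'(2) unfolding W_def by blast
          obtain q where q: "q \<in> \<Omega>" "q \<in> closure (A z)" "q \<in> closure (A z')"
            using touch[OF z(1) z'(1) zz y] by blast
          have "connected (insert q (A z))" "connected (insert q (A z'))"
            using connected_intermediate_closure[OF Aprops(1)[of z], of "insert q (A z)"]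
              connected_intermediate_closure[OF Aprops(1)[of z'], of "insert q (A z')"] q closure_subset by auto
          then have "connected (insert q (A z) \<union> insert q (A z'))" by (intro connected_Un) auto
          then have "connected (insert q (A z) \<union> insert q (A z') \<union> W)"
            by (rule connected_Un[OF _ W(1)]) (use one in auto)
          moreover have "insert q (A z) \<union> insert q (A z') \<union> W = W \<union> A z \<union> A z' \<union> {q}" by blast
          moreover have "dist z q \<le> (M + 2) * \<eta>" using Adist[OF q(2)] \<eta>(1) by (simp add: algebra_simps)
          ultimately show ?thesis using Adist[OF q(3)] q(1) by (intro exI[of _ q] exI[of _ "{q}"]) auto
        qed
        then obtain q S where q: "dist z q \<le> (M + 2) * \<eta>" "dist z' q \<le> (M + 1) * \<eta>" "S \<subseteq> \<Omega> \<inter> {q}"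
          and c: "connected (W \<union> A z \<union> A z' \<union> S)" by blast
        have "dist z u \<le> R * \<eta>" if u: "u \<in> W \<union> A z \<union> A z' \<union> S" for u
        proof -
          have e: "\<eta> \<le> M * \<eta>" using M(1) \<eta>(1) by simp
          have Az': "dist z w \<le> 3 * (M * \<eta>) + 4 * \<eta>" if "w \<in> A z'" for w
            using Adist'[OF that] q(1,2) dist_triangle[of z w q] dist_triangle[of q w z'] dist_commute[of q z']
            by (simp add: distrib_right)
          have "dist z u \<le> 3 * (M * \<eta>) + 5 * \<eta>" if uW: "u \<in> W"
            using one
          proof
            assume "W \<inter> A z \<noteq> {}"
            from nearW[OF this uW] show ?thesis using e \<eta>(1) unfolding distrib_right by linarith
          next
            assume "W \<inter> A z' \<noteq> {}"
            then obtain w where w: "w \<in> W" "w \<in> A z'" by blast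
            then show ?thesis using Az'[OF w(2)] diam[OF w(1) uW] dist_triangle[of z u w] by linarith
          qed
          moreover have "dist z u \<le> M * \<eta> + 2 * \<eta>" if "u \<in> A z \<union> S"
            using that Adist'[of u z] q(1,3) \<eta>(1) by (auto simp: distrib_right)
          ultimately have "dist z u \<le> 3 * (M * \<eta>) + 5 * \<eta> \<or> dist z u \<le> M * \<eta> + 2 * \<eta> \<or> dist z u \<le> 3 * (M * \<eta>) + 4 * \<eta>"
            using u Az'[of u] by blast
          moreover have "R * \<eta> = 4 * (M * \<eta>) + 4 * \<eta>" unfolding R_def by (simp add: algebra_simps)
          ultimately show ?thesis using e \<eta>(1) by linarith
        qed
        then have "\<exists>G. connected G \<and> G \<subseteq> \<Omega> \<inter> cball z (R * \<eta>) \<and> W \<union> A z \<union> A z' \<subseteq> G"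
          using c W(2) q(3) Aprops(2)[of z] Aprops(2)[of z'] by (intro exI[of _ "W \<union> A z \<union> A z' \<union> S"]) auto
        then obtain G where G: "connected G" "G \<subseteq> \<Omega> \<inter> cball z (R * \<eta>)" "W \<union> A z \<union> A z' \<subseteq> G" by blast
        have "linked (exp (- \<delta>)) (M * R) N \<eta> z z'"
          by (rule N[OF \<eta>(1) Zp(3,2)[OF z(1)] Zp(3)[OF z'(1)] G(1,2)])
             (use Aprops(4)[OF z(1)] Aprops(4)[OF z'(1)] G(3) in auto)
        then show ?thesis using Some G Re unfolding W_def by (auto simp: subset_iff intro: order_trans)
      qed
    qed
    have "labelling (exp (- \<delta>)) (M * R) N (M + 3) x0 \<eta> lab Z"
      unfolding labelling_def
    proof (intro conjI allI impI ballI; (elim conjE)?)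
      show "finite Z" by (rule finZ)
      show "z \<in> \<Omega>" "d z = \<eta>" if "z \<in> Z" for z using Zp[OF that] by auto
      show "\<eta> / 2 \<le> dist z z'" if "z \<in> Z" "z' \<in> Z" "z \<noteq> z'" for z z'
        using Z0(3) Z(1) that unfolding cover_def by blast
      show "z \<in> Z" if "lab V = Some z" for V z using labS[OF that] by blast
      show "V \<subseteq> deep x0 ((M + 3) * \<eta>)" if "piece \<eta> V" "lab V = Some z" for V z using deepV[OF that] .
      show "\<eta> \<le> d x" if "piece \<eta> V" "lab V = None" "x \<in> V" for V x using farN[OF goodN[OF that]] .
    qed (use change in blast)+
    then show "\<exists>lab Z. labelling (exp (- \<delta>)) (M * R) N (M + 3) x0 \<eta> lab Z" by blast
  qed (rule x0 \<eta>0)+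
qed

end


section \<open>Iterated partial derivatives\<close>

definition line_diff :: "'n::finite => (real^'n => real) => real^'n => bool" where
  "line_diff i f x \<longleftrightarrow> (\<lambda>t. f (x + t *\<^sub>R axis i 1)) differentiable (at 0)"

abbreviation D :: "'n::finite list => (real^'n => real) => real^'n => real" where
  "D is f \<equiv> foldr partial is f"

lemma has_partial:
  "line_diff i f x ==> ((\<lambda>t. f (x + t *\<^sub>R axis i 1)) has_real_derivative partial i f x) (at 0)"
  unfolding line_diff_def partial_def by (simp add: DERIV_deriv_iff_real_differentiable)

lemma partialI:
  assumes "((\<lambda>t. f (x + t *\<^sub>R axis i 1)) has_real_derivative d) (at 0)"
  shows "line_diff i f x" "partial i f x = d"
  using assms unfolding line_diff_def partial_def by (auto simp: DERIV_imp_deriv real_differentiable_def)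

lemma line_eventually:
  assumes "open S" "x \<in> S" shows "\<forall>\<^sub>F t in nhds 0. x + t *\<^sub>R axis i (1::real) \<in> S"
proof -
  have "((\<lambda>t. x + t *\<^sub>R axis i (1::real)) \<longlongrightarrow> x + 0 *\<^sub>R axis i 1) (nhds 0)"
    by (intro tendsto_intros filterlim_ident)
  then show ?thesis using assms topological_tendstoD[of _ x "nhds 0" S] by simp
qed

lemma partial_cong:
  assumes S: "open S" "x \<in> S" and eq: "\<And>y. y \<in> S ==> f y = g y"
  shows "partial i f x = partial i g x" "line_diff i f x \<longleftrightarrow> line_diff i g x"
proof -
  have ev: "\<forall>\<^sub>F t in nhds 0. f (x + t *\<^sub>R axis i 1) = g (x + t *\<^sub>R axis i 1)"
    using line_eventually[OF S, of i] by eventually_elim (rule eq)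
  have "((\<lambda>t. f (x + t *\<^sub>R axis i 1)) has_real_derivative d) (at 0) \<longleftrightarrow>
        ((\<lambda>t. g (x + t *\<^sub>R axis i 1)) has_real_derivative d) (at 0)" for d
    by (rule DERIV_cong_ev[OF refl ev refl])
  then show "partial i f x = partial i g x" "line_diff i f x \<longleftrightarrow> line_diff i g x"
    unfolding partial_def deriv_def line_diff_def real_differentiable_def by auto
qed

lemma Ck_on_Suc: "Ck_on (Suc k) S f \<longleftrightarrow> continuous_on S f \<and> (\<forall>i. (\<forall>x\<in>S. line_diff i f x) \<and> Ck_on k S (partial i f))"
  unfolding line_diff_def by simp

lemma Ck_on_continuous: "Ck_on k S f ==> continuous_on S f"
  by (cases k) auto

declare Ck_on.simps(2) [simp del]

lemma Ck_on_cong: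
  assumes "open S" shows "Ck_on k S f ==> (\<And>x. x \<in> S ==> f x = g x) ==> Ck_on k S g"
proof (induction k arbitrary: f g)
  case 0 then show ?case by (simp cong: continuous_on_cong)
next
  case (Suc k)
  have "Ck_on k S (partial i g)" for i
    by (rule Suc.IH[of "partial i f"])
       (use Suc.prems partial_cong(1)[OF assms, of _ f g i] in \<open>auto simp: Ck_on_Suc\<close>)
  moreover have "continuous_on S g" using Suc.prems by (auto simp: Ck_on_Suc cong: continuous_on_cong)
  moreover have "line_diff i g x" if "x \<in> S" for i x
    using partial_cong(2)[OF assms that, of f g i] Suc.prems that by (auto simp: Ck_on_Suc)
  ultimately show ?case by (simp add: Ck_on_Suc)
qed

lemma Ck_on_mono: "Ck_on (Suc k) S f ==> Ck_on k S f"
proof (induction k arbitrary: f)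
  case 0 then show ?case by (simp add: Ck_on_Suc)
next
  case (Suc k) then show ?case using Ck_on_Suc[of "Suc k" S f] Ck_on_Suc[of k S f] by blast
qed

lemma Ck_on_local:
  "(\<And>x. x \<in> S ==> \<exists>B. open B \<and> x \<in> B \<and> Ck_on k B f) ==> Ck_on k S f"
proof (induction k arbitrary: f)
  case 0
  have "continuous (at x) f" if "x \<in> S" for x
    using 0[OF that] continuous_on_eq_continuous_at by auto
  then show ?case by (simp add: continuous_at_imp_continuous_on)
next
  case (Suc k)
  have "continuous (at x) f" if "x \<in> S" for x
    using Suc.prems[OF that] Ck_on_continuous continuous_on_eq_continuous_at by blast
  then have "continuous_on S f" by (simp add: continuous_at_imp_continuous_on)
  moreover have "line_diff i f x" if "x \<in> S" for i x
    using Suc.prems[OF that] by (auto simp: Ck_on_Suc)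
  moreover have "Ck_on k S (partial i f)" for i
    by (rule Suc.IH) (use Suc.prems in \<open>fastforce simp: Ck_on_Suc\<close>)
  ultimately show ?case by (simp add: Ck_on_Suc)
qed

lemma Ck_on_subset: "Ck_on k S f ==> T \<subseteq> S ==> Ck_on k T f"
  by (induction k arbitrary: f) (auto simp: Ck_on_Suc intro: continuous_on_subset)

lemma partial_add:
  assumes "line_diff i f x" "line_diff i g x"
  shows "line_diff i (\<lambda>x. f x + g x) x" "partial i (\<lambda>x. f x + g x) x = partial i f x + partial i g x"
  using partialI[OF DERIV_add[OF has_partial[OF assms(1)] has_partial[OF assms(2)]]] by auto

lemma partial_mult:
  assumes "line_diff i f x" "line_diff i g x"
  shows "line_diff i (\<lambda>x. f x * g x) x"
    "partial i (\<lambda>x. f x * g x) x = partial i f x * g x + f x * partial i g x"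
  using partialI[OF DERIV_mult[OF has_partial[OF assms(1)] has_partial[OF assms(2)]]]
  by (auto simp: mult.commute)

lemma partial_const [simp]: "line_diff i (\<lambda>x. c) x" "partial i (\<lambda>x. c) = (\<lambda>x. 0)"
  using partialI[of "\<lambda>x. c" _ i 0] by (auto simp: fun_eq_iff)

lemma partial_cmult:
  assumes "line_diff i f x" shows "partial i (\<lambda>x. c * f x) x = c * partial i f x"
  using partial_mult(2)[OF partial_const(1) assms, of c] by simp

lemma Ck_on_const: "Ck_on k S (\<lambda>x. c)"
  by (induction k arbitrary: c) (auto simp: Ck_on_Suc)

lemma Ck_on_add:
  assumes "open S" shows "Ck_on k S f ==> Ck_on k S g ==> Ck_on k S (\<lambda>x. f x + g x)"
proof (induction k arbitrary: f g)
  case 0 then show ?case by (auto intro: continuous_intros)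
next
  case (Suc k)
  have "Ck_on k S (partial i (\<lambda>x. f x + g x))" for i
    by (rule Ck_on_cong[OF assms Suc.IH[of "partial i f" "partial i g"]])
       (use Suc.prems in \<open>auto simp: Ck_on_Suc partial_add(2)\<close>)
  moreover have "line_diff i (\<lambda>x. f x + g x) x" if "x \<in> S" for i x
    using Suc.prems that by (auto simp: Ck_on_Suc intro: partial_add(1))
  ultimately show ?case using Suc.prems by (auto simp: Ck_on_Suc intro: continuous_intros)
qed

lemma Ck_on_mult:
  assumes "open S" shows "Ck_on k S f ==> Ck_on k S g ==> Ck_on k S (\<lambda>x. f x * g x)"
proof (induction k arbitrary: f g)
  case 0 then show ?case by (auto intro: continuous_intros)
next
  case (Suc k)
  have mono: "Ck_on k S f" "Ck_on k S g" using Suc.prems Ck_on_mono by blast+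
  have "Ck_on k S (partial i (\<lambda>x. f x * g x))" for i
    by (rule Ck_on_cong[OF assms Ck_on_add[OF assms Suc.IH[of "partial i f" g] Suc.IH[of f "partial i g"]]])
       (use Suc.prems mono in \<open>auto simp: Ck_on_Suc partial_mult(2)\<close>)
  moreover have "line_diff i (\<lambda>x. f x * g x) x" if "x \<in> S" for i x
    using Suc.prems that by (auto simp: Ck_on_Suc intro: partial_mult(1))
  ultimately show ?case using Suc.prems by (auto simp: Ck_on_Suc intro: continuous_intros)
qed

lemma smooth_const: "(\<lambda>x. c) \<in> smooth S"
  unfolding smooth_def by (simp add: Ck_on_const)

lemma smooth_add: "open S ==> f \<in> smooth S ==> g \<in> smooth S ==> (\<lambda>x. f x + g x) \<in> smooth S"
  unfolding smooth_def by (simp add: Ck_on_add)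

lemma smooth_mult: "open S ==> f \<in> smooth S ==> g \<in> smooth S ==> (\<lambda>x. f x * g x) \<in> smooth S"
  unfolding smooth_def by (simp add: Ck_on_mult)

lemma smooth_diff: "open S ==> f \<in> smooth S ==> g \<in> smooth S ==> (\<lambda>x. f x - g x) \<in> smooth S"
  using smooth_add[of S f "\<lambda>x. (-1) * g x"] smooth_mult[OF _ smooth_const, of S g "-1"] by simp

lemma smooth_sum: "open S ==> (\<And>m. m \<in> M ==> f m \<in> smooth S) ==> (\<lambda>x. \<Sum>m\<in>M. f m x) \<in> smooth S"
  by (induction M rule: infinite_finite_induct) (auto intro: smooth_const smooth_add)

lemma smooth_cong: "open S ==> f \<in> smooth S ==> (\<And>x. x \<in> S ==> f x = g x) ==> g \<in> smooth S"
  unfolding smooth_def using Ck_on_cong[of S _ f g] by simp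

lemma smooth_subset: "f \<in> smooth S ==> T \<subseteq> S ==> f \<in> smooth T"
  unfolding smooth_def using Ck_on_subset by blast

lemma smooth_local: "(\<And>x. x \<in> S ==> \<exists>B. open B \<and> x \<in> B \<and> f \<in> smooth B) ==> f \<in> smooth S"
  unfolding smooth_def mem_Collect_eq
proof
  fix k assume "\<And>x. x \<in> S ==> \<exists>B. open B \<and> x \<in> B \<and> (\<forall>k. Ck_on k B f)"
  then show "Ck_on k S f" by (intro Ck_on_local) meson
qed

lemma smooth_continuous: "f \<in> smooth S ==> continuous_on S f"
  unfolding smooth_def using Ck_on_continuous by blast

lemma smooth_line_diff: "f \<in> smooth S ==> x \<in> S ==> line_diff i f x"
  unfolding smooth_def using Ck_on_Suc[of 0 S f] by blast

lemma smooth_partial: "f \<in> smooth S ==> partial i f \<in> smooth S"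
  unfolding smooth_def using Ck_on_Suc by blast

lemma smooth_D: "f \<in> smooth S ==> D is f \<in> smooth S"
  by (induction "is") (auto intro: smooth_partial)

text \<open>Smoothness by coinduction: a family of continuous functions closed under partial derivatives
  consists of smooth functions.\<close>

lemma smooth_coinduct:
  assumes S: "open S" and "f \<in> P"
    and P: "\<And>g. g \<in> P ==> continuous_on S g"
      "\<And>g i. g \<in> P ==> \<exists>h\<in>P. \<forall>x\<in>S. ((\<lambda>t. g (x + t *\<^sub>R axis i 1)) has_real_derivative h x) (at 0)"
  shows "f \<in> smooth S"
proof -
  have "Ck_on k S g" if "g \<in> P" for k g
    using that
  proof (induction k arbitrary: g)
    case 0 then show ?case using P(1) by simp
  next
    case (Suc k)
    have "(\<forall>x\<in>S. line_diff i g x) \<and> Ck_on k S (partial i g)" for i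
    proof -
      obtain h where h: "h \<in> P" "\<forall>x\<in>S. ((\<lambda>t. g (x + t *\<^sub>R axis i 1)) has_real_derivative h x) (at 0)"
        using P(2)[OF Suc.prems] by blast
      have "Ck_on k S (partial i g)"
        by (rule Ck_on_cong[OF S Suc.IH[OF h(1)]]) (use h(2) partialI(2) in fastforce)
      then show ?thesis using h(2) partialI(1) by blast
    qed
    then show ?case using P(1)[OF Suc.prems] by (simp add: Ck_on_Suc)
  qed
  then show ?thesis using assms(2) unfolding smooth_def by blast
qed

lemma D_cong:
  assumes "open S" shows "x \<in> S ==> (\<And>y. y \<in> S ==> f y = g y) ==> D is f x = D is g x"
proof (induction "is" arbitrary: x)
  case (Cons i "is")
  have "partial i (D is f) x = partial i (D is g) x"
    by (rule partial_cong(1)[OF assms Cons.prems(1)]) (use Cons in blast)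
  then show ?case by simp
qed auto

lemma D_zero: "D is (\<lambda>x. 0) = (\<lambda>x. 0)"
  by (induction "is") auto

lemma D_add:
  assumes S: "open S" "f \<in> smooth S" "g \<in> smooth S"
  shows "x \<in> S ==> D is (\<lambda>x. f x + g x) x = D is f x + D is g x"
proof (induction "is" arbitrary: x)
  case (Cons i "is")
  have "partial i (D is (\<lambda>x. f x + g x)) x = partial i (\<lambda>x. D is f x + D is g x) x"
    by (rule partial_cong(1)[OF S(1) Cons.prems]) (rule Cons.IH)
  also have "... = partial i (D is f) x + partial i (D is g) x"
    by (rule partial_add(2)[OF smooth_line_diff[OF smooth_D[OF S(2)] Cons.prems] smooth_line_diff[OF smooth_D[OF S(3)] Cons.prems]])
  finally show ?case by simp
qed auto

lemma D_cmult:
  assumes S: "open S" "f \<in> smooth S"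
  shows "x \<in> S ==> D is (\<lambda>x. c * f x) x = c * D is f x"
proof (induction "is" arbitrary: x)
  case (Cons i "is")
  have "partial i (D is (\<lambda>x. c * f x)) x = partial i (\<lambda>x. c * D is f x) x"
    by (rule partial_cong(1)[OF S(1) Cons.prems]) (rule Cons.IH)
  also have "... = c * partial i (D is f) x"
    by (rule partial_cmult[OF smooth_line_diff[OF smooth_D[OF S(2)] Cons.prems]])
  finally show ?case by simp
qed auto

lemma D_diff:
  assumes S: "open S" "f \<in> smooth S" "g \<in> smooth S" "x \<in> S"
  shows "D is (\<lambda>x. f x - g x) x = D is f x - D is g x"
proof -
  have "D is (\<lambda>x. f x + (-1) * g x) x = D is f x + D is (\<lambda>x. (-1) * g x) x"
    by (rule D_add[OF S(1,2) smooth_mult[OF S(1) smooth_const S(3)] S(4)])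
  also have "D is (\<lambda>x. (-1) * g x) x = (-1) * D is g x" by (rule D_cmult[OF S(1,3,4)])
  finally show ?thesis by simp
qed

lemma D_sum:
  assumes S: "open S" "x \<in> S"
  shows "(\<And>m. m \<in> M ==> f m \<in> smooth S) ==> D is (\<lambda>x. \<Sum>m\<in>M. f m x) x = (\<Sum>m\<in>M. D is (f m) x)"
proof (induction M rule: infinite_finite_induct)
  case (insert m M)
  then show ?case using D_add[OF S(1) _ smooth_sum[OF S(1)] S(2), of "f m" M f "is"] by simp
qed (auto simp: D_zero)

text \<open>The powers of \<open>h\<close> make the Leibniz rule a statement about two constants, which is preserved under
  induction over the list of differentiations.\<close>

lemma D_mult_bound:
  assumes S: "open S" "x \<in> S" and h: "0 < (h::real)"
  shows "f \<in> smooth S ==> g \<in> smooth S ==>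
    (\<And>js. length js \<le> length is ==> \<bar>D js f x\<bar> \<le> a / h ^ length js) ==>
    (\<And>js. length js \<le> length is ==> \<bar>D js g x\<bar> \<le> b / h ^ length js) ==>
    \<bar>D is (\<lambda>x. f x * g x) x\<bar> \<le> 2 ^ length is * a * b / h ^ length is"
proof (induction "is" arbitrary: f g a b rule: rev_induct)
  case Nil
  have "\<bar>f x\<bar> \<le> a" "\<bar>g x\<bar> \<le> b" using Nil(3)[of "[]"] Nil(4)[of "[]"] by auto
  then show ?case by (simp add: abs_mult mult_mono)
next
  case (snoc i "is")
  note fg = snoc.prems(1,2)
  have "D (is @ [i]) (\<lambda>x. f x * g x) x = D is (\<lambda>x. partial i f x * g x + f x * partial i g x) x"
    unfolding foldr_append foldr.simps o_apply id_apply
    by (rule D_cong[OF S]) (use partial_mult(2) smooth_line_diff fg in blast)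
  also have "... = D is (\<lambda>x. partial i f x * g x) x + D is (\<lambda>x. f x * partial i g x) x"
    by (rule D_add[OF S(1) _ _ S(2)]) (use fg in \<open>auto intro: smooth_mult smooth_partial S\<close>)
  finally have eq: "D (is @ [i]) (\<lambda>x. f x * g x) x = D is (\<lambda>x. partial i f x * g x) x + D is (\<lambda>x. f x * partial i g x) x" .
  have 1: "\<bar>D is (\<lambda>x. partial i f x * g x) x\<bar> \<le> 2 ^ length is * (a / h) * b / h ^ length is"
  proof (rule snoc.IH[OF smooth_partial[OF fg(1)] fg(2)])
    fix js :: "'a list" assume js: "length js \<le> length is"
    show "\<bar>D js (partial i f) x\<bar> \<le> a / h / h ^ length js" using snoc.prems(3)[of "js @ [i]"] js by (simp add: mult.commute)
    show "\<bar>D js g x\<bar> \<le> b / h ^ length js" using snoc.prems(4)[of js] js by simp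
  qed
  have 2: "\<bar>D is (\<lambda>x. f x * partial i g x) x\<bar> \<le> 2 ^ length is * a * (b / h) / h ^ length is"
  proof (rule snoc.IH[OF fg(1) smooth_partial[OF fg(2)]])
    fix js :: "'a list" assume js: "length js \<le> length is"
    show "\<bar>D js (partial i g) x\<bar> \<le> b / h / h ^ length js" using snoc.prems(4)[of "js @ [i]"] js by (simp add: mult.commute)
    show "\<bar>D js f x\<bar> \<le> a / h ^ length js" using snoc.prems(3)[of js] js by simp
  qed
  have "2 ^ length is * (a / h) * b / h ^ length is + 2 ^ length is * a * (b / h) / h ^ length is
      = 2 ^ length (is @ [i]) * a * b / h ^ length (is @ [i])"
    using h by (simp add: field_simps)
  then show ?case unfolding eq using 1 2 by linarith
qed

text \<open>Tensor products of one-dimensional functions. A sequence of functions each of which is the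
  derivative of its predecessor is called a ladder; the derivatives of a tensor product are read off
  from the ladders of its factors, and they depend on the order of differentiation only through its
  multiset.\<close>

definition ladder :: "(nat => real => real) => bool" where
  "ladder \<theta> \<longleftrightarrow> (\<forall>n t. (\<theta> n has_real_derivative \<theta> (Suc n) t) (at t))"

definition tensor :: "('n::finite => nat => real => real) => ('n => nat) => real^'n => real" where
  "tensor \<Theta> \<alpha> x = (\<Prod>i\<in>UNIV. \<Theta> i (\<alpha> i) (x $ i))"

lemma ladder_continuous: "ladder \<theta> ==> continuous_on S (\<theta> n)"
  unfolding ladder_def by (meson DERIV_continuous_on has_field_derivative_at_within)

lemma tensor_partial:
  assumes "\<And>i. ladder (\<Theta> i)"
  shows "((\<lambda>t. tensor \<Theta> \<alpha> (x + t *\<^sub>R axis i 1)) has_real_derivative tensor \<Theta> (\<alpha>(i := Suc (\<alpha> i))) (x + t *\<^sub>R axis i 1)) (at t)"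
proof -
  have split: "tensor \<Theta> \<beta> y = \<Theta> i (\<beta> i) (y $ i) * (\<Prod>j\<in>UNIV - {i}. \<Theta> j (\<beta> j) (y $ j))" for \<beta> y
    unfolding tensor_def by (simp add: prod.remove[of UNIV i])
  have c: "(x + t *\<^sub>R axis i 1) $ j = (if j = i then x $ i + t else x $ j)" for t j
    by (simp add: axis_def)
  have "((\<lambda>t. \<Theta> i (\<alpha> i) (x $ i + t)) has_real_derivative \<Theta> i (Suc (\<alpha> i)) (x $ i + t)) (at t)"
    unfolding add.commute[of "x $ i"]
    by (subst DERIV_shift[symmetric]) (use assms[of i] in \<open>simp add: ladder_def\<close>)
  from DERIV_cmult_right[OF this, of "\<Prod>j\<in>UNIV - {i}. \<Theta> j (\<alpha> j) (x $ j)"]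
  show ?thesis unfolding split c by (simp cong: prod.cong_simp)
qed

lemma tensor_continuous:
  assumes "\<And>i. ladder (\<Theta> i)" shows "continuous_on S (tensor \<Theta> \<alpha>)"
proof -
  have "continuous_on S (\<lambda>x. \<Prod>i\<in>UNIV. \<Theta> i (\<alpha> i) (x $ i))"
    by (intro continuous_on_prod continuous_on_compose2[OF ladder_continuous[OF assms, of UNIV]] continuous_intros) auto
  then show ?thesis unfolding tensor_def[abs_def] .
qed

lemma tensor_smooth:
  assumes "open S" "\<And>i. ladder (\<Theta> i)" shows "tensor \<Theta> \<alpha> \<in> smooth S"
proof (rule smooth_coinduct[OF assms(1), of _ "range (tensor \<Theta>)"])
  fix g i assume "g \<in> range (tensor \<Theta>)"
  then obtain \<beta> where g: "g = tensor \<Theta> \<beta>" by blast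
  show "continuous_on S g" unfolding g by (rule tensor_continuous[OF assms(2)])
  show "\<exists>h\<in>range (tensor \<Theta>). \<forall>x\<in>S. ((\<lambda>t. g (x + t *\<^sub>R axis i 1)) has_real_derivative h x) (at 0)"
    using tensor_partial[of \<Theta> \<beta> _ i 0, OF assms(2)] unfolding g
    by (intro bexI[of _ "tensor \<Theta> (\<beta>(i := Suc (\<beta> i)))"]) auto
qed auto

lemma partial_tensor:
  assumes "\<And>i. ladder (\<Theta> i)"
  shows "partial i (tensor \<Theta> \<alpha>) = tensor \<Theta> (\<alpha>(i := Suc (\<alpha> i)))"
  using partialI(2)[OF tensor_partial[of \<Theta> \<alpha> _ i 0, OF assms, simplified]] by (auto simp: fun_eq_iff)

lemma D_tensor:
  assumes "\<And>i. ladder (\<Theta> i)"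
  shows "D is (tensor \<Theta> \<alpha>) = tensor \<Theta> (\<lambda>i. \<alpha> i + count_list is i)"
proof (induction "is")
  case (Cons i "is")
  then show ?case by (auto simp: partial_tensor[OF assms] intro!: arg_cong[of _ _ "tensor \<Theta>"])
qed simp

lemma sum_count_list_UNIV: "(\<Sum>i\<in>UNIV. count_list is (i::'n::finite)) = length is"
proof (induction "is")
  case (Cons a "is")
  have "(\<Sum>i\<in>UNIV. count_list (a # is) i) = (\<Sum>i\<in>UNIV. count_list is i + (if a = i then 1 else 0))"
    by (intro sum.cong) auto
  then show ?case using Cons by (simp add: sum.distrib)
qed simp


section \<open>Bump functions and Taylor polynomials\<close>

text \<open>The polynomial factor makes the family of flat functions closed under differentiation.\<close>

definition flat :: "real poly => real => real" where
  "flat P t = (if t \<le> 0 then 0 else poly P (1 / t) * exp (- (1 / t)))"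

lemma tendsto_flat: "((\<lambda>t. poly P (1 / t) * exp (- (1 / t))) \<longlongrightarrow> 0) (at_right (0::real))"
proof -
  have "((\<lambda>y. \<Sum>i\<le>degree P. coeff P i * (y ^ i / exp y)) \<longlongrightarrow> (\<Sum>i\<le>degree P. coeff P i * 0)) at_top"
    by (intro tendsto_intros tendsto_power_div_exp_0)
  then have "((\<lambda>y. poly P y * exp (- y)) \<longlongrightarrow> 0) at_top"
    by (simp add: poly_altdef exp_minus sum_distrib_right divide_inverse mult.assoc)
  from filterlim_compose[OF this filterlim_inverse_at_top_right] show ?thesis
    by (simp add: divide_inverse)
qed

lemma flat_deriv: "(flat P has_real_derivative flat ([:0, 0, 1:] * (P - pderiv P)) t) (at t)"
proof -
  consider "t < 0" | "t = 0" | "0 < t" by linarith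
  then show ?thesis
  proof cases
    case 1
    have "((\<lambda>t. 0) has_real_derivative flat ([:0, 0, 1:] * (P - pderiv P)) t) (at t)"
      using 1 by (simp add: flat_def)
    then show ?thesis
      by (rule has_field_derivative_transform_within_open[of _ _ _ "{..<0}"]) (use 1 in \<open>auto simp: flat_def\<close>)
  next
    case 3
    have "((\<lambda>t. poly P (1 / t) * exp (- (1 / t))) has_real_derivative flat ([:0, 0, 1:] * (P - pderiv P)) t) (at t)"
      using 3 by (auto intro!: derivative_eq_intros simp: flat_def field_simps power2_eq_square)
    then show ?thesis
      by (rule has_field_derivative_transform_within_open[of _ _ _ "{0<..}"]) (use 3 in \<open>auto simp: flat_def\<close>)
  next
    case 2
    have "((\<lambda>h. flat P h / h) \<longlongrightarrow> 0) (at_left 0)"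
      by (rule Lim_transform_eventually[OF tendsto_const]) (auto simp: flat_def eventually_at_filter)
    moreover have "((\<lambda>h. flat P h / h) \<longlongrightarrow> 0) (at_right 0)"
    proof (rule Lim_transform_eventually[OF tendsto_flat[of "pCons 0 P"]])
      show "\<forall>\<^sub>F h in at_right 0. poly (pCons 0 P) (1 / h) * exp (- (1 / h)) = flat P h / h"
        by (auto simp: flat_def eventually_at_filter)
    qed
    ultimately have "((\<lambda>h. flat P h / h) \<longlongrightarrow> 0) (at 0)" by (simp add: filterlim_split_at)
    then show ?thesis using 2 by (simp add: DERIV_def flat_def)
  qed
qed

text \<open>Sums of products of a flat function and a reflected one are closed under differentiation, too.\<close>

inductive_set flat_span :: "(real => real) set" where
  prod: "(\<lambda>t. c * (flat P t * flat Q (1 - t))) \<in> flat_span"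
| add: "f \<in> flat_span ==> g \<in> flat_span ==> (\<lambda>t. f t + g t) \<in> flat_span"

lemma flat_span_deriv: "f \<in> flat_span ==> \<exists>f'\<in>flat_span. \<forall>t. (f has_real_derivative f' t) (at t)"
proof (induction rule: flat_span.induct)
  case (prod c P Q)
  let ?P = "[:0, 0, 1:] * (P - pderiv P)" and ?Q = "[:0, 0, 1:] * (Q - pderiv Q)"
  have "((\<lambda>t. c * (flat P t * flat Q (1 - t))) has_real_derivative
      c * (flat ?P t * flat Q (1 - t)) + (- c) * (flat P t * flat ?Q (1 - t))) (at t)" for t
  proof -
    have "((\<lambda>t. flat Q (1 - t)) has_real_derivative flat ?Q (1 - t) * (0 - 1)) (at t)"
      by (rule DERIV_chain2[OF flat_deriv DERIV_diff[OF DERIV_const DERIV_ident]])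
    note D = DERIV_cmult[OF DERIV_mult[OF flat_deriv[of P t] this], of c]
    have "c * (x * q + (y * (0 - 1)) * z) = c * (x * q) + (- c) * (z * y)" for x y z q :: real by (simp add: algebra_simps)
    from DERIV_cong[OF D this[of "flat ?P t" "flat Q (1 - t)" "flat ?Q (1 - t)" "flat P t"]] show ?thesis .
  qed
  then show ?case by (intro bexI[OF _ flat_span.add[OF flat_span.prod flat_span.prod]] allI)
next
  case (add f g)
  then obtain f' g' where "f' \<in> flat_span" "g' \<in> flat_span"
    "\<forall>t. (f has_real_derivative f' t) (at t)" "\<forall>t. (g has_real_derivative g' t) (at t)" by blast
  then show ?case by (intro bexI[of _ "\<lambda>t. f' t + g' t"] flat_span.add allI DERIV_add) auto
qed

lemma flat_span_ladder: assumes "f \<in> flat_span" shows "ladder (\<lambda>n. (deriv ^^ n) f)"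
proof -
  have *: "deriv g \<in> flat_span \<and> (\<forall>t. (g has_real_derivative deriv g t) (at t))" if g: "g \<in> flat_span" for g
  proof -
    obtain g' where g': "g' \<in> flat_span" "\<forall>t. (g has_real_derivative g' t) (at t)" using flat_span_deriv[OF g] by blast
    then have "deriv g = g'" by (intro ext DERIV_imp_deriv) blast
    then show ?thesis using g' by simp
  qed
  then have "(deriv ^^ n) f \<in> flat_span" for n by (induction n) (use assms in auto)
  then show ?thesis unfolding ladder_def using * by simp
qed

lemma ladder_zero:
  assumes "ladder \<theta>" "open U" "\<And>t. t \<in> U ==> \<theta> 0 t = 0"
  shows "t \<in> U ==> \<theta> n t = 0"
proof (induction n arbitrary: t)
  case (Suc n)
  have "((\<lambda>t. 0) has_real_derivative \<theta> (Suc n) t) (at t)"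
  proof (rule has_field_derivative_transform_within_open[OF _ assms(2) Suc.prems])
    show "(\<theta> n has_real_derivative \<theta> (Suc n) t) (at t)" using assms(1) unfolding ladder_def by blast
  qed (use Suc.IH in auto)
  then show ?case using DERIV_unique[OF _ DERIV_const] by blast
qed (rule assms(3))

text \<open>With \<open>A\<close> an antiderivative of a bump supported in the unit interval, normalized by \<open>A 1 = 1\<close>, the
  function \<open>A (t + 1) - A t\<close> has integer translates that sum to one.\<close>

lemma bump_exists:
  obtains \<theta> where "ladder \<theta>" "\<And>n t. 1 < \<bar>t\<bar> ==> \<theta> n t = 0" "\<And>t. 0 \<le> \<theta> 0 t"
    "\<And>t. 0 \<le> t ==> t \<le> 1 ==> \<theta> 0 t + \<theta> 0 (t - 1) = 1" "\<And>n. \<exists>B. \<forall>t. \<bar>\<theta> n t\<bar> \<le> B"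
proof -
  define b where "b t = 1 * (flat [:1:] t * flat [:1:] (1 - t))" for t
  have b0: "b t = 0" if "t \<le> 0 \<or> 1 \<le> t" for t using that by (auto simp: b_def flat_def)
  have bpos: "0 < b t" if "0 < t" "t < 1" for t using that by (auto simp: b_def flat_def)
  have bnn: "0 \<le> b t" for t using b0[of t] bpos[of t] by (cases "t \<le> 0 \<or> 1 \<le> t") auto
  have "b \<in> flat_span" unfolding b_def by (rule flat_span.prod)
  from flat_span_ladder[OF this] have lb: "ladder (\<lambda>n. (deriv ^^ n) b)" .
  define \<beta> where "\<beta> n = (deriv ^^ n) b" for n
  have \<beta>: "(\<beta> n has_real_derivative \<beta> (Suc n) t) (at t)" for n t
    using lb unfolding ladder_def \<beta>_def by blast
  have "isCont b t" for t using \<beta>[of 0 t] unfolding \<beta>_def by (auto intro: DERIV_isCont)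
  then obtain F where F: "\<And>t. (F has_real_derivative b t) (at t)"
    using einterval_antiderivative[of "-\<infinity>" \<infinity> b] by (auto simp: has_real_derivative_iff_has_vector_derivative)
  have const: "F s = F t" if "s < t" "\<And>u. s < u ==> u < t ==> b u = 0" for s t
    using MVT2[OF that(1), of F b] F that(2) by fastforce
  define A where "A t = F t - F 0" for t
  have dA: "(A has_real_derivative b t) (at t)" for t
    unfolding A_def using DERIV_diff[OF F DERIV_const] by simp
  have A0: "A t = 0" if "t \<le> 0" for t unfolding A_def using const[of t 0] that b0 by (cases "t = 0") auto
  have A1: "A t = A 1" if "1 \<le> t" for t unfolding A_def using const[of 1 t] that b0 by (cases "t = 1") auto
  have mono: "A s \<le> A t" if "s \<le> t" for s t
    by (rule DERIV_nonneg_imp_nondecreasing[OF that]) (use dA bnn in blast)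
  have "A 0 < A 1"
  proof -
    have "A (1/4) < A (3/4)" by (rule DERIV_pos_imp_increasing) (use dA bpos in \<open>auto intro!: exI\<close>)
    then show ?thesis using mono[of 0 "1/4"] mono[of "3/4" 1] by simp
  qed
  then have I: "0 < A 1" using A0[of 0] by simp
  define \<theta> where "\<theta> n t = (case n of 0 => (A (t + 1) - A t) / A 1 | Suc m => (\<beta> m (t + 1) - \<beta> m t) / A 1)" for n t
  have \<beta>0: "\<beta> 0 = b" unfolding \<beta>_def by simp
  have lt: "ladder \<theta>" unfolding ladder_def
  proof (intro allI)
    fix n t
    show "(\<theta> n has_real_derivative \<theta> (Suc n) t) (at t)"
    proof (cases n)
      case 0
      have "((\<lambda>t. (A (t + 1) - A t) / A 1) has_real_derivative (b (t + 1) - b t) / A 1) (at t)"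
        using dA[of "t + 1"] dA[of t] by (intro DERIV_cdivide DERIV_diff) (auto simp: DERIV_shift)
      then show ?thesis unfolding 0 \<theta>_def using \<beta>0 by simp
    next
      case (Suc m)
      have "((\<lambda>t. (\<beta> m (t + 1) - \<beta> m t) / A 1) has_real_derivative (\<beta> (Suc m) (t + 1) - \<beta> (Suc m) t) / A 1) (at t)"
        using \<beta>[of m "t + 1"] \<beta>[of m t] by (intro DERIV_cdivide DERIV_diff) (auto simp: DERIV_shift)
      then show ?thesis unfolding Suc \<theta>_def by simp
    qed
  qed
  have out: "\<theta> n t = 0" if "1 < \<bar>t\<bar>" for n t
  proof (rule ladder_zero[OF lt, of "{t. 1 < \<bar>t\<bar>}"])
    show "open {t::real. 1 < \<bar>t\<bar>}" by (intro open_Collect_less continuous_intros)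
    fix t :: real assume "t \<in> {t. 1 < \<bar>t\<bar>}"
    then show "\<theta> 0 t = 0" using A0[of t] A0[of "t + 1"] A1[of t] A1[of "t + 1"] unfolding \<theta>_def
      by (cases "t < 0") auto
  qed (use that in auto)
  show ?thesis
  proof (rule that[OF lt out])
    show "0 \<le> \<theta> 0 t" for t using mono[of t "t + 1"] I unfolding \<theta>_def by simp
    show "\<theta> 0 t + \<theta> 0 (t - 1) = 1" if "0 \<le> t" "t \<le> 1" for t
      using A0[of "t - 1"] A1[of "t + 1"] I that unfolding \<theta>_def by (simp add: field_simps)
    show "\<exists>B. \<forall>t. \<bar>\<theta> n t\<bar> \<le> B" for n
    proof -
      have "compact (\<theta> n ` {-1..1})" by (intro compact_continuous_image ladder_continuous[OF lt]) simp
      then obtain B where B: "\<And>t. t \<in> {-1..1} ==> \<bar>\<theta> n t\<bar> \<le> B"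
        using compact_imp_bounded bounded_iff by (metis image_eqI real_norm_def)
      have "\<bar>\<theta> n t\<bar> \<le> max B 0" for t
      proof (cases "1 < \<bar>t\<bar>")
        case False
        then have "t \<in> {-1..1}" by auto
        then show ?thesis using B[of t] by simp
      qed (use out in simp)
      then show ?thesis by blast
    qed
  qed
qed

definition power_ladder :: "real => nat => nat => real => real" where
  "power_ladder c a n t = (if n \<le> a then (t - c) ^ (a - n) / fact (a - n) else 0)"

lemma ladder_power: "ladder (power_ladder c a)"
  unfolding ladder_def
proof (intro allI)
  fix n t
  show "(power_ladder c a n has_real_derivative power_ladder c a (Suc n) t) (at t)"
  proof (cases "Suc n \<le> a")
    case True
    then obtain m where m: "a - n = Suc m" "a - Suc n = m" by (metis Suc_diff_Suc Suc_le_lessD)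
    have "((\<lambda>t. (t - c) ^ Suc m) has_real_derivative real (Suc m) * (t - c) ^ m) (at t)"
      by (auto intro!: derivative_eq_intros simp del: power_Suc)
    from DERIV_cdivide[OF this, of "fact (Suc m)"]
    have "((\<lambda>t. (t - c) ^ Suc m / fact (Suc m)) has_real_derivative (t - c) ^ m / fact m) (at t)"
      by (simp del: power_Suc of_nat_Suc)
    then show ?thesis using True m unfolding power_ladder_def[abs_def] by simp
  next
    case False
    then have "power_ladder c a n = (\<lambda>t. if n \<le> a then 1 else 0)" "power_ladder c a (Suc n) t = 0"
      unfolding power_ladder_def by (auto simp: fun_eq_iff)
    then show ?thesis by simp
  qed
qed

definition monomial :: "real^'n::finite => ('n => nat) => real^'n => real" where
  "monomial z \<alpha> = tensor (\<lambda>i. power_ladder (z $ i) (\<alpha> i)) (\<lambda>_. 0)"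

lemma monomial_smooth: "open S ==> monomial z \<alpha> \<in> smooth S"
  unfolding monomial_def by (intro tensor_smooth ladder_power)

lemma D_monomial: "D is (monomial z \<alpha>) x = (\<Prod>i\<in>UNIV. power_ladder (z $ i) (\<alpha> i) (count_list is i) (x $ i))"
  unfolding monomial_def D_tensor[OF ladder_power] by (simp add: tensor_def)

lemma D_monomial_centre: "D is (monomial z \<alpha>) z = (if count_list is = \<alpha> then 1 else 0)"
proof (cases "count_list is = \<alpha>")
  case False
  then obtain i where "count_list is i \<noteq> \<alpha> i" by auto
  then have "power_ladder (z $ i) (\<alpha> i) (count_list is i) (z $ i) = 0" unfolding power_ladder_def by auto
  then have "\<exists>i\<in>UNIV. power_ladder (z $ i) (\<alpha> i) (count_list is i) (z $ i) = 0" by blast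
  then show ?thesis using False unfolding D_monomial by (simp add: prod_zero)
qed (auto simp: D_monomial power_ladder_def)

lemma D_monomial_high:
  assumes "order_of \<alpha> < length is" shows "D is (monomial z \<alpha>) x = 0"
proof -
  have "\<exists>i. \<alpha> i < count_list is i"
  proof (rule ccontr)
    assume "\<not> ?thesis"
    then have "(\<Sum>i\<in>UNIV. count_list is i) \<le> (\<Sum>i\<in>UNIV. \<alpha> i)" by (intro sum_mono) (auto simp: not_less)
    then show False using assms sum_count_list_UNIV[of "is"] unfolding order_of_def by simp
  qed
  then obtain i where "\<alpha> i < count_list is i" by blast
  then have "power_ladder (z $ i) (\<alpha> i) (count_list is i) (x $ i) = 0" unfolding power_ladder_def by simp
  then have "\<exists>i\<in>UNIV. power_ladder (z $ i) (\<alpha> i) (count_list is i) (x $ i) = 0" by blast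
  then show ?thesis unfolding D_monomial by (simp add: prod_zero)
qed

definition multi_list :: "('n::finite => nat) => 'n list" where
  "multi_list \<alpha> = concat (map (\<lambda>i. replicate (\<alpha> i) i) index_enum)"

lemma index_enum: "distinct (index_enum :: 'n::finite list)" "set (index_enum :: 'n list) = UNIV"
proof -
  obtain xs :: "'n list" where "set xs = UNIV \<and> distinct xs" using finite_distinct_list[of "UNIV :: 'n set"] by auto
  then have "\<exists>xs :: 'n list. distinct xs \<and> set xs = UNIV" by blast
  from someI_ex[OF this] show "distinct (index_enum :: 'n list)" "set (index_enum :: 'n list) = UNIV"
    unfolding index_enum_def by auto
qed

lemma classical_deriv_D: "classical_deriv \<alpha> f = D (multi_list \<alpha>) f"
proof -
  have *: "foldr partial (replicate n i) g = (partial i ^^ n) g" for n g and i :: 'a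
    by (induction n) auto
  have "foldr (\<lambda>i g. (partial i ^^ \<alpha> i) g) xs f = D (concat (map (\<lambda>i. replicate (\<alpha> i) i) xs)) f" for xs
    by (induction xs) (auto simp: *)
  then show ?thesis unfolding classical_deriv_def multi_list_def .
qed

lemma count_multi_list: "count_list (multi_list \<alpha>) i = \<alpha> i"
proof -
  have "count_list (replicate n j) i = (if i = j then n else 0)" for n and j :: 'a by (induction n) auto
  then have "count_list (concat (map (\<lambda>j. replicate (\<alpha> j) j) xs)) i = (if i \<in> set xs then \<alpha> i else 0)"
    if "distinct xs" for xs
    using that by (induction xs) auto
  from this[OF index_enum(1)] show ?thesis unfolding multi_list_def index_enum(2) by simp
qed

lemma length_multi_list: "length (multi_list \<alpha>) = order_of \<alpha>"
  unfolding sum_count_list_UNIV[symmetric] order_of_def by (simp add: count_multi_list)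

lemma finite_order_less: "finite {\<alpha> :: 'n::finite => nat. order_of \<alpha> < k}"
proof (rule finite_subset)
  show "{\<alpha> :: 'n => nat. order_of \<alpha> < k} \<subseteq> UNIV \<rightarrow>\<^sub>E {..k}"
  proof
    fix \<alpha> :: "'n => nat" assume "\<alpha> \<in> {\<alpha>. order_of \<alpha> < k}"
    then have "\<alpha> i \<le> k" for i using member_le_sum[of i UNIV \<alpha>] unfolding order_of_def by simp
    then show "\<alpha> \<in> UNIV \<rightarrow>\<^sub>E {..k}" by auto
  qed
qed (intro finite_PiE, auto)

definition taylor :: "nat => (real^'n::finite => real) => real^'n => real^'n => real" where
  "taylor k f z x = (\<Sum>\<alpha> | order_of \<alpha> < k. D (multi_list \<alpha>) f z * monomial z \<alpha> x)"

lemma taylor_smooth: "open S ==> taylor k f z \<in> smooth S"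
  unfolding taylor_def[abs_def] by (intro smooth_sum smooth_mult smooth_const monomial_smooth)

lemma D_taylor:
  "D is (taylor k f z) x = (\<Sum>\<alpha> | order_of \<alpha> < k. D (multi_list \<alpha>) f z * D is (monomial z \<alpha>) x)"
proof -
  have "D is (taylor k f z) x = (\<Sum>\<alpha> | order_of \<alpha> < k. D is (\<lambda>x. D (multi_list \<alpha>) f z * monomial z \<alpha> x) x)"
    unfolding taylor_def[abs_def] by (rule D_sum[OF open_UNIV UNIV_I]) (rule smooth_mult[OF open_UNIV smooth_const monomial_smooth[OF open_UNIV]])
  also have "... = (\<Sum>\<alpha> | order_of \<alpha> < k. D (multi_list \<alpha>) f z * D is (monomial z \<alpha>) x)"
    by (intro sum.cong D_cmult[OF open_UNIV monomial_smooth]) auto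
  finally show ?thesis .
qed

lemma D_taylor_high: "k \<le> length is ==> D is (taylor k f z) x = 0"
  unfolding D_taylor by (intro sum.neutral) (auto simp: D_monomial_high)

text \<open>The hypothesis is the symmetry of mixed partial derivatives, which mollifications have by construction
  (\<open>D_moll\<close>).\<close>

lemma D_taylor_centre:
  assumes sym: "\<And>js. count_list js = count_list is ==> D js f z = D is f z" and "length is < k"
  shows "D is (taylor k f z) z = D is f z"
proof -
  have "D is (taylor k f z) z = (\<Sum>\<alpha> | order_of \<alpha> < k. if \<alpha> = count_list is then D (multi_list \<alpha>) f z else 0)"
    unfolding D_taylor D_monomial_centre by (intro sum.cong) auto
  also have "... = D (multi_list (count_list is)) f z"
    using assms(2) sum_count_list_UNIV[of "is"] by (subst sum.delta[OF finite_order_less]) (simp add: order_of_def)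
  also have "... = D is f z" by (rule sym) (simp add: fun_eq_iff count_multi_list)
  finally show ?thesis .
qed

text \<open>The mean value theorem, one coordinate at a time; for this reason the neighbourhoods are
  cubes.\<close>

definition cube :: "real^'n::finite => real => (real^'n) set" where
  "cube z r = {x. \<forall>i. \<bar>x $ i - z $ i\<bar> \<le> r}"

lemma mvt_cube:
  fixes z x :: "real^'n::finite" and r E :: real
  assumes S: "cube z r \<subseteq> S" and f: "f \<in> smooth S" and r: "0 \<le> r"
    and E: "\<And>x i. x \<in> cube z r ==> \<bar>partial i f x\<bar> \<le> E" and x: "x \<in> cube z r"
  shows "\<bar>f x - f z\<bar> \<le> CARD('n) * r * E"
proof -
  have "\<bar>f x - f z\<bar> \<le> card A * r * E"
    if "finite A" "x \<in> cube z r" "\<And>i. i \<notin> A ==> x $ i = z $ i" for A :: "'n set" and x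
    using that
  proof (induction A arbitrary: x rule: finite_induct)
    case empty
    then have "x = z" by (simp add: vec_eq_iff)
    then show ?case by simp
  next
    case (insert i A)
    define h where "h = x $ i - z $ i"
    define y where "y = x - h *\<^sub>R axis i 1"
    have c: "(y + t *\<^sub>R axis i 1) $ j = (if j = i then z $ i + t else x $ j)" for t j
      unfolding y_def h_def by (simp add: axis_def)
    have hr: "\<bar>h\<bar> \<le> r" using insert.prems(1) unfolding cube_def h_def by auto
    have line: "y + t *\<^sub>R axis i 1 \<in> cube z r" if "\<bar>t\<bar> \<le> \<bar>h\<bar>" for t
      unfolding cube_def mem_Collect_eq c using that hr insert.prems(1) by (auto simp: cube_def)
    have y: "y \<in> cube z r" using line[of 0] by simp
    have IH: "\<bar>f y - f z\<bar> \<le> card A * r * E"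
      by (rule insert.IH[OF y]) (use c[of 0] insert.prems(2) in auto)
    have der: "((\<lambda>t. f (y + t *\<^sub>R axis i 1)) has_real_derivative partial i f (y + t *\<^sub>R axis i 1)) (at t)"
      if t: "\<bar>t\<bar> \<le> \<bar>h\<bar>" for t
    proof -
      have "line_diff i f (y + t *\<^sub>R axis i 1)" by (rule smooth_line_diff[OF f]) (use S line[OF t] in blast)
      from has_partial[OF this]
      have "((\<lambda>s. f (y + (s + t) *\<^sub>R axis i 1)) has_real_derivative partial i f (y + t *\<^sub>R axis i 1)) (at 0)"
        by (simp add: algebra_simps)
      then show ?thesis using DERIV_shift[of "\<lambda>s. f (y + s *\<^sub>R axis i 1)" _ 0 t] by simp
    qed
    have x': "y + h *\<^sub>R axis i 1 = x" unfolding y_def by simp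
    have "\<bar>f x - f y\<bar> \<le> r * E"
    proof -
      have E0: "0 \<le> E" using E[OF y, of i] by simp
      have "norm (f (y + h *\<^sub>R axis i 1) - f (y + 0 *\<^sub>R axis i 1)) \<le> E * norm (h - 0)"
      proof (rule field_differentiable_bound[of "{- \<bar>h\<bar>..\<bar>h\<bar>}"])
        fix t assume t: "t \<in> {- \<bar>h\<bar>..\<bar>h\<bar>}"
        then have t': "\<bar>t\<bar> \<le> \<bar>h\<bar>" by auto
        show "((\<lambda>t. f (y + t *\<^sub>R axis i 1)) has_real_derivative partial i f (y + t *\<^sub>R axis i 1)) (at t within {- \<bar>h\<bar>..\<bar>h\<bar>})"
          using der[OF t'] has_field_derivative_at_within by blast
        show "norm (partial i f (y + t *\<^sub>R axis i 1)) \<le> E" using E[OF line[OF t']] by simp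
      qed auto
      also have "... \<le> r * E" using hr E0 by (simp add: mult.commute mult_left_mono)
      finally show ?thesis unfolding x' by simp
    qed
    then show ?case using IH insert.hyps by (simp add: algebra_simps)
  qed
  from this[of UNIV x] show ?thesis using x by simp
qed

text \<open>The bound on the derivatives of order \<open>k\<close> is integrated downwards, one order at a time, with the
  values at the centre as initial values.\<close>

lemma growth_cube:
  fixes h :: "real^'n::finite => real" and r E :: real
  assumes S: "cube z r \<subseteq> S" and h: "h \<in> smooth S" and r: "0 < r" and E: "0 \<le> E"
    and top: "\<And>is x. length is = k ==> x \<in> cube z r ==> \<bar>D is h x\<bar> \<le> E"
    and ini: "\<And>is. length is < k ==> \<bar>D is h z\<bar> \<le> E * r ^ (k - length is)"
    and "is": "length is \<le> k" and x: "x \<in> cube z r"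
  shows "\<bar>D is h x\<bar> \<le> (CARD('n) + 1) ^ k * E * r ^ (k - length is)"
proof -
  let ?n = "real CARD('n)"
  have "length is + j = k ==> x \<in> cube z r ==> \<bar>D is h x\<bar> \<le> (?n + 1) ^ j * E * r ^ j" for j x
  proof (induction j arbitrary: "is" x)
    case 0 then show ?case using top by simp
  next
    case (Suc j)
    have "\<bar>D is h x - D is h z\<bar> \<le> ?n * r * ((?n + 1) ^ j * E * r ^ j)"
    proof (rule mvt_cube[OF S smooth_D[OF h] _ _ Suc.prems(2)])
      fix y i assume "y \<in> cube z r"
      then show "\<bar>partial i (D is h) y\<bar> \<le> (?n + 1) ^ j * E * r ^ j" using Suc.IH[of "i # is" y] Suc.prems(1) by simp
    qed (use r in simp)
    moreover have "\<bar>D is h z\<bar> \<le> E * r ^ Suc j" using ini[of "is"] Suc.prems(1) by (simp add: Suc.prems(1)[symmetric])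
    moreover have "E * r ^ Suc j \<le> (?n + 1) ^ j * E * r ^ Suc j"
    proof -
      have "1 \<le> (?n + 1) ^ j" by (intro one_le_power) simp
      then have "1 * (E * r ^ Suc j) \<le> (?n + 1) ^ j * (E * r ^ Suc j)" using E r by (intro mult_right_mono) auto
      then show ?thesis by simp
    qed
    moreover have "?n * r * ((?n + 1) ^ j * E * r ^ j) + (?n + 1) ^ j * E * r ^ Suc j = (?n + 1) ^ Suc j * E * r ^ Suc j"
      by (simp add: algebra_simps)
    ultimately show ?case by linarith
  qed
  from this[of "k - length is" x] have "\<bar>D is h x\<bar> \<le> (?n + 1) ^ (k - length is) * E * r ^ (k - length is)"
    using "is" x by simp
  also have "... \<le> (?n + 1) ^ k * E * r ^ (k - length is)"
    using E r by (intro mult_right_mono power_increasing) auto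
  finally show ?thesis by (simp add: add.commute)
qed


section \<open>Cutoffs and convolution\<close>

definition bump :: "nat => real => real" where
  "bump = (SOME \<theta>. ladder \<theta> \<and> (\<forall>n t. 1 < \<bar>t\<bar> --> \<theta> n t = 0) \<and> (\<forall>t. 0 \<le> \<theta> 0 t) \<and>
     (\<forall>t. 0 \<le> t \<and> t \<le> 1 --> \<theta> 0 t + \<theta> 0 (t - 1) = 1) \<and> (\<forall>n. \<exists>B. \<forall>t. \<bar>\<theta> n t\<bar> \<le> B))"

lemma bump:
  "ladder bump" "1 < \<bar>t\<bar> ==> bump n t = 0" "0 \<le> bump 0 t"
  "0 \<le> t ==> t \<le> 1 ==> bump 0 t + bump 0 (t - 1) = 1" "\<exists>B. \<forall>t. \<bar>bump n t\<bar> \<le> B"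
proof -
  have "\<exists>\<theta>. ladder \<theta> \<and> (\<forall>n t. 1 < \<bar>t\<bar> --> \<theta> n t = 0) \<and> (\<forall>t. 0 \<le> \<theta> 0 t) \<and>
     (\<forall>t. 0 \<le> t \<and> t \<le> 1 --> \<theta> 0 t + \<theta> 0 (t - 1) = 1) \<and> (\<forall>n. \<exists>B. \<forall>t. \<bar>\<theta> n t\<bar> \<le> B)"
    by (rule bump_exists) blast
  from someI_ex[OF this, folded bump_def] show "ladder bump" "1 < \<bar>t\<bar> ==> bump n t = 0" "0 \<le> bump 0 t"
    "0 \<le> t ==> t \<le> 1 ==> bump 0 t + bump 0 (t - 1) = 1" "\<exists>B. \<forall>t. \<bar>bump n t\<bar> \<le> B" by blast+
qed

definition cutoff :: "real => real^'n::finite => ('n => nat) => real^'n => real" where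
  "cutoff h c = tensor (\<lambda>i n t. bump n ((t - c $ i) / h) / h ^ n)"

lemma ladder_scaled: assumes "0 < h" shows "ladder (\<lambda>n t. bump n ((t - c) / h) / h ^ n)"
  unfolding ladder_def
proof (intro allI)
  fix n t
  have "(bump n has_real_derivative bump (Suc n) ((t - c) / h)) (at ((t - c) / h))"
    using bump(1) unfolding ladder_def by blast
  moreover have "((\<lambda>t. (t - c) / h) has_real_derivative 1 / h) (at t)"
    using assms by (auto intro!: derivative_eq_intros)
  ultimately have "((\<lambda>t. bump n ((t - c) / h)) has_real_derivative bump (Suc n) ((t - c) / h) * (1 / h)) (at t)"
    by (rule DERIV_chain2)
  from DERIV_cdivide[OF this, of "h ^ n"]
  show "((\<lambda>t. bump n ((t - c) / h) / h ^ n) has_real_derivative bump (Suc n) ((t - c) / h) / h ^ Suc n) (at t)"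
    by (simp add: mult.commute)
qed

lemma cutoff_smooth: "0 < h ==> open S ==> cutoff h c \<alpha> \<in> smooth S"
  unfolding cutoff_def by (intro tensor_smooth ladder_scaled)

lemma cutoff_continuous: "0 < h ==> continuous_on S (cutoff h c \<alpha>)"
  unfolding cutoff_def by (intro tensor_continuous ladder_scaled)

lemma D_cutoff: "0 < h ==> D is (cutoff h c \<alpha>) = cutoff h c (\<lambda>i. \<alpha> i + count_list is i)"
  unfolding cutoff_def by (intro D_tensor ladder_scaled)

lemma cutoff_support:
  assumes "0 < h" "x \<notin> cube c h" shows "cutoff h c \<alpha> x = 0"
proof -
  obtain i where "h < \<bar>x $ i - c $ i\<bar>" using assms(2) unfolding cube_def by (auto simp: not_le)
  then have "1 < \<bar>(x $ i - c $ i) / h\<bar>" using assms(1) by simp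
  then have "bump (\<alpha> i) ((x $ i - c $ i) / h) / h ^ \<alpha> i = 0" using bump(2) by simp
  then show ?thesis unfolding cutoff_def tensor_def by (intro prod_zero) auto
qed

lemma cutoff_nonneg: "0 \<le> cutoff h c (\<lambda>_. 0) x"
  unfolding cutoff_def tensor_def using bump(3) by (simp add: prod_nonneg)

lemma cutoff_shift: "cutoff h 0 \<alpha> (y - x) = cutoff h x \<alpha> y"
  unfolding cutoff_def tensor_def by simp

definition bump_sup :: "nat => real" where
  "bump_sup k = (SOME B. 1 \<le> B \<and> (\<forall>n\<le>k. \<forall>t. \<bar>bump n t\<bar> \<le> B))"

lemma bump_sup: "1 \<le> bump_sup k" "n \<le> k ==> \<bar>bump n t\<bar> \<le> bump_sup k"
proof -
  obtain b where b: "\<And>n t. \<bar>bump n t\<bar> \<le> b n" using bump(5) by metis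
  have "b n \<le> Max (insert 1 (b ` {..k}))" if "n \<le> k" for n using that by (intro Max_ge) auto
  then have "1 \<le> Max (insert 1 (b ` {..k})) \<and> (\<forall>n\<le>k. \<forall>t. \<bar>bump n t\<bar> \<le> Max (insert 1 (b ` {..k})))"
    using b order_trans by (auto intro!: Max_ge) blast
  from someI[of "\<lambda>B. 1 \<le> B \<and> (\<forall>n\<le>k. \<forall>t. \<bar>bump n t\<bar> \<le> B)", OF this, folded bump_sup_def]
  show "1 \<le> bump_sup k" "n \<le> k ==> \<bar>bump n t\<bar> \<le> bump_sup k" by auto
qed

lemma cutoff_bound:
  fixes c x :: "real^'n::finite"
  assumes h: "0 < h" and \<alpha>: "order_of \<alpha> \<le> k"
  shows "\<bar>cutoff h c \<alpha> x\<bar> \<le> bump_sup k ^ CARD('n) / h ^ order_of \<alpha>"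
proof -
  have "\<bar>cutoff h c \<alpha> x\<bar> = (\<Prod>i\<in>UNIV. \<bar>bump (\<alpha> i) ((x $ i - c $ i) / h)\<bar> / h ^ \<alpha> i)"
    unfolding cutoff_def tensor_def abs_prod using h by (simp add: abs_mult)
  also have "... \<le> (\<Prod>i\<in>UNIV. bump_sup k / h ^ \<alpha> i)"
  proof (rule prod_mono)
    fix i :: 'n
    have "\<alpha> i \<le> k" using member_le_sum[of i UNIV \<alpha>] \<alpha> unfolding order_of_def by simp
    then show "0 \<le> \<bar>bump (\<alpha> i) ((x $ i - c $ i) / h)\<bar> / h ^ \<alpha> i \<and>
        \<bar>bump (\<alpha> i) ((x $ i - c $ i) / h)\<bar> / h ^ \<alpha> i \<le> bump_sup k / h ^ \<alpha> i"
      using h by (auto intro: divide_right_mono bump_sup(2))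
  qed
  also have "... = bump_sup k ^ CARD('n) / h ^ order_of \<alpha>"
    by (simp add: prod_dividef order_of_def power_sum)
  finally show ?thesis .
qed

lemma cube_closed_bounded: "compact (cube c h)" for c :: "real^'n::finite"
proof -
  have "cube c h = cbox (\<chi> i. c $ i - h) (\<chi> i. c $ i + h)"
    unfolding cube_def by (auto simp: mem_box_cart abs_le_iff algebra_simps)
  then show ?thesis by simp
qed

lemma cube_dist:
  fixes c :: "real^'n::finite" and h :: real
  assumes "x \<in> cube c h" shows "dist c x \<le> CARD('n) * h"
proof -
  have "dist c x \<le> (\<Sum>i\<in>UNIV. \<bar>(c - x) $ i\<bar>)" unfolding dist_norm by (rule norm_le_l1_cart)
  also have "... \<le> (\<Sum>i\<in>(UNIV :: 'n set). h)"
    by (rule sum_mono) (use assms in \<open>auto simp: cube_def abs_minus_commute\<close>)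
  finally show ?thesis by simp
qed

lemma bump_edge: assumes "1 \<le> \<bar>t\<bar>" shows "bump 0 t = 0"
proof -
  have c: "continuous_on S (bump 0)" for S by (rule ladder_continuous[OF bump(1)])
  consider "t \<in> closure {1<..}" | "t \<in> closure {..<-1}" using assms by force
  then show ?thesis
  proof cases
    case 1
    then show ?thesis by (rule continuous_constant_on_closure[OF c, rotated]) (rule bump(2), simp)
  next
    case 2
    then show ?thesis by (rule continuous_constant_on_closure[OF c, rotated]) (rule bump(2), simp)
  qed
qed

lemma bump_partition:
  fixes N :: int
  assumes "\<bar>t\<bar> \<le> of_int N - 1" shows "(\<Sum>j\<in>{-N..N}. bump 0 (t - of_int j)) = 1"
proof -
  have "of_int \<lfloor>t\<rfloor> \<le> t" "t < of_int \<lfloor>t\<rfloor> + 1" by linarith+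
  note fl = this
  have "(\<Sum>j\<in>{-N..N}. bump 0 (t - of_int j)) = (\<Sum>j\<in>{\<lfloor>t\<rfloor>, \<lfloor>t\<rfloor> + 1}. bump 0 (t - of_int j))"
  proof (rule sum.mono_neutral_right)
    show "{\<lfloor>t\<rfloor>, \<lfloor>t\<rfloor> + 1} \<subseteq> {-N..N}" using assms by (auto; linarith)
    show "\<forall>j\<in>{-N..N} - {\<lfloor>t\<rfloor>, \<lfloor>t\<rfloor> + 1}. bump 0 (t - of_int j) = 0"
    proof
      fix j assume "j \<in> {-N..N} - {\<lfloor>t\<rfloor>, \<lfloor>t\<rfloor> + 1}"
      then consider "j \<le> \<lfloor>t\<rfloor> - 1" | "\<lfloor>t\<rfloor> + 2 \<le> j" by fastforce
      then show "bump 0 (t - of_int j) = 0" by cases (rule bump_edge; linarith)+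
    qed
  qed simp
  also have "... = bump 0 (t - of_int \<lfloor>t\<rfloor>) + bump 0 (t - of_int \<lfloor>t\<rfloor> - 1)" by (simp add: algebra_simps)
  also have "... = 1" by (rule bump(4)) (use fl in linarith)+
  finally show ?thesis .
qed

definition node :: "real => ('n => int) => real^'n::finite" where
  "node h m = (\<chi> i. h * of_int (m i))"

definition grid :: "int => ('n::finite => int) set" where
  "grid N = (\<Pi>\<^sub>E i\<in>UNIV. {-N..N})"

lemma finite_grid: "finite (grid N)" unfolding grid_def by (intro finite_PiE) auto

lemma cutoff_partition:
  fixes x :: "real^'n::finite"
  assumes h: "0 < h" and x: "\<And>i. \<bar>x $ i\<bar> \<le> h * (of_int N - 1)"
  shows "(\<Sum>m\<in>grid N. cutoff h (node h m) (\<lambda>_. 0) x) = 1"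
proof -
  have "cutoff h (node h m) (\<lambda>_. 0) x = (\<Prod>i\<in>UNIV. bump 0 (x $ i / h - of_int (m i)))" for m :: "'n => int"
    using h by (simp add: cutoff_def tensor_def node_def diff_divide_distrib)
  then have "(\<Sum>m\<in>grid N. cutoff h (node h m) (\<lambda>_. 0) x) =
      (\<Sum>m\<in>(\<Pi>\<^sub>E i\<in>UNIV. {-N..N}). \<Prod>i\<in>UNIV. bump 0 (x $ i / h - of_int (m i)))"
    unfolding grid_def by simp
  also have "... = (\<Prod>i\<in>(UNIV :: 'n set). \<Sum>j\<in>{-N..N}. bump 0 (x $ i / h - of_int j))"
    by (rule prod_sum_PiE[symmetric]) auto
  also have "... = 1"
  proof (intro prod.neutral ballI bump_partition)
    fix i
    show "\<bar>x $ i / h\<bar> \<le> of_int N - 1" using x[of i] h by (simp add: abs_divide field_simps)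
  qed
  finally show ?thesis .
qed

text \<open>The argument \<open>y - x\<close> makes this the integral of \<open>w\<close> against a translate of \<open>\<phi>\<close>, which is the form in
  which weak derivatives are tested. The price is a sign for each differentiation.\<close>

definition conv :: "(real^'n::finite => real) => (real^'n => real) => real^'n => real" where
  "conv w \<phi> x = (LINT y|lborel. w y * \<phi> (y - x))"

lemma conv_integrable:
  fixes \<phi> :: "real^'n::finite => real"
  assumes w: "integrable lborel w" and \<phi>: "continuous_on UNIV \<phi>" "\<And>y. \<bar>\<phi> y\<bar> \<le> B"
  shows "integrable lborel (\<lambda>y. w y * \<phi> (y - x))"
proof (rule Bochner_Integration.integrable_bound[of _ "\<lambda>y. B * w y"])
  have [measurable]: "\<phi> \<in> borel_measurable borel" by (rule borel_measurable_continuous_onI[OF \<phi>(1)])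
  show "(\<lambda>y. w y * \<phi> (y - x)) \<in> borel_measurable lborel" using w by measurable
  have B: "0 \<le> B" using \<phi>(2)[of undefined] by linarith
  show "AE y in lborel. norm (w y * \<phi> (y - x)) \<le> norm (B * w y)"
    using \<phi>(2) B by (auto simp: abs_mult mult.commute[of "\<bar>w _\<bar>"] intro!: mult_right_mono)
qed (use w in simp)

lemma conv_continuous:
  fixes \<phi> :: "real^'n::finite => real"
  assumes w: "integrable lborel w" and \<phi>: "continuous_on UNIV \<phi>" "\<And>y. \<bar>\<phi> y\<bar> \<le> B"
  shows "continuous_on UNIV (conv w \<phi>)"
  unfolding continuous_on_sequentially
proof (intro ballI allI impI, elim conjE)
  fix x and X :: "nat => real^'n" assume X: "X \<longlonglongrightarrow> x"
  have [measurable]: "\<phi> \<in> borel_measurable borel" by (rule borel_measurable_continuous_onI[OF \<phi>(1)])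
  have B: "0 \<le> B" using \<phi>(2)[of undefined] by linarith
  have "(\<lambda>n. LINT y|lborel. w y * \<phi> (y - X n)) \<longlonglongrightarrow> (LINT y|lborel. w y * \<phi> (y - x))"
  proof (rule integral_dominated_convergence[of _ _ _ "\<lambda>y. B * \<bar>w y\<bar>"])
    show "AE y in lborel. (\<lambda>n. w y * \<phi> (y - X n)) \<longlonglongrightarrow> w y * \<phi> (y - x)"
    proof (intro AE_I2 tendsto_intros)
      fix y
      have "isCont \<phi> (y - x)" using \<phi>(1) by (simp add: continuous_on_eq_continuous_at)
      then show "(\<lambda>n. \<phi> (y - X n)) \<longlonglongrightarrow> \<phi> (y - x)"
        by (rule isCont_tendsto_compose) (intro tendsto_intros X)
    qed
    show "AE y in lborel. norm (w y * \<phi> (y - X n)) \<le> B * \<bar>w y\<bar>" for n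
      using \<phi>(2) by (auto simp: abs_mult mult.commute[of "\<bar>w _\<bar>"] intro!: mult_right_mono)
    show "integrable lborel (\<lambda>y. B * \<bar>w y\<bar>)" using w by auto
    show "(\<lambda>y. w y * \<phi> (y - x)) \<in> borel_measurable lborel" using w by measurable
    show "(\<lambda>y. w y * \<phi> (y - X n)) \<in> borel_measurable lborel" for n using w by measurable
  qed
  then show "(conv w \<phi> \<circ> X) \<longlonglongrightarrow> conv w \<phi> x" unfolding conv_def o_def .
qed

lemma conv_derivative:
  fixes \<phi> \<phi>' :: "real^'n::finite => real"
  assumes w: "integrable lborel w" and \<phi>: "continuous_on UNIV \<phi>" "\<And>y. \<bar>\<phi> y\<bar> \<le> B"
    and \<phi>': "continuous_on UNIV \<phi>'" "\<And>y. \<bar>\<phi>' y\<bar> \<le> B"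
    and der: "\<And>y t. ((\<lambda>t. \<phi> (y + t *\<^sub>R axis i 1)) has_real_derivative \<phi>' (y + t *\<^sub>R axis i 1)) (at t)"
  shows "((\<lambda>t. conv w \<phi> (x + t *\<^sub>R axis i 1)) has_real_derivative - conv w \<phi>' x) (at 0)"
  unfolding DERIV_def tendsto_at_iff_sequentially
proof (intro allI impI)
  fix X :: "nat => real" assume X: "\<forall>n. X n \<in> UNIV - {0}" "X \<longlonglongrightarrow> 0"
  have [measurable]: "\<phi> \<in> borel_measurable borel" "\<phi>' \<in> borel_measurable borel"
    by (auto intro: borel_measurable_continuous_onI \<phi> \<phi>')
  define q where "q n y = w y * ((\<phi> (y - (x + X n *\<^sub>R axis i 1)) - \<phi> (y - x)) / X n)" for n y
  have B: "0 \<le> B" using \<phi>(2)[of undefined] by linarith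
  have lip: "\<bar>\<phi> (y + t *\<^sub>R axis i 1) - \<phi> y\<bar> \<le> B * \<bar>t\<bar>" for y t
  proof -
    have "norm (\<phi> (y + t *\<^sub>R axis i 1) - \<phi> (y + 0 *\<^sub>R axis i 1)) \<le> B * norm (t - 0)"
      by (rule field_differentiable_bound[of UNIV]) (use der \<phi>'(2) in auto)
    then show ?thesis by simp
  qed
  have qb: "\<bar>q n y\<bar> \<le> B * \<bar>w y\<bar>" for n y
  proof -
    have "\<bar>\<phi> (y - (x + X n *\<^sub>R axis i 1)) - \<phi> (y - x)\<bar> \<le> B * \<bar>X n\<bar>"
      using lip[of "y - x" "- X n"] by (simp add: algebra_simps)
    then have "\<bar>(\<phi> (y - (x + X n *\<^sub>R axis i 1)) - \<phi> (y - x)) / X n\<bar> \<le> B"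
      using X(1)[rule_format, of n] by (simp add: divide_le_eq)
    then have "\<bar>w y\<bar> * \<bar>(\<phi> (y - (x + X n *\<^sub>R axis i 1)) - \<phi> (y - x)) / X n\<bar> \<le> \<bar>w y\<bar> * B"
      by (rule mult_left_mono) simp
    then show ?thesis unfolding q_def abs_mult by (simp add: mult.commute)
  qed
  have "(\<lambda>n. LINT y|lborel. q n y) \<longlonglongrightarrow> (LINT y|lborel. w y * - \<phi>' (y - x))"
  proof (rule integral_dominated_convergence[of _ _ _ "\<lambda>y. B * \<bar>w y\<bar>"])
    show "AE y in lborel. (\<lambda>n. q n y) \<longlonglongrightarrow> w y * - \<phi>' (y - x)"
    proof (intro AE_I2)
      fix y
      have "((\<lambda>h. (\<phi> (y - x + h *\<^sub>R axis i 1) - \<phi> (y - x)) / h) \<longlongrightarrow> \<phi>' (y - x)) (at 0)"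
        using der[of "y - x" 0] unfolding DERIV_def by simp
      then have "((\<lambda>h. (\<phi> (y - x + h *\<^sub>R axis i 1) - \<phi> (y - x)) / h) \<circ> (\<lambda>n. - X n)) \<longlonglongrightarrow> \<phi>' (y - x)"
        unfolding tendsto_at_iff_sequentially using X tendsto_minus[OF X(2)] by simp
      then have "(\<lambda>n. w y * - ((\<phi> (y - x + (- X n) *\<^sub>R axis i 1) - \<phi> (y - x)) / (- X n))) \<longlonglongrightarrow> w y * - \<phi>' (y - x)"
        unfolding o_def by (intro tendsto_intros)
      then show "(\<lambda>n. q n y) \<longlonglongrightarrow> w y * - \<phi>' (y - x)" unfolding q_def by (simp add: algebra_simps)
    qed
    show "AE y in lborel. norm (q n y) \<le> B * \<bar>w y\<bar>" for n using qb by auto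
    show "integrable lborel (\<lambda>y. B * \<bar>w y\<bar>)" using w by auto
    show "(\<lambda>y. w y * - \<phi>' (y - x)) \<in> borel_measurable lborel" using w by measurable
    show "(\<lambda>y. q n y) \<in> borel_measurable lborel" for n unfolding q_def using w by measurable
  qed
  also have "(LINT y|lborel. w y * - \<phi>' (y - x)) = - conv w \<phi>' x" unfolding conv_def by simp
  also have "(\<lambda>n. LINT y|lborel. q n y) = (\<lambda>n. (conv w \<phi> (x + X n *\<^sub>R axis i 1) - conv w \<phi> x) / X n)"
  proof
    fix n
    have "(LINT y|lborel. q n y) = (LINT y|lborel. (w y * \<phi> (y - (x + X n *\<^sub>R axis i 1)) - w y * \<phi> (y - x)) / X n)"
      unfolding q_def by (simp add: algebra_simps diff_divide_distrib)
    also have "... = (conv w \<phi> (x + X n *\<^sub>R axis i 1) - conv w \<phi> x) / X n"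
      unfolding conv_def using conv_integrable[OF w \<phi>] by (simp add: Bochner_Integration.integral_diff)
    finally show "(LINT y|lborel. q n y) = (conv w \<phi> (x + X n *\<^sub>R axis i 1) - conv w \<phi> x) / X n" .
  qed
  finally show "((\<lambda>h. (conv w \<phi> (x + (0 + h) *\<^sub>R axis i 1) - conv w \<phi> (x + 0 *\<^sub>R axis i 1)) / h) \<circ> X) \<longlonglongrightarrow> - conv w \<phi>' x"
    unfolding o_def by simp
qed

lemma cutoff_bounded: "0 < h ==> \<exists>B. \<forall>x. \<bar>cutoff h c \<alpha> x\<bar> \<le> B"
  using cutoff_bound[OF _ order.refl] by blast

lemma conv_cutoff_derivative:
  fixes w :: "real^'n::finite => real"
  assumes w: "integrable lborel w" and h: "0 < h"
  shows "((\<lambda>t. conv w (cutoff h 0 \<alpha>) (x + t *\<^sub>R axis i 1)) has_real_derivative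
     - conv w (cutoff h 0 (\<alpha>(i := Suc (\<alpha> i)))) x) (at 0)"
proof -
  obtain B B' where B: "\<And>y. \<bar>cutoff h 0 \<alpha> y\<bar> \<le> B" "\<And>y. \<bar>cutoff h 0 (\<alpha>(i := Suc (\<alpha> i))) y\<bar> \<le> B'"
    using cutoff_bounded[OF h] by metis
  show ?thesis
  proof (rule conv_derivative[OF w cutoff_continuous[OF h] _ cutoff_continuous[OF h], where B = "max B B'"])
    show "((\<lambda>t. cutoff h 0 \<alpha> (y + t *\<^sub>R axis i 1)) has_real_derivative
        cutoff h 0 (\<alpha>(i := Suc (\<alpha> i))) (y + t *\<^sub>R axis i 1)) (at t)" for y t
      unfolding cutoff_def by (rule tensor_partial[OF ladder_scaled[OF h]])
  qed (use B in \<open>auto simp: le_max_iff_disj\<close>)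
qed

lemma conv_cutoff_smooth:
  fixes w :: "real^'n::finite => real"
  assumes w: "integrable lborel w" and h: "0 < h"
  shows "conv w (cutoff h 0 \<alpha>) \<in> smooth UNIV"
proof (rule smooth_coinduct[OF open_UNIV, where P = "{\<lambda>x. c * conv w (cutoff h 0 \<alpha>) x | c \<alpha>. True}"])
  show "conv w (cutoff h 0 \<alpha>) \<in> {\<lambda>x. c * conv w (cutoff h 0 \<alpha>) x | c \<alpha>. True}"
    by (auto intro!: exI[of _ 1] exI[of _ \<alpha>])
  fix g i assume "g \<in> {\<lambda>x. c * conv w (cutoff h 0 \<alpha>) x | c \<alpha>. True}"
  then obtain c \<beta> where g: "g = (\<lambda>x. c * conv w (cutoff h 0 \<beta>) x)" by blast
  obtain B where B: "\<And>y. \<bar>cutoff h 0 \<beta> y\<bar> \<le> B" using cutoff_bounded[OF h] by metis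
  show "continuous_on UNIV g" unfolding g
    by (intro continuous_intros conv_continuous[OF w cutoff_continuous[OF h] B])
  have "((\<lambda>t. g (x + t *\<^sub>R axis i 1)) has_real_derivative (- c) * conv w (cutoff h 0 (\<beta>(i := Suc (\<beta> i)))) x) (at 0)" for x
    unfolding g using DERIV_cmult[OF conv_cutoff_derivative[OF w h, of \<beta> x i], of c] by simp
  then show "\<exists>h'\<in>{\<lambda>x. c * conv w (cutoff h 0 \<alpha>) x | c \<alpha>. True}.
      \<forall>x\<in>UNIV. ((\<lambda>t. g (x + t *\<^sub>R axis i 1)) has_real_derivative h' x) (at 0)"
    by (intro bexI[of _ "\<lambda>x. (- c) * conv w (cutoff h 0 (\<beta>(i := Suc (\<beta> i)))) x"]) blast+
qed

lemma D_conv_cutoff: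
  fixes w :: "real^'n::finite => real"
  assumes w: "integrable lborel w" and h: "0 < h"
  shows "D is (conv w (cutoff h 0 (\<lambda>_. 0))) x = (-1) ^ length is * conv w (cutoff h 0 (count_list is)) x"
proof (induction "is" arbitrary: x)
  case (Cons i "is")
  have "D (i # is) (conv w (cutoff h 0 (\<lambda>_. 0))) x = partial i (\<lambda>x. (-1) ^ length is * conv w (cutoff h 0 (count_list is)) x) x"
    unfolding foldr.simps o_apply by (rule partial_cong(1)[OF open_UNIV]) (auto simp: Cons.IH)
  also have "... = (-1) ^ length is * - conv w (cutoff h 0 ((count_list is)(i := Suc (count_list is i)))) x"
    by (rule partialI(2)[OF DERIV_cmult[OF conv_cutoff_derivative[OF w h]]])
  also have "(count_list is)(i := Suc (count_list is i)) = count_list (i # is)" by (auto simp: fun_eq_iff)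
  finally show ?case by simp
next
  case Nil
  have "count_list [] = (\<lambda>_ :: 'n. 0)" by (simp add: fun_eq_iff)
  then show ?case by simp
qed


section \<open>Integration by parts\<close>

lemma smooth_line_derivative:
  assumes "f \<in> smooth S" "x + t *\<^sub>R axis i 1 \<in> S"
  shows "((\<lambda>t. f (x + t *\<^sub>R axis i 1)) has_real_derivative partial i f (x + t *\<^sub>R axis i 1)) (at t)"
proof -
  have "((\<lambda>s. f (x + (s + t) *\<^sub>R axis i 1)) has_real_derivative partial i f (x + t *\<^sub>R axis i 1)) (at 0)"
    using has_partial[OF smooth_line_diff[OF assms]] by (simp add: algebra_simps)
  then show ?thesis using DERIV_shift[of "\<lambda>s. f (x + s *\<^sub>R axis i 1)" _ 0 t] by simp
qed

lemma compact_support_bounded: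
  fixes f :: "'a::metric_space => real"
  assumes "continuous_on UNIV f" "compact K" "\<And>x. x \<notin> K ==> f x = 0"
  obtains B where "\<And>x. \<bar>f x\<bar> \<le> B"
proof -
  have "compact (f ` K)" by (intro compact_continuous_image continuous_on_subset[OF assms(1)] assms(2)) auto
  then obtain B where B: "\<And>x. x \<in> K ==> \<bar>f x\<bar> \<le> B"
    using compact_imp_bounded bounded_iff by (metis image_eqI real_norm_def)
  have "\<bar>f x\<bar> \<le> max B 0" for x
  proof (cases "x \<in> K")
    case True then show ?thesis using B[of x] by simp
  qed (use assms(3) in simp)
  then show ?thesis by (rule that)
qed

lemma compact_support_integrable:
  fixes f :: "'a::euclidean_space => real"
  assumes "continuous_on UNIV f" "compact K" "\<And>x. x \<notin> K ==> f x = 0"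
  shows "integrable lborel f"
proof -
  have "integrable lborel (\<lambda>x. indicator K x *\<^sub>R f x)"
    by (rule borel_integrable_compact[OF assms(2)]) (rule continuous_on_subset[OF assms(1)], simp)
  also have "(\<lambda>x. indicator K x *\<^sub>R f x) = f" using assms(3) by (auto simp: indicator_def fun_eq_iff)
  finally show ?thesis .
qed

lemma integral_translation:
  fixes f :: "'a::euclidean_space => real"
  assumes "f \<in> borel_measurable borel"
  shows "(LINT y|lborel. f (y - x)) = (LINT y|lborel. f y)"
proof -
  have "(LINT y|lborel. f y) = (LINT y|distr lborel borel ((+) (- x)). f y)"
    unfolding lborel_distr_plus ..
  also have "... = (LINT y|lborel. f (- x + y))" by (rule integral_distr) (use assms in auto)
  finally show ?thesis by (simp add: algebra_simps)
qed

text \<open>A compactly supported function has the same integral as its translates, so the integral of a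
  partial derivative vanishes.\<close>

lemma integral_partial_zero:
  fixes f :: "real^'n::finite => real"
  assumes f: "f \<in> smooth UNIV" and K: "compact K" "\<And>x. x \<notin> K ==> f x = 0"
  shows "(LINT x|lborel. partial i f x) = 0"
proof -
  have f0: "partial i f x = 0" if "x \<notin> K" for x
    using partial_cong(1)[of "- K" x f "\<lambda>_. 0" i] that K compact_imp_closed by auto
  have cf: "continuous_on UNIV f" "continuous_on UNIV (partial i f)"
    using smooth_continuous smooth_partial f by blast+
  obtain B B' where B: "\<And>x. \<bar>f x\<bar> \<le> B" "\<And>x. \<bar>partial i f x\<bar> \<le> B'"
    using compact_support_bounded[OF cf(1) K] compact_support_bounded[OF cf(2) K(1) f0] by metis
  obtain R where R: "\<And>x. x \<in> K ==> norm x \<le> R" using compact_imp_bounded[OF K(1)] bounded_iff by metis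
  define w :: "real^'n => real" where "w = indicator (ball 0 (R + 1))"
  have w: "integrable lborel w" unfolding w_def by (rule integrable_real_indicator) (auto simp: emeasure_lborel_ball_finite[unfolded infinity_ennreal_def])
  have in_ball: "w y * g (y - x) = g (y - x)" if "norm x < 1" "\<And>y. y \<notin> K ==> g y = 0" for x y and g :: "real^'n => real"
  proof (cases "y - x \<in> K")
    case True
    then have "norm (y - x) \<le> R" by (rule R)
    then have "norm y < R + 1" using that(1) norm_triangle_ineq[of "y - x" x] by simp
    then show ?thesis unfolding w_def by (simp add: indicator_def)
  qed (use that in simp)
  have const: "conv w f x = (LINT y|lborel. f y)" if "norm x < 1" for x
  proof -
    have "(\<lambda>y. w y * f (y - x)) = (\<lambda>y. f (y - x))" by (rule ext) (rule in_ball[OF that K(2)])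
    then show ?thesis unfolding conv_def
      using integral_translation[OF borel_measurable_continuous_onI[OF cf(1)]] by simp
  qed
  have "((\<lambda>t. conv w f (0 + t *\<^sub>R axis i 1)) has_real_derivative - conv w (partial i f) 0) (at 0)"
    by (rule conv_derivative[OF w cf(1) _ cf(2) _ smooth_line_derivative[OF f], where B = "max B B'"])
       (use B in \<open>auto simp: le_max_iff_disj\<close>)
  moreover have "((\<lambda>t. conv w f (0 + t *\<^sub>R axis i 1)) has_real_derivative 0) (at 0)"
  proof (rule has_field_derivative_transform_within_open)
    show "((\<lambda>t :: real. LINT y|lborel. f y) has_real_derivative 0) (at 0)" by simp
    show "open {-1<..<1 :: real}" "0 \<in> {-1<..<1 :: real}" by auto
    show "(LINT y|lborel. f y) = conv w f (0 + t *\<^sub>R axis i 1)" if "t \<in> {-1<..<1}" for t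
      using that by (subst const) auto
  qed
  ultimately have "conv w (partial i f) 0 = 0" using DERIV_unique by fastforce
  moreover have "(\<lambda>y. w y * partial i f (y - 0)) = partial i f"
    using in_ball[of 0 "partial i f", OF _ f0] by (intro ext) simp
  ultimately show ?thesis unfolding conv_def by simp
qed

definition support :: "(real^'n::finite => real) => (real^'n) set" where
  "support \<phi> = closure {x. \<phi> x \<noteq> 0}"

lemma not_in_support: "x \<notin> support \<phi> ==> \<phi> x = 0"
  unfolding support_def using closure_subset[of "{x. \<phi> x \<noteq> 0}"] by blast

lemma test_functions_iff: "\<phi> \<in> test_functions \<Omega> \<longleftrightarrow> \<phi> \<in> smooth UNIV \<and> compact (support \<phi>) \<and> support \<phi> \<subseteq> \<Omega>"
  unfolding test_functions_def support_def by simp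

lemma test_functionI:
  assumes "\<phi> \<in> smooth UNIV" "compact K" "K \<subseteq> \<Omega>" "\<And>x. x \<notin> K ==> \<phi> x = 0"
  shows "\<phi> \<in> test_functions \<Omega>"
proof -
  have "support \<phi> \<subseteq> K" unfolding support_def
    by (rule closure_minimal) (use assms compact_imp_closed in auto)
  moreover have "compact (support \<phi>)" unfolding support_def
    using bounded_subset[OF compact_imp_bounded[OF assms(2)], of "{x. \<phi> x \<noteq> 0}"] assms(4) by auto
  ultimately show ?thesis unfolding test_functions_iff using assms(1,3) by blast
qed

lemma test_partial: assumes "\<phi> \<in> test_functions \<Omega>" shows "partial i \<phi> \<in> test_functions \<Omega>"
proof (rule test_functionI[of _ "support \<phi>"])
  fix x assume x: "x \<notin> support \<phi>"
  have "open (- support \<phi>)" unfolding support_def by auto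
  then show "partial i \<phi> x = 0"
    using partial_cong(1)[of "- support \<phi>" x \<phi> "\<lambda>_. 0" i] x not_in_support by auto
qed (use assms smooth_partial in \<open>auto simp: test_functions_iff\<close>)

lemma test_D: "\<phi> \<in> test_functions \<Omega> ==> D is \<phi> \<in> test_functions \<Omega>"
  by (induction "is") (auto intro: test_partial)

text \<open>The product of a function that is smooth on \<open>\<Omega>\<close> with a test function, extended by zero, is smooth on
  the whole space, so that integration by parts takes place there.\<close>

definition extend0 :: "(real^'n::finite) set => (real^'n => real) => real^'n => real" where
  "extend0 \<Omega> f x = (if x \<in> \<Omega> then f x else 0)"

lemma extend0_smooth:
  assumes \<Omega>: "open \<Omega>" and u: "u \<in> smooth \<Omega>" and \<phi>: "\<phi> \<in> test_functions \<Omega>"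
  shows "extend0 \<Omega> (\<lambda>x. u x * \<phi> x) \<in> smooth UNIV" "\<And>x. x \<notin> support \<phi> ==> extend0 \<Omega> (\<lambda>x. u x * \<phi> x) x = 0"
proof -
  show out: "\<And>x. x \<notin> support \<phi> ==> extend0 \<Omega> (\<lambda>x. u x * \<phi> x) x = 0"
    unfolding extend0_def using not_in_support by auto
  show "extend0 \<Omega> (\<lambda>x. u x * \<phi> x) \<in> smooth UNIV"
  proof (rule smooth_local)
    fix x :: "real^'a"
    show "\<exists>B. open B \<and> x \<in> B \<and> extend0 \<Omega> (\<lambda>x. u x * \<phi> x) \<in> smooth B"
    proof (cases "x \<in> \<Omega>")
      case True
      have "\<phi> \<in> smooth \<Omega>" using \<phi> smooth_subset[of \<phi> UNIV \<Omega>] unfolding test_functions_iff by simp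
      from smooth_mult[OF \<Omega> u this] have "extend0 \<Omega> (\<lambda>x. u x * \<phi> x) \<in> smooth \<Omega>"
        by (rule smooth_cong[OF \<Omega>]) (simp add: extend0_def)
      then show ?thesis using True \<Omega> by blast
    next
      case False
      have "open (- support \<phi>)" unfolding support_def by auto
      moreover from this have "extend0 \<Omega> (\<lambda>x. u x * \<phi> x) \<in> smooth (- support \<phi>)"
        by (rule smooth_cong[OF _ smooth_const[of 0]]) (use out in auto)
      moreover have "x \<in> - support \<phi>" using False \<phi> unfolding test_functions_iff by blast
      ultimately show ?thesis by blast
    qed
  qed
qed

lemma integral_extend0:
  assumes \<Omega>: "open \<Omega>" and c: "continuous_on UNIV (extend0 \<Omega> f)"
  shows "(LINT x|lebesgue_on \<Omega>. f x) = (LINT x|lborel. extend0 \<Omega> f x)"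
proof -
  have "(LINT x|lebesgue_on \<Omega>. f x) = (LINT x|lebesgue. indicator \<Omega> x *\<^sub>R f x)"
    using \<Omega> by (intro integral_restrict_space) auto
  also have "(\<lambda>x. indicator \<Omega> x *\<^sub>R f x) = extend0 \<Omega> f" unfolding extend0_def by (auto simp: indicator_def)
  also have "(LINT x|lebesgue. extend0 \<Omega> f x) = (LINT x|lborel. extend0 \<Omega> f x)"
    by (rule integral_completion) (use borel_measurable_continuous_onI[OF c] in simp)
  finally show ?thesis .
qed

lemma integration_by_parts:
  assumes \<Omega>: "open \<Omega>" and v: "v \<in> smooth \<Omega>" and \<phi>: "\<phi> \<in> test_functions \<Omega>"
  shows "(LINT x|lebesgue_on \<Omega>. v x * partial i \<phi> x) = - (LINT x|lebesgue_on \<Omega>. partial i v x * \<phi> x)"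
proof -
  let ?F = "extend0 \<Omega> (\<lambda>x. v x * \<phi> x)" and ?F1 = "extend0 \<Omega> (\<lambda>x. v x * partial i \<phi> x)"
    and ?F2 = "extend0 \<Omega> (\<lambda>x. partial i v x * \<phi> x)"
  have \<phi>': "partial i \<phi> \<in> test_functions \<Omega>" and v': "partial i v \<in> smooth \<Omega>"
    using test_partial[OF \<phi>] smooth_partial[OF v] by auto
  note F = extend0_smooth[OF \<Omega> v \<phi>] and F1 = extend0_smooth[OF \<Omega> v \<phi>'] and F2 = extend0_smooth[OF \<Omega> v' \<phi>]
  have K: "compact (support \<phi>)" "compact (support (partial i \<phi>))" using \<phi> \<phi>' unfolding test_functions_iff by auto
  have c: "continuous_on UNIV ?F1" "continuous_on UNIV ?F2" using F1(1) F2(1) smooth_continuous by blast+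
  have int: "integrable lborel ?F1" "integrable lborel ?F2"
    using compact_support_integrable[OF c(1) K(2) F1(2)] compact_support_integrable[OF c(2) K(1) F2(2)] by auto
  have "partial i ?F x = ?F1 x + ?F2 x" for x
  proof (cases "x \<in> \<Omega>")
    case True
    have "partial i ?F x = partial i (\<lambda>x. v x * \<phi> x) x"
      by (rule partial_cong(1)[OF \<Omega> True]) (simp add: extend0_def)
    also have "... = partial i v x * \<phi> x + v x * partial i \<phi> x"
      by (rule partial_mult(2)[OF smooth_line_diff[OF v True] smooth_line_diff[of \<phi> UNIV]])
         (use \<phi> in \<open>auto simp: test_functions_iff\<close>)
    finally show ?thesis using True unfolding extend0_def by simp
  next
    case False
    have "open (- support \<phi>)" unfolding support_def by auto
    moreover have "x \<in> - support \<phi>" using False \<phi> unfolding test_functions_iff by blast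
    ultimately have "partial i ?F x = partial i (\<lambda>_. 0) x" by (rule partial_cong(1)) (use F(2) in auto)
    then show ?thesis using False unfolding extend0_def by simp
  qed
  then have "(LINT x|lborel. ?F1 x + ?F2 x) = 0" using integral_partial_zero[OF F(1) K(1) F(2), of i] by simp
  then have "(LINT x|lborel. ?F1 x) + (LINT x|lborel. ?F2 x) = 0"
    by (subst (asm) Bochner_Integration.integral_add[OF int]) simp
  then show ?thesis unfolding integral_extend0[OF \<Omega> c(1)] integral_extend0[OF \<Omega> c(2)] by simp
qed

lemma integration_by_parts_D:
  assumes \<Omega>: "open \<Omega>" and \<phi>: "\<phi> \<in> test_functions \<Omega>"
  shows "v \<in> smooth \<Omega> ==>
    (LINT x|lebesgue_on \<Omega>. v x * D is \<phi> x) = (-1) ^ length is * (LINT x|lebesgue_on \<Omega>. D (rev is) v x * \<phi> x)"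
proof (induction "is" arbitrary: v)
  case (Cons i "is")
  have "(LINT x|lebesgue_on \<Omega>. v x * D (i # is) \<phi> x) = - (LINT x|lebesgue_on \<Omega>. partial i v x * D is \<phi> x)"
    using integration_by_parts[OF \<Omega> Cons.prems test_D[OF \<phi>], of i "is"] by simp
  then show ?case using Cons.IH[OF smooth_partial[OF Cons.prems]] by simp
qed simp

lemma L1_loc_continuous:
  assumes "continuous_on \<Omega> (f :: real^'n::finite => real)" shows "f \<in> L1_loc \<Omega>"
  unfolding L1_loc_def mem_Collect_eq
proof (intro allI impI, elim conjE)
  fix K :: "(real^'n) set" assume K: "compact K" "K \<subseteq> \<Omega>"
  have i: "integrable lborel (\<lambda>x. indicator K x *\<^sub>R f x)"
    by (rule borel_integrable_compact[OF K(1) continuous_on_subset[OF assms K(2)]])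
  show "f absolutely_integrable_on K" unfolding set_integrable_def
    using integrable_completion[OF borel_measurable_integrable[OF i]] i by blast
qed

lemma is_weak_deriv_smooth:
  assumes \<Omega>: "open \<Omega>" and v: "v \<in> smooth \<Omega>"
  shows "is_weak_deriv \<Omega> \<alpha> v (D (rev (multi_list \<alpha>)) v)"
  unfolding is_weak_deriv_def classical_deriv_D
proof (intro conjI ballI)
  show "v \<in> L1_loc \<Omega>" "D (rev (multi_list \<alpha>)) v \<in> L1_loc \<Omega>"
    by (intro L1_loc_continuous smooth_continuous smooth_D v)+
  fix \<phi> assume "\<phi> \<in> test_functions \<Omega>"
  from integration_by_parts_D[OF \<Omega> this v, of "multi_list \<alpha>"]
  show "(LINT x|lebesgue_on \<Omega>. v x * D (multi_list \<alpha>) \<phi> x) =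
      (- 1) ^ order_of \<alpha> * (LINT x|lebesgue_on \<Omega>. D (rev (multi_list \<alpha>)) v x * \<phi> x)"
    unfolding length_multi_list .
qed


section \<open>Mollification\<close>

lemma powr_tangent:
  fixes a t p :: real
  assumes p: "1 \<le> p" and a: "0 < a" and t: "0 \<le> t"
  shows "a powr p + p * a powr (p - 1) * (t - a) \<le> t powr p"
proof (cases "t = 0")
  case True
  have "a powr (p - 1) * a = a powr p" using a by (simp add: powr_mult_base[of a "p - 1"] mult.commute)
  then have "a powr p + p * a powr (p - 1) * (t - a) = (1 - p) * a powr p" using True by (simp add: algebra_simps)
  also have "... \<le> 0" using p by (simp add: mult_nonpos_nonneg)
  finally show ?thesis using True by simp
next
  case False
  have "t powr p - a powr p \<ge> (p * a powr (p - 1)) * (t - a)"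
  proof (rule convex_on_imp_above_tangent[OF powr_convex[OF p]])
    show "((\<lambda>x. x powr p) has_real_derivative p * a powr (p - 1)) (at a within {0<..})"
      using a by (auto intro!: derivative_eq_intros)
  qed (use a t False in \<open>auto simp: interior_open\<close>)
  then show ?thesis by simp
qed

lemma powr_sum_le:
  fixes a b p :: real
  assumes "0 \<le> p" shows "\<bar>a + b\<bar> powr p \<le> 2 powr p * (\<bar>a\<bar> powr p + \<bar>b\<bar> powr p)"
proof -
  have "\<bar>a + b\<bar> powr p \<le> (2 * max \<bar>a\<bar> \<bar>b\<bar>) powr p" using assms by (intro powr_mono2) auto
  also have "... = 2 powr p * max \<bar>a\<bar> \<bar>b\<bar> powr p" by (simp add: powr_mult)
  also have "... \<le> 2 powr p * (\<bar>a\<bar> powr p + \<bar>b\<bar> powr p)" by (intro mult_left_mono) (auto simp: max_def)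
  finally show ?thesis .
qed

text \<open>The tangent of \<open>t powr p\<close> at the mean \<open>a\<close> of the absolute values lies below the function.\<close>

lemma jensen_kernel:
  fixes w \<kappa> :: "'a::euclidean_space => real"
  assumes p: "1 \<le> p" and [measurable]: "w \<in> borel_measurable borel"
    and \<kappa>: "integrable lborel \<kappa>" "\<And>y. 0 \<le> \<kappa> y" "(LINT y|lborel. \<kappa> y) = 1"
  shows "ennreal (\<bar>LINT y|lborel. w y * \<kappa> y\<bar> powr p) \<le> (\<integral>\<^sup>+y. ennreal (\<bar>w y\<bar> powr p * \<kappa> y) \<partial>lborel)"
proof (cases "(\<integral>\<^sup>+y. ennreal (\<bar>w y\<bar> powr p * \<kappa> y) \<partial>lborel) = \<infinity>")
  case False
  have [measurable]: "\<kappa> \<in> borel_measurable borel" using \<kappa>(1) by auto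
  have ip: "integrable lborel (\<lambda>y. \<bar>w y\<bar> powr p * \<kappa> y)"
    by (rule integrableI_nonneg) (use False \<kappa>(2) in \<open>auto simp: top.not_eq_extremum\<close>)
  have le1: "\<bar>w y\<bar> \<le> 1 + \<bar>w y\<bar> powr p" for y
  proof (cases "\<bar>w y\<bar> \<le> 1")
    case True then show ?thesis by (simp add: add_increasing2)
  next
    case False
    then have "\<bar>w y\<bar> powr 1 \<le> \<bar>w y\<bar> powr p" using p by (intro powr_mono) auto
    then show ?thesis using False by simp
  qed
  have i1: "integrable lborel (\<lambda>y. \<bar>w y\<bar> * \<kappa> y)"
  proof (rule Bochner_Integration.integrable_bound[of _ "\<lambda>y. \<kappa> y + \<bar>w y\<bar> powr p * \<kappa> y"])
    show "integrable lborel (\<lambda>y. \<kappa> y + \<bar>w y\<bar> powr p * \<kappa> y)" using \<kappa>(1) ip by simp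
    have "\<bar>w y\<bar> * \<kappa> y \<le> \<kappa> y + \<bar>w y\<bar> powr p * \<kappa> y" for y
      using mult_right_mono[OF le1 \<kappa>(2), of y y] by (simp add: algebra_simps)
    then show "AE y in lborel. norm (\<bar>w y\<bar> * \<kappa> y) \<le> norm (\<kappa> y + \<bar>w y\<bar> powr p * \<kappa> y)" using \<kappa>(2) by auto
  qed simp
  define a where "a = (LINT y|lborel. \<bar>w y\<bar> * \<kappa> y)"
  have "\<bar>LINT y|lborel. w y * \<kappa> y\<bar> \<le> a"
    unfolding a_def using integral_norm_bound[of lborel "\<lambda>y. w y * \<kappa> y"] \<kappa>(2) by (simp add: abs_mult)
  then have 1: "\<bar>LINT y|lborel. w y * \<kappa> y\<bar> powr p \<le> a powr p" using p by (intro powr_mono2) auto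
  have a0: "0 \<le> a" unfolding a_def using \<kappa>(2) by (intro Bochner_Integration.integral_nonneg) auto
  have 2: "a powr p \<le> (LINT y|lborel. \<bar>w y\<bar> powr p * \<kappa> y)"
  proof (cases "a = 0")
    case True
    then show ?thesis using \<kappa>(2) by (auto intro!: Bochner_Integration.integral_nonneg)
  next
    case False
    let ?b = "p * a powr (p - 1)"
    have i2: "integrable lborel (\<lambda>y. (a powr p - ?b * a) * \<kappa> y + ?b * (\<bar>w y\<bar> * \<kappa> y))"
      using \<kappa>(1) i1 by (intro Bochner_Integration.integrable_add integrable_mult_right)
    have "a powr p = (a powr p - ?b * a) * 1 + ?b * a" by simp
    also have "... = (LINT y|lborel. (a powr p - ?b * a) * \<kappa> y + ?b * (\<bar>w y\<bar> * \<kappa> y))"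
      using \<kappa> i1 a_def by (subst Bochner_Integration.integral_add) auto
    also have "... \<le> (LINT y|lborel. \<bar>w y\<bar> powr p * \<kappa> y)"
    proof (rule integral_mono[OF i2 ip])
      fix y
      have "a powr p + ?b * (\<bar>w y\<bar> - a) \<le> \<bar>w y\<bar> powr p" by (rule powr_tangent[OF p]) (use False a0 in auto)
      from mult_right_mono[OF this \<kappa>(2), of y]
      show "(a powr p - ?b * a) * \<kappa> y + ?b * (\<bar>w y\<bar> * \<kappa> y) \<le> \<bar>w y\<bar> powr p * \<kappa> y" by (simp add: algebra_simps)
    qed
    finally show ?thesis .
  qed
  have "(\<integral>\<^sup>+y. ennreal (\<bar>w y\<bar> powr p * \<kappa> y) \<partial>lborel) = ennreal (LINT y|lborel. \<bar>w y\<bar> powr p * \<kappa> y)"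
    by (rule nn_integral_eq_integral[OF ip]) (use \<kappa>(2) in auto)
  then show ?thesis using 1 2 by (simp add: ennreal_leI)
qed simp

lemma nn_integral_reflect:
  fixes f :: "'a::euclidean_space => ennreal"
  assumes [measurable]: "f \<in> borel_measurable borel"
  shows "(\<integral>\<^sup>+x. f (y - x) \<partial>lborel) = (\<integral>\<^sup>+x. f x \<partial>lborel)"
proof -
  have "(lborel :: 'a measure) = density (distr lborel borel (\<lambda>x. y + (-1) *\<^sub>R x)) (\<lambda>_. ennreal (\<bar>-1\<bar>^DIM('a)))"
    by (rule lborel_affine) simp
  also have "... = distr lborel borel (\<lambda>x. y - x)" by (simp add: density_1)
  finally have e: "(lborel :: 'a measure) = distr lborel borel (\<lambda>x. y - x)" .
  have "(\<integral>\<^sup>+x. f x \<partial>lborel) = (\<integral>\<^sup>+x. f x \<partial>distr lborel borel (\<lambda>x. y - x))" using e by simp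
  also have "... = (\<integral>\<^sup>+x. f (y - x) \<partial>lborel)" by (subst nn_integral_distr) auto
  finally show ?thesis by simp
qed

lemma translate_integral_one:
  fixes \<kappa> :: "'a::euclidean_space => real"
  assumes "integrable lborel \<kappa>" "(LINT y|lborel. \<kappa> y) = 1"
  shows "integrable lborel (\<lambda>y. \<kappa> (y - x))" "(LINT y|lborel. \<kappa> (y - x)) = 1"
proof -
  show e: "(LINT y|lborel. \<kappa> (y - x)) = 1" using integral_translation[of \<kappa> x] assms by auto
  show "integrable lborel (\<lambda>y. \<kappa> (y - x))"
    using not_integrable_integral_eq[of lborel "\<lambda>y. \<kappa> (y - x)"] e by force
qed

lemma young_convolution:
  fixes w \<kappa> :: "real^'n::finite => real"
  assumes p: "1 \<le> p" and w[measurable]: "w \<in> borel_measurable borel"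
    and \<kappa>: "integrable lborel \<kappa>" "\<And>y. 0 \<le> \<kappa> y" "(LINT y|lborel. \<kappa> y) = 1"
  shows "ennreal (\<bar>conv w \<kappa> x\<bar> powr p) \<le> (\<integral>\<^sup>+y. ennreal (\<bar>w y\<bar> powr p * \<kappa> (y - x)) \<partial>lborel)"
    "(\<integral>\<^sup>+x. ennreal (\<bar>conv w \<kappa> x\<bar> powr p) \<partial>lborel) \<le> (\<integral>\<^sup>+y. ennreal (\<bar>w y\<bar> powr p) \<partial>lborel)"
proof -
  have [measurable]: "\<kappa> \<in> borel_measurable borel" using \<kappa>(1) by auto
  note sh = translate_integral_one[OF \<kappa>(1,3)]
  show j: "ennreal (\<bar>conv w \<kappa> x\<bar> powr p) \<le> (\<integral>\<^sup>+y. ennreal (\<bar>w y\<bar> powr p * \<kappa> (y - x)) \<partial>lborel)" for x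
    unfolding conv_def by (rule jensen_kernel[OF p w sh(1) \<kappa>(2) sh(2)])
  have "(\<integral>\<^sup>+x. ennreal (\<bar>conv w \<kappa> x\<bar> powr p) \<partial>lborel)
      \<le> (\<integral>\<^sup>+x. (\<integral>\<^sup>+y. ennreal (\<bar>w y\<bar> powr p * \<kappa> (y - x)) \<partial>lborel) \<partial>lborel)"
    by (rule nn_integral_mono) (rule j)
  also have "... = (\<integral>\<^sup>+y. (\<integral>\<^sup>+x. ennreal (\<bar>w y\<bar> powr p * \<kappa> (y - x)) \<partial>lborel) \<partial>lborel)"
    by (rule lborel_pair.Fubini') measurable
  also have "... = (\<integral>\<^sup>+y. ennreal (\<bar>w y\<bar> powr p) \<partial>lborel)"
  proof (rule nn_integral_cong)
    fix y
    have "(\<integral>\<^sup>+x. ennreal (\<bar>w y\<bar> powr p * \<kappa> (y - x)) \<partial>lborel) = ennreal (\<bar>w y\<bar> powr p) * (\<integral>\<^sup>+x. ennreal (\<kappa> (y - x)) \<partial>lborel)"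
      by (subst nn_integral_cmult[symmetric]) (auto simp: ennreal_mult' \<kappa>(2))
    also have "(\<integral>\<^sup>+x. ennreal (\<kappa> (y - x)) \<partial>lborel) = (\<integral>\<^sup>+x. ennreal (\<kappa> x) \<partial>lborel)"
      by (rule nn_integral_reflect) measurable
    also have "... = 1" using nn_integral_eq_integral[OF \<kappa>(1)] \<kappa>(2,3) by simp
    finally show "(\<integral>\<^sup>+x. ennreal (\<bar>w y\<bar> powr p * \<kappa> (y - x)) \<partial>lborel) = ennreal (\<bar>w y\<bar> powr p)" by simp
  qed
  finally show "(\<integral>\<^sup>+x. ennreal (\<bar>conv w \<kappa> x\<bar> powr p) \<partial>lborel) \<le> (\<integral>\<^sup>+y. ennreal (\<bar>w y\<bar> powr p) \<partial>lborel)" .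
qed

definition mass :: "'n::finite itself => real => real" where
  "mass _ \<rho> = (LINT y|lborel. cutoff \<rho> (0 :: real^'n) (\<lambda>_. 0) y)"

definition kernel :: "real => real^'n::finite => real" where
  "kernel \<rho> y = cutoff \<rho> 0 (\<lambda>_. 0) y / mass TYPE('n) \<rho>"

lemma cutoff_integrable: "0 < \<rho> ==> integrable lborel (cutoff \<rho> c \<alpha>)"
  by (rule compact_support_integrable[OF cutoff_continuous cube_closed_bounded cutoff_support]) auto

lemma measure_cube: "0 \<le> r ==> measure lborel (cube z r) = (2 * r) ^ CARD('n)" for z :: "real^'n::finite"
proof -
  assume r: "0 \<le> r"
  have e: "cube z r = cbox (\<chi> i. z $ i - r) (\<chi> i. z $ i + r)"
    unfolding cube_def by (auto simp: mem_box_cart abs_le_iff algebra_simps)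
  have "z \<in> cube z r" unfolding cube_def using r by simp
  then have "cbox (\<chi> i. z $ i - r) (\<chi> i. z $ i + r) \<noteq> {}" using e by auto
  then show ?thesis unfolding e by (subst content_cbox_cart) (auto simp: mult_2[symmetric])
qed

text \<open>The cutoffs centred at \<open>5 ^ n\<close> lattice points sum to one on a cube of side \<open>2 * \<rho>\<close>, and all of them
  have the same integral.\<close>

lemma mass_lower:
  assumes \<rho>: "0 < \<rho>" shows "(2 * \<rho>) ^ CARD('n) \<le> 5 ^ CARD('n) * mass TYPE('n::finite) \<rho>"
proof -
  let ?c = "cube (0 :: real^'n) \<rho>" and ?\<psi> = "\<lambda>m :: 'n => int. cutoff \<rho> (node \<rho> m) (\<lambda>_. 0)"
  have fin: "emeasure lborel ?c < \<infinity>" using emeasure_compact_finite[OF cube_closed_bounded] by simp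
  have "(2 * \<rho>) ^ CARD('n) = (LINT y|lborel. indicator ?c y)" using measure_cube[of \<rho> "0 :: real^'n"] \<rho> by simp
  also have "... \<le> (LINT y|lborel. (\<Sum>m\<in>grid 2. ?\<psi> m y))"
  proof (rule integral_mono)
    show "integrable lborel (\<lambda>y. indicator ?c y :: real)"
      by (rule integrable_real_indicator[OF _ fin]) (simp add: borel_compact cube_closed_bounded)
    show "integrable lborel (\<lambda>y. \<Sum>m\<in>grid 2. ?\<psi> m y)" by (intro Bochner_Integration.integrable_sum cutoff_integrable \<rho>)
    show "indicator ?c y \<le> (\<Sum>m\<in>grid 2. ?\<psi> m y)" for y
    proof (cases "y \<in> ?c")
      case True
      have "(\<Sum>m\<in>grid 2. ?\<psi> m y) = 1" by (rule cutoff_partition[OF \<rho>]) (use True in \<open>simp add: cube_def\<close>)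
      then show ?thesis using True by simp
    qed (simp add: sum_nonneg cutoff_nonneg)
  qed
  also have "... = (\<Sum>m\<in>grid 2. LINT y|lborel. ?\<psi> m y)"
    by (rule Bochner_Integration.integral_sum) (rule cutoff_integrable[OF \<rho>])
  also have "... = (\<Sum>m\<in>(grid 2 :: ('n => int) set). mass TYPE('n) \<rho>)"
  proof (rule sum.cong[OF refl])
    fix m :: "'n => int"
    show "(LINT y|lborel. ?\<psi> m y) = mass TYPE('n) \<rho>" unfolding mass_def
      by (rule integral_translation[OF borel_measurable_continuous_onI[OF cutoff_continuous[OF \<rho>]], of 0 _ "node \<rho> m",
            unfolded cutoff_shift])
  qed
  also have "... = 5 ^ CARD('n) * mass TYPE('n) \<rho>" unfolding grid_def by (simp add: card_PiE)
  finally show ?thesis .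
qed

lemma mass_pos: assumes "0 < \<rho>" shows "0 < mass TYPE('n::finite) \<rho>"
proof -
  have "0 < (2 * \<rho>) ^ CARD('n)" using assms by simp
  from order.strict_trans2[OF this mass_lower[OF assms]] show ?thesis by (simp add: zero_less_mult_iff)
qed

lemma kernel:
  fixes y :: "real^'n::finite"
  assumes "0 < \<rho>"
  shows "integrable lborel (kernel \<rho> :: real^'n => real)" "0 \<le> kernel \<rho> y"
    "(LINT y|lborel. kernel \<rho> (y :: real^'n)) = 1" "y \<notin> cube 0 \<rho> ==> kernel \<rho> y = 0"
    "continuous_on UNIV (kernel \<rho> :: real^'n => real)"
proof -
  have m: "0 < mass TYPE('n) \<rho>" by (rule mass_pos[OF assms])
  show "integrable lborel (kernel \<rho> :: real^'n => real)"
    unfolding kernel_def[abs_def] by (intro integrable_divide cutoff_integrable[OF assms])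
  show "0 \<le> kernel \<rho> y" unfolding kernel_def using m cutoff_nonneg[of \<rho> 0 y] by (intro divide_nonneg_nonneg) auto
  show "(LINT y|lborel. kernel \<rho> (y :: real^'n)) = 1" unfolding kernel_def using m by (simp add: mass_def)
  show "y \<notin> cube 0 \<rho> ==> kernel \<rho> y = 0" unfolding kernel_def using cutoff_support[OF assms, of y 0] by simp
  show "continuous_on UNIV (kernel \<rho> :: real^'n => real)"
    unfolding kernel_def[abs_def] by (intro continuous_intros cutoff_continuous assms) (use m in auto)
qed

abbreviation moll :: "real => (real^'n::finite => real) => real^'n => real" where
  "moll \<rho> w \<equiv> conv w (kernel \<rho>)"

lemma moll_eq: "moll \<rho> w = (\<lambda>x. inverse (mass TYPE('n) \<rho>) * conv w (cutoff \<rho> 0 (\<lambda>_. 0)) x)"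
  for w :: "real^'n::finite => real"
proof
  fix x
  have "moll \<rho> w x = (LINT y|lborel. inverse (mass TYPE('n) \<rho>) * (w y * cutoff \<rho> 0 (\<lambda>_. 0) (y - x)))"
    unfolding conv_def kernel_def by (intro Bochner_Integration.integral_cong) (auto simp: divide_inverse)
  then show "moll \<rho> w x = inverse (mass TYPE('n) \<rho>) * conv w (cutoff \<rho> 0 (\<lambda>_. 0)) x"
    unfolding conv_def by simp
qed

lemma moll_smooth:
  fixes w :: "real^'n::finite => real"
  assumes "integrable lborel w" "0 < \<rho>" shows "moll \<rho> w \<in> smooth UNIV"
  unfolding moll_eq by (intro smooth_mult smooth_const conv_cutoff_smooth assms open_UNIV)

lemma D_moll:
  fixes w :: "real^'n::finite => real"
  assumes "integrable lborel w" "0 < \<rho>"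
  shows "D is (moll \<rho> w) x = inverse (mass TYPE('n) \<rho>) * ((-1) ^ length is * conv w (cutoff \<rho> 0 (count_list is)) x)"
  unfolding moll_eq using D_cmult[OF open_UNIV conv_cutoff_smooth[OF assms]] D_conv_cutoff[OF assms] by simp


section \<open>Convergence of mollifications\<close>

abbreviation pint :: "real => (real^'n::finite => real) => ennreal" where
  "pint p f \<equiv> (\<integral>\<^sup>+x. ennreal (\<bar>f x\<bar> powr p) \<partial>lborel)"

lemma pint_add_le:
  assumes p: "0 \<le> p" and [measurable]: "f \<in> borel_measurable borel" "g \<in> borel_measurable borel"
    and h: "\<And>x. \<bar>h x\<bar> \<le> \<bar>f x + g x\<bar>"
  shows "pint p h \<le> ennreal (2 powr p) * (pint p f + pint p g)"
proof -
  have "pint p h \<le> (\<integral>\<^sup>+x. ennreal (2 powr p) * (ennreal (\<bar>f x\<bar> powr p) + ennreal (\<bar>g x\<bar> powr p)) \<partial>lborel)"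
  proof (rule nn_integral_mono)
    fix x
    have "\<bar>h x\<bar> powr p \<le> \<bar>f x + g x\<bar> powr p" by (rule powr_mono2[OF p]) (use h in auto)
    also have "... \<le> 2 powr p * (\<bar>f x\<bar> powr p + \<bar>g x\<bar> powr p)" by (rule powr_sum_le[OF p])
    finally show "ennreal (\<bar>h x\<bar> powr p) \<le> ennreal (2 powr p) * (ennreal (\<bar>f x\<bar> powr p) + ennreal (\<bar>g x\<bar> powr p))"
      by (simp add: ennreal_mult'[symmetric] ennreal_plus[symmetric] ennreal_leI del: ennreal_plus)
  qed
  also have "... = ennreal (2 powr p) * (pint p f + pint p g)"
    by (simp add: nn_integral_cmult nn_integral_add)
  finally show ?thesis .
qed

lemma truncation_approx:
  fixes w :: "real^'n::finite => real"
  assumes p: "1 \<le> p" and w[measurable]: "w \<in> borel_measurable borel" and fin: "pint p w < \<infinity>" and \<tau>: "0 < (\<tau>::ennreal)"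
  obtains v and j :: nat where "v \<in> borel_measurable borel" "\<And>x. \<bar>v x\<bar> \<le> real j" "\<And>x. x \<notin> ball 0 (real j) ==> v x = 0"
    "pint p (\<lambda>x. w x - v x) < \<tau>"
proof -
  define v where "v j x = max (- real j) (min (real j) (w x)) * indicator (ball 0 (real j)) x" for j :: nat and x
  have [measurable]: "ball (0 :: real^'n) (real j) \<in> sets borel" for j by simp
  have m[measurable]: "v j \<in> borel_measurable borel" for j unfolding v_def by measurable
  have le: "\<bar>w x - v j x\<bar> \<le> \<bar>w x\<bar>" for x j unfolding v_def by (auto simp: indicator_def)
  have "(\<lambda>j. pint p (\<lambda>x. w x - v j x)) \<longlonglongrightarrow> (\<integral>\<^sup>+x. 0 \<partial>(lborel :: (real^'n) measure))"
  proof (rule nn_integral_dominated_convergence[of _ _ _ "\<lambda>x. ennreal (\<bar>w x\<bar> powr p)"])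
    show "AE x in lborel. ennreal (\<bar>w x - v j x\<bar> powr p) \<le> ennreal (\<bar>w x\<bar> powr p)" for j
      using p le by (auto intro!: AE_I2 ennreal_leI powr_mono2)
    show "AE x in lborel. (\<lambda>j. ennreal (\<bar>w x - v j x\<bar> powr p)) \<longlonglongrightarrow> 0"
    proof (intro AE_I2 tendsto_eventually)
      fix x :: "real^'n"
      obtain N :: nat where N: "max (norm x) \<bar>w x\<bar> < real N" using reals_Archimedean2 by blast
      have "v j x = w x" if "j \<ge> N" for j
      proof -
        have "real N \<le> real j" using that by simp
        then show ?thesis using N unfolding v_def by (auto simp: indicator_def)
      qed
      then show "\<forall>\<^sub>F j in sequentially. ennreal (\<bar>w x - v j x\<bar> powr p) = 0"
        by (intro eventually_sequentiallyI[of N]) simp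
    qed
  qed (use fin in auto)
  then have "(\<lambda>j. pint p (\<lambda>x. w x - v j x)) \<longlonglongrightarrow> 0" by simp
  from order_tendstoD(2)[OF this \<tau>] obtain j where "pint p (\<lambda>x. w x - v j x) < \<tau>"
    unfolding eventually_sequentially by blast
  then show ?thesis by (rule that[OF m, rotated 2]) (auto simp: v_def indicator_def)
qed

lemma tendsto_powr_0:
  assumes "X \<longlonglongrightarrow> (a::real)" "1 \<le> p" shows "(\<lambda>n. ennreal (\<bar>a - X n\<bar> powr p)) \<longlonglongrightarrow> 0"
proof -
  have "(\<lambda>n. \<bar>a - X n\<bar> powr p) \<longlonglongrightarrow> \<bar>a - a\<bar> powr p"
    by (intro tendsto_powr' tendsto_intros assms) (use assms(2) in auto)
  then show ?thesis using tendsto_ennrealI by fastforce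
qed

lemma continuous_approx_bounded:
  fixes v :: "real^'n::finite => real" and j :: nat
  assumes p: "1 \<le> p" and v[measurable]: "v \<in> borel_measurable borel"
    and bd: "\<And>x. \<bar>v x\<bar> \<le> real j" "\<And>x. x \<notin> ball 0 (real j) ==> v x = 0" and \<tau>: "0 < (\<tau>::ennreal)"
  obtains g where "continuous_on UNIV g" "\<And>x. x \<notin> cball 0 (real j + 1) ==> g x = 0" "pint p (\<lambda>x. v x - g x) < \<tau>"
proof -
  have "v measurable_on UNIV" by (rule lebesgue_measurable_imp_measurable_on_real) (use measurable_completion[of v lborel borel] v in auto)
  then obtain N G where N: "negligible N" and G: "\<And>n. continuous_on UNIV (G n)"
    "\<And>x. x \<notin> N ==> (\<lambda>n. G n x) \<longlonglongrightarrow> v x" unfolding measurable_on_def by auto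
  define ramp where "ramp x = max 0 (min 1 (real j + 1 - norm x))" for x :: "real^'n"
  define h where "h n x = ramp x * max (- real j) (min (real j) (G n x))" for n x
  have hc: "continuous_on UNIV (h n)" for n unfolding h_def ramp_def by (intro continuous_intros G(1))
  then have [measurable]: "h n \<in> borel_measurable borel" for n by (intro borel_measurable_continuous_onI)
  have h0: "h n x = 0" if "x \<notin> cball 0 (real j + 1)" for n x using that unfolding h_def ramp_def by simp
  have hb: "\<bar>h n x\<bar> \<le> real j" for n x
  proof -
    have "\<bar>h n x\<bar> \<le> 1 * real j" unfolding h_def abs_mult by (intro mult_mono) (auto simp: ramp_def)
    then show ?thesis by simp
  qed
  have "(\<lambda>n. pint p (\<lambda>x. v x - h n x)) \<longlonglongrightarrow> (\<integral>\<^sup>+x. 0 \<partial>(lborel :: (real^'n) measure))"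
  proof (rule nn_integral_dominated_convergence[of _ _ _ "\<lambda>x. ennreal ((2 * real j) powr p) * indicator (cball 0 (real j + 1)) x"])
    show "AE x in lborel. ennreal (\<bar>v x - h n x\<bar> powr p) \<le> ennreal ((2 * real j) powr p) * indicator (cball 0 (real j + 1)) x" for n
    proof (rule AE_I2)
      fix x
      show "ennreal (\<bar>v x - h n x\<bar> powr p) \<le> ennreal ((2 * real j) powr p) * indicator (cball 0 (real j + 1)) x"
      proof (cases "x \<in> cball 0 (real j + 1)")
        case True
        have "\<bar>v x - h n x\<bar> \<le> 2 * real j" using bd(1)[of x] hb[of n x] by linarith
        then show ?thesis using True p by (auto intro!: ennreal_leI powr_mono2)
      next
        case False
        then have "v x = 0" by (intro bd(2)) auto
        then show ?thesis using h0[OF False] by simp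
      qed
    qed
    have "AE x in lebesgue. x \<notin> N" using N unfolding negligible_iff_null_sets by (rule AE_not_in)
    then have "AE x in lborel. x \<notin> N" by (simp add: AE_completion_iff)
    then show "AE x in lborel. (\<lambda>n. ennreal (\<bar>v x - h n x\<bar> powr p)) \<longlonglongrightarrow> 0"
    proof eventually_elim
      case (elim x)
      have "(\<lambda>n. h n x) \<longlonglongrightarrow> ramp x * max (- real j) (min (real j) (v x))"
        unfolding h_def by (intro tendsto_intros G(2)[OF elim])
      also have "ramp x * max (- real j) (min (real j) (v x)) = v x"
        using bd(1)[of x] bd(2)[of x] unfolding ramp_def by (cases "x \<in> ball 0 (real j)") auto
      finally show ?case by (rule tendsto_powr_0[OF _ p])
    qed
    show "(\<integral>\<^sup>+ x. ennreal ((2 * real j) powr p) * indicator (cball 0 (real j + 1)) x \<partial>(lborel :: (real^'n) measure)) < \<infinity>"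
      by (simp add: nn_integral_cmult_indicator ennreal_mult_less_top emeasure_lborel_cball_finite[unfolded infinity_ennreal_def])
    have [measurable]: "cball (0 :: real^'n) (real j + 1) \<in> sets borel" by simp
    show "(\<lambda>x. ennreal ((2 * real j) powr p) * indicator (cball (0 :: real^'n) (real j + 1)) x) \<in> borel_measurable lborel"
      by measurable
    show "(\<lambda>x. ennreal (\<bar>v x - h n x\<bar> powr p)) \<in> borel_measurable lborel" for n by measurable
  qed simp
  then have "(\<lambda>n. pint p (\<lambda>x. v x - h n x)) \<longlonglongrightarrow> 0" by simp
  from order_tendstoD(2)[OF this \<tau>] obtain n where "pint p (\<lambda>x. v x - h n x) < \<tau>"
    unfolding eventually_sequentially by blast
  then show ?thesis using that[of "h n"] hc h0 by blast
qed

lemma continuous_approx: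
  fixes w :: "real^'n::finite => real"
  assumes p: "1 \<le> p" and w[measurable]: "w \<in> borel_measurable borel" and fin: "pint p w < \<infinity>" and \<tau>: "0 < (\<tau>::real)"
  obtains g R where "continuous_on UNIV g" "\<And>x. x \<notin> cball 0 R ==> g x = 0" "pint p (\<lambda>x. w x - g x) \<le> ennreal \<tau>"
proof -
  define t where "t = \<tau> / (2 * 2 powr p)"
  have t: "0 < ennreal t" unfolding t_def using \<tau> by (simp add: ennreal_zero_less_divide)
  obtain v and j :: nat where v[measurable]: "v \<in> borel_measurable borel"
    and bd: "\<And>x. \<bar>v x\<bar> \<le> real j" "\<And>x. x \<notin> ball 0 (real j) ==> v x = 0" and wv: "pint p (\<lambda>x. w x - v x) < ennreal t"
    by (rule truncation_approx[OF p w fin t]) blast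
  obtain g where g: "continuous_on UNIV g" "\<And>x. x \<notin> cball 0 (real j + 1) ==> g x = 0" "pint p (\<lambda>x. v x - g x) < ennreal t"
    by (rule continuous_approx_bounded[OF p v bd t]) auto
  have [measurable]: "g \<in> borel_measurable borel" by (rule borel_measurable_continuous_onI[OF g(1)])
  have "pint p (\<lambda>x. w x - g x) \<le> ennreal (2 powr p) * (pint p (\<lambda>x. w x - v x) + pint p (\<lambda>x. v x - g x))"
    by (rule pint_add_le) (use p in auto)
  also have "... \<le> ennreal (2 powr p) * (ennreal t + ennreal t)"
    using wv g(3) by (intro mult_left_mono add_mono) auto
  also have "... = ennreal \<tau>" using \<tau> unfolding t_def
    by (simp add: ennreal_plus[symmetric] ennreal_mult'[symmetric] del: ennreal_plus)
  finally show ?thesis using that g(1,2) by blast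
qed

lemma kernel_bounded: assumes "0 < \<rho>" shows "\<exists>B. \<forall>y :: real^'n::finite. \<bar>kernel \<rho> y\<bar> \<le> B"
  by (rule compact_support_bounded[OF kernel(5)[OF assms] cube_closed_bounded[of 0 \<rho>] kernel(4)[OF assms]]) (assumption, blast)

lemma moll_continuous_close:
  fixes g :: "real^'n::finite => real"
  assumes p: "1 \<le> p" and g: "continuous_on UNIV g" "\<And>x. x \<notin> cball 0 R ==> g x = 0" and \<tau>: "0 < (\<tau>::real)"
  obtains \<rho>0 where "0 < \<rho>0" "\<And>\<rho>. 0 < \<rho> ==> \<rho> < \<rho>0 ==> pint p (\<lambda>x. moll \<rho> g x - g x) \<le> ennreal \<tau>"
proof -
  let ?n = "real CARD('n)" and ?S = "cball (0 :: real^'n) (R + 1)"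
  define V where "V = measure lborel ?S"
  define \<eta> where "\<eta> = (\<tau> / (V + 1)) powr (1 / p)"
  have V: "0 \<le> V" unfolding V_def by simp
  have \<eta>: "0 < \<eta>" unfolding \<eta>_def using \<tau> V by simp
  have "uniformly_continuous_on (cball 0 (R + 2)) g"
    by (rule compact_uniformly_continuous[OF continuous_on_subset[OF g(1)]]) auto
  then obtain e where e: "0 < e" "\<And>x y. x \<in> cball 0 (R + 2) ==> y \<in> cball 0 (R + 2) ==> dist y x < e ==> dist (g y) (g x) < \<eta>"
    unfolding uniformly_continuous_on_def using \<eta> by metis
  have gi: "integrable lborel g" by (rule compact_support_integrable[OF g(1) compact_cball g(2)])
  show ?thesis
  proof (rule that[of "min 1 e / ?n"])
    show "0 < min 1 e / ?n" using e(1) by simp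
    fix \<rho> :: real assume \<rho>: "0 < \<rho>" "\<rho> < min 1 e / ?n"
    have \<rho>n: "?n * \<rho> < e" "?n * \<rho> < 1" using \<rho>(2) by (auto simp: pos_less_divide_eq mult.commute)
    \<comment> \<open>both values vanish unless \<open>x\<close> is close to the support of \<open>g\<close>\<close>
    have near: "\<bar>(g y - g x) * kernel \<rho> (y - x)\<bar> \<le> \<eta> * indicator ?S x * kernel \<rho> (y - x)" for x y
    proof (cases "kernel \<rho> (y - x) = 0")
      case False
      then have "y - x \<in> cube 0 \<rho>" using kernel(4)[OF \<rho>(1)] by blast
      from cube_dist[OF this] have xy: "norm (y - x) \<le> ?n * \<rho>" by simp
      have "\<bar>g y - g x\<bar> \<le> \<eta> * indicator ?S x"
      proof (cases "x \<in> ?S")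
        case True
        then have "x \<in> cball 0 (R + 2)" "y \<in> cball 0 (R + 2)" "dist y x < e"
          using xy \<rho>n norm_triangle_sub[of y x] by (auto simp: dist_norm)
        from e(2)[OF this] show ?thesis using True by (simp add: dist_real_def)
      next
        case False
        then have "x \<notin> cball 0 R" "y \<notin> cball 0 R"
          using xy \<rho>n norm_triangle_sub[of x y] by (auto simp: norm_minus_commute)
        then show ?thesis using g(2) False by simp
      qed
      then show ?thesis using kernel(2)[OF \<rho>(1), of "y - x"] by (simp add: abs_mult mult_right_mono)
    qed simp
    have ik: "integrable lborel (\<lambda>y. kernel \<rho> (y - x))" "(LINT y|lborel. kernel \<rho> (y - x)) = 1" for x :: "real^'n"
      using translate_integral_one[OF kernel(1,3)[OF \<rho>(1)]] by auto
    obtain Bk where Bk: "\<And>y :: real^'n. \<bar>kernel \<rho> y\<bar> \<le> Bk"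
      using kernel_bounded[OF \<rho>(1), where 'n = 'n] by blast
    have small: "\<bar>moll \<rho> g x - g x\<bar> \<le> \<eta> * indicator ?S x" for x
    proof -
      have i: "integrable lborel (\<lambda>y. g y * kernel \<rho> (y - x))" by (rule conv_integrable[OF gi kernel(5)[OF \<rho>(1)] Bk])
      have i2: "integrable lborel (\<lambda>y. (g y - g x) * kernel \<rho> (y - x))"
        unfolding left_diff_distrib using i ik(1) by (intro Bochner_Integration.integrable_diff integrable_mult_right)
      have "moll \<rho> g x - g x = (LINT y|lborel. (g y - g x) * kernel \<rho> (y - x))"
        unfolding left_diff_distrib conv_def using i ik[of x] by (subst Bochner_Integration.integral_diff) auto
      then have "\<bar>moll \<rho> g x - g x\<bar> \<le> (LINT y|lborel. \<bar>(g y - g x) * kernel \<rho> (y - x)\<bar>)"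
        using integral_norm_bound[of lborel "\<lambda>y. (g y - g x) * kernel \<rho> (y - x)"] by simp
      also have "... \<le> (LINT y|lborel. \<eta> * indicator ?S x * kernel \<rho> (y - x))"
        by (rule integral_mono[OF _ _ near]) (use i2 ik(1) in auto)
      also have "... = \<eta> * indicator ?S x" using ik(2) by simp
      finally show ?thesis .
    qed
    have "pint p (\<lambda>x. moll \<rho> g x - g x) \<le> (\<integral>\<^sup>+x. ennreal (\<eta> powr p) * indicator ?S x \<partial>lborel)"
    proof (rule nn_integral_mono)
      fix x
      show "ennreal (\<bar>moll \<rho> g x - g x\<bar> powr p) \<le> ennreal (\<eta> powr p) * indicator ?S x"
        using small[of x] p by (cases "x \<in> ?S") (auto intro!: ennreal_leI powr_mono2)
    qed
    also have "... = ennreal (\<eta> powr p) * ennreal V"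
      unfolding V_def using emeasure_eq_ennreal_measure[of lborel ?S] emeasure_lborel_cball_finite[of "0 :: real^'n" "R + 1"]
      by (simp add: nn_integral_cmult_indicator less_imp_neq)
    also have "... = ennreal (\<tau> / (V + 1) * V)"
      unfolding \<eta>_def using p \<tau> V by (simp add: powr_powr ennreal_mult'[symmetric])
    also have "... \<le> ennreal \<tau>" using \<tau> V by (intro ennreal_leI) (simp add: divide_simps)
    finally show "pint p (\<lambda>x. moll \<rho> g x - g x) \<le> ennreal \<tau>" .
  qed
qed

text \<open>Mollification does not increase the \<open>L\<^sup>p\<close> norm, so the convergence for continuous functions of compact
  support extends to their closure.\<close>

lemma moll_converges:
  fixes w :: "real^'n::finite => real"
  assumes p: "1 \<le> p" and w: "integrable lborel w" and fin: "pint p w < \<infinity>" and \<tau>: "0 < (\<tau>::real)"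
  obtains \<rho>0 where "0 < \<rho>0" "\<And>\<rho>. 0 < \<rho> ==> \<rho> < \<rho>0 ==> pint p (\<lambda>x. moll \<rho> w x - w x) \<le> ennreal \<tau>"
proof -
  have [measurable]: "w \<in> borel_measurable borel" using w by auto
  define t where "t = \<tau> / (2 powr p * (1 + 2 powr p * 2))"
  have den: "0 < 2 powr p * (1 + 2 powr p * 2)" by (intro mult_pos_pos add_pos_pos) auto
  have t: "0 < t" unfolding t_def using \<tau> den by simp
  obtain g R where g: "continuous_on UNIV g" "\<And>x. x \<notin> cball 0 R ==> g x = 0" "pint p (\<lambda>x. w x - g x) \<le> ennreal t"
    by (rule continuous_approx[OF p _ fin t]) auto
  obtain \<rho>0 where \<rho>0: "0 < \<rho>0" "\<And>\<rho>. 0 < \<rho> ==> \<rho> < \<rho>0 ==> pint p (\<lambda>x. moll \<rho> g x - g x) \<le> ennreal t"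
    by (rule moll_continuous_close[OF p g(1,2) t]) blast+
  have gi: "integrable lborel g" by (rule compact_support_integrable[OF g(1) compact_cball g(2)])
  have [measurable]: "g \<in> borel_measurable borel" using gi by auto
  show ?thesis
  proof (rule that[OF \<rho>0(1)])
    fix \<rho> assume \<rho>: "0 < \<rho>" "\<rho> < \<rho>0"
    have [measurable]: "moll \<rho> w \<in> borel_measurable borel" "moll \<rho> g \<in> borel_measurable borel"
      using smooth_continuous[OF moll_smooth[OF w \<rho>(1)]] smooth_continuous[OF moll_smooth[OF gi \<rho>(1)]]
      by (auto intro: borel_measurable_continuous_onI)
    obtain Bk where Bk: "\<And>y :: real^'n. \<bar>kernel \<rho> y\<bar> \<le> Bk"
      using kernel_bounded[OF \<rho>(1), where 'n = 'n] by blast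
    have lin: "moll \<rho> (\<lambda>x. w x - g x) x = moll \<rho> w x - moll \<rho> g x" for x
      unfolding conv_def left_diff_distrib
      by (rule Bochner_Integration.integral_diff) (rule conv_integrable[OF _ kernel(5)[OF \<rho>(1)] Bk], fact)+
    have [measurable]: "moll \<rho> (\<lambda>x. w x - g x) \<in> borel_measurable borel" unfolding lin[abs_def] by measurable
    have y: "pint p (moll \<rho> (\<lambda>x. w x - g x)) \<le> pint p (\<lambda>x. w x - g x)"
      by (rule young_convolution(2)[OF p _ kernel(1)[OF \<rho>(1)] kernel(2)[OF \<rho>(1)] kernel(3)[OF \<rho>(1)]]) measurable
    have g2: "pint p (\<lambda>x. g x - w x) \<le> ennreal t" using g(3) by (simp add: abs_minus_commute)
    have "pint p (\<lambda>x. moll \<rho> w x - w x) \<le> ennreal (2 powr p) *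
        (pint p (moll \<rho> (\<lambda>x. w x - g x)) + pint p (\<lambda>x. moll \<rho> g x - w x))"
      by (rule pint_add_le) (use p lin in auto)
    also have "pint p (\<lambda>x. moll \<rho> g x - w x) \<le> ennreal (2 powr p) * (pint p (\<lambda>x. moll \<rho> g x - g x) + pint p (\<lambda>x. g x - w x))"
      by (rule pint_add_le) (use p in auto)
    also have "pint p (\<lambda>x. moll \<rho> g x - g x) + pint p (\<lambda>x. g x - w x) \<le> ennreal t + ennreal t"
      by (intro add_mono \<rho>0(2) \<rho> g2)
    also have "pint p (moll \<rho> (\<lambda>x. w x - g x)) \<le> ennreal t" using y g(3) by (rule order_trans)
    finally have "pint p (\<lambda>x. moll \<rho> w x - w x) \<le> ennreal (2 powr p) * (ennreal t + ennreal (2 powr p) * (ennreal t + ennreal t))"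
      by (simp add: add_mono mult_left_mono)
    also have "... = ennreal (2 powr p * (t + 2 powr p * (t + t)))"
      using t by (simp add: ennreal_plus[symmetric] ennreal_mult'[symmetric] del: ennreal_plus)
    also have "2 powr p * (t + 2 powr p * (t + t)) = \<tau>"
    proof -
      have "2 powr p * (t + 2 powr p * (t + t)) = t * (2 powr p * (1 + 2 powr p * 2))" by (simp add: algebra_simps)
      also have "... = \<tau>" unfolding t_def by (rule nonzero_eq_divide_eq[THEN iffD1, OF _ refl]) (use den in linarith)
      finally show ?thesis .
    qed
    finally show "pint p (\<lambda>x. moll \<rho> w x - w x) \<le> ennreal \<tau>" .
  qed
qed


section \<open>Uniqueness of weak derivatives\<close>

lemma borel_version:
  fixes f :: "real^'n::finite => real"
  assumes "f \<in> borel_measurable lebesgue"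
  obtains w where "w \<in> borel_measurable borel" "AE x in lebesgue. f x = w x"
  using completion_ex_borel_measurable_real[OF assms] AE_completion by (metis measurable_lborel2)

lemma borel_version_integral:
  fixes f w \<phi> :: "real^'n::finite => real"
  assumes f: "integrable lebesgue f" and w: "w \<in> borel_measurable borel" "AE x in lebesgue. f x = w x"
    and \<phi>: "continuous_on UNIV \<phi>"
  shows "integrable lborel w" "(LINT x|lebesgue. f x * \<phi> x) = (LINT x|lborel. w x * \<phi> x)"
proof -
  have [measurable]: "w \<in> borel_measurable borel" "\<phi> \<in> borel_measurable borel"
    using w(1) borel_measurable_continuous_onI[OF \<phi>] by auto
  have wl: "w \<in> borel_measurable lebesgue" "\<phi> \<in> borel_measurable lebesgue"
    by (auto intro!: measurable_completion)
  have "integrable lebesgue w" using f w(2) wl(1) by (subst integrable_cong_AE[symmetric, of f]) auto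
  then show "integrable lborel w" using integrable_completion[of w lborel] by simp
  have "(LINT x|lebesgue. f x * \<phi> x) = (LINT x|lebesgue. w x * \<phi> x)"
    by (rule integral_cong_AE) (use f w(2) wl in auto)
  also have "... = (LINT x|lborel. w x * \<phi> x)" by (rule integral_completion) simp
  finally show "(LINT x|lebesgue. f x * \<phi> x) = (LINT x|lborel. w x * \<phi> x)" .
qed

lemma cutoff_test:
  fixes x :: "real^'n::finite"
  assumes "0 < \<rho>" "cube x \<rho> \<subseteq> \<Omega>" shows "cutoff \<rho> x (\<lambda>_. 0) \<in> test_functions \<Omega>"
  by (rule test_functionI[OF cutoff_smooth[OF assms(1) open_UNIV] cube_closed_bounded assms(2) cutoff_support[OF assms(1)]])

lemma lebesgue_on_restrict:
  fixes h \<phi> :: "real^'n::finite => real"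
  assumes \<Omega>: "open \<Omega>" and K: "K \<subseteq> \<Omega>" and \<phi>: "\<And>x. x \<notin> K ==> \<phi> x = 0"
  shows "(LINT x|lebesgue_on \<Omega>. h x * \<phi> x) = (LINT x|lebesgue. (indicator K x * h x) * \<phi> x)"
proof -
  have "(LINT x|lebesgue_on \<Omega>. h x * \<phi> x) = (LINT x|lebesgue. indicator \<Omega> x *\<^sub>R (h x * \<phi> x))"
    using \<Omega> by (intro integral_restrict_space) auto
  also have "(\<lambda>x. indicator \<Omega> x *\<^sub>R (h x * \<phi> x)) = (\<lambda>x. (indicator K x * h x) * \<phi> x)"
    using K \<phi> by (fastforce simp: indicator_def)
  finally show ?thesis .
qed

lemma L1_locD:
  assumes "h \<in> L1_loc \<Omega>" "compact K" "K \<subseteq> \<Omega>"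
  shows "integrable lebesgue (\<lambda>x. indicator K x * h x)"
  using assms unfolding L1_loc_def set_integrable_def by simp

lemma L1_loc_test_integrable:
  fixes h :: "real^'n::finite => real"
  assumes \<Omega>: "open \<Omega>" and h: "h \<in> L1_loc \<Omega>" and \<phi>: "\<phi> \<in> test_functions \<Omega>"
  shows "integrable (lebesgue_on \<Omega>) (\<lambda>x. h x * \<phi> x)"
proof -
  have K: "compact (support \<phi>)" "support \<phi> \<subseteq> \<Omega>" and c: "continuous_on UNIV \<phi>"
    using \<phi> smooth_continuous unfolding test_functions_iff by auto
  have "\<exists>B. \<forall>x. \<bar>\<phi> x\<bar> \<le> B" by (rule compact_support_bounded[OF c K(1)]) (rule not_in_support, assumption, blast)
  then obtain B where B: "\<And>x. \<bar>\<phi> x\<bar> \<le> B" by blast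
  have "\<phi> \<in> borel_measurable lebesgue" using borel_measurable_continuous_onI[OF c] by (intro measurable_completion) simp
  note m\<phi> = this
  have "integrable lebesgue (\<lambda>x. (indicator (support \<phi>) x * h x) * \<phi> x)"
  proof (rule Bochner_Integration.integrable_bound[of _ "\<lambda>x. B * (indicator (support \<phi>) x * h x)"])
    show "integrable lebesgue (\<lambda>x. B * (indicator (support \<phi>) x * h x))" using L1_locD[OF h K] by (rule integrable_mult_right)
    show "(\<lambda>x. (indicator (support \<phi>) x * h x) * \<phi> x) \<in> borel_measurable lebesgue"
      by (rule borel_measurable_times[OF borel_measurable_integrable[OF L1_locD[OF h K]] m\<phi>])
    show "AE x in lebesgue. norm ((indicator (support \<phi>) x * h x) * \<phi> x) \<le> norm (B * (indicator (support \<phi>) x * h x))"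
    proof (rule AE_I2)
      fix x
      have "\<bar>\<phi> x\<bar> \<le> \<bar>B\<bar>" using B[of x] by linarith
      from mult_left_mono[OF this, of "\<bar>indicator (support \<phi>) x * h x\<bar>"]
      show "norm ((indicator (support \<phi>) x * h x) * \<phi> x) \<le> norm (B * (indicator (support \<phi>) x * h x))"
        unfolding real_norm_def abs_mult[of _ "\<phi> x"] abs_mult[of B] by (simp only: mult.commute abs_ge_zero)
    qed
  qed
  also have "(\<lambda>x. (indicator (support \<phi>) x * h x) * \<phi> x) = (\<lambda>x. indicator \<Omega> x *\<^sub>R (h x * \<phi> x))"
    using K(2) not_in_support[of _ \<phi>] by (fastforce simp: indicator_def)
  finally show ?thesis using \<Omega> by (subst integrable_restrict_space) auto
qed

lemma integral_test_eq_moll: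
  fixes h w :: "real^'n::finite => real"
  assumes \<Omega>: "open \<Omega>" and w: "w \<in> borel_measurable borel" "AE x in lebesgue. indicator K x * h x = w x"
    and int: "integrable lebesgue (\<lambda>x. indicator K x * h x)"
    and \<rho>: "0 < \<rho>" and x: "cube x \<rho> \<subseteq> K" "K \<subseteq> \<Omega>"
  shows "(LINT y|lebesgue_on \<Omega>. h y * cutoff \<rho> x \<alpha> y) = conv w (cutoff \<rho> 0 \<alpha>) x"
proof -
  have "(LINT y|lebesgue_on \<Omega>. h y * cutoff \<rho> x \<alpha> y) = (LINT y|lebesgue. (indicator K y * h y) * cutoff \<rho> x \<alpha> y)"
    by (rule lebesgue_on_restrict[OF \<Omega> x(2)]) (use cutoff_support[OF \<rho>] x(1) in blast)
  also have "... = (LINT y|lborel. w y * cutoff \<rho> x \<alpha> y)"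
    by (rule borel_version_integral(2)[OF int w cutoff_continuous[OF \<rho>]])
  finally show ?thesis unfolding conv_def cutoff_shift .
qed

text \<open>The mollifications of \<open>h\<close> are its integrals against test functions, so they vanish, and locally they
  converge to \<open>h\<close> in \<open>L\<^sup>1\<close>.\<close>

lemma du_bois_reymond:
  fixes h :: "real^'n::finite => real"
  assumes \<Omega>: "open \<Omega>" and h: "h \<in> L1_loc \<Omega>"
    and orth: "\<And>\<phi>. \<phi> \<in> test_functions \<Omega> ==> (LINT x|lebesgue_on \<Omega>. h x * \<phi> x) = 0"
  shows "AE x in lebesgue_on \<Omega>. h x = 0"
proof -
  have local: "\<exists>r>0. AE x in lebesgue. x \<in> ball a r --> h x = 0" if a: "a \<in> \<Omega>" for a
  proof -
    obtain r0 where r0: "0 < r0" "cball a r0 \<subseteq> \<Omega>"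
      using open_contains_cball[THEN iffD1, OF \<Omega>, rule_format, OF a] by blast
    define r where "r = r0 / 2"
    have r: "0 < r" unfolding r_def using r0 by simp
    define K where "K = cball a r0"
    have K: "compact K" "K \<subseteq> \<Omega>" unfolding K_def using r0 by auto
    note int = L1_locD[OF h K]
    obtain w where w: "w \<in> borel_measurable borel" "AE x in lebesgue. indicator K x * h x = w x"
      by (rule borel_version[OF borel_measurable_integrable[OF int]])
    have iw: "integrable lborel w" by (rule borel_version_integral(1)[OF int w continuous_on_const])
    have fin: "pint 1 w < \<infinity>" using iw unfolding integrable_iff_bounded by simp
    have zero: "moll \<rho> w x = 0" if \<rho>: "0 < \<rho>" "CARD('n) * \<rho> < r" and x: "x \<in> ball a r" for \<rho> :: real and x
    proof -
      have "cube x \<rho> \<subseteq> K"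
      proof
        fix y assume "y \<in> cube x \<rho>"
        then have "dist x y \<le> CARD('n) * \<rho>" by (rule cube_dist)
        then have "dist x y < r" using \<rho>(2) by linarith
        then show "y \<in> K" using x dist_triangle[of a y x] unfolding K_def r_def by auto
      qed
      then have "conv w (cutoff \<rho> 0 (\<lambda>_. 0)) x = 0"
        using integral_test_eq_moll[OF \<Omega> w int \<rho>(1) _ K(2), of x "\<lambda>_. 0"] orth[OF cutoff_test[OF \<rho>(1), of x]] K(2) by auto
      then show ?thesis unfolding moll_eq by simp
    qed
    have small: "(\<integral>\<^sup>+x. ennreal \<bar>w x\<bar> * indicator (ball a r) x \<partial>lborel) \<le> 0 + ennreal \<tau>" if \<tau>: "0 < \<tau>" for \<tau>
    proof -
      obtain \<rho>0 where \<rho>0: "0 < \<rho>0" "\<And>\<rho>. 0 < \<rho> ==> \<rho> < \<rho>0 ==> pint 1 (\<lambda>x. moll \<rho> w x - w x) \<le> ennreal \<tau>"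
        by (rule moll_converges[OF order.refl iw fin \<tau>]) blast+
      define \<rho> where "\<rho> = min (\<rho>0 / 2) (r / (2 * CARD('n)))"
      have n: "0 < real CARD('n)" by simp
      have \<rho>: "0 < \<rho>" "\<rho> < \<rho>0" unfolding \<rho>_def using \<rho>0(1) r by auto
      have "CARD('n) * \<rho> \<le> CARD('n) * (r / (2 * CARD('n)))" unfolding \<rho>_def by (intro mult_left_mono) auto
      also have "... = r / 2" using n by simp
      finally have \<rho>r: "CARD('n) * \<rho> < r" using r by simp
      have "(\<integral>\<^sup>+x. ennreal \<bar>w x\<bar> * indicator (ball a r) x \<partial>lborel) \<le> pint 1 (\<lambda>x. moll \<rho> w x - w x)"
        by (rule nn_integral_mono) (auto simp: indicator_def zero[OF \<rho>(1) \<rho>r])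
      also have "... \<le> ennreal \<tau>" by (rule \<rho>0(2)[OF \<rho>])
      finally show ?thesis by simp
    qed
    have "(\<integral>\<^sup>+x. ennreal \<bar>w x\<bar> * indicator (ball a r) x \<partial>lborel) \<le> 0" by (rule ennreal_le_epsilon) (rule small)
    then have 0: "(\<integral>\<^sup>+x. ennreal \<bar>w x\<bar> * indicator (ball a r) x \<partial>(lborel :: (real^'n) measure)) = 0" by simp
    have [measurable]: "w \<in> borel_measurable borel" "ball a r \<in> sets borel" using w(1) by auto
    have "(\<lambda>x. ennreal \<bar>w x\<bar> * indicator (ball a r) x) \<in> borel_measurable lborel" by measurable
    from iffD1[OF nn_integral_0_iff_AE[OF this] 0]
    have "AE x in lborel. ennreal \<bar>w x\<bar> * indicator (ball a r) x = 0" .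
    then have "AE x in lebesgue. ennreal \<bar>w x\<bar> * indicator (ball a r) x = 0" by (rule AE_completion)
    then have "AE x in lebesgue. x \<in> ball a r --> h x = 0"
      using w(2)
    proof eventually_elim
      case (elim x)
      show ?case
      proof
        assume x: "x \<in> ball a r"
        then have "x \<in> K" unfolding K_def r_def using r0(1) by auto
        then show "h x = 0" using elim x by (auto simp: indicator_def)
      qed
    qed
    then show ?thesis using r by blast
  qed
  then obtain r where r: "\<And>a. a \<in> \<Omega> ==> 0 < r a \<and> (AE x in lebesgue. x \<in> ball a (r a) --> h x = 0)" by metis
  obtain \<F> where F: "\<F> \<subseteq> (\<lambda>a. ball a (r a)) ` \<Omega>" "countable \<F>" "\<Union>\<F> = \<Union>((\<lambda>a. ball a (r a)) ` \<Omega>)"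
    by (rule Lindelof[of "(\<lambda>a. ball a (r a)) ` \<Omega>"]) auto
  have "AE x in lebesgue. \<forall>B\<in>\<F>. x \<in> B --> h x = 0"
    by (subst AE_ball_countable[OF F(2)]) (use F(1) r in blast)
  then have "AE x in lebesgue. x \<in> \<Omega> --> h x = 0"
  proof eventually_elim
    case (elim x)
    show ?case
    proof
      assume "x \<in> \<Omega>"
      then have "x \<in> ball x (r x)" using r by simp
      then have "x \<in> \<Union>\<F>" unfolding F(3) using \<open>x \<in> \<Omega>\<close> by blast
      then show "h x = 0" using elim by blast
    qed
  qed
  then show ?thesis using \<Omega> by (subst AE_restrict_space_iff) auto
qed

lemma weak_deriv_unique:
  fixes u :: "real^'n::finite => real"
  assumes \<Omega>: "open \<Omega>" and g: "is_weak_deriv \<Omega> \<alpha> u g" "is_weak_deriv \<Omega> \<alpha> u g'"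
  shows "AE x in lebesgue_on \<Omega>. g x = g' x"
proof -
  have loc: "g \<in> L1_loc \<Omega>" "g' \<in> L1_loc \<Omega>" using g unfolding is_weak_deriv_def by auto
  have "AE x in lebesgue_on \<Omega>. g x - g' x = 0"
  proof (rule du_bois_reymond[OF \<Omega>])
    show "(\<lambda>x. g x - g' x) \<in> L1_loc \<Omega>" using loc unfolding L1_loc_def by auto
    fix \<phi> assume \<phi>: "\<phi> \<in> test_functions \<Omega>"
    have "(-1) ^ order_of \<alpha> * (LINT x|lebesgue_on \<Omega>. g x * \<phi> x) = (-1) ^ order_of \<alpha> * (LINT x|lebesgue_on \<Omega>. g' x * \<phi> x)"
      using g \<phi> unfolding is_weak_deriv_def by simp
    then have "(LINT x|lebesgue_on \<Omega>. g x * \<phi> x) = (LINT x|lebesgue_on \<Omega>. g' x * \<phi> x)" by simp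
    then show "(LINT x|lebesgue_on \<Omega>. (g x - g' x) * \<phi> x) = 0"
      unfolding left_diff_distrib
      by (subst Bochner_Integration.integral_diff) (use L1_loc_test_integrable[OF \<Omega> _ \<phi>] loc in auto)
  qed
  then show ?thesis by simp
qed

lemma weak_deriv_diff:
  fixes u v :: "real^'n::finite => real"
  assumes \<Omega>: "open \<Omega>" and g: "is_weak_deriv \<Omega> \<alpha> u g" "is_weak_deriv \<Omega> \<alpha> v g'"
  shows "is_weak_deriv \<Omega> \<alpha> (\<lambda>x. u x - v x) (\<lambda>x. g x - g' x)"
proof -
  have loc: "u \<in> L1_loc \<Omega>" "v \<in> L1_loc \<Omega>" "g \<in> L1_loc \<Omega>" "g' \<in> L1_loc \<Omega>"
    using g unfolding is_weak_deriv_def by auto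
  then have loc': "(\<lambda>x. u x - v x) \<in> L1_loc \<Omega>" "(\<lambda>x. g x - g' x) \<in> L1_loc \<Omega>" unfolding L1_loc_def by auto
  have "(LINT x|lebesgue_on \<Omega>. (u x - v x) * classical_deriv \<alpha> \<phi> x) =
      (-1) ^ order_of \<alpha> * (LINT x|lebesgue_on \<Omega>. (g x - g' x) * \<phi> x)" if \<phi>: "\<phi> \<in> test_functions \<Omega>" for \<phi>
  proof -
    have \<phi>': "classical_deriv \<alpha> \<phi> \<in> test_functions \<Omega>" unfolding classical_deriv_D by (rule test_D[OF \<phi>])
    have "(LINT x|lebesgue_on \<Omega>. (u x - v x) * classical_deriv \<alpha> \<phi> x) =
        (LINT x|lebesgue_on \<Omega>. u x * classical_deriv \<alpha> \<phi> x) - (LINT x|lebesgue_on \<Omega>. v x * classical_deriv \<alpha> \<phi> x)"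
      unfolding left_diff_distrib
      by (rule Bochner_Integration.integral_diff) (use L1_loc_test_integrable[OF \<Omega> _ \<phi>'] loc in auto)
    also have "... = (-1) ^ order_of \<alpha> * ((LINT x|lebesgue_on \<Omega>. g x * \<phi> x) - (LINT x|lebesgue_on \<Omega>. g' x * \<phi> x))"
      using g \<phi> unfolding is_weak_deriv_def by (simp add: right_diff_distrib)
    also have "(LINT x|lebesgue_on \<Omega>. g x * \<phi> x) - (LINT x|lebesgue_on \<Omega>. g' x * \<phi> x) = (LINT x|lebesgue_on \<Omega>. (g x - g' x) * \<phi> x)"
      unfolding left_diff_distrib
      by (rule Bochner_Integration.integral_diff[symmetric]) (use L1_loc_test_integrable[OF \<Omega> _ \<phi>] loc in auto)
    finally show ?thesis .
  qed
  then show ?thesis using loc' unfolding is_weak_deriv_def by blast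
qed

lemma Lp_norm_cong_AE:
  assumes "AE x in lebesgue_on \<Omega>. f x = g x" "p < \<infinity>"
  shows "Lp_norm p \<Omega> f = Lp_norm p \<Omega> g"
proof -
  have "(\<integral>\<^sup>+ x. ennreal (\<bar>f x\<bar> powr enn2real p) \<partial>lebesgue_on \<Omega>) = (\<integral>\<^sup>+ x. ennreal (\<bar>g x\<bar> powr enn2real p) \<partial>lebesgue_on \<Omega>)"
    by (rule nn_integral_cong_AE) (use assms(1) in eventually_elim, simp)
  moreover have "p \<noteq> \<infinity>" using assms(2) by auto
  ultimately show ?thesis unfolding Lp_norm_def by simp
qed

lemma Lp_norm_le:
  assumes "p < \<infinity>" "0 \<le> B" and I: "(\<integral>\<^sup>+ x. ennreal (\<bar>f x\<bar> powr enn2real p) \<partial>lebesgue_on \<Omega>) \<le> ennreal B"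
  shows "Lp_norm p \<Omega> f \<le> ennreal (B powr (1 / enn2real p))"
proof -
  let ?I = "\<integral>\<^sup>+ x. ennreal (\<bar>f x\<bar> powr enn2real p) \<partial>lebesgue_on \<Omega>"
  have fin: "?I \<noteq> \<infinity>" using I by (auto simp: top_unique)
  have "enn2real ?I \<le> B" using I assms(2) by (metis enn2real_ennreal enn2real_mono ennreal_less_top)
  then have "enn2real ?I powr (1 / enn2real p) \<le> B powr (1 / enn2real p)" by (intro powr_mono2) auto
  moreover have "p \<noteq> \<infinity>" using assms(1) by auto
  ultimately show ?thesis using fin unfolding Lp_norm_def by (simp add: Let_def ennreal_leI)
qed

lemma Linf_subset_Lp:
  assumes f: "f \<in> Lp \<infinity> \<Omega>" and \<Omega>: "open \<Omega>" "bounded \<Omega>" and p: "p < \<infinity>" shows "f \<in> Lp p \<Omega>"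
proof -
  have m: "f \<in> borel_measurable (lebesgue_on \<Omega>)" and e: "esssup (lebesgue_on \<Omega>) (\<lambda>x. ennreal \<bar>f x\<bar>) < \<infinity>"
    using f unfolding Lp_def Lp_norm_def by auto
  define B where "B = enn2real (esssup (lebesgue_on \<Omega>) (\<lambda>x. ennreal \<bar>f x\<bar>))"
  have eB: "esssup (lebesgue_on \<Omega>) (\<lambda>x. ennreal \<bar>f x\<bar>) = ennreal B" unfolding B_def using e by simp
  have AE: "AE x in lebesgue_on \<Omega>. ennreal \<bar>f x\<bar> \<le> ennreal B"
    unfolding eB[symmetric] by (rule esssup_AE)
  have fin: "emeasure (lebesgue_on \<Omega>) \<Omega> < \<infinity>"
    using \<Omega> emeasure_bounded_finite[of \<Omega>] by (simp add: emeasure_restrict_space)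
  have "(\<integral>\<^sup>+ x. ennreal (\<bar>f x\<bar> powr enn2real p) \<partial>lebesgue_on \<Omega>) \<le> (\<integral>\<^sup>+ x. ennreal (B powr enn2real p) \<partial>lebesgue_on \<Omega>)"
  proof (rule nn_integral_mono_AE)
    show "AE x in lebesgue_on \<Omega>. ennreal (\<bar>f x\<bar> powr enn2real p) \<le> ennreal (B powr enn2real p)"
      using AE by eventually_elim (auto simp: B_def intro!: ennreal_leI powr_mono2)
  qed
  also have "... = ennreal (B powr enn2real p) * emeasure (lebesgue_on \<Omega>) \<Omega>" by simp
  also have "... < \<infinity>" using fin by (simp add: ennreal_mult_less_top)
  finally have "Lp_norm p \<Omega> f < \<infinity>" using p unfolding Lp_norm_def by (auto simp: Let_def)
  then show ?thesis using m unfolding Lp_def by simp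
qed


section \<open>Mollification of Sobolev functions\<close>

lemma kernel_sup:
  fixes y :: "real^'n::finite"
  assumes \<rho>: "0 < \<rho>" shows "kernel \<rho> y \<le> (5 * bump_sup 0 / 2) ^ CARD('n) / \<rho> ^ CARD('n)"
proof -
  have "cutoff \<rho> 0 (\<lambda>_. 0) y \<le> bump_sup 0 ^ CARD('n)"
    using cutoff_bound[OF \<rho>, of "\<lambda>_. 0" 0 0 y] by (simp add: order_of_def)
  moreover have "0 < (2 * \<rho> / 5) ^ CARD('n)" "(2 * \<rho> / 5) ^ CARD('n) \<le> mass TYPE('n) \<rho>"
    using mass_lower[OF \<rho>, where 'n = 'n] \<rho> by (auto simp: power_divide pos_divide_le_eq mult.commute)
  ultimately have "cutoff \<rho> 0 (\<lambda>_. 0) y / mass TYPE('n) \<rho> \<le> bump_sup 0 ^ CARD('n) / (2 * \<rho> / 5) ^ CARD('n)"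
    using bump_sup(1)[of 0] by (intro frac_le) auto
  also have "... = (5 * bump_sup 0 / 2) ^ CARD('n) / \<rho> ^ CARD('n)" by (simp flip: power_divide add: mult.commute)
  finally show ?thesis unfolding kernel_def .
qed

abbreviation load :: "(real^'n::finite => real) => (real^'n) set => real" where
  "load T S \<equiv> (LINT y|lborel. indicator S y * T y)"

lemma moll_pointwise:
  fixes G T :: "real^'n::finite => real"
  assumes p: "1 \<le> p" and G: "G \<in> borel_measurable borel" and T: "integrable lborel T" "\<And>y. \<bar>G y\<bar> powr p \<le> T y"
    and \<rho>: "0 < \<rho>" and C: "\<And>y :: real^'n. kernel \<rho> y \<le> A" and S: "cube x \<rho> \<subseteq> S" "S \<in> sets borel"
  shows "\<bar>moll \<rho> G x\<bar> powr p \<le> A * load T S"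
proof -
  have T0: "0 \<le> T y" for y using T(2)[of y] powr_ge_zero[of "\<bar>G y\<bar>" p] by linarith
  have A0: "0 \<le> A" by (rule order_trans[OF kernel(2)[OF \<rho>] C])
  have int: "integrable lborel (\<lambda>y. indicator S y * T y)"
    using integrable_mult_indicator[of S lborel T] T(1) S(2) by simp
  have "ennreal (\<bar>moll \<rho> G x\<bar> powr p) \<le> (\<integral>\<^sup>+y. ennreal (\<bar>G y\<bar> powr p * kernel \<rho> (y - x)) \<partial>lborel)"
    by (rule young_convolution(1)[OF p G kernel(1-3)[OF \<rho>]])
  also have "... \<le> (\<integral>\<^sup>+y. ennreal (A * (indicator S y * T y)) \<partial>lborel)"
  proof (intro nn_integral_mono ennreal_leI)
    fix y :: "real^'n"
    show "\<bar>G y\<bar> powr p * kernel \<rho> (y - x) \<le> A * (indicator S y * T y)"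
    proof (cases "y - x \<in> cube 0 \<rho>")
      case True
      then have "y \<in> S" using S(1) by (auto simp: cube_def)
      have "\<bar>G y\<bar> powr p * kernel \<rho> (y - x) \<le> T y * A"
        by (intro mult_mono T(2) C T0 kernel(2)[OF \<rho>])
      then show ?thesis using \<open>y \<in> S\<close> by (simp add: mult.commute)
    next
      case False
      then have "kernel \<rho> (y - x) = 0" by (rule kernel(4)[OF \<rho>])
      then show ?thesis using A0 T0 by (simp add: indicator_def)
    qed
  qed
  also have "... = ennreal (LINT y|lborel. A * (indicator S y * T y))"
    by (rule nn_integral_eq_integral) (use int A0 T0 in \<open>auto simp: indicator_def\<close>)
  finally have "\<bar>moll \<rho> G x\<bar> powr p \<le> (LINT y|lborel. A * (indicator S y * T y))"
    by (subst (asm) ennreal_le_iff) (use A0 T0 in \<open>auto intro!: integral_nonneg_AE simp: indicator_def\<close>)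
  then show ?thesis by simp
qed

text \<open>The kernel centred at \<open>x\<close> is a test function as soon as the cube that supports it lies in \<open>\<Omega>\<close>.\<close>

lemma D_moll_weak_deriv:
  fixes u w G :: "real^'n::finite => real"
  assumes \<Omega>: "open \<Omega>" and u: "u \<in> L1_loc \<Omega>" and K: "compact K" "K \<subseteq> \<Omega>"
    and w: "w \<in> borel_measurable borel" "AE x in lebesgue. indicator K x * u x = w x"
    and G: "is_weak_deriv \<Omega> \<alpha> u G" "integrable lborel G" "\<And>x. x \<notin> \<Omega> ==> G x = 0"
    and \<rho>: "0 < \<rho>" and x: "cube x \<rho> \<subseteq> K" and \<alpha>: "count_list is = \<alpha>"
  shows "D is (moll \<rho> w) x = moll \<rho> G x"
proof -
  note int = L1_locD[OF u K]
  have iw: "integrable lborel w" by (rule borel_version_integral(1)[OF int w continuous_on_const])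
  have ord: "order_of \<alpha> = length is" unfolding order_of_def \<alpha>[symmetric] by (rule sum_count_list_UNIV)
  have \<phi>: "cutoff \<rho> x (\<lambda>_. 0) \<in> test_functions \<Omega>" using cutoff_test[OF \<rho>] x K(2) by blast
  have cd: "classical_deriv \<alpha> (cutoff \<rho> x (\<lambda>_. 0)) = cutoff \<rho> x \<alpha>"
    unfolding classical_deriv_D D_cutoff[OF \<rho>] count_multi_list by simp
  have GG: "(\<lambda>x. indicator \<Omega> x * G x) = G" using G(3) by (force simp: indicator_def)
  have mG: "G \<in> borel_measurable borel" using borel_measurable_integrable[OF G(2)] by simp
  have "conv w (cutoff \<rho> 0 \<alpha>) x = (LINT y|lebesgue_on \<Omega>. u y * cutoff \<rho> x \<alpha> y)"
    by (rule integral_test_eq_moll[OF \<Omega> w int \<rho> x K(2), symmetric])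
  also have "... = (-1) ^ length is * (LINT y|lebesgue_on \<Omega>. G y * cutoff \<rho> x (\<lambda>_. 0) y)"
    using G(1) \<phi> unfolding is_weak_deriv_def ord cd[symmetric] by blast
  also have "(LINT y|lebesgue_on \<Omega>. G y * cutoff \<rho> x (\<lambda>_. 0) y) = conv G (cutoff \<rho> 0 (\<lambda>_. 0)) x"
  proof (rule integral_test_eq_moll[OF \<Omega> mG _ _ \<rho> _ order.refl])
    show "AE x in lebesgue. indicator \<Omega> x * G x = G x" using G(3) by (intro AE_I2) (auto simp: indicator_def)
    show "integrable lebesgue (\<lambda>x. indicator \<Omega> x * G x)" unfolding GG using G(2) by (rule integrable_completion[THEN iffD2, rotated]) (use mG in simp)
    show "cube x \<rho> \<subseteq> \<Omega>" using x K(2) by blast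
  qed
  finally have *: "conv w (cutoff \<rho> 0 \<alpha>) x = (-1) ^ length is * conv G (cutoff \<rho> 0 (\<lambda>_. 0)) x" .
  have "D is (moll \<rho> w) x = inverse (mass TYPE('n) \<rho>) * ((-1) ^ length is * ((-1) ^ length is * conv G (cutoff \<rho> 0 (\<lambda>_. 0)) x))"
    unfolding D_moll[OF iw \<rho>] \<alpha> * ..
  also have "... = moll \<rho> G x" unfolding moll_eq by (simp add: power_mult_distrib[symmetric] flip: mult.assoc)
  finally show ?thesis .
qed

lemma is_weak_deriv_cong_AE:
  fixes g G :: "real^'n::finite => real"
  assumes \<Omega>: "open \<Omega>" and g: "is_weak_deriv \<Omega> \<alpha> u g" and G: "integrable lebesgue G" "AE x in lebesgue. x \<in> \<Omega> --> g x = G x"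
  shows "is_weak_deriv \<Omega> \<alpha> u G"
proof -
  have loc: "G \<in> L1_loc \<Omega>" unfolding L1_loc_def set_integrable_def
  proof (intro CollectI allI impI)
    fix K assume "compact K \<and> K \<subseteq> \<Omega>"
    then have "K \<in> sets borel" by (intro borel_closed compact_imp_closed) simp
    then have "K \<in> sets lebesgue" by simp
    from integrable_mult_indicator[OF this G(1)] show "integrable lebesgue (\<lambda>x. indicator K x *\<^sub>R G x)" .
  qed
  have AE: "AE x in lebesgue_on \<Omega>. g x = G x" using G(2) \<Omega> by (subst AE_restrict_space_iff) auto
  have g': "g \<in> L1_loc \<Omega>" using g unfolding is_weak_deriv_def by blast
  have "(LINT x|lebesgue_on \<Omega>. g x * \<phi> x) = (LINT x|lebesgue_on \<Omega>. G x * \<phi> x)" if "\<phi> \<in> test_functions \<Omega>" for \<phi>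
    using borel_measurable_integrable[OF L1_loc_test_integrable[OF \<Omega> g' that]]
      borel_measurable_integrable[OF L1_loc_test_integrable[OF \<Omega> loc that]] AE
    by (intro integral_cong_AE) auto
  then show ?thesis using g loc unfolding is_weak_deriv_def by simp
qed

text \<open>Borel functions on the whole space are what convolution, and Fubini's theorem for \<open>lborel\<close>, apply to.
  Integrability comes from \<open>\<bar>t\<bar> \<le> 1 + \<bar>t\<bar> powr p\<close> and the finite volume of \<open>\<Omega>\<close>.\<close>

lemma Lp_representative:
  fixes g :: "real^'n::finite => real"
  assumes \<Omega>: "open \<Omega>" "bounded \<Omega>" and p: "1 \<le> p" "p < \<infinity>" and g: "g \<in> Lp p \<Omega>" "is_weak_deriv \<Omega> \<alpha> u g"
  obtains G where "integrable lborel G" "pint (enn2real p) G < \<infinity>" "\<And>x. x \<notin> \<Omega> ==> G x = 0" "is_weak_deriv \<Omega> \<alpha> u G"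
proof -
  define P where "P = enn2real p"
  have P: "1 \<le> P" unfolding P_def using p enn2real_mono[of 1 p] by simp
  have gm: "g \<in> borel_measurable (lebesgue_on \<Omega>)" and fin: "Lp_norm p \<Omega> g < \<infinity>" using g(1) unfolding Lp_def by auto
  have "(\<lambda>x. indicator \<Omega> x * g x) \<in> borel_measurable lebesgue"
    using gm \<Omega>(1) by (subst (asm) borel_measurable_restrict_space_iff) auto
  then obtain w where w: "w \<in> borel_measurable borel" "AE x in lebesgue. indicator \<Omega> x * g x = w x"
    by (rule borel_version)
  define G where "G = (\<lambda>x. indicator \<Omega> x * w x)"
  have [measurable]: "w \<in> borel_measurable borel" "\<Omega> \<in> sets borel" using w(1) \<Omega>(1) by auto
  have mG[measurable]: "G \<in> borel_measurable borel" unfolding G_def by measurable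
  have mG': "G \<in> borel_measurable lebesgue" using mG by (intro measurable_completion) simp
  have AE: "AE x in lebesgue. x \<in> \<Omega> --> g x = G x"
    using w(2) by eventually_elim (auto simp: G_def indicator_def)
  then have AE': "AE x in lebesgue_on \<Omega>. g x = G x" using \<Omega>(1) by (subst AE_restrict_space_iff) auto
  have "pint P G = (\<integral>\<^sup>+x. ennreal (\<bar>G x\<bar> powr P) \<partial>lebesgue)"
    by (rule nn_integral_completion[symmetric])
  also have "... = (\<integral>\<^sup>+x. ennreal (\<bar>G x\<bar> powr P) * indicator \<Omega> x \<partial>lebesgue)"
    using P by (intro nn_integral_cong) (auto simp: G_def indicator_def)
  also have "... = (\<integral>\<^sup>+x. ennreal (\<bar>G x\<bar> powr P) \<partial>lebesgue_on \<Omega>)"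
    using \<Omega>(1) by (intro nn_integral_restrict_space[symmetric]) auto
  also have "... = (\<integral>\<^sup>+x. ennreal (\<bar>g x\<bar> powr P) \<partial>lebesgue_on \<Omega>)"
    by (rule nn_integral_cong_AE) (use AE' in eventually_elim, simp)
  also have "... < \<infinity>" using fin p(2) unfolding Lp_norm_def P_def
    by (auto simp: Let_def top.not_eq_extremum split: if_splits)
  finally have pG: "pint P G < \<infinity>" .
  have iG: "integrable lborel G"
  proof (rule integrableI_bounded)
    show "G \<in> borel_measurable lborel" by simp
    have "(\<integral>\<^sup>+x. ennreal (norm (G x)) \<partial>lborel) \<le> (\<integral>\<^sup>+x. indicator \<Omega> x + ennreal (\<bar>G x\<bar> powr P) \<partial>lborel)"
    proof (rule nn_integral_mono)
      fix x
      show "ennreal (norm (G x)) \<le> indicator \<Omega> x + ennreal (\<bar>G x\<bar> powr P)"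
      proof (cases "x \<in> \<Omega>")
        case True
        have "\<bar>G x\<bar> \<le> 1 + \<bar>G x\<bar> powr P"
        proof (cases "\<bar>G x\<bar> \<le> 1")
          case True
          then show ?thesis using powr_ge_zero[of "\<bar>G x\<bar>" P] by linarith
        next
          case False
          then have "\<bar>G x\<bar> powr 1 \<le> \<bar>G x\<bar> powr P" using P by (intro powr_mono) auto
          then show ?thesis using False by simp
        qed
        then have "ennreal \<bar>G x\<bar> \<le> ennreal (1 + \<bar>G x\<bar> powr P)" by (rule ennreal_leI)
        also have "... = indicator \<Omega> x + ennreal (\<bar>G x\<bar> powr P)" using True by (subst ennreal_plus) auto
        finally show ?thesis by simp
      qed (simp add: G_def)
    qed
    also have "... = emeasure lborel \<Omega> + pint P G" by (subst nn_integral_add) auto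
    also have "... < \<infinity>" using pG emeasure_bounded_finite[OF \<Omega>(2)] by simp
    finally show "(\<integral>\<^sup>+x. ennreal (norm (G x)) \<partial>lborel) < \<infinity>" .
  qed
  have "integrable lebesgue G" using iG by (subst integrable_completion) auto
  from is_weak_deriv_cong_AE[OF \<Omega>(1) g(2) this AE] have "is_weak_deriv \<Omega> \<alpha> u G" .
  then show ?thesis by (intro that[OF iG]) (use pG in \<open>auto simp: P_def G_def\<close>)
qed

text \<open>At the later of two consecutive points the derivatives of both polynomials are close to those of \<open>f\<close>.
  The difference of the polynomials has no derivatives of order \<open>q\<close>, so \<open>growth_cube\<close> carries the
  estimate over to the larger cube.\<close>

lemma taylor_chain:
  fixes f :: "real^'n::finite => real" and p :: "nat => real^'n" and E r1 r2 :: real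
  assumes f: "f \<in> smooth UNIV" and sym: "\<And>is js z. count_list js = count_list is ==> D js f z = D is f z"
    and r: "0 < r1" "r1 \<le> r2" and E: "0 \<le> E"
    and top: "\<And>i is y. i \<le> M ==> length is = q ==> y \<in> cube (p i) r1 ==> \<bar>D is f y\<bar> \<le> E"
    and step: "\<And>i. i < M ==> p (Suc i) \<in> cube (p i) r1"
    and x: "\<And>i. i \<le> M ==> x \<in> cube (p i) r2" and js: "length js \<le> q"
  shows "\<bar>D js (taylor q f (p M)) x - D js (taylor q f (p 0)) x\<bar> \<le> M * ((CARD('n) + 1) ^ q * ((CARD('n) + 1) ^ q * E) * r2 ^ (q - length js))"
proof -
  let ?c = "real ((CARD('n) + 1) ^ q)"
  let ?\<tau> = "\<lambda>i. taylor q f (p i)"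
  have \<tau>: "?\<tau> i \<in> smooth UNIV" for i by (rule taylor_smooth) simp
  have c: "0 \<le> ?c" by simp
  have one: "\<bar>D js (?\<tau> (Suc i)) x - D js (?\<tau> i) x\<bar> \<le> ?c * (?c * E) * r2 ^ (q - length js)" if i: "i < M" for i
  proof -
    have ut: "\<bar>D is (\<lambda>y. f y - ?\<tau> i y) y\<bar> \<le> ?c * E * r1 ^ (q - length is)"
      if "is": "length is \<le> q" and y: "y \<in> cube (p i) r1" for "is" y
    proof (rule growth_cube[where z = "p i" and r = r1 and S = UNIV, OF subset_UNIV])
      show "length is \<le> q" "y \<in> cube (p i) r1" "0 < r1" "0 \<le> E" using "is" y r(1) E by auto
      show "(\<lambda>y. f y - ?\<tau> i y) \<in> smooth UNIV" by (rule smooth_diff[OF open_UNIV f \<tau>])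
    next
      fix "is" :: "'n list" and y assume "length is = q" "y \<in> cube (p i) r1"
      then show "\<bar>D is (\<lambda>y. f y - ?\<tau> i y) y\<bar> \<le> E"
        using top[of i "is" y] i by (simp add: D_diff[OF open_UNIV f \<tau>] D_taylor_high)
    next
      fix "is" :: "'n list" assume "length is < q"
      then have "D is (\<lambda>y. f y - ?\<tau> i y) (p i) = 0"
        using D_taylor_centre[OF sym] by (simp add: D_diff[OF open_UNIV f \<tau>])
      then show "\<bar>D is (\<lambda>y. f y - ?\<tau> i y) (p i)\<bar> \<le> E * r1 ^ (q - length is)" using E r(1) by simp
    qed
    have "\<bar>D js (\<lambda>y. ?\<tau> (Suc i) y - ?\<tau> i y) x\<bar> \<le> ?c * (?c * E) * r2 ^ (q - length js)"
    proof (rule growth_cube[where z = "p (Suc i)" and r = r2, OF subset_UNIV smooth_diff[OF open_UNIV \<tau> \<tau>] _ _ _ _ js])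
      show "0 < r2" "0 \<le> ?c * E" "x \<in> cube (p (Suc i)) r2" using r E x[of "Suc i"] i by auto
      fix "is" :: "'n list" and y assume "length is = q"
      then show "\<bar>D is (\<lambda>y. ?\<tau> (Suc i) y - ?\<tau> i y) y\<bar> \<le> ?c * E"
        using E by (simp add: D_diff[OF open_UNIV \<tau> \<tau>] D_taylor_high)
    next
      fix "is" :: "'n list" assume "is": "length is < q"
      have "D is (\<lambda>y. ?\<tau> (Suc i) y - ?\<tau> i y) (p (Suc i)) = D is (\<lambda>y. f y - ?\<tau> i y) (p (Suc i))"
        using D_taylor_centre[OF sym "is"] by (simp add: D_diff[OF open_UNIV f \<tau>] D_diff[OF open_UNIV \<tau> \<tau>])
      also have "\<bar>...\<bar> \<le> ?c * E * r1 ^ (q - length is)" using ut[of "is" "p (Suc i)"] "is" step[OF i] by simp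
      also have "... \<le> ?c * E * r2 ^ (q - length is)" using r E by (intro mult_left_mono power_mono) auto
      finally show "\<bar>D is (\<lambda>y. ?\<tau> (Suc i) y - ?\<tau> i y) (p (Suc i))\<bar> \<le> ?c * E * r2 ^ (q - length is)" .
    qed
    then show ?thesis by (simp add: D_diff[OF open_UNIV \<tau> \<tau>])
  qed
  have "\<bar>D js (?\<tau> m) x - D js (?\<tau> 0) x\<bar> \<le> m * (?c * (?c * E) * r2 ^ (q - length js))" if "m \<le> M" for m
    using that
  proof (induction m)
    case (Suc m)
    then have "\<bar>D js (?\<tau> m) x - D js (?\<tau> 0) x\<bar> \<le> m * (?c * (?c * E) * r2 ^ (q - length js))" by simp
    with one[of m] Suc.prems have "\<bar>D js (?\<tau> (Suc m)) x - D js (?\<tau> 0) x\<bar> \<le>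
        ?c * (?c * E) * r2 ^ (q - length js) + m * (?c * (?c * E) * r2 ^ (q - length js))" by linarith
    also have "... = Suc m * (?c * (?c * E) * r2 ^ (q - length js))"
      by (simp only: of_nat_Suc distrib_right mult_1)
    finally show ?case .
  qed simp
  from this[OF order.refl] show ?thesis .
qed


section \<open>Gluing over the sheets of a lattice\<close>

definition ocube :: "real^'n::finite => real => (real^'n) set" where
  "ocube c r = {x. \<forall>i. \<bar>x $ i - c $ i\<bar> < r}"

lemma ocube_dist: "x \<in> ocube c r ==> y \<in> ocube c r ==> dist x y \<le> CARD('n) * (2 * r)"
  for c :: "real^'n::finite" and r :: real
proof -
  assume x: "x \<in> ocube c r" and y: "y \<in> ocube c r"
  have "y \<in> cube x (2 * r)" unfolding cube_def
  proof (intro CollectI allI)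
    fix i
    have "\<bar>x $ i - c $ i\<bar> < r" "\<bar>y $ i - c $ i\<bar> < r" using x y unfolding ocube_def by auto
    then show "\<bar>y $ i - x $ i\<bar> \<le> 2 * r" by linarith
  qed
  then show ?thesis by (rule cube_dist)
qed

definition near :: "real => int => real^'n::finite => ('n => int) set" where
  "near h N x = {m\<in>grid N. x \<in> ocube (node h m) (2 * h)}"

lemma card_near:
  fixes x :: "real^'n::finite"
  assumes h: "0 < h" shows "card (near h N x) \<le> 5 ^ CARD('n)"
proof -
  have "near h N x \<subseteq> (\<Pi>\<^sub>E i\<in>UNIV. {\<lfloor>x $ i / h\<rfloor> - 2..\<lfloor>x $ i / h\<rfloor> + 2})" (is "_ \<subseteq> ?B")
  proof
    fix m assume m: "m \<in> near h N x"
    have "m i \<in> {\<lfloor>x $ i / h\<rfloor> - 2..\<lfloor>x $ i / h\<rfloor> + 2}" for i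
    proof -
      have "\<bar>x $ i - h * of_int (m i)\<bar> < 2 * h" using m unfolding near_def ocube_def node_def by auto
      moreover have "x $ i - h * of_int (m i) = h * (x $ i / h - of_int (m i))" using h by (simp add: field_simps)
      ultimately have "\<bar>x $ i / h - of_int (m i)\<bar> < 2" using h by (simp add: abs_mult)
      then show ?thesis by (auto; linarith)
    qed
    then show "m \<in> ?B" by auto
  qed
  then have "card (near h N x) \<le> card ?B" by (intro card_mono finite_PiE) auto
  also have "... = 5 ^ CARD('n)" by (subst card_PiE) auto
  finally show ?thesis .
qed

definition cell :: "(real^'n::finite) set => real => ('n => int) => real^'n => (real^'n) set" where
  "cell \<Omega> h m x = connected_component_set (\<Omega> \<inter> ocube (node h m) (2 * h)) x"

text \<open>Different components of \<open>\<Omega>\<close> inside one lattice cube count as different sheets, and each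
  sheet of each cube carries its own local function.\<close>

definition glue ::
  "(real^'n::finite) set => real => int => ((real^'n) set => 'l) => ('l => real^'n => real) => real^'n => real" where
  "glue \<Omega> h N lab W y = (\<Sum>m\<in>grid N. cutoff h (node h m) (\<lambda>_. 0) y * W (lab (cell \<Omega> h m y)) y)"

lemma cell_mem: "x \<in> \<Omega> ==> m \<in> near h N x ==> x \<in> cell \<Omega> h m x"
  unfolding cell_def near_def by (simp add: connected_component_refl)

text \<open>A small ball that meets the support of a cutoff lies in the doubled cube, and being connected it stays
  on one sheet of it; so the sheets, and with them the labels, are constant on the ball.\<close>

lemma glue_locally:
  fixes x :: "real^'n::finite"
  assumes \<Omega>: "open \<Omega>" "x \<in> \<Omega>" and h: "0 < h" and N: "\<And>x i. x \<in> \<Omega> ==> \<bar>x $ i\<bar> \<le> h * (of_int N - 1)"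
  obtains B where "open B" "x \<in> B" "B \<subseteq> \<Omega>"
    "\<And>y. y \<in> B ==> glue \<Omega> h N lab W y = (\<Sum>m\<in>near h N x. cutoff h (node h m) (\<lambda>_. 0) y * W (lab (cell \<Omega> h m x)) y)"
    "\<And>y. y \<in> B ==> (\<Sum>m\<in>near h N x. cutoff h (node h m) (\<lambda>_. 0) y) = 1"
proof -
  obtain r0 where r0: "0 < r0" "ball x r0 \<subseteq> \<Omega>" using open_contains_ball \<Omega> by blast
  define r where "r = min r0 (h / 2)"
  have r: "0 < r" "r \<le> r0" "r \<le> h / 2" unfolding r_def using r0 h by auto
  define B where "B = ball x r"
  have B: "open B" "x \<in> B" "B \<subseteq> \<Omega>" unfolding B_def using r r0(2) by auto
  have sub: "B \<subseteq> ocube (node h m) (2 * h)" if y: "y \<in> B" "y \<in> cube (node h m) h" for m y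
  proof
    fix y' assume y': "y' \<in> B"
    show "y' \<in> ocube (node h m) (2 * h)" unfolding ocube_def
    proof (intro CollectI allI)
      fix i
      have "\<bar>(y' - x) $ i\<bar> \<le> norm (y' - x)" "\<bar>(x - y) $ i\<bar> \<le> norm (x - y)" by (rule component_le_norm_cart)+
      moreover have "norm (y' - x) < r" "norm (x - y) < r" using y' y(1) unfolding B_def by (auto simp: dist_norm norm_minus_commute)
      moreover have "\<bar>y $ i - node h m $ i\<bar> \<le> h" using y(2) unfolding cube_def by auto
      ultimately show "\<bar>y' $ i - node h m $ i\<bar> < 2 * h" using r(3) unfolding vector_minus_component by linarith
    qed
  qed
  have cell: "cell \<Omega> h m y = cell \<Omega> h m x" if "y \<in> B" "B \<subseteq> ocube (node h m) (2 * h)" for m y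
  proof -
    have "connected B" unfolding B_def by simp
    then have "connected_component (\<Omega> \<inter> ocube (node h m) (2 * h)) y x"
      unfolding connected_component_def using that B by blast
    then show ?thesis unfolding cell_def by (rule connected_component_eq[OF iffD2[OF mem_Collect_eq], symmetric])
  qed
  have out: "cutoff h (node h m) (\<lambda>_. 0) y = 0" if m: "m \<in> grid N" "m \<notin> near h N x" and y: "y \<in> B" for m y
  proof (rule cutoff_support[OF h], rule notI)
    assume "y \<in> cube (node h m) h"
    then have "x \<in> ocube (node h m) (2 * h)" using sub[OF y] B(2) by blast
    then show False using m unfolding near_def by blast
  qed
  have near: "near h N x \<subseteq> grid N" unfolding near_def by blast
  have eq: "cutoff h (node h m) (\<lambda>_. 0) y * W (lab (cell \<Omega> h m y)) y = cutoff h (node h m) (\<lambda>_. 0) y * W (lab (cell \<Omega> h m x)) y"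
    if y: "y \<in> B" for m y
  proof (cases "y \<in> cube (node h m) h")
    case True
    then show ?thesis using cell[OF y sub[OF y True]] by simp
  qed (simp add: cutoff_support[OF h])
  show ?thesis
  proof (rule that[OF B])
    fix y assume y: "y \<in> B"
    show "glue \<Omega> h N lab W y = (\<Sum>m\<in>near h N x. cutoff h (node h m) (\<lambda>_. 0) y * W (lab (cell \<Omega> h m x)) y)"
      unfolding glue_def eq[OF y]
      by (rule sum.mono_neutral_right[OF finite_grid near]) (use out y in auto)
    have "(\<Sum>m\<in>near h N x. cutoff h (node h m) (\<lambda>_. 0) y) = (\<Sum>m\<in>grid N. cutoff h (node h m) (\<lambda>_. 0) y)"
      by (rule sum.mono_neutral_left[OF finite_grid near]) (use out y in auto)
    also have "... = 1" by (rule cutoff_partition[OF h N]) (use y B(3) in blast)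
    finally show "(\<Sum>m\<in>near h N x. cutoff h (node h m) (\<lambda>_. 0) y) = 1" .
  qed
qed

context
  fixes \<Omega> :: "(real^'n::finite) set" and h :: real and N :: int and lab :: "(real^'n) set => 'l" and W :: "'l => real^'n => real"
  assumes \<Omega>: "open \<Omega>" and h: "0 < h" and N: "\<And>x i. x \<in> \<Omega> ==> \<bar>x $ i\<bar> \<le> h * (of_int N - 1)"
    and W: "\<And>l. W l \<in> smooth UNIV"
begin

abbreviation "\<psi> m \<equiv> cutoff h (node h m) (\<lambda>_. 0)"

lemma smooth_term: "(\<lambda>y. \<psi> m y * W l y) \<in> smooth S" if "open S"
  by (rule smooth_mult[OF that cutoff_smooth[OF h that] smooth_subset[OF W subset_UNIV]])

lemma glue_smooth: "glue \<Omega> h N lab W \<in> smooth \<Omega>"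
proof (rule smooth_local)
  fix x assume x: "x \<in> \<Omega>"
  show "\<exists>B. open B \<and> x \<in> B \<and> glue \<Omega> h N lab W \<in> smooth B"
  proof (rule glue_locally[OF \<Omega> x h N, where lab = lab and W = W], assumption, goal_cases)
    case (1 B)
    have "(\<lambda>y. \<Sum>m\<in>near h N x. \<psi> m y * W (lab (cell \<Omega> h m x)) y) \<in> smooth B"
      by (rule smooth_sum[OF 1(1) smooth_term[OF 1(1)]])
    then have "glue \<Omega> h N lab W \<in> smooth B" by (rule smooth_cong[OF 1(1)]) (rule 1(4)[symmetric])
    then show ?case using 1 by blast
  qed
qed

lemma D_glue:
  assumes x: "x \<in> \<Omega>"
  shows "D is (glue \<Omega> h N lab W) x = (\<Sum>m\<in>near h N x. D is (\<lambda>y. \<psi> m y * W (lab (cell \<Omega> h m x)) y) x)"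
proof (rule glue_locally[OF \<Omega> x h N, where lab = lab and W = W], assumption, goal_cases)
  case (1 B)
  have "D is (glue \<Omega> h N lab W) x = D is (\<lambda>y. \<Sum>m\<in>near h N x. \<psi> m y * W (lab (cell \<Omega> h m x)) y) x"
    by (rule D_cong[OF 1(1,2)]) (rule 1(4))
  also have "... = (\<Sum>m\<in>near h N x. D is (\<lambda>y. \<psi> m y * W (lab (cell \<Omega> h m x)) y) x)"
    by (rule D_sum[OF open_UNIV UNIV_I]) (rule smooth_term[OF open_UNIV])
  finally show ?case .
qed

lemma near_nonempty: assumes x: "x \<in> \<Omega>" shows "near h N x \<noteq> {}"
  by (rule glue_locally[OF \<Omega> x h N, where lab = lab and W = W]) (assumption, force)

text \<open>Since the cutoffs sum to one, subtracting a single local function from all of them leaves only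
  the differences of local functions.\<close>

lemma D_glue_close:
  assumes x: "x \<in> \<Omega>" and f: "f \<in> smooth UNIV" and b: "0 \<le> b"
    "\<And>m js. m \<in> near h N x ==> length js \<le> length is ==> \<bar>D js (\<lambda>y. W (lab (cell \<Omega> h m x)) y - f y) x\<bar> \<le> b / h ^ length js"
    and B: "B = bump_sup (length is) ^ CARD('n)"
  shows "\<bar>D is (glue \<Omega> h N lab W) x - D is f x\<bar> \<le> 5 ^ CARD('n) * (2 ^ length is * B * b / h ^ length is)"
proof (rule glue_locally[OF \<Omega> x h N, where lab = lab and W = W], assumption, goal_cases)
  case (1 U)
  let ?g = "\<lambda>m y. \<psi> m y * (W (lab (cell \<Omega> h m x)) y - f y)"
  have sm: "?g m \<in> smooth UNIV" for m
    by (intro smooth_mult smooth_diff cutoff_smooth h f W open_UNIV)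
  have "D is (glue \<Omega> h N lab W) x = D is (\<lambda>y. f y + (\<Sum>m\<in>near h N x. ?g m y)) x"
  proof (rule D_cong[OF 1(1,2)])
    fix y assume y: "y \<in> U"
    have "(\<Sum>m\<in>near h N x. ?g m y) = (\<Sum>m\<in>near h N x. \<psi> m y * W (lab (cell \<Omega> h m x)) y) - (\<Sum>m\<in>near h N x. \<psi> m y) * f y"
      unfolding right_diff_distrib sum_subtractf sum_distrib_right by (rule refl)
    then show "glue \<Omega> h N lab W y = f y + (\<Sum>m\<in>near h N x. ?g m y)" using 1(4,5)[OF y] by simp
  qed
  also have "... = D is f x + (\<Sum>m\<in>near h N x. D is (?g m) x)"
    by (subst D_add[OF open_UNIV f _ UNIV_I]) (simp_all add: smooth_sum sm D_sum[OF open_UNIV UNIV_I])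
  finally have "\<bar>D is (glue \<Omega> h N lab W) x - D is f x\<bar> = \<bar>\<Sum>m\<in>near h N x. D is (?g m) x\<bar>" by simp
  also have "... \<le> (\<Sum>m\<in>near h N x. \<bar>D is (?g m) x\<bar>)" by (rule sum_abs)
  also have "... \<le> (\<Sum>m\<in>near h N x. 2 ^ length is * B * b / h ^ length is)"
  proof (rule sum_mono)
    fix m assume m: "m \<in> near h N x"
    show "\<bar>D is (?g m) x\<bar> \<le> 2 ^ length is * B * b / h ^ length is"
    proof (rule D_mult_bound[OF open_UNIV UNIV_I h cutoff_smooth[OF h open_UNIV] smooth_diff[OF open_UNIV W f] _ b(2)[OF m]])
      fix js :: "'n list" assume js: "length js \<le> length is"
      have "order_of (count_list js) = length js" unfolding order_of_def by (rule sum_count_list_UNIV)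
      then show "\<bar>D js (\<psi> m) x\<bar> \<le> B / h ^ length js"
        using cutoff_bound[OF h, of "count_list js" "length is" "node h m" x] js unfolding D_cutoff[OF h] B by simp
    qed
  qed
  also have "... = card (near h N x) * (2 ^ length is * B * b / h ^ length is)" by simp
  also have "... \<le> 5 ^ CARD('n) * (2 ^ length is * B * b / h ^ length is)"
  proof (rule mult_right_mono)
    have "real (card (near h N x)) \<le> real (5 ^ CARD('n))" by (rule of_nat_mono[OF card_near[OF h]])
    then show "real (card (near h N x)) \<le> 5 ^ CARD('n)" by simp
    show "0 \<le> 2 ^ length is * B * b / h ^ length is" using bump_sup(1)[of "length is"] b(1) h unfolding B by simp
  qed
  finally show ?case .
qed

lemma D_glue_eq:
  assumes x: "x \<in> \<Omega>" and f: "f \<in> smooth UNIV" and eq: "\<And>m. m \<in> near h N x ==> W (lab (cell \<Omega> h m x)) = f"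
  shows "D is (glue \<Omega> h N lab W) x = D is f x"
proof -
  have "\<bar>D is (glue \<Omega> h N lab W) x - D is f x\<bar> \<le> 5 ^ CARD('n) * (2 ^ length is * bump_sup (length is) ^ CARD('n) * 0 / h ^ length is)"
    by (rule D_glue_close[OF x f _ _ refl]) (use eq in \<open>auto simp: D_zero\<close>)
  then show ?thesis by simp
qed

lemma D_glue_bounded:
  assumes bd: "bounded \<Omega>" and L: "finite L" "\<And>x m. x \<in> \<Omega> ==> m \<in> near h N x ==> lab (cell \<Omega> h m x) \<in> L"
  shows "\<exists>B. \<forall>x\<in>\<Omega>. \<bar>D is (glue \<Omega> h N lab W) x\<bar> \<le> B"
proof -
  have "\<exists>b. \<forall>x\<in>\<Omega>. \<bar>D is (\<lambda>y. \<psi> m y * W l y) x\<bar> \<le> b" for m l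
  proof -
    have "compact (D is (\<lambda>y. \<psi> m y * W l y) ` closure \<Omega>)"
      by (intro compact_continuous_image smooth_continuous[OF smooth_subset[OF smooth_D[OF smooth_term[OF open_UNIV]] subset_UNIV]])
         (use bd in simp)
    from compact_imp_bounded[OF this] obtain b where "\<forall>x\<in>closure \<Omega>. \<bar>D is (\<lambda>y. \<psi> m y * W l y) x\<bar> \<le> b"
      unfolding bounded_iff by auto
    then show ?thesis using closure_subset[of \<Omega>] by blast
  qed
  then obtain b where b: "\<And>m l x. x \<in> \<Omega> ==> \<bar>D is (\<lambda>y. \<psi> m y * W l y) x\<bar> \<le> b m l" by metis
  show ?thesis
  proof (intro exI ballI)
    fix x assume x: "x \<in> \<Omega>"
    have b0: "0 \<le> b m l" for m l using b[OF x, of m l] by linarith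
    have "\<bar>D is (glue \<Omega> h N lab W) x\<bar> \<le> (\<Sum>m\<in>near h N x. \<bar>D is (\<lambda>y. \<psi> m y * W (lab (cell \<Omega> h m x)) y) x\<bar>)"
      unfolding D_glue[OF x] by (rule sum_abs)
    also have "... \<le> (\<Sum>m\<in>near h N x. \<Sum>l\<in>L. b m l)"
    proof (rule sum_mono)
      fix m assume m: "m \<in> near h N x"
      have "\<bar>D is (\<lambda>y. \<psi> m y * W (lab (cell \<Omega> h m x)) y) x\<bar> \<le> b m (lab (cell \<Omega> h m x))" by (rule b[OF x])
      also have "... \<le> (\<Sum>l\<in>L. b m l)" by (rule member_le_sum) (use L(2)[OF x m] L(1) b0 in auto)
      finally show "\<bar>D is (\<lambda>y. \<psi> m y * W (lab (cell \<Omega> h m x)) y) x\<bar> \<le> (\<Sum>l\<in>L. b m l)" .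
    qed
    also have "... \<le> (\<Sum>m\<in>grid N. \<Sum>l\<in>L. b m l)"
      by (rule sum_mono2[OF finite_grid]) (auto simp: near_def intro!: sum_nonneg b0)
    finally show "\<bar>D is (glue \<Omega> h N lab W) x\<bar> \<le> (\<Sum>m\<in>grid N. \<Sum>l\<in>L. b m l)" .
  qed
qed

end


section \<open>The glued approximation\<close>

context hyperbolic_domain
begin

definition core :: "real => (real^'n) set" where
  "core r = {x\<in>\<Omega>. r \<le> d x}"

lemma core_compact: assumes "0 < r" shows "compact (core r)"
proof -
  have "core r = closure \<Omega> \<inter> {x. r \<le> d x}"
    using assms closure_subset[of \<Omega>] by (auto simp: core_def closure_Un_frontier)
  moreover have "closed {x. r \<le> d x}" by (intro closed_Collect_le continuous_intros)
  ultimately have "closed (core r)" by (simp add: closed_Int)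
  moreover have "bounded (core r)" using bdd by (rule bounded_subset) (auto simp: core_def)
  ultimately show ?thesis by (simp add: compact_eq_bounded_closed)
qed

end

text \<open>All scales are fixed multiples of \<open>\<eta>\<close>. The mollification scale \<open>\<rho>\<close> and the step \<open>r1\<close> keep the
  averages near a chain inside \<open>core\<close>; the radius \<open>r2\<close> covers the region in which the Taylor polynomials
  of a chain are compared; the mesh \<open>h\<close> makes the doubled lattice cubes small enough for their sheets
  to be pieces. The function \<open>w\<close> is \<open>u\<close> cut off near the boundary, \<open>G\<close> are its derivatives of order \<open>q\<close>,
  and \<open>T\<close> dominates their \<open>P\<close>-th powers.\<close>

locale labelled_domain = hyperbolic_domain \<Omega> \<delta> for \<Omega> :: "(real^'n::finite) set" and \<delta> +
  fixes q N :: nat and Q :: int and P \<kappa> C K \<eta> \<rho> r1 r2 h c B C0 :: real and x0 :: "real^'n"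
    and lab :: "(real^'n) set => (real^'n) option" and Z :: "(real^'n) set"
    and u w T :: "real^'n => real" and G :: "('n => nat) => real^'n => real"
  assumes lab: "labelling \<kappa> C N K x0 \<eta> lab Z"
    and pos: "0 < \<eta>" "0 < \<kappa>" "\<kappa> \<le> 1" "1 \<le> C" "1 \<le> P"
    and Q: "\<And>x i. x \<in> \<Omega> ==> \<bar>x $ i\<bar> \<le> \<eta> / (8 * CARD('n)) * (of_int Q - 1)"
    and u: "u \<in> L1_loc \<Omega>"
    and w: "w \<in> borel_measurable borel" "AE x in lebesgue. indicator (core (\<kappa> * \<eta> / 2)) x * u x = w x"
    and G: "\<And>\<alpha>. order_of \<alpha> = q ==> is_weak_deriv \<Omega> \<alpha> u (G \<alpha>)" "\<And>\<alpha>. order_of \<alpha> = q ==> integrable lborel (G \<alpha>)"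
      "\<And>\<alpha> x. order_of \<alpha> = q ==> x \<notin> \<Omega> ==> G \<alpha> x = 0"
    and T: "integrable lborel T" "\<And>y. 0 \<le> T y" "\<And>\<alpha> y. order_of \<alpha> = q ==> \<bar>G \<alpha> y\<bar> powr P \<le> T y"
    and scale_defs: "\<rho> = \<kappa> * \<eta> / (16 * CARD('n))" "r1 = \<kappa> * \<eta> / (8 * CARD('n))" "r2 = 2 * C * \<eta>"
      "h = \<eta> / (8 * CARD('n))" "c = real ((CARD('n) + 1) ^ q)"
      "B = bump_sup q ^ CARD('n)" "C0 = (5 * bump_sup 0 / 2) ^ CARD('n)"
begin

abbreviation ut :: "real^'n => real" where "ut \<equiv> moll \<rho> w"
abbreviation energy :: "real^'n => real" where "energy z \<equiv> (LINT y|lborel. indicator (cball z ((C + 1) * \<eta>)) y * T y)"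
abbreviation E :: "real^'n => real" where "E z \<equiv> (C0 / \<rho> ^ CARD('n) * energy z) powr (1 / P)"
abbreviation W :: "(real^'n) option => real^'n => real" where "W \<equiv> case_option ut (\<lambda>z. taylor q ut z)"
abbreviation v :: "real^'n => real" where "v \<equiv> glue \<Omega> h Q lab W"

lemma labD:
  "finite Z" "piece \<eta> V ==> lab V = Some z ==> z \<in> Z" "piece \<eta> V ==> lab V = Some z ==> V \<subseteq> deep x0 (K * \<eta>)"
  "piece \<eta> V ==> lab V = None ==> x \<in> V ==> \<eta> \<le> d x"
  using lab unfolding labelling_def by simp_all

lemma B_C0: "1 \<le> B" "0 < C0" using bump_sup(1)[of q] bump_sup(1)[of 0] unfolding scale_defs by auto

lemma n_pos: "0 < real CARD('n)" by simp

lemma scales: "0 < \<rho>" "0 < r1" "r1 \<le> r2" "0 < h" "0 < r2"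
proof -
  show "0 < \<rho>" "0 < r1" "0 < h" "0 < r2" using pos unfolding scale_defs by auto
  have "1 \<le> CARD('n)" by (simp add: Suc_leI)
  then have "1 \<le> real CARD('n)" by (metis of_nat_1 of_nat_le_iff)
  then have "1 \<le> 8 * real CARD('n)" by linarith
  from mult_left_mono[OF this, of "\<kappa> * \<eta>"] have "\<kappa> * \<eta> * 1 \<le> \<kappa> * \<eta> * (8 * real CARD('n))"
    using pos by simp
  then have "r1 \<le> \<kappa> * \<eta>" unfolding scale_defs by (simp add: divide_simps)
  also have "... \<le> 1 * \<eta>" using pos by (intro mult_right_mono) auto
  also have "... \<le> (2 * C) * \<eta>" using pos by (intro mult_right_mono) auto
  finally show "r1 \<le> r2" unfolding scale_defs .
qed

lemma iw: "integrable lborel w"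
  by (rule borel_version_integral(1)[OF L1_locD[OF u core_compact] w continuous_on_const])
     (use pos in \<open>auto simp: core_def\<close>)

lemma ut_smooth: "ut \<in> smooth UNIV" by (rule moll_smooth[OF iw scales(1)])

lemma W_smooth: "W l \<in> smooth UNIV"
  by (cases l) (auto simp: ut_smooth taylor_smooth)

text \<open>The derivatives of the kernel, a product of functions of one variable, do not depend on the order of differentiation.\<close>

lemma D_ut_sym: assumes "count_list js = count_list is" shows "D js ut z = D is ut z"
proof -
  have "length js = length is" using assms sum_count_list_UNIV[of js] sum_count_list_UNIV[of "is"] by simp
  then show ?thesis unfolding D_moll[OF iw scales(1)] assms by simp
qed

lemma cube_inside:
  assumes p: "p \<in> \<Omega>" "\<kappa> * \<eta> \<le> d p" and y: "y \<in> cube p r1"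
  shows "cube y \<rho> \<subseteq> core (\<kappa> * \<eta> / 2)" "cube y \<rho> \<subseteq> cball p \<eta>"
proof -
  have *: "y' \<in> core (\<kappa> * \<eta> / 2) \<and> dist p y' \<le> \<eta>" if y': "y' \<in> cube y \<rho>" for y'
  proof -
    have "dist p y \<le> CARD('n) * r1" "dist y y' \<le> CARD('n) * \<rho>" by (rule cube_dist, rule y, rule cube_dist, rule y')
    then have "dist p y \<le> \<kappa> * \<eta> / 8" "dist y y' \<le> \<kappa> * \<eta> / 16" using n_pos unfolding scale_defs by auto
    then have dp: "dist p y' \<le> 3 / 16 * (\<kappa> * \<eta>)" using dist_triangle[of p y' y] by linarith
    have "0 < \<kappa> * \<eta>" using pos by simp
    have "\<kappa> * \<eta> \<le> 1 * \<eta>" using pos by (intro mult_right_mono) auto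
    have "y' \<in> ball p (d p)" using dp p(2) \<open>0 < \<kappa> * \<eta>\<close> unfolding mem_ball by linarith
    moreover have "d p \<le> d y' + dist y' p" by (rule d_le)
    then have "\<kappa> * \<eta> / 2 \<le> d y'" using dp p(2) \<open>0 < \<kappa> * \<eta>\<close> dist_commute[of y' p] by linarith
    moreover have "dist p y' \<le> \<eta>" using dp \<open>\<kappa> * \<eta> \<le> 1 * \<eta>\<close> \<open>0 < \<kappa> * \<eta>\<close> by linarith
    ultimately show ?thesis using ball_d_subset[OF p(1)] unfolding core_def by blast
  qed
  then show "cube y \<rho> \<subseteq> core (\<kappa> * \<eta> / 2)" "cube y \<rho> \<subseteq> cball p \<eta>" by auto
qed

lemma D_ut:
  assumes "cube y \<rho> \<subseteq> core (\<kappa> * \<eta> / 2)" "length is = q"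
  shows "D is ut y = moll \<rho> (G (count_list is)) y"
proof -
  have o: "order_of (count_list is) = q" unfolding order_of_def by (simp only: sum_count_list_UNIV assms(2))
  have K: "compact (core (\<kappa> * \<eta> / 2))" "core (\<kappa> * \<eta> / 2) \<subseteq> \<Omega>"
    using core_compact[of "\<kappa> * \<eta> / 2"] pos by (auto simp: core_def)
  show ?thesis
    by (rule D_moll_weak_deriv[OF open_dom u K w G(1)[OF o] G(2)[OF o] G(3)[OF o] scales(1) assms(1) refl])
qed

lemma energy_nonneg: "0 \<le> energy z"
  using T(2) by (intro integral_nonneg_AE) (auto simp: indicator_def)

text \<open>The quantity \<open>E z\<close> bounds the derivatives of order \<open>q\<close> of the mollification near the boundary point
  \<open>z\<close>. It is the price of every change of labels there.\<close>

lemma E_powr: "E z powr P = C0 / \<rho> ^ CARD('n) * energy z"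
proof -
  have "0 \<le> C0 / \<rho> ^ CARD('n) * energy z"
    by (intro mult_nonneg_nonneg divide_nonneg_nonneg zero_le_power energy_nonneg) (use B_C0 scales in auto)
  then have e: "(C0 / \<rho> ^ CARD('n) * energy z) powr 1 = C0 / \<rho> ^ CARD('n) * energy z" by (rule powr_one)
  have "1 / P * P = 1" using pos(5) by simp
  then show ?thesis unfolding powr_powr using e by (simp only:)
qed

lemma D_ut_bound:
  assumes "cube y \<rho> \<subseteq> core (\<kappa> * \<eta> / 2)" "cube y \<rho> \<subseteq> cball z ((C + 1) * \<eta>)" "length is = q"
  shows "\<bar>D is ut y\<bar> \<le> E z"
proof -
  have o: "order_of (count_list is) = q" unfolding order_of_def by (simp only: sum_count_list_UNIV assms(3))
  have mG: "G (count_list is) \<in> borel_measurable borel" using borel_measurable_integrable[OF G(2)[OF o]] by simp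
  have kr: "kernel \<rho> y \<le> C0 / \<rho> ^ CARD('n)" for y :: "real^'n" unfolding scale_defs(7) by (rule kernel_sup[OF scales(1)])
  have "\<bar>moll \<rho> (G (count_list is)) y\<bar> powr P \<le> C0 / \<rho> ^ CARD('n) * energy z"
    by (rule moll_pointwise[OF pos(5) mG T(1) T(3)[OF o] scales(1) kr assms(2)]) simp
  then have "(\<bar>moll \<rho> (G (count_list is)) y\<bar> powr P) powr (1 / P) \<le> E z" using pos(5) by (intro powr_mono2) auto
  then show ?thesis using pos(5) unfolding D_ut[OF assms(1,3)] by (simp add: powr_powr)
qed

lemma E_nonneg: "0 \<le> E z" by simp

lemma one_le_c: "1 \<le> c"
proof -
  have "1 \<le> (CARD('n) + 1) ^ q" by simp
  then show ?thesis unfolding scale_defs by (metis of_nat_1 of_nat_le_iff)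
qed

lemma cube_E:
  assumes p: "p \<in> \<Omega>" "\<kappa> * \<eta> \<le> d p" "dist p z \<le> C * \<eta>" and y: "y \<in> cube p r1" and "length is = q"
  shows "\<bar>D is ut y\<bar> \<le> E z"
proof (rule D_ut_bound[OF cube_inside(1)[OF p(1,2) y] _ assms(5)])
  show "cube y \<rho> \<subseteq> cball z ((C + 1) * \<eta>)"
  proof
    fix y' assume "y' \<in> cube y \<rho>"
    then have "dist p y' \<le> \<eta>" using cube_inside(2)[OF p(1,2) y] by auto
    then show "y' \<in> cball z ((C + 1) * \<eta>)"
      using p(3) dist_triangle[of z y' p] dist_commute[of p z] unfolding mem_cball distrib_right by linarith
  qed
qed

lemma cubeI: "dist x p \<le> r ==> x \<in> cube p r" for x p :: "real^'n"
proof -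
  assume "dist x p \<le> r"
  then have "\<bar>(x - p) $ i\<bar> \<le> r" for i using component_le_norm_cart[of "x - p" i] by (simp add: dist_norm)
  then show ?thesis unfolding cube_def by simp
qed

lemma taylor_linked:
  assumes "linked \<kappa> C N \<eta> z y" and x: "dist x z \<le> C * \<eta>" and js: "length js \<le> q"
  shows "\<bar>D js (taylor q ut y) x - D js (taylor q ut z) x\<bar> \<le> N * (c * (c * E z) * r2 ^ (q - length js))"
proof -
  obtain p M where M: "M \<le> N" and p: "p 0 = z" "p M = y"
    "\<And>i. i \<le> M ==> p i \<in> \<Omega> \<and> \<kappa> * \<eta> \<le> d (p i) \<and> dist (p i) z \<le> C * \<eta>"
    "\<And>i. i < M ==> dist (p i) (p (Suc i)) \<le> r1"
    using assms(1) unfolding linked_def scale_defs by blast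
  have "\<bar>D js (taylor q ut (p M)) x - D js (taylor q ut (p 0)) x\<bar> \<le> M * (c * (c * E z) * r2 ^ (q - length js))"
    unfolding scale_defs(5)
  proof (rule taylor_chain[where ?r1.0 = r1, OF ut_smooth D_ut_sym scales(2,3) E_nonneg _ _ _ js], assumption)
    fix i :: nat and "is" :: "'n list" and y assume "i \<le> M" "length is = q" "y \<in> cube (p i) r1"
    then show "\<bar>D is ut y\<bar> \<le> E z" using cube_E p(3) by blast
  next
    fix i :: nat assume "i < M"
    then show "p (Suc i) \<in> cube (p i) r1" using p(4) by (intro cubeI) (simp add: dist_commute)
  next
    fix i :: nat assume "i \<le> M"
    then have "dist (p i) z \<le> C * \<eta>" using p(3) by blast
    then show "x \<in> cube (p i) r2" using x dist_triangle2[of x "p i" z] unfolding scale_defs(3) by (intro cubeI) linarith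
  qed
  also have "... \<le> N * (c * (c * E z) * r2 ^ (q - length js))"
  proof (rule mult_right_mono)
    show "real M \<le> real N" using M by simp
    show "0 \<le> c * (c * E z) * r2 ^ (q - length js)"
      using scales(5) one_le_c by (intro mult_nonneg_nonneg zero_le_power E_nonneg) auto
  qed
  finally show ?thesis using p by simp
qed

lemma taylor_centre:
  assumes p: "p \<in> \<Omega>" "\<kappa> * \<eta> \<le> d p" "dist p z \<le> C * \<eta>" and js: "length js \<le> q"
  shows "\<bar>D js ut p - D js (taylor q ut p) p\<bar> \<le> c * (c * E z) * r2 ^ (q - length js)"
proof (cases "length js = q")
  case True
  have "p \<in> cube p r1" using scales(2) by (intro cubeI) simp
  then have "\<bar>D js ut p\<bar> \<le> E z" by (rule cube_E[OF p _ True])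
  also have "... = 1 * (1 * E z)" by simp
  also have "... \<le> c * (c * E z)" using one_le_c by (intro mult_mono) auto
  finally show ?thesis using True by (simp add: D_taylor_high)
next
  case False
  then have "D js (taylor q ut p) p = D js ut p" using js by (intro D_taylor_centre[OF D_ut_sym]) auto
  then show ?thesis using scales(5) one_le_c by (simp add: mult_nonneg_nonneg)
qed

lemma cell_piece:
  assumes "x \<in> \<Omega>" "m \<in> near h Q x" shows "piece \<eta> (cell \<Omega> h m x)"
proof -
  have "CARD('n) * (2 * (2 * h)) = \<eta> / 2" using n_pos unfolding scale_defs by simp
  then have "dist a b \<le> \<eta> / 2" if "a \<in> cell \<Omega> h m x" "b \<in> cell \<Omega> h m x" for a b
    using that ocube_dist[of a "node h m" "2 * h" b] connected_component_subset unfolding cell_def by fastforce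
  then show ?thesis using cell_mem[OF assms] connected_component_subset
    unfolding piece_def cell_def by (fastforce simp: connected_connected_component)
qed

lemma label_diff:
  assumes x: "x \<in> \<Omega>" and m: "m0 \<in> near h Q x" "m \<in> near h Q x"
    and z: "lab (cell \<Omega> h m0 x) = Some z" and ne: "lab (cell \<Omega> h m x) \<noteq> Some z"
  shows "x \<in> cball z (C * \<eta>)" "length js \<le> q ==>
    \<bar>D js (\<lambda>y. W (lab (cell \<Omega> h m x)) y - taylor q ut z y) x\<bar> \<le> (N + 1) * (c * (c * E z) * r2 ^ (q - length js))"
proof -
  let ?V = "cell \<Omega> h m0 x" and ?V' = "cell \<Omega> h m x"
  have xV: "x \<in> ?V" "x \<in> ?V'" by (rule cell_mem[OF x m(1)], rule cell_mem[OF x m(2)])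
  have pc: "piece \<eta> ?V" "piece \<eta> ?V'" by (rule cell_piece[OF x m(1)], rule cell_piece[OF x m(2)])
  have "?V \<inter> ?V' \<noteq> {}" using xV by blast
  with lab pc z ne have *: "?V \<union> ?V' \<subseteq> cball z (C * \<eta>)"
    "case lab ?V' of None => \<forall>x\<in>?V'. linked \<kappa> C N \<eta> z x | Some z' => linked \<kappa> C N \<eta> z z'"
    unfolding labelling_def by blast+
  show xz: "x \<in> cball z (C * \<eta>)" using *(1) xV by blast
  then have dxz: "dist x z \<le> C * \<eta>" by (simp add: dist_commute)
  assume js: "length js \<le> q"
  let ?b = "c * (c * E z) * r2 ^ (q - length js)"
  have b: "0 \<le> ?b" using scales(5) one_le_c by simp
  have D: "D js (\<lambda>y. W l y - taylor q ut z y) x = D js (W l) x - D js (taylor q ut z) x" for l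
    by (rule D_diff[OF open_UNIV W_smooth taylor_smooth[OF open_UNIV] UNIV_I])
  show "\<bar>D js (\<lambda>y. W (lab ?V') y - taylor q ut z y) x\<bar> \<le> (N + 1) * ?b"
  proof (cases "lab ?V'")
    case (Some z')
    then have "\<bar>D js (taylor q ut z') x - D js (taylor q ut z) x\<bar> \<le> N * ?b" using *(2) taylor_linked[OF _ dxz js] by simp
    also have "... \<le> (N + 1) * ?b" using b by (intro mult_right_mono) auto
    finally show ?thesis unfolding D Some by simp
  next
    case None
    then have "linked \<kappa> C N \<eta> z x" using *(2) xV by simp
    then have l: "\<bar>D js (taylor q ut x) x - D js (taylor q ut z) x\<bar> \<le> N * ?b" by (rule taylor_linked[OF _ dxz js])
    have "\<eta> \<le> d x" by (rule labD(4)[OF pc(2) None xV(2)])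
    moreover have "\<kappa> * \<eta> \<le> 1 * \<eta>" using pos by (intro mult_right_mono) auto
    ultimately have "\<bar>D js ut x - D js (taylor q ut x) x\<bar> \<le> ?b" by (intro taylor_centre[OF x _ dxz js]) linarith
    with l have "\<bar>D js ut x - D js (taylor q ut z) x\<bar> \<le> N * ?b + ?b" by linarith
    also have "... = (N + 1) * ?b" by (simp add: distrib_right)
    finally show ?thesis unfolding D None by simp
  qed
qed

lemma Q': "x \<in> \<Omega> ==> \<bar>x $ i\<bar> \<le> h * (of_int Q - 1)"
  using Q unfolding scale_defs by simp

lemmas v_facts = open_dom scales(4) Q' W_smooth

definition amplification :: real where
  "amplification = 5 ^ CARD('n) * (2 ^ q * B * ((N + 1) * (c * c) * (2 * C) ^ q) * (8 * CARD('n)) ^ q)"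

lemma radius_power: assumes "j \<le> q" shows "r2 ^ (q - j) \<le> (2 * C) ^ q * \<eta> ^ q / h ^ j"
proof -
  have "1 \<le> CARD('n)" by (simp add: Suc_leI)
  then have "1 \<le> real CARD('n)" by (metis of_nat_1 of_nat_le_iff)
  then have "1 \<le> 8 * real CARD('n)" by linarith
  then have "\<eta> / (8 * real CARD('n)) \<le> \<eta> / 1" using pos by (intro divide_left_mono) auto
  then have h: "h \<le> \<eta>" unfolding scale_defs by simp
  have "\<eta> ^ (q - j) * h ^ j \<le> \<eta> ^ (q - j) * \<eta> ^ j" using pos scales h by (intro mult_left_mono power_mono) auto
  also have "... = \<eta> ^ q" using assms by (simp flip: power_add)
  finally have e: "\<eta> ^ (q - j) \<le> \<eta> ^ q / h ^ j" using scales by (simp add: pos_le_divide_eq)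
  have "r2 ^ (q - j) = (2 * C) ^ (q - j) * \<eta> ^ (q - j)" unfolding scale_defs(3) by (rule power_mult_distrib)
  also have "... \<le> (2 * C) ^ q * (\<eta> ^ q / h ^ j)"
    using pos e by (intro mult_mono power_increasing) auto
  finally show ?thesis by simp
qed

text \<open>At a point all of whose sheets are unlabelled the glued function is the mollification. At
  every other point only a labelled boundary point nearby contributes.\<close>

lemma pointwise_estimate:
  assumes x: "x \<in> \<Omega>" and "is": "length is = q"
  shows "D is v x = moll \<rho> (G (count_list is)) x \<or> x \<in> deep x0 (K * \<eta>) \<and>
    \<bar>D is v x\<bar> powr P \<le> (\<Sum>z\<in>Z. amplification powr P * (C0 / \<rho> ^ CARD('n)) * indicator (cball z (C * \<eta>)) x * energy z)"
proof (cases "\<forall>m\<in>near h Q x. lab (cell \<Omega> h m x) = None")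
  case True
  obtain m where m: "m \<in> near h Q x" using near_nonempty[OF v_facts x] by blast
  have "\<eta> \<le> d x" by (rule labD(4)[OF cell_piece[OF x m] _ cell_mem[OF x m]]) (use True m in blast)
  moreover have "\<kappa> * \<eta> \<le> 1 * \<eta>" using pos by (intro mult_right_mono) auto
  ultimately have "\<kappa> * \<eta> \<le> d x" by linarith
  from cube_inside(1)[OF x this, of x] have "cube x \<rho> \<subseteq> core (\<kappa> * \<eta> / 2)" using scales(2) cubeI by simp
  then have "D is ut x = moll \<rho> (G (count_list is)) x" by (rule D_ut[OF _ "is"])
  moreover have "D is v x = D is ut x" by (rule D_glue_eq[OF v_facts x ut_smooth]) (use True in auto)
  ultimately show ?thesis by simp
next
  case False
  then obtain m0 z where m0: "m0 \<in> near h Q x" and z: "lab (cell \<Omega> h m0 x) = Some z" by fastforce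
  have zZ: "z \<in> Z" "cell \<Omega> h m0 x \<subseteq> deep x0 (K * \<eta>)"
    using labD(2,3)[OF cell_piece[OF x m0] z] by blast+
  have dp: "x \<in> deep x0 (K * \<eta>)" using zZ(2) cell_mem[OF x m0] by blast
  let ?A = "amplification powr P * (C0 / \<rho> ^ CARD('n))"
  have A0: "0 \<le> ?A" using B_C0 scales by simp
  have term0: "0 \<le> ?A * indicator (cball z (C * \<eta>)) x * energy z" for z
    by (intro mult_nonneg_nonneg A0 energy_nonneg indicator_pos_le)
  let ?f = "taylor q ut z"
  have f: "?f \<in> smooth UNIV" by (rule taylor_smooth) simp
  have Df: "D is ?f x = 0" using "is" by (simp add: D_taylor_high)
  show ?thesis
  proof (cases "\<forall>m\<in>near h Q x. lab (cell \<Omega> h m x) = Some z")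
    case True
    have "D is v x = D is ?f x" by (rule D_glue_eq[OF v_facts x f]) (use True in auto)
    then have "\<bar>D is v x\<bar> powr P = 0" using Df by simp
    also have "... \<le> (\<Sum>z\<in>Z. ?A * indicator (cball z (C * \<eta>)) x * energy z)" by (rule sum_nonneg) (rule term0)
    finally show ?thesis using dp by blast
  next
    case False
    then obtain m1 where m1: "m1 \<in> near h Q x" "lab (cell \<Omega> h m1 x) \<noteq> Some z" by blast
    have xz: "x \<in> cball z (C * \<eta>)" by (rule label_diff(1)[OF x m0 m1(1) z m1(2)])
    define b where "b = (N + 1) * (c * (c * E z)) * ((2 * C) ^ q * \<eta> ^ q)"
    have b: "0 \<le> b" unfolding b_def using one_le_c pos by simp
    have bnd: "\<bar>D js (\<lambda>y. W (lab (cell \<Omega> h m x)) y - ?f y) x\<bar> \<le> b / h ^ length js"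
      if m: "m \<in> near h Q x" and js: "length js \<le> length is" for m js
    proof (cases "lab (cell \<Omega> h m x) = Some z")
      case True
      then show ?thesis using b scales by (simp add: D_zero)
    next
      case False
      have js': "length js \<le> q" using js "is" by simp
      have "\<bar>D js (\<lambda>y. W (lab (cell \<Omega> h m x)) y - ?f y) x\<bar> \<le> (N + 1) * (c * (c * E z) * r2 ^ (q - length js))"
        by (rule label_diff(2)[OF x m0 m z False js'])
      also have "... \<le> (N + 1) * (c * (c * E z) * ((2 * C) ^ q * \<eta> ^ q / h ^ length js))"
        using radius_power[OF js'] one_le_c by (intro mult_left_mono) auto
      also have "... = b / h ^ length js" unfolding b_def by simp
      finally show ?thesis .
    qed
    have "\<bar>D is v x - D is ?f x\<bar> \<le> 5 ^ CARD('n) * (2 ^ length is * B * b / h ^ length is)"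
      by (rule D_glue_close[where W = W and lab = lab, OF v_facts x f b]) (assumption, rule bnd, simp_all add: scale_defs "is")
    also have "... = amplification * E z"
    proof -
      have "\<eta> ^ q / h ^ q = (8 * CARD('n)) ^ q" using pos(1) unfolding scale_defs by (simp add: power_divide)
      then have "b / h ^ q = (N + 1) * (c * (c * E z)) * (2 * C) ^ q * (8 * CARD('n)) ^ q"
        unfolding b_def by (simp add: mult.assoc flip: times_divide_eq_right)
      then have "2 ^ q * B * b / h ^ q = 2 ^ q * B * ((N + 1) * (c * (c * E z)) * (2 * C) ^ q * (8 * CARD('n)) ^ q)"
        by (simp flip: times_divide_eq_right)
      then show ?thesis unfolding amplification_def "is" by simp
    qed
    finally have "\<bar>D is v x\<bar> \<le> amplification * E z" using Df by simp
    then have "\<bar>D is v x\<bar> powr P \<le> (amplification * E z) powr P" using pos by (intro powr_mono2) auto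
    also have "... = amplification powr P * E z powr P"
      by (rule powr_mult)
    also have "... = ?A * indicator (cball z (C * \<eta>)) x * energy z" unfolding E_powr using xz by simp
    also have "... \<le> (\<Sum>z\<in>Z. ?A * indicator (cball z (C * \<eta>)) x * energy z)"
      by (rule member_le_sum[OF zZ(1) term0 labD(1)])
    finally show ?thesis using dp by blast
  qed
qed

lemma v_smooth: "v \<in> smooth \<Omega>" by (rule glue_smooth[OF v_facts])

lemma D_v_bounded: "\<exists>b. \<forall>x\<in>\<Omega>. \<bar>D is v x\<bar> \<le> b"
proof (rule D_glue_bounded[OF v_facts bdd])
  show "finite (insert None (Some ` Z))" using labD(1) by simp
  fix x m assume x: "x \<in> \<Omega>" "m \<in> near h Q x"
  then show "lab (cell \<Omega> h m x) \<in> insert None (Some ` Z)"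
    using labD(2)[OF cell_piece[OF x]] by (cases "lab (cell \<Omega> h m x)") auto
qed

end


section \<open>The integral estimate\<close>

context hyperbolic_domain
begin

lemma collar_borel: "{x\<in>\<Omega>. d x \<le> r} \<in> sets borel"
proof -
  have "{x\<in>\<Omega>. d x \<le> r} = \<Omega> \<inter> {x. d x \<le> r}" by blast
  moreover have "closed {x. d x \<le> r}" by (intro closed_Collect_le continuous_intros)
  ultimately show ?thesis by simp
qed

text \<open>The complement in \<open>\<Omega>\<close> is the component of \<open>x0\<close> among the points outside the closed collar.\<close>

lemma deep_borel: assumes "x0 \<in> \<Omega>" shows "deep x0 r \<in> sets borel"
proof -
  let ?U = "{x\<in>\<Omega>. r < d x}"
  have "?U = \<Omega> \<inter> {x. r < d x}" by blast
  moreover have "open {x. r < d x}" by (intro open_Collect_less continuous_intros)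
  ultimately have "open ?U" by (simp add: open_Int)
  then have o: "open (connected_component_set ?U x0)" by (rule open_connected_component)
  have "deep x0 r = \<Omega> - connected_component_set ?U x0"
  proof (intro equalityI subsetI)
    fix x assume x: "x \<in> deep x0 r"
    have "\<not> connected_component ?U x0 x"
    proof
      assume "connected_component ?U x0 x"
      then obtain \<sigma> where s: "connected \<sigma>" "\<sigma> \<subseteq> ?U" "x0 \<in> \<sigma>" "x \<in> \<sigma>" unfolding connected_component_def by blast
      then have "\<exists>w\<in>\<sigma>. d w \<le> r" using x unfolding deep_def by blast
      then show False using s(2) by force
    qed
    then show "x \<in> \<Omega> - connected_component_set ?U x0" using x unfolding deep_def by blast
  next
    fix x assume x: "x \<in> \<Omega> - connected_component_set ?U x0"
    show "x \<in> deep x0 r" unfolding deep_def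
    proof (intro CollectI conjI allI impI)
      show "x \<in> \<Omega>" using x by blast
      fix \<sigma> assume s: "connected \<sigma> \<and> \<sigma> \<subseteq> \<Omega> \<and> x0 \<in> \<sigma> \<and> x \<in> \<sigma>"
      show "\<exists>w\<in>\<sigma>. d w \<le> r"
      proof (rule ccontr)
        assume "\<not> (\<exists>w\<in>\<sigma>. d w \<le> r)"
        then have "\<sigma> \<subseteq> ?U" using s by force
        then have "connected_component ?U x0 x" using s unfolding connected_component_def by blast
        then show False using x by blast
      qed
    qed
  qed
  then show ?thesis using o by simp
qed

end

text \<open>Otherwise dominated convergence along a sequence of scales would fail.\<close>

lemma integral_vanishing_sets:
  fixes T :: "real^'n::finite => real" and S :: "real => (real^'n) set"
  assumes T: "integrable lborel T" "\<And>y. 0 \<le> T y" and S: "\<And>\<eta>. S \<eta> \<in> sets borel"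
    and ev: "\<And>x. T x \<noteq> 0 ==> eventually (\<lambda>\<eta>. x \<notin> S \<eta>) (at_right 0)" and \<tau>: "0 < \<tau>"
  shows "eventually (\<lambda>\<eta>. load T (S \<eta>) \<le> \<tau>) (at_right 0)"
proof (rule ccontr)
  assume "\<not> ?thesis"
  then have "\<exists>\<eta>>0. \<eta> < b \<and> \<tau> < load T (S \<eta>)" if "0 < b" for b
    using that unfolding eventually_at_right_field by (auto simp: not_le)
  then have "\<forall>j. \<exists>\<eta>>0. \<eta> < inverse (real (Suc j)) \<and> \<tau> < load T (S \<eta>)" by simp
  then obtain e where e: "\<And>j. 0 < e j" "\<And>j. e j < inverse (real (Suc j))" "\<And>j. \<tau> < load T (S (e j))"
    by metis
  have e0: "e \<longlonglongrightarrow> 0"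
    by (rule tendsto_sandwich[OF _ _ tendsto_const LIMSEQ_inverse_real_of_nat])
       (use e(1,2) in \<open>auto intro!: always_eventually less_imp_le simp del: of_nat_Suc\<close>)
  have lim: "filterlim e (at_right 0) sequentially"
    by (rule tendsto_imp_filterlim_at_right[OF e0]) (use e(1) in \<open>auto intro: always_eventually\<close>)
  have "(\<lambda>j. load T (S (e j))) \<longlonglongrightarrow> (LINT y|(lborel :: (real^'n) measure). 0)"
  proof (rule integral_dominated_convergence[OF _ _ T(1)])
    have [measurable]: "T \<in> borel_measurable borel" using borel_measurable_integrable[OF T(1)] by simp
    note S[measurable]
    show "(\<lambda>y. indicator (S (e j)) y * T y) \<in> borel_measurable lborel" for j by measurable
    show "AE x in lborel. (\<lambda>j. indicator (S (e j)) x * T x) \<longlonglongrightarrow> 0"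
    proof (rule AE_I2)
      fix x
      show "(\<lambda>j. indicator (S (e j)) x * T x) \<longlonglongrightarrow> 0"
      proof (cases "T x = 0")
        case False
        have "eventually (\<lambda>j. x \<notin> S (e j)) sequentially"
          using filterlim_iff[THEN iffD1, OF lim, rule_format, OF ev[OF False]] .
        then have "eventually (\<lambda>j. indicator (S (e j)) x * T x = 0) sequentially"
          by eventually_elim simp
        then show ?thesis by (rule tendsto_eventually)
      qed simp
    qed
    show "AE x in lborel. norm (indicator (S (e j)) x * T x) \<le> T x" for j
      using T(2) by (intro AE_I2) (auto simp: indicator_def)
  qed simp
  then have "(\<lambda>j. load T (S (e j))) \<longlonglongrightarrow> 0" by simp
  then have "\<tau> \<le> 0" by (rule LIMSEQ_le_const) (use e(3) in \<open>auto intro: less_imp_le\<close>)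
  then show False using \<tau> by simp
qed

context labelled_domain
begin

abbreviation "collar \<equiv> {x\<in>\<Omega>. d x \<le> (C + 2) * \<eta>}"

definition overlap :: real where "overlap = (4 * (C + 2)) ^ CARD('n)"

text \<open>The labels are separated on the scale \<open>\<eta>\<close>.\<close>

lemma overlap_bound: "real (card {z\<in>Z. y \<in> cball z ((C + 1) * \<eta>)}) \<le> overlap"
proof -
  let ?Y = "{z\<in>Z. y \<in> cball z ((C + 1) * \<eta>)}"
  have sep: "\<eta> / 2 \<le> dist z z'" if "z \<in> Z" "z' \<in> Z" "z \<noteq> z'" for z z'
  proof -
    have "\<forall>z\<in>Z. \<forall>z'\<in>Z. z \<noteq> z' --> \<eta> / 2 \<le> dist z z'" using lab unfolding labelling_def by (elim conjE)
    then show ?thesis using that by blast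
  qed
  have "(\<Sum>z\<in>?Y. (\<eta> / 4) ^ CARD('n)) \<le> ((C + 2) * \<eta>) ^ CARD('n)"
  proof (rule packing_balls[where a = y])
    show "finite ?Y" using labD(1) by simp
    show "disjoint_family_on (\<lambda>z. ball z (\<eta> / 4)) ?Y" unfolding disjoint_family_on_def
    proof (intro ballI impI)
      fix z z' assume "z \<in> ?Y" "z' \<in> ?Y" "z \<noteq> z'"
      then have "\<eta> / 2 \<le> dist z z'" using sep by blast
      then show "ball z (\<eta> / 4) \<inter> ball z' (\<eta> / 4) = {}" by (intro disjoint_ballI) simp
    qed
    show "0 \<le> (C + 2) * \<eta>" using pos by simp
    fix z assume z: "z \<in> ?Y"
    show "0 \<le> \<eta> / 4 \<and> ball z (\<eta> / 4) \<subseteq> ball y ((C + 2) * \<eta>)"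
    proof (intro conjI subsetI)
      show "0 \<le> \<eta> / 4" using pos by simp
      fix x assume "x \<in> ball z (\<eta> / 4)"
      then have "dist y x < (C + 1) * \<eta> + \<eta> / 4" using z dist_triangle[of y x z] dist_commute[of y z] by auto
      also have "... \<le> (C + 2) * \<eta>" using pos by (simp add: algebra_simps)
      finally show "x \<in> ball y ((C + 2) * \<eta>)" by simp
    qed
  qed
  then have "card ?Y * (\<eta> / 4) ^ CARD('n) \<le> ((C + 2) * \<eta>) ^ CARD('n)" by simp
  also have "(C + 2) * \<eta> = 4 * (C + 2) * (\<eta> / 4)" by simp
  also have "(4 * (C + 2) * (\<eta> / 4)) ^ CARD('n) = overlap * (\<eta> / 4) ^ CARD('n)"
    unfolding overlap_def by (rule power_mult_distrib)
  finally show ?thesis using pos by (simp add: mult_le_cancel_right)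
qed

lemma set_integrable_T: "S \<in> sets borel ==> integrable lborel (\<lambda>y. indicator S y * T y)"
  using integrable_mult_indicator[of S lborel T] T(1) by simp

lemma sum_energy_le:
  assumes T0: "\<And>y. y \<notin> \<Omega> ==> T y = 0"
  shows "(\<Sum>z\<in>Z. energy z) \<le> overlap * load T collar"
proof -
  have "(\<Sum>z\<in>Z. energy z) = (LINT y|lborel. (\<Sum>z\<in>Z. indicator (cball z ((C + 1) * \<eta>)) y * T y))"
    by (rule Bochner_Integration.integral_sum[symmetric]) (rule set_integrable_T, simp)
  also have "... \<le> (LINT y|lborel. overlap * (indicator collar y * T y))"
  proof (rule integral_mono)
    show "integrable lborel (\<lambda>y. \<Sum>z\<in>Z. indicator (cball z ((C + 1) * \<eta>)) y * T y)"
      by (rule Bochner_Integration.integrable_sum) (rule set_integrable_T, simp)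
    show "integrable lborel (\<lambda>y. overlap * (indicator collar y * T y))"
      by (rule integrable_mult_right[OF set_integrable_T[OF collar_borel]])
    fix y :: "real^'n"
    have "(\<Sum>z\<in>Z. indicator (cball z ((C + 1) * \<eta>)) y * T y) = card {z\<in>Z. y \<in> cball z ((C + 1) * \<eta>)} * T y"
      using labD(1) by (simp add: indicator_def sum.If_cases Int_def flip: sum_distrib_right)
    also have "... \<le> overlap * (indicator collar y * T y)"
    proof (cases "y \<in> collar")
      case True
      then show ?thesis using mult_right_mono[OF overlap_bound T(2)] by simp
    next
      case False
      have "T y = 0 \<or> {z\<in>Z. y \<in> cball z ((C + 1) * \<eta>)} = {}"
      proof (rule disjCI)
        assume "{z\<in>Z. y \<in> cball z ((C + 1) * \<eta>)} \<noteq> {}"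
        then obtain z where z: "z \<in> Z" "dist z y \<le> (C + 1) * \<eta>" by auto
        have "\<forall>z\<in>Z. z \<in> \<Omega> \<and> d z = \<eta>" using lab unfolding labelling_def by (elim conjE)
        then have "d z = \<eta>" using z(1) by blast
        then have "d y \<le> (C + 2) * \<eta>" using z(2) d_le[of y z] dist_commute[of y z] by (simp add: algebra_simps)
        then have "y \<notin> \<Omega>" using False by blast
        then show "T y = 0" by (rule T0)
      qed
      then have 0: "card {z\<in>Z. y \<in> cball z ((C + 1) * \<eta>)} * T y = 0"
        by (elim disjE) (simp_all only: card.empty of_nat_0 mult_zero_left mult_zero_right)
      have "indicator collar y = (0 :: real)" using False by (rule indicator_simps(2))
      then show ?thesis unfolding 0 by simp
    qed
    finally show "(\<Sum>z\<in>Z. indicator (cball z ((C + 1) * \<eta>)) y * T y) \<le> overlap * (indicator collar y * T y)" .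
  qed
  finally show ?thesis by simp
qed

definition total :: real where
  "total = amplification powr P * C0 * (32 * C * CARD('n) / \<kappa>) ^ CARD('n) * overlap"

text \<open>The volume of the ball around \<open>z\<close> cancels the power of \<open>\<rho>\<close> in \<open>E z powr P\<close>, so the constants in front
  of the integrals over the collar and over the deep part do not depend on \<open>\<eta>\<close>.\<close>

lemma integral_estimate:
  assumes \<alpha>: "order_of \<alpha> = q" and x0: "x0 \<in> \<Omega>" and T0: "\<And>y. y \<notin> \<Omega> ==> T y = 0"
  shows "(\<integral>\<^sup>+x. ennreal (\<bar>G \<alpha> x - D (rev (multi_list \<alpha>)) v x\<bar> powr P) \<partial>lebesgue_on \<Omega>) \<le>
    pint P (\<lambda>x. moll \<rho> (G \<alpha>) x - G \<alpha> x) + ennreal (2 powr P * (total * load T collar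
      + load T (deep x0 (K * \<eta>))))"
proof -
  let ?is = "rev (multi_list \<alpha>)" and ?A = "amplification powr P * (C0 / \<rho> ^ CARD('n))" and ?S = "deep x0 (K * \<eta>)"
  have "is": "length ?is = q" "count_list ?is = \<alpha>" using \<alpha> by (auto simp: length_multi_list count_multi_list)
  define F where "F = (\<lambda>x. \<Sum>z\<in>Z. ?A * indicator (cball z (C * \<eta>)) x * energy z)"
  define R where "R = (\<lambda>x. 2 powr P * (F x + indicator ?S x * T x))"
  have A0: "0 \<le> ?A" using B_C0 scales by simp
  have F0: "0 \<le> F x" for x unfolding F_def by (intro sum_nonneg mult_nonneg_nonneg A0 energy_nonneg indicator_pos_le)
  have R0: "0 \<le> R x" for x unfolding R_def using F0 T(2) by (simp add: indicator_def)
  have S: "?S \<in> sets borel" by (rule deep_borel[OF x0])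
  have pt: "\<bar>G \<alpha> x - D ?is v x\<bar> powr P \<le> \<bar>moll \<rho> (G \<alpha>) x - G \<alpha> x\<bar> powr P + R x" if x: "x \<in> \<Omega>" for x
    using pointwise_estimate[OF x "is"(1)] unfolding "is"(2)
  proof
    assume "D ?is v x = moll \<rho> (G \<alpha>) x"
    then show ?thesis using R0[of x] by (simp add: abs_minus_commute)
  next
    assume *: "x \<in> ?S \<and> \<bar>D ?is v x\<bar> powr P \<le> (\<Sum>z\<in>Z. ?A * indicator (cball z (C * \<eta>)) x * energy z)"
    have "\<bar>G \<alpha> x + - D ?is v x\<bar> powr P \<le> 2 powr P * (\<bar>G \<alpha> x\<bar> powr P + \<bar>- D ?is v x\<bar> powr P)"
      by (rule powr_sum_le) (use pos in simp)
    also have "... \<le> 2 powr P * (T x + F x)"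
      using * T(3)[OF \<alpha>, of x] unfolding F_def by (intro mult_left_mono add_mono) auto
    also have "... = R x" unfolding R_def using * by simp
    also have "... \<le> \<bar>moll \<rho> (G \<alpha>) x - G \<alpha> x\<bar> powr P + R x" by simp
    finally show ?thesis by simp
  qed
  have iF: "integrable lborel F" unfolding F_def
    by (intro Bochner_Integration.integrable_sum integrable_mult_left integrable_mult_right)
       (auto intro!: integrable_real_indicator emeasure_lborel_cball_finite)
  have iR: "integrable lborel R" unfolding R_def
    by (intro integrable_mult_right Bochner_Integration.integrable_add iF set_integrable_T S)
  have mG: "G \<alpha> \<in> borel_measurable borel" using borel_measurable_integrable[OF G(2)[OF \<alpha>]] by simp
  have mm: "moll \<rho> (G \<alpha>) \<in> borel_measurable borel"
    by (rule borel_measurable_continuous_onI[OF smooth_continuous[OF moll_smooth[OF G(2)[OF \<alpha>] scales(1)]]])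
  have "(\<integral>\<^sup>+x. ennreal (\<bar>G \<alpha> x - D ?is v x\<bar> powr P) \<partial>lebesgue_on \<Omega>)
      = (\<integral>\<^sup>+x. ennreal (\<bar>G \<alpha> x - D ?is v x\<bar> powr P) * indicator \<Omega> x \<partial>lebesgue)"
    by (rule nn_integral_restrict_space) simp
  also have "... \<le> (\<integral>\<^sup>+x. ennreal (\<bar>moll \<rho> (G \<alpha>) x - G \<alpha> x\<bar> powr P) + ennreal (R x) \<partial>lebesgue)"
  proof (rule nn_integral_mono)
    fix x
    show "ennreal (\<bar>G \<alpha> x - D ?is v x\<bar> powr P) * indicator \<Omega> x \<le> ennreal (\<bar>moll \<rho> (G \<alpha>) x - G \<alpha> x\<bar> powr P) + ennreal (R x)"
      using pt[of x] R0[of x] by (cases "x \<in> \<Omega>") (simp_all add: ennreal_leI flip: ennreal_plus)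
  qed
  also have "... = (\<integral>\<^sup>+x. ennreal (\<bar>moll \<rho> (G \<alpha>) x - G \<alpha> x\<bar> powr P) + ennreal (R x) \<partial>lborel)"
    by (rule nn_integral_completion)
  also have "... = pint P (\<lambda>x. moll \<rho> (G \<alpha>) x - G \<alpha> x) + (\<integral>\<^sup>+x. ennreal (R x) \<partial>lborel)"
    using mG mm borel_measurable_integrable[OF iR] by (intro nn_integral_add) auto
  also have "(\<integral>\<^sup>+x. ennreal (R x) \<partial>lborel) = ennreal (LINT x|lborel. R x)"
    by (rule nn_integral_eq_integral[OF iR]) (use R0 in simp)
  also have "(LINT x|lborel. R x) = 2 powr P * ((LINT x|lborel. F x) + load T ?S)"
    unfolding R_def using iF set_integrable_T[OF S] by simp
  also have "(LINT x|lborel. F x) \<le> total * load T collar"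
  proof -
    have "(LINT x|lborel. F x) = (\<Sum>z\<in>Z. LINT x|lborel. ?A * indicator (cball z (C * \<eta>)) x * energy z)"
      unfolding F_def
      by (intro Bochner_Integration.integral_sum integrable_mult_left integrable_mult_right)
         (auto intro!: integrable_real_indicator emeasure_lborel_cball_finite)
    also have "... = (\<Sum>z\<in>Z. ?A * measure lborel (cball z (C * \<eta>)) * energy z)" by simp
    also have "... \<le> (\<Sum>z\<in>Z. ?A * (2 * (C * \<eta>)) ^ CARD('n) * energy z)"
    proof (intro sum_mono mult_right_mono mult_left_mono A0 energy_nonneg)
      fix z :: "real^'n"
      have "cball z (C * \<eta>) \<subseteq> cube z (C * \<eta>)" using cubeI by (auto simp: dist_commute)
      then have "measure lborel (cball z (C * \<eta>)) \<le> measure lborel (cube z (C * \<eta>))"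
        using cube_closed_bounded[of z "C * \<eta>"] by (intro measure_mono_fmeasurable fmeasurable_compact) auto
      then show "measure lborel (cball z (C * \<eta>)) \<le> (2 * (C * \<eta>)) ^ CARD('n)"
        using pos by (subst (asm) measure_cube) auto
    qed
    also have "... = ?A * (2 * (C * \<eta>)) ^ CARD('n) * (\<Sum>z\<in>Z. energy z)" by (rule sum_distrib_left[symmetric])
    also have "... \<le> ?A * (2 * (C * \<eta>)) ^ CARD('n) * (overlap * load T collar)"
    proof (rule mult_left_mono[OF sum_energy_le[OF T0]])
      show "0 \<le> ?A * (2 * (C * \<eta>)) ^ CARD('n)" by (intro mult_nonneg_nonneg[OF A0] zero_le_power) (use pos in simp)
    qed
    also have "... = total * load T collar"
    proof -
      have "2 * (C * \<eta>) = 32 * C * CARD('n) / \<kappa> * \<rho>" unfolding scale_defs using pos by (simp add: field_simps)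
      then have "(2 * (C * \<eta>)) ^ CARD('n) = (32 * C * CARD('n) / \<kappa>) ^ CARD('n) * \<rho> ^ CARD('n)" by (simp only: power_mult_distrib)
      then show ?thesis unfolding total_def using scales(1) by simp
    qed
    finally show ?thesis .
  qed
  finally show ?thesis by (simp add: mult_left_mono add_left_mono ennreal_leI)
qed

end


section \<open>Density\<close>

context hyperbolic_domain
begin

lemma collar_eventually:
  assumes "x \<in> \<Omega>" "0 < a" shows "eventually (\<lambda>\<eta>. x \<notin> {x\<in>\<Omega>. d x \<le> a * \<eta>}) (at_right 0)"
  unfolding eventually_at_right_field
proof (intro exI conjI allI impI)
  show "0 < d x / a" using d_pos[OF assms(1)] assms(2) by simp
  fix \<eta> :: real assume "0 < \<eta>" "\<eta> < d x / a"
  then have "a * \<eta> < d x" using assms(2) by (simp add: field_simps)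
  then show "x \<notin> {x\<in>\<Omega>. d x \<le> a * \<eta>}" by simp
qed

lemma deep_eventually:
  assumes x: "x0 \<in> \<Omega>" "x \<in> \<Omega>" shows "eventually (\<lambda>\<eta>. x \<notin> deep x0 (a * \<eta>)) (at_right 0)"
proof -
  have "\<exists>e>0. \<forall>\<eta>. \<eta> < e --> x \<notin> deep x0 \<eta>" by (rule eventually_not_deep[OF x]) blast
  then obtain e where e: "0 < e" "\<And>\<eta>. \<eta> < e ==> x \<notin> deep x0 \<eta>" by blast
  show ?thesis unfolding eventually_at_right_field
  proof (intro exI conjI allI impI)
    show "0 < e / (\<bar>a\<bar> + 1)" using e(1) by simp
    fix \<eta> :: real assume \<eta>: "0 < \<eta>" "\<eta> < e / (\<bar>a\<bar> + 1)"
    have "a * \<eta> \<le> (\<bar>a\<bar> + 1) * \<eta>" using \<eta>(1) by (intro mult_right_mono) auto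
    also have "... < e" using \<eta>(2) by (simp add: field_simps)
    finally show "x \<notin> deep x0 (a * \<eta>)" by (rule e(2))
  qed
qed

lemma bounded_coordinates:
  assumes "0 < h" shows "\<exists>Q :: int. \<forall>x\<in>\<Omega>. \<forall>i. \<bar>x $ i\<bar> \<le> h * (of_int Q - 1)"
proof -
  obtain r where r: "\<And>x. x \<in> \<Omega> ==> norm x \<le> r" using bdd unfolding bounded_iff by blast
  show ?thesis
  proof (intro exI[of _ "\<lceil>r / h\<rceil> + 1"] ballI allI)
    fix x i assume "x \<in> \<Omega>"
    then have "\<bar>x $ i\<bar> \<le> r" using r component_le_norm_cart[of x i] by force
    also have "r = h * (r / h)" using assms by simp
    also have "... \<le> h * of_int \<lceil>r / h\<rceil>" using assms by (intro mult_left_mono) auto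
    finally show "\<bar>x $ i\<bar> \<le> h * (of_int (\<lceil>r / h\<rceil> + 1) - 1)" by simp
  qed
qed

lemma smooth_bounded_sobolev:
  assumes v: "v \<in> smooth \<Omega>" and b: "\<And>is. \<exists>b. \<forall>x\<in>\<Omega>. \<bar>D is v x\<bar> \<le> b"
  shows "v \<in> sobolev_W q \<infinity> \<Omega>"
proof -
  have "D is v \<in> Lp \<infinity> \<Omega>" for "is"
  proof -
    obtain b where b: "\<And>x. x \<in> \<Omega> ==> \<bar>D is v x\<bar> \<le> b" using b by blast
    have m: "D is v \<in> borel_measurable (lebesgue_on \<Omega>)"
      by (rule continuous_imp_measurable_on_sets_lebesgue[OF smooth_continuous[OF smooth_D[OF v]]]) simp
    have "esssup (lebesgue_on \<Omega>) (\<lambda>x. ennreal \<bar>D is v x\<bar>) \<le> ennreal b"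
    proof (rule esssup_I)
      show "(\<lambda>x. ennreal \<bar>D is v x\<bar>) \<in> borel_measurable (lebesgue_on \<Omega>)" using m by measurable
      show "AE x in lebesgue_on \<Omega>. ennreal \<bar>D is v x\<bar> \<le> ennreal b" by (rule AE_I2) (auto intro: ennreal_leI b)
    qed
    then have "esssup (lebesgue_on \<Omega>) (\<lambda>x. ennreal \<bar>D is v x\<bar>) < \<infinity>" by (rule order.strict_trans1) simp
    then show ?thesis using m unfolding Lp_def Lp_norm_def by simp
  qed
  then show ?thesis using is_weak_deriv_smooth[OF open_dom v] L1_loc_continuous[OF smooth_continuous[OF v]]
    unfolding sobolev_W_def by blast
qed

lemma finite_order: "finite {\<alpha> :: 'n => nat. order_of \<alpha> = q}"
  by (rule finite_subset[OF _ finite_order_less[of "Suc q"]]) auto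

text \<open>As \<open>\<eta>\<close> tends to zero, the mollifications converge, and every point of \<open>\<Omega>\<close> eventually leaves the
  collar and the deep part.\<close>

lemma approximation:
  fixes u :: "real^'n => real"
  assumes P: "1 \<le> P"
    and u: "u \<in> L1_loc \<Omega>" and G: "\<And>\<alpha>. order_of \<alpha> = q ==> is_weak_deriv \<Omega> \<alpha> u (G \<alpha>)" "\<And>\<alpha>. order_of \<alpha> = q ==> integrable lborel (G \<alpha>)"
      "\<And>\<alpha> x. order_of \<alpha> = q ==> x \<notin> \<Omega> ==> G \<alpha> x = 0" "\<And>\<alpha>. order_of \<alpha> = q ==> pint P (G \<alpha>) < \<infinity>"
    and \<tau>: "0 < \<tau>"
  shows "\<exists>v\<in>smooth \<Omega>. (\<forall>is. \<exists>b. \<forall>x\<in>\<Omega>. \<bar>D is v x\<bar> \<le> b) \<and> (\<forall>\<alpha>. order_of \<alpha> = q -->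
    (\<integral>\<^sup>+x. ennreal (\<bar>G \<alpha> x - D (rev (multi_list \<alpha>)) v x\<bar> powr P) \<partial>lebesgue_on \<Omega>) \<le> ennreal \<tau>)"
proof -
  let ?A = "{\<alpha> :: 'n => nat. order_of \<alpha> = q}"
  define T where "T = (\<lambda>x. \<Sum>\<alpha>\<in>?A. \<bar>G \<alpha> x\<bar> powr P)"
  have iG: "integrable lborel (\<lambda>x. \<bar>G \<alpha> x\<bar> powr P)" if "order_of \<alpha> = q" for \<alpha>
    unfolding integrable_iff_bounded using G(4)[OF that] borel_measurable_integrable[OF G(2)[OF that]] by auto
  have T: "integrable lborel T" "\<And>y. 0 \<le> T y" "\<And>\<alpha> y. order_of \<alpha> = q ==> \<bar>G \<alpha> y\<bar> powr P \<le> T y" "\<And>y. y \<notin> \<Omega> ==> T y = 0"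
  proof -
    show "integrable lborel T" unfolding T_def by (rule Bochner_Integration.integrable_sum) (simp add: iG)
    show "0 \<le> T y" for y unfolding T_def by (rule sum_nonneg) simp
    show "\<bar>G \<alpha> y\<bar> powr P \<le> T y" if "order_of \<alpha> = q" for \<alpha> y
      unfolding T_def by (rule member_le_sum[where f = "\<lambda>\<alpha>. \<bar>G \<alpha> y\<bar> powr P", OF _ _ finite_order]) (use that in auto)
    show "T y = 0" if "y \<notin> \<Omega>" for y unfolding T_def by (rule sum.neutral) (use G(3)[OF _ that] in auto)
  qed
  have "\<exists>\<kappa> C N K x0 \<eta>0. 0 < \<kappa> \<and> \<kappa> \<le> 1 \<and> 1 \<le> C \<and> x0 \<in> \<Omega> \<and> 0 < \<eta>0 \<and>
      (\<forall>\<eta>. 0 < \<eta> --> \<eta> < \<eta>0 --> (\<exists>lab Z. labelling \<kappa> C N K x0 \<eta> lab Z))"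
    by (rule labelling_exists) blast
  then obtain \<kappa> C N K x0 \<eta>0 where geo: "0 < \<kappa>" "\<kappa> \<le> 1" "1 \<le> C" "x0 \<in> \<Omega>" "0 < \<eta>0"
    "\<And>\<eta>. 0 < \<eta> ==> \<eta> < \<eta>0 ==> \<exists>lab Z. labelling \<kappa> C N K x0 \<eta> lab Z"
    by blast
  let ?c = "real ((CARD('n) + 1) ^ q)" and ?B = "bump_sup q ^ CARD('n)" and ?C0 = "(5 * bump_sup 0 / 2) ^ CARD('n)"
  define \<Lambda> where "\<Lambda> = (5 ^ CARD('n) * (2 ^ q * ?B * ((N + 1) * (?c * ?c) * (2 * C) ^ q) * (8 * CARD('n)) ^ q)) powr P
    * ?C0 * (32 * C * CARD('n) / \<kappa>) ^ CARD('n) * (4 * (C + 2)) ^ CARD('n)"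
  have \<Lambda>0: "0 \<le> \<Lambda>" unfolding \<Lambda>_def using bump_sup(1)[of 0] geo(1,3) by simp
  define \<tau>' where "\<tau>' = \<tau> / (2 * (2 powr P * (\<Lambda> + 1)))"
  have \<tau>': "0 < \<tau>'" "2 powr P * (\<Lambda> * \<tau>' + \<tau>') = \<tau> / 2"
  proof -
    have p: "0 < 2 powr P * (\<Lambda> + 1)" using \<Lambda>0 by simp
    then show "0 < \<tau>'" unfolding \<tau>'_def using \<tau> by simp
    have "2 powr P * (\<Lambda> * \<tau>' + \<tau>') = (2 powr P * (\<Lambda> + 1)) * \<tau>'" by (simp add: algebra_simps)
    also have "... = \<tau> / 2" 
    proof -
      have "X * (\<tau> / (2 * X)) = \<tau> / 2" if "0 < X" for X :: real using that by simp
      from this[OF p] show ?thesis unfolding \<tau>'_def .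
    qed
    finally show "2 powr P * (\<Lambda> * \<tau>' + \<tau>') = \<tau> / 2" .
  qed
  let ?collar = "\<lambda>\<eta>. {x\<in>\<Omega>. d x \<le> (C + 2) * \<eta>}" and ?n = "real CARD('n)"
  have Tin: "x \<in> \<Omega>" if "T x \<noteq> 0" for x using T(4) that by blast
  have ev1: "eventually (\<lambda>\<eta>. load T (?collar \<eta>) \<le> \<tau>') (at_right 0)"
    by (rule integral_vanishing_sets[OF T(1,2) collar_borel collar_eventually \<tau>'(1)]) (use Tin geo(3) in auto)
  have ev2: "eventually (\<lambda>\<eta>. load T (deep x0 (K * \<eta>)) \<le> \<tau>') (at_right 0)"
    by (rule integral_vanishing_sets[OF T(1,2) deep_borel[OF geo(4)] deep_eventually[OF geo(4)] \<tau>'(1)]) (rule Tin)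
  have ev3: "eventually (\<lambda>\<eta>. \<forall>\<alpha>\<in>?A. pint P (\<lambda>x. moll (\<kappa> * \<eta> / (16 * ?n)) (G \<alpha>) x - G \<alpha> x) \<le> ennreal (\<tau> / 2)) (at_right 0)"
  proof (rule eventually_ball_finite[OF finite_order], intro ballI)
    fix \<alpha> :: "'n => nat" assume "\<alpha> \<in> ?A"
    then have o: "order_of \<alpha> = q" by simp
    have "\<exists>\<rho>0>0. \<forall>\<rho>. 0 < \<rho> --> \<rho> < \<rho>0 --> pint P (\<lambda>x. moll \<rho> (G \<alpha>) x - G \<alpha> x) \<le> ennreal (\<tau> / 2)"
      by (rule moll_converges[OF P G(2)[OF o] G(4)[OF o], of "\<tau> / 2"]) (use \<tau> in simp, blast)
    then obtain \<rho>0 where \<rho>0: "0 < \<rho>0" "\<And>\<rho>. 0 < \<rho> ==> \<rho> < \<rho>0 ==> pint P (\<lambda>x. moll \<rho> (G \<alpha>) x - G \<alpha> x) \<le> ennreal (\<tau> / 2)"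
      by blast
    show "eventually (\<lambda>\<eta>. pint P (\<lambda>x. moll (\<kappa> * \<eta> / (16 * ?n)) (G \<alpha>) x - G \<alpha> x) \<le> ennreal (\<tau> / 2)) (at_right 0)"
      unfolding eventually_at_right_field
    proof (intro exI conjI allI impI)
      show "0 < \<rho>0 * (16 * ?n) / \<kappa>" using \<rho>0(1) geo(1) by simp
      fix \<eta> :: real assume \<eta>: "0 < \<eta>" "\<eta> < \<rho>0 * (16 * ?n) / \<kappa>"
      show "pint P (\<lambda>x. moll (\<kappa> * \<eta> / (16 * ?n)) (G \<alpha>) x - G \<alpha> x) \<le> ennreal (\<tau> / 2)"
      proof (rule \<rho>0(2))
        show "0 < \<kappa> * \<eta> / (16 * ?n)" using \<eta>(1) geo(1) by simp
        have "\<kappa> * \<eta> < \<rho>0 * (16 * ?n)" using \<eta>(2) geo(1) by (simp add: pos_less_divide_eq mult.commute)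
        then show "\<kappa> * \<eta> / (16 * ?n) < \<rho>0" by (simp add: pos_divide_less_eq)
      qed
    qed
  qed
  have ev4: "eventually (\<lambda>\<eta>. 0 < \<eta> \<and> \<eta> < \<eta>0) (at_right 0)"
    unfolding eventually_at_right_field using geo(5) by blast
  obtain \<eta> where \<eta>: "load T (?collar \<eta>) \<le> \<tau>'" "load T (deep x0 (K * \<eta>)) \<le> \<tau>'"
    "\<forall>\<alpha>\<in>?A. pint P (\<lambda>x. moll (\<kappa> * \<eta> / (16 * ?n)) (G \<alpha>) x - G \<alpha> x) \<le> ennreal (\<tau> / 2)" "0 < \<eta>" "\<eta> < \<eta>0"
    using eventually_happens'[OF _ eventually_conj[OF ev1 eventually_conj[OF ev2 eventually_conj[OF ev3 ev4]]]]
    by auto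
  obtain lab Z where lab: "labelling \<kappa> C N K x0 \<eta> lab Z" using geo(6)[OF \<eta>(4,5)] by blast
  define \<rho> r1 r2 h where "\<rho> = \<kappa> * \<eta> / (16 * CARD('n))" and "r1 = \<kappa> * \<eta> / (8 * CARD('n))" and "r2 = 2 * C * \<eta>"
    and h: "h = \<eta> / (8 * CARD('n))"
  note sd = this
  have h0: "0 < h" unfolding h using \<eta>(4) by simp
  obtain Q :: int where Q: "\<And>x i. x \<in> \<Omega> ==> \<bar>x $ i\<bar> \<le> h * (of_int Q - 1)"
    using bounded_coordinates[OF h0] by blast
  have "0 < \<kappa> * \<eta> / 2" "core (\<kappa> * \<eta> / 2) \<subseteq> \<Omega>" using geo(1) \<eta>(4) by (auto simp: core_def)
  from borel_measurable_integrable[OF L1_locD[OF u core_compact[OF this(1)] this(2)]] obtain w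
    where w: "w \<in> borel_measurable borel" "AE x in lebesgue. indicator (core (\<kappa> * \<eta> / 2)) x * u x = w x"
    by (rule borel_version)
  note T0 = T(4)
  interpret labelled_domain \<Omega> \<delta> q N Q P \<kappa> C K \<eta> \<rho> r1 r2 h ?c ?B ?C0 x0 lab Z u w T G
  proof (unfold_locales)
  qed (fact lab geo \<eta> P u w G T sd refl Q[unfolded h])+
  show ?thesis
  proof (intro bexI[OF _ v_smooth] conjI allI impI D_v_bounded)
    fix \<alpha> :: "'n => nat" assume \<alpha>: "order_of \<alpha> = q"
    have "total = \<Lambda>" unfolding total_def amplification_def overlap_def \<Lambda>_def ..
    then have "(\<integral>\<^sup>+x. ennreal (\<bar>G \<alpha> x - D (rev (multi_list \<alpha>)) v x\<bar> powr P) \<partial>lebesgue_on \<Omega>) \<le>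
      pint P (\<lambda>x. moll \<rho> (G \<alpha>) x - G \<alpha> x) + ennreal (2 powr P * (\<Lambda> * load T collar
        + load T (deep x0 (K * \<eta>))))"
      using integral_estimate[OF \<alpha> geo(4) T0] by simp
    also have "... \<le> ennreal (\<tau> / 2) + ennreal (2 powr P * (\<Lambda> * \<tau>' + \<tau>'))"
    proof (rule add_mono)
      show "pint P (\<lambda>x. moll \<rho> (G \<alpha>) x - G \<alpha> x) \<le> ennreal (\<tau> / 2)" using \<eta>(3) \<alpha> unfolding sd(1) by simp
      show "ennreal (2 powr P * (\<Lambda> * load T collar
        + load T (deep x0 (K * \<eta>)))) \<le> ennreal (2 powr P * (\<Lambda> * \<tau>' + \<tau>'))"
        by (intro ennreal_leI mult_left_mono add_mono \<eta>(1,2) \<Lambda>0) simp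
    qed
    also have "... = ennreal \<tau>" unfolding \<tau>'(2) using \<tau> by (simp flip: ennreal_plus)
    finally show "(\<integral>\<^sup>+x. ennreal (\<bar>G \<alpha> x - D (rev (multi_list \<alpha>)) v x\<bar> powr P) \<partial>lebesgue_on \<Omega>) \<le> ennreal \<tau>" .
  qed
qed

end

theorem theorem1p1:
  fixes \<Omega> :: "(real^'n::finite) set" and \<delta> :: real and k :: nat and p :: ennreal
  assumes "0 \<le> \<delta>" and "k \<ge> 1" and "1 \<le> p" and "p < \<infinity>"
    and "bounded \<Omega>" and "gromov_hyperbolic_domain \<delta> \<Omega>"
  shows "dense_in_sobolev_L (smooth \<Omega> \<inter> sobolev_W k \<infinity> \<Omega>) k p \<Omega>"
  unfolding dense_in_sobolev_L_def
proof (intro conjI ballI allI impI subsetI)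
  interpret hyperbolic_domain \<Omega> \<delta>
    by unfold_locales (use assms in \<open>auto simp: gromov_hyperbolic_domain_def\<close>)
  have \<Omega>: "open \<Omega>" by (rule open_dom)
  {
    fix v assume "v \<in> smooth \<Omega> \<inter> sobolev_W k \<infinity> \<Omega>"
    then show "v \<in> sobolev_L k p \<Omega>"
      using Linf_subset_Lp[OF _ \<Omega> assms(5,4)] unfolding sobolev_W_def sobolev_L_def by blast
  next
    fix u and e :: real assume u: "u \<in> sobolev_L k p \<Omega>" and e: "0 < e"
    define P where "P = enn2real p"
    have P: "1 \<le> P" unfolding P_def using assms(3,4) enn2real_mono[of 1 p] by simp
    have uloc: "u \<in> L1_loc \<Omega>" using u unfolding sobolev_L_def by blast
    have "\<exists>G. integrable lborel G \<and> pint P G < \<infinity> \<and> (\<forall>x. x \<notin> \<Omega> --> G x = 0) \<and> is_weak_deriv \<Omega> \<alpha> u G"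
      if o: "order_of \<alpha> = k" for \<alpha>
    proof -
      obtain g where "g \<in> Lp p \<Omega>" "is_weak_deriv \<Omega> \<alpha> u g" using u o unfolding sobolev_L_def by blast
      then show ?thesis unfolding P_def by (rule Lp_representative[OF \<Omega> assms(5,3,4)]) blast
    qed
    then obtain G where G: "\<And>\<alpha>. order_of \<alpha> = k ==> integrable lborel (G \<alpha>) \<and> pint P (G \<alpha>) < \<infinity> \<and> (\<forall>x. x \<notin> \<Omega> --> G \<alpha> x = 0) \<and> is_weak_deriv \<Omega> \<alpha> u (G \<alpha>)"
      by metis
    let ?A = "{\<alpha> :: 'n => nat. order_of \<alpha> = k}"
    define s where "s = e / (2 * (card ?A + 1))"
    have s: "0 < s" unfolding s_def using e by simp
    have sP: "(s powr P) powr (1 / P) = s" using s P by (simp add: powr_powr)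
    have s': "0 < s powr P" using s by simp
    have Gs: "\<And>\<alpha>. order_of \<alpha> = k ==> is_weak_deriv \<Omega> \<alpha> u (G \<alpha>)" "\<And>\<alpha>. order_of \<alpha> = k ==> integrable lborel (G \<alpha>)"
      "\<And>\<alpha> x. order_of \<alpha> = k ==> x \<notin> \<Omega> ==> G \<alpha> x = 0" "\<And>\<alpha>. order_of \<alpha> = k ==> pint P (G \<alpha>) < \<infinity>"
      using G by simp_all
    from approximation[OF P uloc Gs s'] obtain v where v: "v \<in> smooth \<Omega>" "\<And>is. \<exists>b. \<forall>x\<in>\<Omega>. \<bar>D is v x\<bar> \<le> b"
      "\<And>\<alpha>. order_of \<alpha> = k ==> (\<integral>\<^sup>+x. ennreal (\<bar>G \<alpha> x - D (rev (multi_list \<alpha>)) v x\<bar> powr P) \<partial>lebesgue_on \<Omega>) \<le> ennreal (s powr P)"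
      by blast
    have "sobolev_L_seminorm k p \<Omega> (\<lambda>x. u x - v x) \<le> (\<Sum>\<alpha>\<in>?A. ennreal s)"
      unfolding sobolev_L_seminorm_def
    proof (rule sum_mono)
      fix \<alpha> :: "'n => nat" assume "\<alpha> \<in> ?A"
      then have o: "order_of \<alpha> = k" by simp
      have wd: "is_weak_deriv \<Omega> \<alpha> (\<lambda>x. u x - v x) (\<lambda>x. G \<alpha> x - D (rev (multi_list \<alpha>)) v x)"
        using G[OF o] by (intro weak_deriv_diff[OF \<Omega> _ is_weak_deriv_smooth[OF \<Omega> v(1)]]) blast
      have "is_weak_deriv \<Omega> \<alpha> (\<lambda>x. u x - v x) (weak_deriv \<Omega> \<alpha> (\<lambda>x. u x - v x))"
        unfolding weak_deriv_def by (rule someI[of "is_weak_deriv \<Omega> \<alpha> (\<lambda>x. u x - v x)", OF wd])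
      from Lp_norm_cong_AE[OF weak_deriv_unique[OF \<Omega> this wd] assms(4)]
      have "Lp_norm p \<Omega> (weak_deriv \<Omega> \<alpha> (\<lambda>x. u x - v x)) = Lp_norm p \<Omega> (\<lambda>x. G \<alpha> x - D (rev (multi_list \<alpha>)) v x)" .
      also have "... \<le> ennreal ((s powr P) powr (1 / P))"
        unfolding P_def by (rule Lp_norm_le[OF assms(4)]) (use v(3)[OF o] in \<open>auto simp: P_def\<close>)
      finally show "Lp_norm p \<Omega> (weak_deriv \<Omega> \<alpha> (\<lambda>x. u x - v x)) \<le> ennreal s" unfolding sP .
    qed
    also have "... = ennreal (card ?A * s)" using s by (simp add: ennreal_mult ennreal_of_nat_eq_real_of_nat)
    also have "... < ennreal e"
    proof (rule ennreal_lessI[OF e])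
      have "card ?A * s \<le> (card ?A + 1) * s" using s by (intro mult_right_mono) auto
      also have "... = e / 2" unfolding s_def by (simp add: field_simps)
      finally show "card ?A * s < e" using e by linarith
    qed
    finally have "sobolev_L_seminorm k p \<Omega> (\<lambda>x. u x - v x) < ennreal e" .
    then show "\<exists>v\<in>smooth \<Omega> \<inter> sobolev_W k \<infinity> \<Omega>. sobolev_L_seminorm k p \<Omega> (\<lambda>x. u x - v x) < ennreal e"
      using v(1) smooth_bounded_sobolev[OF v(1,2)] by blast
  }
qed

end
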